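(* Let $k\in\mathbb N$, $k\ge1$. There is a constant $C>0$ such that $$\|F(v_d,v_d)\|_{H^k(\Omega)}\le C\,\|v_d\|_{H^{k+2}(\Omega)}^{1/2}\,\|v_d\|_{H^{k+1}(\Omega)}\,\|v_d\|_{H^k(\Omega)}^{1/2}$$ for all $v_d\in H^{k+2}(\Omega)\cap L^2_{\bar\sigma}(\Omega)$. Moreover, for $k=0$ there is a constant $C>0$ such that $$\|F(v_d,v_d)\|_{L^2(\Omega)}\le C\,\|v_d\|_{H^{3/2}(\Omega)}^2$$ for all $v_d\in H^{3/2}(\Omega)\cap L^2_{\bar\sigma}(\Omega)$.
   Context: $h>0$, $\Omega=\mathbb T^2\times(-h,0)$ with $\mathbb T^2$ the two-dimensional torus. $\nabla_{\mathrm H}$ and $\mathrm{div}_{\mathrm H}$ are the gradient and divergence in the horizontal variables $(x,y)$. Function spaces on $\Omega$ consist of $2$-component vector fields. $\bar v(x,y)=\frac1h\int_{-h}^0v(x,y,z)\,dz$ is the vertical average, $L^2_{\bar\sigma}(\Omega)$ is the closure in $L^2(\Omega)$ of the smooth vector fields $v$ (up to the boundary) with $\mathrm{div}_{\mathrm H}\bar v=0$, and $\mathcal P:L^2(\Omega)\to L^2_{\bar\sigma}(\Omega)$ is the hydrostatic Helmholtz projection (the orthogonal projection). The bilinear map is $$F(v,v')=\mathcal P\bigl(v\cdot\nabla_{\mathrm H}v'+w(v)\,\partial_zv'\bigr),\qquad w(v)(x,y,z)=-\int_{-h}^z\mathrm{div}_{\mathrm H}v(x,y,\xi)\,d\xi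 .$$ *)

theory Defs
  imports "HOL-Analysis.Analysis"
begin

text \<open>
  The domain is the product of the torus (the plane modulo the integer lattice) and the interval
  \<open>(-h, 0)\<close>. A function on it is a function on \<open>real \<times> real \<times> real\<close> that is 1-periodic in the first
  two variables on the slab \<open>-h < z < 0\<close>; its values off the slab are irrelevant. Elements of
  function spaces are representatives, not classes: all memberships and norms below are invariant
  under changes on null sets. Representatives are Borel; every Lebesgue class has one.
\<close>

type_synonym point = "real \<times> real \<times> real"

definition cell :: "real \<Rightarrow> point set" where
  "cell h = {0..<1} \<times> {0..<1} \<times> {-h<..<0}"

definition hperiodic :: "real \<Rightarrow> (point \<Rightarrow> 'b) \<Rightarrow> bool" where
  "hperiodic h f \<longleftrightarrow>
    (\<forall>x y z. z \<in> {-h<..<0} \<longrightarrow> f (x + 1, y, z) = f (x, y, z) \<and> f (x, y + 1, z) = f (x, y, z))"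

subsection \<open>Square integrable functions\<close>

definition L2 :: "real \<Rightarrow> (point \<Rightarrow> 'b::euclidean_space) set" where
  "L2 h = {f. hperiodic h f \<and> set_borel_measurable lborel (cell h) f \<and>
              set_integrable lborel (cell h) (\<lambda>p. (norm (f p))\<^sup>2)}"

definition L2_inner :: "real \<Rightarrow> (point \<Rightarrow> 'b::euclidean_space) \<Rightarrow> (point \<Rightarrow> 'b) \<Rightarrow> real" where
  "L2_inner h f g = (LINT p:cell h|lborel. f p \<bullet> g p)"

definition L2_norm :: "real \<Rightarrow> (point \<Rightarrow> 'b::euclidean_space) \<Rightarrow> real" where
  "L2_norm h f = sqrt (LINT p:cell h|lborel. (norm (f p))\<^sup>2)"

subsection \<open>Smooth functions and weak derivatives\<close>

primrec Ck :: "nat \<Rightarrow> ('a::euclidean_space \<Rightarrow> 'b::real_normed_vector) \<Rightarrow> bool" where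
  "Ck 0 f \<longleftrightarrow> continuous_on UNIV f"
| "Ck (Suc n) f \<longleftrightarrow>
     f differentiable_on UNIV \<and> (\<forall>e\<in>Basis. Ck n (\<lambda>x. frechet_derivative f (at x) e))"

definition smooth :: "('a::euclidean_space \<Rightarrow> 'b::real_normed_vector) \<Rightarrow> bool" where
  "smooth f \<longleftrightarrow> (\<forall>n. Ck n f)"

definition partial :: "'a \<Rightarrow> ('a::real_normed_vector \<Rightarrow> 'b::real_normed_vector) \<Rightarrow> 'a \<Rightarrow> 'b" where
  "partial e f = (\<lambda>p. frechet_derivative f (at p) e)"

type_synonym multiindex = "nat \<times> nat \<times> nat"

fun mi_order :: "multiindex \<Rightarrow> nat" where
  "mi_order (a, b, c) = a + b + c"

fun partials :: "multiindex \<Rightarrow> (point \<Rightarrow> 'b::real_normed_vector) \<Rightarrow> point \<Rightarrow> 'b" where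
  "partials (a, b, c) f =
     (partial (1, 0, 0) ^^ a) ((partial (0, 1, 0) ^^ b) ((partial (0, 0, 1) ^^ c) f))"

text \<open>Smooth functions with compact support in torus times \<open>(-h, 0)\<close>: since the torus is compact,
  only the support in the vertical variable is restricted.\<close>

definition test_function :: "real \<Rightarrow> (point \<Rightarrow> real) \<Rightarrow> bool" where
  "test_function h \<phi> \<longleftrightarrow> smooth \<phi> \<and> hperiodic h \<phi> \<and>
     (\<exists>a b. -h < a \<and> a < b \<and> b < 0 \<and> (\<forall>x y z. z \<notin> {a..b} \<longrightarrow> \<phi> (x, y, z) = 0))"

definition has_weak_deriv ::
    "real \<Rightarrow> multiindex \<Rightarrow> (point \<Rightarrow> 'b::euclidean_space) \<Rightarrow> (point \<Rightarrow> 'b) \<Rightarrow> bool" where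
  "has_weak_deriv h \<alpha> f g \<longleftrightarrow> f \<in> L2 h \<and> g \<in> L2 h \<and>
     (\<forall>\<phi>. test_function h \<phi> \<longrightarrow>
        (LINT p:cell h|lborel. partials \<alpha> \<phi> p *\<^sub>R f p) =
        (-1) ^ mi_order \<alpha> *\<^sub>R (LINT p:cell h|lborel. \<phi> p *\<^sub>R g p))"

definition weak_deriv ::
    "real \<Rightarrow> multiindex \<Rightarrow> (point \<Rightarrow> 'b::euclidean_space) \<Rightarrow> point \<Rightarrow> 'b" where
  "weak_deriv h \<alpha> f = (SOME g. has_weak_deriv h \<alpha> f g)"

subsection \<open>Sobolev spaces\<close>

lemma finite_multiindices: "finite {\<alpha>. mi_order \<alpha> \<le> k}"
  by (rule finite_subset[of _ "{..k} \<times> {..k} \<times> {..k}"]) auto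

definition Sobolev :: "real \<Rightarrow> nat \<Rightarrow> (point \<Rightarrow> 'b::euclidean_space) set" where
  "Sobolev h k = {f \<in> L2 h. \<forall>\<alpha>. mi_order \<alpha> \<le> k \<longrightarrow> (\<exists>g. has_weak_deriv h \<alpha> f g)}"

definition Sobolev_norm :: "real \<Rightarrow> nat \<Rightarrow> (point \<Rightarrow> 'b::euclidean_space) \<Rightarrow> real" where
  "Sobolev_norm h k f = sqrt (\<Sum>\<alpha> | mi_order \<alpha> \<le> k. (L2_norm h (weak_deriv h \<alpha> f))\<^sup>2)"

text \<open>Geodesic distance on the domain; \<open>\<bar>t - round t\<bar>\<close> is the distance of \<open>t\<close> to the integers.\<close>

fun tdist :: "point \<Rightarrow> point \<Rightarrow> real" where
  "tdist (x, y, z) (x', y', z') =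
     sqrt (\<bar>x - x' - of_int (round (x - x'))\<bar>\<^sup>2 + \<bar>y - y' - of_int (round (y - y'))\<bar>\<^sup>2 + (z - z')\<^sup>2)"

text \<open>Slobodeckij spaces of order \<open>m + s\<close>, where \<open>0 < s < 1\<close>; the exponent of the distance is
  the dimension 3 plus \<open>2 s\<close>.\<close>

definition slobodeckij_kernel ::
    "real \<Rightarrow> (point \<Rightarrow> 'b::euclidean_space) \<Rightarrow> point \<times> point \<Rightarrow> real" where
  "slobodeckij_kernel s g = (\<lambda>(p, q). (norm (g p - g q))\<^sup>2 / tdist p q powr (3 + 2 * s))"

definition frac_Sobolev :: "real \<Rightarrow> nat \<Rightarrow> real \<Rightarrow> (point \<Rightarrow> 'b::euclidean_space) set" where
  "frac_Sobolev h m s = {f \<in> Sobolev h m. \<forall>\<alpha>. mi_order \<alpha> = m \<longrightarrow>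
     set_integrable lborel (cell h \<times> cell h) (slobodeckij_kernel s (weak_deriv h \<alpha> f))}"

definition frac_Sobolev_norm ::
    "real \<Rightarrow> nat \<Rightarrow> real \<Rightarrow> (point \<Rightarrow> 'b::euclidean_space) \<Rightarrow> real" where
  "frac_Sobolev_norm h m s f = sqrt ((Sobolev_norm h m f)\<^sup>2 +
     (\<Sum>\<alpha> | mi_order \<alpha> = m.
        (LINT pq:cell h \<times> cell h|lborel. slobodeckij_kernel s (weak_deriv h \<alpha> f) pq)))"

subsection \<open>Hydrostatically solenoidal fields and the projection\<close>

type_synonym field = "point \<Rightarrow> real^2"

definition vertical_average :: "real \<Rightarrow> field \<Rightarrow> real \<times> real \<Rightarrow> real^2" where
  "vertical_average h v = (\<lambda>(x, y). (1 / h) *\<^sub>R (LINT z:{-h<..<0}|lborel. v (x, y, z)))"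

definition div2 :: "(real \<times> real \<Rightarrow> real^2) \<Rightarrow> real \<times> real \<Rightarrow> real" where
  "div2 u = (\<lambda>p. partial (1, 0) u p $ 1 + partial (0, 1) u p $ 2)"

text \<open>Smoothness up to the boundary is realised as restriction to the slab of a smooth function on
  the whole space.\<close>

definition smooth_solenoidal :: "real \<Rightarrow> field set" where
  "smooth_solenoidal h =
     {v. smooth v \<and> hperiodic h v \<and> (\<forall>p. div2 (vertical_average h v) p = 0)}"

definition L2_sigma :: "real \<Rightarrow> field set" where
  "L2_sigma h =
     {u \<in> L2 h. \<forall>\<epsilon>>0. \<exists>v\<in>smooth_solenoidal h. L2_norm h (\<lambda>p. u p - v p) < \<epsilon>}"

text \<open>The orthogonal projection, determined up to null sets; meaningful for arguments in \<open>L2 h\<close>.\<close>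

definition helmholtz_proj :: "real \<Rightarrow> field \<Rightarrow> field" where
  "helmholtz_proj h u = (SOME p. p \<in> L2_sigma h \<and>
     (\<forall>\<phi>\<in>L2_sigma h. L2_inner h (\<lambda>x. u x - p x) \<phi> = 0))"

subsection \<open>The nonlinearity\<close>

definition divH :: "real \<Rightarrow> field \<Rightarrow> point \<Rightarrow> real" where
  "divH h v = (\<lambda>p. weak_deriv h (1, 0, 0) v p $ 1 + weak_deriv h (0, 1, 0) v p $ 2)"

definition vert_velocity :: "real \<Rightarrow> field \<Rightarrow> point \<Rightarrow> real" where
  "vert_velocity h v = (\<lambda>(x, y, z). - (LINT \<xi>:{-h<..<z}|lborel. divH h v (x, y, \<xi>)))"

definition advection :: "real \<Rightarrow> field \<Rightarrow> field \<Rightarrow> field" where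
  "advection h v v' = (\<lambda>p.
     v p $ 1 *\<^sub>R weak_deriv h (1, 0, 0) v' p + v p $ 2 *\<^sub>R weak_deriv h (0, 1, 0) v' p +
     vert_velocity h v p *\<^sub>R weak_deriv h (0, 0, 1) v' p)"

definition hydro_F :: "real \<Rightarrow> field \<Rightarrow> field \<Rightarrow> field" where
  "hydro_F h v v' = helmholtz_proj h (advection h v v')"

end

theory Submission
  imports Defs
begin

text \<open>
  Each term of the differentiated advection is a product of a derivative of \<open>v\<close> and a factor which
  is either a derivative of \<open>v\<close> or a horizontal derivative of \<open>w(v)\<close>. Such a factor is dominated
  pointwise by a vertical integral of some \<open>\<psi>\<close>, so by Cauchy--Schwarz on vertical lines and then on
  horizontal slices the \<open>L\<^sup>2\<close> norm of the product is bounded by the norms of \<open>\<psi>\<close> and of the other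
  factor in \<open>L\<^sup>2\<close> in \<open>z\<close> with values in \<open>L\<^sup>4\<close> in \<open>(x, y)\<close>. The square of that norm of \<open>g\<close> is
  at most a constant times \<open>\<parallel>g\<parallel> (\<parallel>g\<parallel> + \<parallel>\<nabla>\<^sub>H g\<parallel>)\<close> by Ladyzhenskaya's inequality on the slices; for
  \<open>k = 0\<close> the derivatives of \<open>v\<close> are instead estimated by the embedding of \<open>H\<^sup>1\<^sup>/\<^sup>2\<close> into \<open>L\<^sup>4\<close>,
  proved by comparing averages over dyadic cells; a three-point argument passes from the
  three-dimensional Slobodeckij integral to the slices.

  The projection commutes with horizontal derivatives because it commutes with horizontal shifts.
  A product test function differentiated in \<open>z\<close> has vertical average zero, hence
  \<open>\<partial>\<^sub>z (u - P u) = 0\<close>: vertical derivatives remove the projection. Weak derivatives are handled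
  through absolute continuity on almost every coordinate line, where the product rule and the
  exchange of derivatives with the vertical integral are elementary.
\<close>

subsection \<open>The measure on the domain\<close>

text \<open>Products of derivatives of \<open>v\<close> are square integrable only by virtue of the
  anisotropic estimates, so a product rule inside \<open>L2\<close> would presuppose them. The
  relation \<open>wd\<close> asks only for absolute continuity on almost every line; it is closed
  under products, and integrability on the domain is supplied afterwards, product by product.

  The exponents come from counting derivatives. A factor of order \<open>a\<close> that is dominated
  by a vertical integral costs the norms of orders \<open>a + 1\<close> and \<open>a + 2\<close>,
  the other factor, of order \<open>c\<close>, those of orders \<open>c\<close> and
  \<open>c + 1\<close>. A derivative of order \<open>m\<close> of the advection has
  \<open>a + c = m + 1\<close> and \<open>c \<ge> 1\<close>. For \<open>k \<ge> 1\<close> the four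
  orders always fit below \<open>k\<close>, \<open>k + 1\<close>, \<open>k + 1\<close>,
  \<open>k + 2\<close>, and the square root of the product of these norms is the right-hand side.
  For \<open>k = 0\<close> they would be 1, 2, 1, 2, which is too much; this is why the half
  derivative replaces Ladyzhenskaya's interpolation there.\<close>

lemma restrict_space_pair_measure:
  assumes "sigma_finite_measure M" "sigma_finite_measure N"
    and [measurable]: "S \<in> sets M" "T \<in> sets N"
  shows "restrict_space M S \<Otimes>\<^sub>M restrict_space N T = restrict_space (M \<Otimes>\<^sub>M N) (S \<times> T)"
proof (rule pair_measure_eqI)
  interpret M: sigma_finite_measure M by fact
  interpret N: sigma_finite_measure N by fact
  show "sigma_finite_measure (restrict_space M S)" "sigma_finite_measure (restrict_space N T)"
    using assms by (auto intro: sigma_finite_measure_restrict_space)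
  have sp: "space (restrict_space M S \<Otimes>\<^sub>M restrict_space N T) = S \<times> T"
    using assms by (auto simp: space_pair_measure)
  have sp2: "space (restrict_space (M \<Otimes>\<^sub>M N) (S \<times> T)) = S \<times> T"
    using assms by simp
  have "a \<times> b \<in> sets (restrict_space (M \<Otimes>\<^sub>M N) (S \<times> T))"
    if "a \<in> sets (restrict_space M S)" "b \<in> sets (restrict_space N T)" for a b
    using that assms by (auto simp: sets_restrict_space_iff)
  then have "sets (restrict_space M S \<Otimes>\<^sub>M restrict_space N T) \<subseteq> sets (restrict_space (M \<Otimes>\<^sub>M N) (S \<times> T))"
    unfolding sets_pair_measure[of "restrict_space M S" "restrict_space N T"]
      sp[unfolded space_pair_measure]
    using sets.sigma_sets_subset[of "{a \<times> b |a b. a \<in> sets (restrict_space M S) \<and> b \<in> sets (restrict_space N T)}"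
        "restrict_space (M \<Otimes>\<^sub>M N) (S \<times> T)", unfolded sp2]
    by blast
  moreover have "sets (restrict_space (M \<Otimes>\<^sub>M N) (S \<times> T)) \<subseteq> sets (restrict_space M S \<Otimes>\<^sub>M restrict_space N T)"
  proof
    fix A assume "A \<in> sets (restrict_space (M \<Otimes>\<^sub>M N) (S \<times> T))"
    then have A: "A \<in> sets (M \<Otimes>\<^sub>M N)" "A \<subseteq> S \<times> T"
      by (auto simp: sets_restrict_space_iff)
    have 1: "(\<lambda>x. x) \<in> measurable (restrict_space M S) M" "(\<lambda>x. x) \<in> measurable (restrict_space N T) N"
      by (auto intro: measurable_restrict_space1)
    have "(\<lambda>p. (fst p, snd p)) \<in> measurable (restrict_space M S \<Otimes>\<^sub>M restrict_space N T) (M \<Otimes>\<^sub>M N)"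
      by (intro measurable_Pair measurable_compose[OF measurable_fst 1(1)] measurable_compose[OF measurable_snd 1(2)])
    from measurable_sets[OF this A(1)] show "A \<in> sets (restrict_space M S \<Otimes>\<^sub>M restrict_space N T)"
      using A(2) unfolding sp by (simp add: Int_absorb2)
  qed
  ultimately show "sets (restrict_space M S \<Otimes>\<^sub>M restrict_space N T) = sets (restrict_space (M \<Otimes>\<^sub>M N) (S \<times> T))"
    by blast
  fix A B assume "A \<in> sets (restrict_space M S)" "B \<in> sets (restrict_space N T)"
  then have A: "A \<in> sets M" "A \<subseteq> S" and B: "B \<in> sets N" "B \<subseteq> T"
    using assms by (auto simp: sets_restrict_space_iff)
  then have "A \<times> B \<subseteq> S \<times> T" by auto
  then show "emeasure (restrict_space M S) A * emeasure (restrict_space N T) B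
      = emeasure (restrict_space (M \<Otimes>\<^sub>M N) (S \<times> T)) (A \<times> B)"
    using A B assms
    by (simp add: emeasure_restrict_space N.emeasure_pair_measure_Times)
qed

definition XM :: "real measure" where
  "XM = restrict_space lborel {0..<1}"

definition ZM :: "real \<Rightarrow> real measure" where
  "ZM h = restrict_space lborel {-h<..<0}"

definition Om :: "real \<Rightarrow> point measure" where
  "Om h = XM \<Otimes>\<^sub>M (XM \<Otimes>\<^sub>M ZM h)"

lemma cell_measurable [measurable]: "cell h \<in> sets borel"
  unfolding cell_def by (intro borel_Times) auto

lemma Om_eq: "Om h = restrict_space lborel (cell h)"
proof -
  have "XM \<Otimes>\<^sub>M ZM h = restrict_space (lborel \<Otimes>\<^sub>M lborel) ({0..<1} \<times> {-h<..<0})"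
    unfolding XM_def ZM_def by (rule restrict_space_pair_measure) (auto intro: lborel.sigma_finite_measure_axioms)
  then have "XM \<Otimes>\<^sub>M (XM \<Otimes>\<^sub>M ZM h) = restrict_space (lborel \<Otimes>\<^sub>M lborel) ({0..<1} \<times> ({0..<1} \<times> {-h<..<0}))"
    unfolding XM_def[symmetric] lborel_prod
    by (simp only: XM_def, subst restrict_space_pair_measure)
       (auto simp: borel_Times lborel_prod intro: lborel.sigma_finite_measure_axioms)
  then show ?thesis by (simp add: Om_def cell_def lborel_prod)
qed

lemma space_XM [simp]: "space XM = {0..<1}"
  and space_ZM [simp]: "space (ZM h) = {-h<..<0}"
  and space_Om [simp]: "space (Om h) = cell h"
  by (auto simp: XM_def ZM_def Om_eq space_restrict_space)

lemma set_integrable_cell: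
  fixes f :: "point \<Rightarrow> 'b::euclidean_space"
  shows "set_integrable lborel (cell h) f \<longleftrightarrow> integrable (Om h) f"
  unfolding Om_eq set_integrable_def by (simp add: integrable_restrict_space)

lemma set_integral_cell:
  fixes f :: "point \<Rightarrow> 'b::euclidean_space"
  shows "(LINT p:cell h|lborel. f p) = integral\<^sup>L (Om h) f"
  unfolding Om_eq set_lebesgue_integral_def by (simp add: integral_restrict_space)

lemma set_measurable_cell:
  fixes f :: "point \<Rightarrow> 'b::euclidean_space"
  shows "set_borel_measurable lborel (cell h) f \<longleftrightarrow> f \<in> borel_measurable (Om h)"
  unfolding Om_eq set_borel_measurable_def by (simp add: borel_measurable_restrict_space_iff)

lemma Om_pair_eq: "Om h \<Otimes>\<^sub>M Om h = restrict_space lborel (cell h \<times> cell h)"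
  unfolding Om_eq by (subst restrict_space_pair_measure) (auto simp: lborel_prod intro: lborel.sigma_finite_measure_axioms)

lemma set_integrable_cell_pair:
  fixes f :: "point \<times> point \<Rightarrow> 'b::euclidean_space"
  shows "set_integrable lborel (cell h \<times> cell h) f \<longleftrightarrow> integrable (Om h \<Otimes>\<^sub>M Om h) f"
  unfolding Om_pair_eq set_integrable_def
  by (simp add: integrable_restrict_space borel_Times)

lemma set_integral_cell_pair:
  fixes f :: "point \<times> point \<Rightarrow> 'b::euclidean_space"
  shows "(LINT p:cell h \<times> cell h|lborel. f p) = integral\<^sup>L (Om h \<Otimes>\<^sub>M Om h) f"
  unfolding Om_pair_eq set_lebesgue_integral_def
  by (simp add: integral_restrict_space borel_Times)

lemma L2_iff: "f \<in> L2 h \<longleftrightarrow> hperiodic h f \<and> f \<in> borel_measurable (Om h)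
    \<and> integrable (Om h) (\<lambda>p. (norm (f p))\<^sup>2)"
  by (simp add: L2_def set_integrable_cell set_measurable_cell)

lemma L2_inner_eq: "L2_inner h f g = (\<integral>p. f p \<bullet> g p \<partial>Om h)"
  by (simp add: L2_inner_def set_integral_cell)

lemma L2_norm_eq: "L2_norm h f = sqrt (\<integral>p. (norm (f p))\<^sup>2 \<partial>Om h)"
  by (simp add: L2_norm_def set_integral_cell)

subsection \<open>Absolutely continuous functions on an interval\<close>

text \<open>Only the interior and the closure of \<open>S\<close> are prescribed, so that the
  half-open period cell and the open vertical interval are treated alike; they differ from a closed
  interval by null sets.\<close>

locale itv =
  fixes a b :: real and S :: "real set" and T :: "real measure"
  assumes ab: "a < b" and S_lower: "{a<..<b} \<subseteq> S" and S_upper: "S \<subseteq> {a..b}"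
    and S_meas [measurable]: "S \<in> sets borel" and T_eq: "T = restrict_space lborel S"
begin

lemma space_T [simp]: "space T = S"
  by (simp add: T_eq space_restrict_space)

lemma AE_T_iff: "(AE t in T. P t) \<longleftrightarrow> (AE t in lborel. t \<in> S \<longrightarrow> P t)"
  unfolding T_eq by (rule AE_restrict_space_iff) simp

lemma AE_neq: "AE s in T. s \<noteq> t"
  unfolding AE_T_iff using AE_lborel_singleton[of t] by eventually_elim auto

lemma AE_interior: "AE s in T. a < s \<and> s < b"
  using AE_neq[of a] AE_neq[of b] AE_space by eventually_elim (use S_upper in force)

lemma emeasure_S: "emeasure lborel S = ennreal (b - a)"
proof (rule antisym)
  show "emeasure lborel S \<le> ennreal (b - a)"
    using emeasure_mono[OF S_upper, of lborel] ab by simp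
  show "ennreal (b - a) \<le> emeasure lborel S"
    using emeasure_mono[OF S_lower, of lborel] ab by simp
qed

lemma emeasure_T: "emeasure T S = ennreal (b - a)"
  unfolding T_eq by (subst emeasure_restrict_space) (auto simp: emeasure_S)

lemma measure_T: "measure T S = b - a"
  using ab by (simp add: measure_def emeasure_T)

sublocale finite_measure T
  by (rule finite_measureI) (simp add: emeasure_T)

lemma measurable_T_id [measurable]: "(\<lambda>x. x) \<in> borel_measurable T"
  unfolding T_eq by (rule measurable_restrict_space1) simp

lemma measurable_T_fst [measurable]: "fst \<in> borel_measurable (T \<Otimes>\<^sub>M N)"
  by (rule measurable_compose[OF measurable_fst measurable_T_id])

lemma measurable_T_snd [measurable]: "snd \<in> borel_measurable (N \<Otimes>\<^sub>M T)"
  by (rule measurable_compose[OF measurable_snd measurable_T_id])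

lemma borel_measurable_T: "f \<in> borel_measurable borel \<Longrightarrow> f \<in> borel_measurable T"
  by (rule measurable_compose[OF measurable_T_id])

text \<open>Keeping the domain of integration fixed and putting the upper limit into an indicator
  reduces measurability in parameters and exchanges of integrals to statements about one product
  measure.\<close>

definition prim :: "(real \<Rightarrow> real) \<Rightarrow> real \<Rightarrow> real" where
  "prim g t = (\<integral>s. indicator {..<t} s * g s \<partial>T)"

lemma integrable_indicator_mult:
  assumes "integrable T g" "A \<in> sets borel"
  shows "integrable T (\<lambda>s. indicator A s * g s :: real)"
proof (rule Bochner_Integration.integrable_bound[OF assms(1)])
  have [measurable]: "g \<in> borel_measurable T" using assms(1) by auto
  have [measurable]: "indicator A \<in> borel_measurable T"
    using assms(2) by (intro borel_measurable_T) auto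
  show "(\<lambda>s. indicator A s * g s :: real) \<in> borel_measurable T"
    by measurable
qed (auto simp: indicator_def)

lemma prim_measurable_pair [measurable]:
  assumes [measurable]: "case_prod g \<in> borel_measurable (N \<Otimes>\<^sub>M T)" "f \<in> borel_measurable N"
  shows "(\<lambda>x. prim (g x) (f x)) \<in> borel_measurable N"
proof -
  have "prim (g x) (f x) = (\<integral>s. (if s < f x then 1 else 0) * g x s \<partial>T)" for x
    unfolding prim_def by (intro Bochner_Integration.integral_cong) (auto simp: indicator_def)
  then show ?thesis by simp
qed

lemma prim_measurable [measurable]:
  assumes [measurable]: "g \<in> borel_measurable T"
  shows "prim g \<in> borel_measurable T"
  by (rule prim_measurable_pair) measurable

lemma prim_bound: "integrable T g \<Longrightarrow> \<bar>prim g t\<bar> \<le> (\<integral>s. \<bar>g s\<bar> \<partial>T)"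
  unfolding prim_def
  by (rule order_trans[OF integral_abs_bound], intro integral_mono integrable_abs integrable_indicator_mult)
     (auto simp: abs_mult indicator_def)

lemma integrable_mult_bounded:
  assumes "integrable T g" "f \<in> borel_measurable T" "\<And>t. \<bar>f t\<bar> \<le> K"
  shows "integrable T (\<lambda>s. g s * f s :: real)"
proof (rule Bochner_Integration.integrable_bound)
  show "integrable T (\<lambda>s. K * \<bar>g s\<bar>)" using assms(1) by simp
  show "(\<lambda>s. g s * f s) \<in> borel_measurable T" using assms(1,2) by measurable
  have "norm (g s * f s) \<le> norm (K * \<bar>g s\<bar>)" for s
    using assms(3)[of s] mult_left_mono[OF assms(3)[of s], of "\<bar>g s\<bar>"]
    by (simp add: abs_mult mult.commute)
  then show "AE s in T. norm (g s * f s) \<le> norm (K * \<bar>g s\<bar>)" by simp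
qed

lemma integrable_mult_prim:
  assumes "integrable T g" "integrable T g2"
  shows "integrable T (\<lambda>s. g s * prim g2 s)"
proof (rule integrable_mult_bounded[OF assms(1)])
  have [measurable]: "g2 \<in> borel_measurable T" using assms(2) by auto
  show "prim g2 \<in> borel_measurable T" by measurable
qed (rule prim_bound[OF assms(2)])

text \<open>Integration by parts is Fubini's theorem on the two halves of a square.\<close>

lemma prim_product:
  assumes g: "integrable T g" and g2: "integrable T g2"
    and A: "A \<in> sets borel" "\<And>r s. s \<in> A \<Longrightarrow> r < s \<Longrightarrow> r \<in> A"
  shows "(\<integral>s. indicator A s * g s \<partial>T) * (\<integral>s. indicator A s * g2 s \<partial>T)
     = (\<integral>s. indicator A s * (g s * prim g2 s + g2 s * prim g s) \<partial>T)"
proof -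
  interpret TT: pair_sigma_finite T T ..
  have [measurable]: "g \<in> borel_measurable T" "g2 \<in> borel_measurable T" "A \<in> sets borel"
    using g g2 A by auto
  have [measurable]: "(indicator A :: real \<Rightarrow> real) \<in> borel_measurable T"
    by (rule borel_measurable_T) auto
  have I0: "integrable (T \<Otimes>\<^sub>M T) (\<lambda>(s, r). g s * g2 r)"
  proof (rule TT.Fubini_integrable)
    show "integrable T (\<lambda>x. \<integral>y. norm (case (x, y) of (s, r) \<Rightarrow> g s * g2 r) \<partial>T)"
      using g by (simp add: abs_mult)
    show "AE x in T. integrable T (\<lambda>y. case (x, y) of (s, r) \<Rightarrow> g s * g2 r)"
      using g2 by simp
  qed measurable
  \<comment> \<open>The square is cut along its null diagonal. Since \<open>A\<close> is closed
    downwards, \<open>s \<in> A\<close> already implies \<open>r \<in> A\<close> on the half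
    \<open>r < s\<close>, and symmetrically on the other half, so one indicator is enough on
    each.\<close>
  have I1: "integrable (T \<Otimes>\<^sub>M T) (\<lambda>(s, r). indicator A s * (if r < s then g s * g2 r else 0))"
    by (rule Bochner_Integration.integrable_bound[OF I0]) (measurable, auto simp: indicator_def)
  have I2: "integrable (T \<Otimes>\<^sub>M T) (\<lambda>(s, r). indicator A r * (if s < r then g s * g2 r else 0))"
    by (rule Bochner_Integration.integrable_bound[OF I0]) (measurable, auto simp: indicator_def)
  have E1: "(\<integral>s. \<integral>r. indicator A s * (if r < s then g s * g2 r else 0) \<partial>T \<partial>T)
      = (\<integral>s. indicator A s * (g s * prim g2 s) \<partial>T)"
    unfolding prim_def
    by (intro Bochner_Integration.integral_cong refl, simp only: integral_mult_right_zero[symmetric],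
        intro Bochner_Integration.integral_cong refl, simp add: indicator_def)
  have "(\<integral>s. \<integral>r. indicator A r * (if s < r then g s * g2 r else 0) \<partial>T \<partial>T)
     = (\<integral>r. \<integral>s. indicator A r * (if s < r then g s * g2 r else 0) \<partial>T \<partial>T)"
    by (rule TT.Fubini_integral[OF I2, symmetric])
  also have "\<dots> = (\<integral>s. indicator A s * (g2 s * prim g s) \<partial>T)"
    unfolding prim_def
    by (intro Bochner_Integration.integral_cong refl, simp only: integral_mult_right_zero[symmetric],
        intro Bochner_Integration.integral_cong refl, simp add: indicator_def)
  finally have E2: "(\<integral>s. \<integral>r. indicator A r * (if s < r then g s * g2 r else 0) \<partial>T \<partial>T)
     = (\<integral>s. indicator A s * (g2 s * prim g s) \<partial>T)" .
  have "(\<integral>s. indicator A s * g s \<partial>T) * (\<integral>r. indicator A r * g2 r \<partial>T)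
      = (\<integral>s. (\<integral>r. indicator A s * g s * (indicator A r * g2 r) \<partial>T) \<partial>T)"
    by simp
  also have "\<dots> = (\<integral>s. (\<integral>r. indicator A s * (if r < s then g s * g2 r else 0) \<partial>T)
          + (\<integral>r. indicator A r * (if s < r then g s * g2 r else 0) \<partial>T) \<partial>T)"
  proof (rule Bochner_Integration.integral_cong_AE)
    show "AE s in T. (\<integral>r. indicator A s * g s * (indicator A r * g2 r) \<partial>T) =
        (\<integral>r. indicator A s * (if r < s then g s * g2 r else 0) \<partial>T)
        + (\<integral>r. indicator A r * (if s < r then g s * g2 r else 0) \<partial>T)"
      using TT.AE_integrable_fst'[OF I1] TT.AE_integrable_fst'[OF I2]
    proof eventually_elim
      fix s assume i: "integrable T (\<lambda>y. case (s, y) of (s, r) \<Rightarrow> indicator A s * (if r < s then g s * g2 r else 0))"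
        "integrable T (\<lambda>y. case (s, y) of (s, r) \<Rightarrow> indicator A r * (if s < r then g s * g2 r else 0))"
      have "(\<integral>r. indicator A s * g s * (indicator A r * g2 r) \<partial>T)
        = (\<integral>r. indicator A s * (if r < s then g s * g2 r else 0)
            + indicator A r * (if s < r then g s * g2 r else 0) \<partial>T)"
      proof (rule Bochner_Integration.integral_cong_AE)
        show "AE r in T. indicator A s * g s * (indicator A r * g2 r) =
             indicator A s * (if r < s then g s * g2 r else 0)
            + indicator A r * (if s < r then g s * g2 r else 0)"
          using AE_neq[of s]
        proof eventually_elim
          case (elim r)
          then have "r < s \<or> s < r" by auto
          then show ?case using A(2)[of r s] A(2)[of s r] by (auto simp: indicator_def)
        qed
      qed measurable
      also have "\<dots> = (\<integral>r. indicator A s * (if r < s then g s * g2 r else 0) \<partial>T)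
        + (\<integral>r. indicator A r * (if s < r then g s * g2 r else 0) \<partial>T)"
        using i by (intro Bochner_Integration.integral_add) auto
      finally show "(\<integral>r. indicator A s * g s * (indicator A r * g2 r) \<partial>T) = \<dots>" .
    qed
  qed measurable
  also have "\<dots> = (\<integral>s. (\<integral>r. indicator A s * (if r < s then g s * g2 r else 0) \<partial>T) \<partial>T)
          + (\<integral>s. (\<integral>r. indicator A r * (if s < r then g s * g2 r else 0) \<partial>T) \<partial>T)"
    using TT.integrable_fst'[OF I1] TT.integrable_fst'[OF I2]
    by (intro Bochner_Integration.integral_add) auto
  also have "\<dots> = (\<integral>s. indicator A s * (g s * prim g2 s) \<partial>T) + (\<integral>s. indicator A s * (g2 s * prim g s) \<partial>T)"
    by (simp only: E1 E2)
  also have "\<dots> = (\<integral>s. indicator A s * (g s * prim g2 s) + indicator A s * (g2 s * prim g s) \<partial>T)"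
    using integrable_mult_prim[OF g g2] integrable_mult_prim[OF g2 g] A
    by (intro Bochner_Integration.integral_add[symmetric] integrable_indicator_mult) auto
  finally show ?thesis by (simp add: distrib_left)
qed

text \<open>The product formula with constants of integration. With \<open>A = {..<t}\<close> it is
  the product rule at \<open>t\<close>; with \<open>A = UNIV\<close> it gives the values at the
  right end point, hence periodicity of products and integration by parts.\<close>

lemma affine_prim_product:
  assumes g: "integrable T g" and g2: "integrable T g2"
    and A: "A \<in> sets borel" "\<And>r s. s \<in> A \<Longrightarrow> r < s \<Longrightarrow> r \<in> A"
    and f: "AE t in T. f t = C + prim g t" and f2: "AE t in T. f2 t = C2 + prim g2 t"
    and mf [measurable]: "f \<in> borel_measurable T" "f2 \<in> borel_measurable T"
  shows "(C + (\<integral>s. indicator A s * g s \<partial>T)) * (C2 + (\<integral>s. indicator A s * g2 s \<partial>T))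
     = C * C2 + (\<integral>s. indicator A s * (g s * f2 s + f s * g2 s) \<partial>T)"
    and "integrable T (\<lambda>s. g s * f2 s + f s * g2 s)"
proof -
  have m[measurable]: "g \<in> borel_measurable T" "g2 \<in> borel_measurable T" "A \<in> sets borel"
    using g g2 A by auto
  have [measurable]: "(indicator A :: real \<Rightarrow> real) \<in> borel_measurable T"
    by (rule borel_measurable_T) auto
  have AEq: "AE s in T. C2 * g s + C * g2 s + (g s * prim g2 s + g2 s * prim g s) = g s * f2 s + f s * g2 s"
    using f f2 by eventually_elim (simp add: algebra_simps)
  have i: "integrable T (\<lambda>s. g s * prim g2 s + g2 s * prim g s)"
    by (intro Bochner_Integration.integrable_add integrable_mult_prim g g2)
  have i2: "integrable T (\<lambda>s. C2 * g s + C * g2 s)"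
    using g g2 by simp
  show int: "integrable T (\<lambda>s. g s * f2 s + f s * g2 s)"
    by (rule integrable_cong_AE_imp[OF Bochner_Integration.integrable_add[OF i2 i] _ AEq]) measurable
  have "(\<integral>s. indicator A s * (g s * f2 s + f s * g2 s) \<partial>T)
      = (\<integral>s. indicator A s * (C2 * g s + C * g2 s) + indicator A s * (g s * prim g2 s + g2 s * prim g s) \<partial>T)"
  proof (rule Bochner_Integration.integral_cong_AE)
    show "AE s in T. indicator A s * (g s * f2 s + f s * g2 s) =
       indicator A s * (C2 * g s + C * g2 s) + indicator A s * (g s * prim g2 s + g2 s * prim g s)"
      using AEq by eventually_elim (simp add: distrib_left[symmetric])
  qed measurable
  also have "\<dots> = (\<integral>s. indicator A s * (C2 * g s + C * g2 s) \<partial>T)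
      + (\<integral>s. indicator A s * (g s * prim g2 s + g2 s * prim g s) \<partial>T)"
    by (intro Bochner_Integration.integral_add integrable_indicator_mult i i2 A)
  also have "(\<integral>s. indicator A s * (C2 * g s + C * g2 s) \<partial>T)
    = (\<integral>s. C2 * (indicator A s * g s) + C * (indicator A s * g2 s) \<partial>T)"
    by (simp add: algebra_simps)
  also have "\<dots> = C2 * (\<integral>s. indicator A s * g s \<partial>T) + C * (\<integral>s. indicator A s * g2 s \<partial>T)"
    by (subst Bochner_Integration.integral_add)
       (auto intro!: Bochner_Integration.integrable_mult_right integrable_indicator_mult g g2)
  finally show "(C + (\<integral>s. indicator A s * g s \<partial>T)) * (C2 + (\<integral>s. indicator A s * g2 s \<partial>T))
     = C * C2 + (\<integral>s. indicator A s * (g s * f2 s + f s * g2 s) \<partial>T)"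
    using prim_product[OF g g2 A] by (simp add: algebra_simps)
qed

text \<open>Almost everywhere equality with an absolutely continuous function with derivative \<open>g\<close>,
  which takes equal values at the end points if \<open>per\<close>.\<close>

definition ac :: "bool \<Rightarrow> (real \<Rightarrow> real) \<Rightarrow> (real \<Rightarrow> real) \<Rightarrow> bool" where
  "ac per f g \<longleftrightarrow> f \<in> borel_measurable T \<and> integrable T g \<and> (\<exists>C. AE t in T. f t = C + prim g t) \<and>
     (per \<longrightarrow> (\<integral>s. g s \<partial>T) = 0)"

lemma acD:
  assumes "ac per f g"
  shows "integrable T g" "f \<in> borel_measurable T" "g \<in> borel_measurable T"
  using assms by (auto simp: ac_def)

lemma ac_add:
  assumes "ac per f g" "ac per f2 g2"
  shows "ac per (\<lambda>t. f t + f2 t) (\<lambda>t. g t + g2 t)"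
proof -
  from assms obtain C C2 where C: "AE t in T. f t = C + prim g t" "AE t in T. f2 t = C2 + prim g2 t"
    and g: "integrable T g" "integrable T g2"
    by (auto simp: ac_def)
  have "prim (\<lambda>t. g t + g2 t) t = prim g t + prim g2 t" for t
    unfolding prim_def distrib_left
    by (intro Bochner_Integration.integral_add integrable_indicator_mult g) auto
  note pr = this
  have "AE t in T. f t + f2 t = (C + C2) + prim (\<lambda>t. g t + g2 t) t"
    using C by eventually_elim (simp add: pr)
  then show ?thesis using assms unfolding ac_def by auto
qed

lemma ac_cmult:
  assumes "ac per f g"
  shows "ac per (\<lambda>t. c * f t) (\<lambda>t. c * g t)"
proof -
  from assms obtain C where C: "AE t in T. f t = C + prim g t" by (auto simp: ac_def)
  have "prim (\<lambda>t. c * g t) t = c * prim g t" for t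
    unfolding prim_def by (subst integral_mult_right_zero[symmetric]) (simp add: ac_simps)
  note pr = this
  have "AE t in T. c * f t = c * C + prim (\<lambda>t. c * g t) t"
    using C by eventually_elim (simp add: pr algebra_simps)
  then show ?thesis using assms unfolding ac_def by auto
qed

lemma ac_cong_AE:
  assumes "ac per f g" "AE t in T. f t = f2 t" "AE t in T. g t = g2 t"
    "f2 \<in> borel_measurable T" "g2 \<in> borel_measurable T"
  shows "ac per f2 g2"
proof -
  from assms obtain C where C: "AE t in T. f t = C + prim g t" by (auto simp: ac_def)
  have m[measurable]: "g \<in> borel_measurable T" "g2 \<in> borel_measurable T" using acD[OF assms(1)] assms by auto
  have "prim g t = prim g2 t" for t
    unfolding prim_def
  proof (rule Bochner_Integration.integral_cong_AE)
    have [measurable]: "(indicator {..<t} :: real \<Rightarrow> real) \<in> borel_measurable T"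
      by (rule borel_measurable_T) auto
    show "(\<lambda>s. indicator {..<t} s * g s) \<in> borel_measurable T"
      "(\<lambda>s. indicator {..<t} s * g2 s) \<in> borel_measurable T" by measurable
    show "AE s in T. indicator {..<t} s * g s = indicator {..<t} s * g2 s"
      using assms(3) by eventually_elim simp
  qed
  note pr = this
  have "AE t in T. f2 t = C + prim g2 t"
    using C assms(2) by eventually_elim (simp add: pr)
  moreover have "integrable T g2"
    by (rule integrable_cong_AE_imp[OF acD(1)[OF assms(1)] assms(5)]) (use assms(3) in \<open>eventually_elim, simp\<close>)
  moreover have "(\<integral>s. g s \<partial>T) = (\<integral>s. g2 s \<partial>T)"
    by (rule Bochner_Integration.integral_cong_AE) (use assms m in auto)
  ultimately show ?thesis using assms unfolding ac_def by auto
qed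

lemma ac_mult:
  assumes "ac per f g" "ac per f2 g2"
  shows "ac per (\<lambda>t. f t * f2 t) (\<lambda>t. g t * f2 t + f t * g2 t)"
proof -
  from assms obtain C C2 where C: "AE t in T. f t = C + prim g t" "AE t in T. f2 t = C2 + prim g2 t"
    and g: "integrable T g" "integrable T g2"
    and per: "per \<Longrightarrow> (\<integral>s. g s \<partial>T) = 0" "per \<Longrightarrow> (\<integral>s. g2 s \<partial>T) = 0"
    by (auto simp: ac_def)
  note m = acD(2)[OF assms(1)] acD(2)[OF assms(2)]
  have "AE t in T. f t * f2 t = C * C2 + prim (\<lambda>s. g s * f2 s + f s * g2 s) t"
    using C
  proof eventually_elim
    case (elim t)
    show ?case unfolding elim
      using affine_prim_product(1)[OF g _ _ C m, of "{..<t}"] by (simp add: prim_def)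
  qed
  \<comment> \<open>Both primitives return to zero at the right end, so the formula on the whole
    interval reads \<open>C * C2 = C * C2 +\<close> the integral in question.\<close>
  moreover have "per \<longrightarrow> (\<integral>s. g s * f2 s + f s * g2 s \<partial>T) = 0"
  proof
    assume per
    then show "(\<integral>s. g s * f2 s + f s * g2 s \<partial>T) = 0"
      using affine_prim_product(1)[OF g _ _ C m, of UNIV] per by simp
  qed
  ultimately show ?thesis
    using affine_prim_product(2)[OF g _ _ C m, of UNIV] m unfolding ac_def by auto
qed

lemma prim_deriv:
  assumes d: "\<And>t. (\<phi> has_real_derivative \<phi>' t) (at t)" and c: "continuous_on UNIV \<phi>'" and t: "t \<in> {a..b}"
  shows "\<phi> t = \<phi> a + prim \<phi>' t"
proof -
  have "prim \<phi>' t = (\<integral>s. indicator S s * (indicator {..<t} s * \<phi>' s) \<partial>lborel)"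
    unfolding prim_def unfolding T_eq by (subst integral_restrict_space) auto
  also have "\<dots> = (\<integral>s. indicator {a..t} s *\<^sub>R \<phi>' s \<partial>lborel)"
  proof (rule Bochner_Integration.integral_cong_AE)
    have [measurable]: "\<phi>' \<in> borel_measurable borel" using c by (rule borel_measurable_continuous_onI)
    show "(\<lambda>s. indicator S s * (indicator {..<t} s * \<phi>' s)) \<in> borel_measurable lborel"
      "(\<lambda>s. indicator {a..t} s *\<^sub>R \<phi>' s) \<in> borel_measurable lborel" by simp_all
    show "AE s in lborel. indicator S s * (indicator {..<t} s * \<phi>' s) = indicator {a..t} s *\<^sub>R \<phi>' s"
      using AE_lborel_singleton[of t] AE_lborel_singleton[of a]
    proof eventually_elim
      case (elim s)
      have "s \<in> S \<and> s < t \<longleftrightarrow> s \<in> {a..t}"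
        using S_lower S_upper t elim by (force simp: subset_eq)
      then show ?case by (auto simp: indicator_def)
    qed
  qed
  also have "\<dots> = \<phi> t - \<phi> a"
    by (rule integral_FTC_Icc)
       (use t d c in \<open>auto intro: continuous_on_subset has_field_derivative_at_within
          simp: has_real_derivative_iff_has_vector_derivative[symmetric]\<close>)
  finally show ?thesis by simp
qed

lemma integral_deriv:
  assumes d: "\<And>t. (\<phi> has_real_derivative \<phi>' t) (at t)" and c: "continuous_on UNIV \<phi>'"
  shows "(\<integral>s. \<phi>' s \<partial>T) = \<phi> b - \<phi> a"
proof -
  have [measurable]: "\<phi>' \<in> borel_measurable borel" using c by (rule borel_measurable_continuous_onI)
  have "(\<integral>s. \<phi>' s \<partial>T) = prim \<phi>' b"
    unfolding prim_def
  proof (rule Bochner_Integration.integral_cong_AE)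
    show "(\<lambda>s. indicator {..<b} s * \<phi>' s) \<in> borel_measurable T" "\<phi>' \<in> borel_measurable T"
      by (intro borel_measurable_T; measurable)+
    show "AE s in T. \<phi>' s = indicator {..<b} s * \<phi>' s"
      using AE_interior by eventually_elim (auto simp: indicator_def)
  qed
  then show ?thesis using prim_deriv[OF d c, of b] ab by simp
qed

lemma continuous_bounded_T:
  fixes \<phi> :: "real \<Rightarrow> real"
  assumes "continuous_on UNIV \<phi>"
  obtains K where "\<And>t. t \<in> S \<Longrightarrow> \<bar>\<phi> t\<bar> \<le> K"
proof -
  have "bounded (\<phi> ` {a..b})"
    by (intro compact_imp_bounded compact_continuous_image continuous_on_subset[OF assms]) auto
  then show ?thesis using S_upper that unfolding bounded_iff by fastforce
qed

lemma integrable_continuous_T: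
  fixes \<phi> :: "real \<Rightarrow> real"
  assumes "continuous_on UNIV \<phi>"
  shows "integrable T \<phi>"
proof -
  obtain K where "\<And>t. t \<in> S \<Longrightarrow> \<bar>\<phi> t\<bar> \<le> K" using continuous_bounded_T[OF assms] by blast
  then show ?thesis
    by (intro integrable_const_bound[where B=K] borel_measurable_T borel_measurable_continuous_onI assms) auto
qed

text \<open>The product formula on the whole interval leaves the boundary term
  \<open>(C + total) * \<phi> b - C * \<phi> a\<close>, where \<open>total\<close> is the integral
  of \<open>g\<close>. It vanishes if \<open>total = 0\<close> and \<open>\<phi>\<close> is
  periodic, and also if \<open>\<phi>\<close> vanishes at both ends, whatever the boundary values of
  \<open>f\<close>.\<close>

lemma ac_by_parts:
  assumes f: "ac per f g"
    and d: "\<And>t. (\<phi> has_real_derivative \<phi>' t) (at t)" and c: "continuous_on UNIV \<phi>'"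
    and bc: "\<phi> a = \<phi> b" "per \<or> \<phi> a = 0"
  shows "integrable T (\<lambda>t. g t * \<phi> t + f t * \<phi>' t)" "(\<integral>t. g t * \<phi> t + f t * \<phi>' t \<partial>T) = 0"
proof -
  have \<phi>: "continuous_on UNIV \<phi>"
    using d by (meson DERIV_continuous continuous_at_imp_continuous_on)
  from f obtain C where C: "AE t in T. f t = C + prim g t"
    and g: "integrable T g" and per: "per \<Longrightarrow> (\<integral>s. g s \<partial>T) = 0"
    by (auto simp: ac_def)
  have C2: "AE t in T. \<phi> t = \<phi> a + prim \<phi>' t"
  proof (rule AE_I2)
    fix t assume "t \<in> space T"
    then have "t \<in> {a..b}" using S_upper by auto
    then show "\<phi> t = \<phi> a + prim \<phi>' t" by (rule prim_deriv[OF d c])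
  qed
  have m: "f \<in> borel_measurable T" "\<phi> \<in> borel_measurable T"
    using acD[OF f] by (auto intro!: borel_measurable_T borel_measurable_continuous_onI \<phi>)
  note * = affine_prim_product[OF g integrable_continuous_T[OF c] _ _ C C2 m, of UNIV, simplified]
  show "integrable T (\<lambda>t. g t * \<phi> t + f t * \<phi>' t)" by (rule *)
  show "(\<integral>t. g t * \<phi> t + f t * \<phi>' t \<partial>T) = 0"
    using *(1) bc per integral_deriv[OF d c] by auto
qed

text \<open>The one-dimensional Sobolev inequality: passing from \<open>f t\<close> to
  \<open>f s\<close> costs at most the integral of \<open>\<bar>g\<bar>\<close>, and the comparison
  is averaged over \<open>s\<close>.\<close>

lemma ac_bound:
  assumes f: "ac per f g"
  shows "integrable T f" "AE t in T. \<bar>f t\<bar> * (b - a) \<le> (\<integral>s. \<bar>f s\<bar> \<partial>T) + (b - a) * (\<integral>s. \<bar>g s\<bar> \<partial>T)"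
proof -
  from f obtain C where C: "AE t in T. f t = C + prim g t"
    and g: "integrable T g" and m: "f \<in> borel_measurable T"
    by (auto simp: ac_def)
  have m': "g \<in> borel_measurable T" using g by auto
  have "integrable T (\<lambda>t. C + prim g t)"
    using prim_bound[OF g] g prim_measurable[OF m']
    by (intro Bochner_Integration.integrable_add integrable_const integrable_const_bound[where B="\<integral>s. \<bar>g s\<bar> \<partial>T"]) auto
  then show int: "integrable T f"
    by (rule integrable_cong_AE_imp) (use m C in \<open>auto elim: eventually_mono\<close>)
  show "AE t in T. \<bar>f t\<bar> * (b - a) \<le> (\<integral>s. \<bar>f s\<bar> \<partial>T) + (b - a) * (\<integral>s. \<bar>g s\<bar> \<partial>T)"
    using C
  proof eventually_elim
    case (elim t)
    have 1: "AE s in T. \<bar>f t\<bar> \<le> \<bar>f s\<bar> + (\<integral>s. \<bar>g s\<bar> \<partial>T)"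
      using C
    proof eventually_elim
      fix s assume s: "f s = C + prim g s"
      have "prim g t - prim g s = (\<integral>r. (indicator {..<t} r - indicator {..<s} r) * g r \<partial>T)"
        unfolding prim_def left_diff_distrib
        by (intro Bochner_Integration.integral_diff[symmetric] integrable_indicator_mult g) auto
      also have "\<bar>\<dots>\<bar> \<le> (\<integral>r. \<bar>(indicator {..<t} r - indicator {..<s} r) * g r\<bar> \<partial>T)"
        by (rule integral_abs_bound)
      also have "\<dots> \<le> (\<integral>s. \<bar>g s\<bar> \<partial>T)"
      proof (rule integral_mono)
        show "integrable T (\<lambda>r. \<bar>(indicator {..<t} r - indicator {..<s} r) * g r\<bar>)"
          unfolding left_diff_distrib
          by (intro integrable_abs Bochner_Integration.integrable_diff integrable_indicator_mult g) auto
      qed (use g in \<open>auto simp: abs_mult indicator_def\<close>)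
      finally show "\<bar>f t\<bar> \<le> \<bar>f s\<bar> + (\<integral>s. \<bar>g s\<bar> \<partial>T)" using s elim by simp
    qed
    have "(\<integral>s. \<bar>f t\<bar> \<partial>T) \<le> (\<integral>s. \<bar>f s\<bar> + (\<integral>s. \<bar>g s\<bar> \<partial>T) \<partial>T)"
      by (rule integral_mono_AE) (use int 1 in auto)
    also have "\<dots> = (\<integral>s. \<bar>f s\<bar> \<partial>T) + (b - a) * (\<integral>s. \<bar>g s\<bar> \<partial>T)"
      using int by (subst Bochner_Integration.integral_add) (auto simp: measure_T)
    finally show ?case by (simp add: measure_T mult.commute)
  qed
qed

text \<open>The previous bound for the square of \<open>f\<close>, with derivative
  \<open>2 * f * g\<close>. Squaring first is what later produces a product of the norms of
  \<open>f\<close> and of its derivative instead of the norm of the derivative alone.\<close>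

lemma ac_square_bound:
  assumes f: "ac per f g"
  shows "AE t in T. (f t)\<^sup>2 * (b - a) \<le> (\<integral>s. (f s)\<^sup>2 \<partial>T) + 2 * (b - a) * (\<integral>s. \<bar>f s * g s\<bar> \<partial>T)"
    "integrable T (\<lambda>s. (f s)\<^sup>2)" "integrable T (\<lambda>s. \<bar>f s * g s\<bar>)"
proof -
  have *: "ac per (\<lambda>t. (f t)\<^sup>2) (\<lambda>t. 2 * (f t * g t))"
    using ac_mult[OF f f] by (simp add: power2_eq_square mult.commute[of "g _" "f _"])
  have "(\<integral>s. \<bar>2 * (f s * g s)\<bar> \<partial>T) = 2 * (\<integral>s. \<bar>f s * g s\<bar> \<partial>T)"
    by (simp add: abs_mult)
  then show "AE t in T. (f t)\<^sup>2 * (b - a) \<le> (\<integral>s. (f s)\<^sup>2 \<partial>T) + 2 * (b - a) * (\<integral>s. \<bar>f s * g s\<bar> \<partial>T)"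
    using ac_bound(2)[OF *] by (simp only: mult.left_commute[of "b - a" 2] mult.assoc abs_power2)
  show "integrable T (\<lambda>s. (f s)\<^sup>2)" "integrable T (\<lambda>s. \<bar>f s * g s\<bar>)"
    using ac_bound(1)[OF *] acD[OF *] by auto
qed

end

subsection \<open>Smooth functions of one variable\<close>

text \<open>Smoothness is witnessed by a tower of derivatives. This allows proofs by coinduction:
  every set of functions that is closed under differentiation consists of smooth functions.\<close>

definition sm1 :: "(real \<Rightarrow> real) \<Rightarrow> bool" where
  "sm1 f \<longleftrightarrow> (\<exists>F. F 0 = f \<and> (\<forall>n x. (F n has_real_derivative F (Suc n) x) (at x)))"

lemma sm1_coinduct:
  assumes "f \<in> A" and step: "\<And>f. f \<in> A \<Longrightarrow> \<exists>g\<in>A. \<forall>x. (f has_real_derivative g x) (at x)"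
  shows "sm1 f"
proof -
  obtain D where D: "\<And>f. f \<in> A \<Longrightarrow> D f \<in> A" "\<And>f x. f \<in> A \<Longrightarrow> (f has_real_derivative D f x) (at x)"
    using step by metis
  have A: "(D ^^ n) f \<in> A" for n
    by (induction n) (auto simp: D assms(1))
  show ?thesis
    unfolding sm1_def by (intro exI[of _ "\<lambda>n. (D ^^ n) f"]) (auto intro: D(2) A)
qed

lemma sm1_step:
  assumes "sm1 f" obtains g where "sm1 g" "\<And>x. (f has_real_derivative g x) (at x)"
proof -
  obtain F where F: "F 0 = f" "\<And>n x. (F n has_real_derivative F (Suc n) x) (at x)"
    using assms by (auto simp: sm1_def)
  then have "sm1 (F 1)" unfolding sm1_def by (intro exI[of _ "\<lambda>n. F (Suc n)"]) auto
  then show thesis using that[of "F 1"] F(2)[of 0] F(1) by simp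
qed

lemma sm1_deriv: "sm1 f \<Longrightarrow> sm1 (deriv f)"
  and sm1_has_deriv: "sm1 f \<Longrightarrow> (f has_real_derivative deriv f x) (at x)"
proof -
  assume f: "sm1 f"
  obtain g where g: "sm1 g" "\<And>x. (f has_real_derivative g x) (at x)" using sm1_step[OF f] by blast
  then have "deriv f = g" by (intro ext DERIV_imp_deriv)
  with g show "sm1 (deriv f)" "(f has_real_derivative deriv f x) (at x)" by auto
qed

lemma sm1_continuous: "sm1 f \<Longrightarrow> continuous_on A f"
  by (meson sm1_has_deriv DERIV_continuous continuous_at_imp_continuous_on continuous_on_subset subset_UNIV)

lemma sm1_deriv_funpow: "sm1 f \<Longrightarrow> sm1 ((deriv ^^ n) f)"
  by (induction n) (auto intro: sm1_deriv)

lemma sm1_primitive: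
  assumes "sm1 g" "\<And>x. (f has_real_derivative g x) (at x)" shows "sm1 f"
  by (rule sm1_coinduct[of f "insert f {g. sm1 g}"])
     (use assms in \<open>auto intro: sm1_step\<close>)

text \<open>By the chain and product rules this set is closed under differentiation, so one
  coinduction proves that smooth functions are stable under composition, sums and products.\<close>

inductive_set sm_alg :: "(real \<Rightarrow> real) set" where
  comp: "sm1 f \<Longrightarrow> sm1 g \<Longrightarrow> (\<lambda>x. f (g x)) \<in> sm_alg"
| add: "f \<in> sm_alg \<Longrightarrow> g \<in> sm_alg \<Longrightarrow> (\<lambda>x. f x + g x) \<in> sm_alg"
| mult: "f \<in> sm_alg \<Longrightarrow> g \<in> sm_alg \<Longrightarrow> (\<lambda>x. f x * g x) \<in> sm_alg"

lemma sm1_ident: "sm1 (\<lambda>x. x)"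
  unfolding sm1_def
  by (intro exI[of _ "\<lambda>n x. if n = 0 then x else if n = 1 then 1 else 0"])
     (auto intro!: derivative_eq_intros)

lemma sm1_const: "sm1 (\<lambda>x. c)"
  unfolding sm1_def
  by (intro exI[of _ "\<lambda>n x. if n = 0 then c else 0"]) (auto intro!: derivative_eq_intros)

lemma sm1_in_alg: "sm1 f \<Longrightarrow> f \<in> sm_alg"
  using sm_alg.comp[OF _ sm1_ident] by simp

lemma sm_alg_sm1: "f \<in> sm_alg \<Longrightarrow> sm1 f"
proof (erule sm1_coinduct)
  fix f :: "real \<Rightarrow> real" assume "f \<in> sm_alg"
  then show "\<exists>g\<in>sm_alg. \<forall>x. (f has_real_derivative g x) (at x)"
  proof induction
    case (comp f g)
    obtain f' where f: "sm1 f'" "\<And>x. (f has_real_derivative f' x) (at x)" using sm1_step[OF comp(1)] by blast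
    obtain g' where g: "sm1 g'" "\<And>x. (g has_real_derivative g' x) (at x)" using sm1_step[OF comp(2)] by blast
    have "(\<lambda>x. f' (g x) * g' x) \<in> sm_alg"
      by (intro sm_alg.mult sm_alg.comp f g comp sm1_in_alg)
    moreover have "((\<lambda>x. f (g x)) has_real_derivative f' (g x) * g' x) (at x)" for x
      by (rule DERIV_chain2[OF f(2) g(2)])
    ultimately show ?case by (intro bexI[of _ "\<lambda>x. f' (g x) * g' x"] allI)
  next
    case (add f g)
    then obtain f' g' where fg: "f' \<in> sm_alg" "g' \<in> sm_alg" "\<And>x. (f has_real_derivative f' x) (at x)"
        "\<And>x. (g has_real_derivative g' x) (at x)" by auto
    show ?case
      by (rule bexI[OF _ sm_alg.add[OF fg(1,2)]]) (auto intro!: derivative_eq_intros fg)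
  next
    case (mult f g)
    then obtain f' g' where fg: "f' \<in> sm_alg" "g' \<in> sm_alg" "\<And>x. (f has_real_derivative f' x) (at x)"
        "\<And>x. (g has_real_derivative g' x) (at x)" by auto
    have "(\<lambda>x. f x * g' x + f' x * g x) \<in> sm_alg"
      by (intro sm_alg.add sm_alg.mult fg mult)
    moreover have "((\<lambda>x. f x * g x) has_real_derivative f x * g' x + f' x * g x) (at x)" for x
      by (rule DERIV_mult'[OF fg(3,4)])
    ultimately show ?case by (intro bexI[of _ "\<lambda>x. f x * g' x + f' x * g x"] allI)
  qed
qed

lemma sm1_add: "sm1 f \<Longrightarrow> sm1 g \<Longrightarrow> sm1 (\<lambda>x. f x + g x)"
  and sm1_mult: "sm1 f \<Longrightarrow> sm1 g \<Longrightarrow> sm1 (\<lambda>x. f x * g x)"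
  and sm1_comp: "sm1 f \<Longrightarrow> sm1 g \<Longrightarrow> sm1 (\<lambda>x. f (g x))"
  by (auto intro: sm_alg_sm1 sm_alg.intros sm1_in_alg)

lemma sm1_diff: "sm1 f \<Longrightarrow> sm1 g \<Longrightarrow> sm1 (\<lambda>x. f x - g x)"
  using sm1_add[of f "\<lambda>x. (-1) * g x"] sm1_mult[OF sm1_const[of "-1"], of g] by simp

lemma sm1_cos: "sm1 cos"
proof (rule sm1_coinduct[of _ "{cos, sin, \<lambda>x. - cos x, \<lambda>x. - sin x}"])
  fix f :: "real \<Rightarrow> real" assume "f \<in> {cos, sin, \<lambda>x. - cos x, \<lambda>x. - sin x}"
  then show "\<exists>g\<in>{cos, sin, \<lambda>x. - cos x, \<lambda>x. - sin x}. \<forall>x. (f has_real_derivative g x) (at x)"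
    by (elim insertE emptyE) (simp; force intro!: derivative_eq_intros)+
qed simp

text \<open>The flat function \<open>exp (- 1 / t)\<close>, continued by zero, with a polynomial in
  \<open>1 / t\<close> as a factor. The polynomial is carried along because the family is then
  closed under differentiation.\<close>

definition eta :: "real poly \<Rightarrow> real \<Rightarrow> real" where
  "eta p t = (if t > 0 then poly p (1 / t) * exp (- (1 / t)) else 0)"

lemma poly_exp_tendsto_0: "((\<lambda>x. poly p x * exp (- x)) \<longlongrightarrow> 0) at_top" for p :: "real poly"
proof -
  have "((\<lambda>x. \<Sum>i\<le>degree p. coeff p i * (x ^ i / exp x)) \<longlongrightarrow> (\<Sum>i\<le>degree p. coeff p i * 0)) at_top"
    by (intro tendsto_sum tendsto_mult tendsto_const tendsto_power_div_exp_0)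
  then show ?thesis
    by (simp add: poly_altdef sum_distrib_right exp_minus divide_inverse mult.assoc)
qed

text \<open>In the variable \<open>x = 1 / t\<close> the derivative with respect to \<open>t\<close>
  is \<open>- x^2\<close> times the derivative with respect to \<open>x\<close>; applied to
  \<open>p x * exp (- x)\<close> it gives \<open>(p - p') x * x^2 * exp (- x)\<close>.\<close>

lemma eta_deriv: "(eta p has_real_derivative eta ((p - pderiv p) * [:0, 0, 1:]) t) (at t)"
proof -
  consider "t < 0" | "t = 0" | "t > 0" by linarith
  then show ?thesis
  proof cases
    case 1
    have "((\<lambda>x. 0 :: real) has_real_derivative 0) (at t)" by simp
    then show ?thesis
      by (rule has_field_derivative_transform_within_open[where S="{..<0}", THEN DERIV_cong])
         (use 1 in \<open>auto simp: eta_def\<close>)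
  next
    case 3
    have "((\<lambda>x. poly p (1 / x) * exp (- (1 / x))) has_real_derivative
       eta ((p - pderiv p) * [:0, 0, 1:]) t) (at t)"
      using 3 by (auto intro!: derivative_eq_intros DERIV_chain2[OF poly_DERIV] simp: eta_def field_simps power2_eq_square)
    then show ?thesis
      by (rule has_field_derivative_transform_within_open[where S="{0<..}"])
         (use 3 in \<open>auto simp: eta_def\<close>)
  next
    case 2
    \<comment> \<open>At the origin the difference quotient is again a polynomial times
      \<open>exp (- x)\<close> in \<open>x = 1 / h\<close>; the division by \<open>h\<close> only
      raises the degree by one.\<close>
    have "((\<lambda>h. (eta p (0 + h) - eta p 0) / h) \<longlongrightarrow> 0) (at_right 0)"
    proof (rule Lim_transform_eventually)
      have "((\<lambda>x. poly (p * [:0, 1:]) x * exp (- x)) \<longlongrightarrow> 0) at_top" by (rule poly_exp_tendsto_0)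
      then have "((\<lambda>h. poly (p * [:0, 1:]) (inverse h) * exp (- inverse h)) \<longlongrightarrow> 0) (at_right 0)"
        by (rule filterlim_compose[OF _ filterlim_inverse_at_top_right])
      then show "((\<lambda>h. poly (p * [:0, 1:]) (inverse h) * exp (- inverse h)) \<longlongrightarrow> 0) (at_right 0)" .
      show "\<forall>\<^sub>F h in at_right 0. poly (p * [:0, 1:]) (inverse h) * exp (- inverse h) = (eta p (0 + h) - eta p 0) / h"
        by (auto simp: eventually_at_filter eta_def divide_inverse)
    qed
    moreover have "((\<lambda>h. (eta p (0 + h) - eta p 0) / h) \<longlongrightarrow> 0) (at_left 0)"
      by (rule tendsto_eventually) (auto simp: eventually_at_filter eta_def)
    ultimately have "((\<lambda>h. (eta p (0 + h) - eta p 0) / h) \<longlongrightarrow> 0) (at 0)"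
      by (simp add: filterlim_at_split)
    then show ?thesis using 2 by (simp add: DERIV_def eta_def)
  qed
qed

lemma sm1_eta: "sm1 (eta p)"
  by (rule sm1_coinduct[of _ "range eta"]) (use eta_deriv in \<open>auto\<close>)

definition bump :: "real \<Rightarrow> real" where
  "bump t = eta 1 t"

lemma sm1_bump: "sm1 bump"
  using sm1_eta[of 1] by (simp add: bump_def[abs_def])

lemma bump_bounds: "0 \<le> bump t" "bump t \<le> 1" and bump_0: "t \<le> 0 \<Longrightarrow> bump t = 0"
  by (auto simp: bump_def eta_def)

lemma bump_tendsto:
  assumes "filterlim f at_top F" shows "((\<lambda>n. bump (f n)) \<longlongrightarrow> 1) F"
proof -
  have "((\<lambda>t::real. exp (- inverse t)) \<longlongrightarrow> exp (- 0)) at_top"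
    by (intro tendsto_intros tendsto_inverse_0_at_top filterlim_ident)
  then have "((\<lambda>t::real. exp (- inverse t)) \<longlongrightarrow> 1) at_top" by simp
  then have "(bump \<longlongrightarrow> 1) at_top"
  proof (rule Lim_transform_eventually)
    show "\<forall>\<^sub>F x in at_top. exp (- inverse x) = bump x"
      using eventually_gt_at_top[of 0] by eventually_elim (simp add: bump_def eta_def divide_inverse)
  qed
  then show ?thesis by (rule filterlim_compose[OF _ assms])
qed

subsection \<open>Product test functions\<close>

definition per1 :: "(real \<Rightarrow> real) \<Rightarrow> bool" where
  "per1 a \<longleftrightarrow> sm1 a \<and> (\<forall>x. a (x + 1) = a x)"

definition cpt :: "real \<Rightarrow> (real \<Rightarrow> real) \<Rightarrow> bool" where
  "cpt h c \<longleftrightarrow> sm1 c \<and> (\<exists>p q. -h < p \<and> p < q \<and> q < 0 \<and> (\<forall>z. z \<notin> {p..q} \<longrightarrow> c z = 0))"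

text \<open>A cosine centred at the midpoint exceeds its value at the end points exactly inside the
  interval. Applying \<open>bump\<close> to large multiples of this excess gives functions that are
  zero outside and tend to one inside; the cosine makes them periodic without any gluing.\<close>

lemma per1_bump_seq:
  fixes p q :: real
  obtains A where "\<And>n. per1 (A n)" "\<And>n x. 0 \<le> A n x \<and> A n x \<le> 1"
    "\<And>x. 0 \<le> x \<Longrightarrow> x < 1 \<Longrightarrow> (\<lambda>n. A n x) \<longlonglongrightarrow> indicator ({p<..<q} \<inter> {0<..<1}) x"
proof -
  define p' where "p' = max p 0"
  define q' where "q' = min q 1"
  have eq: "{p<..<q} \<inter> {0<..<1} = {p'<..<q'}" by (auto simp: p'_def q'_def)
  show thesis
  proof (cases "p' < q'")
    case False
    show thesis
      by (rule that[of "\<lambda>n x. 0"], unfold eq) (use False in \<open>auto simp: per1_def sm1_const\<close>)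
  next
    case True
    define m where "m = (p' + q') / 2"
    define w where "w = q' - p'"
    have w: "0 < w" "w \<le> 1" "w / 2 \<le> m" "m \<le> 1 - w / 2"
      using True by (auto simp: w_def m_def p'_def q'_def field_simps)
    define g where "g x = cos (2 * pi * (x - m)) - cos (pi * w)" for x
    define A where "A n x = bump (real n * g x)" for n x
    have sg: "sm1 g" unfolding g_def[abs_def]
      by (intro sm1_diff sm1_const sm1_comp[OF sm1_cos] sm1_mult sm1_ident)
    have "per1 (A n)" for n
    proof -
      have "g (x + 1) = g x" for x
        unfolding g_def using cos_periodic[of "2 * pi * (x - m)"] by (simp add: algebra_simps)
      moreover have "sm1 (A n)" unfolding A_def[abs_def]
        by (intro sm1_comp[OF sm1_bump] sm1_mult sm1_const sg)
      ultimately show ?thesis by (simp add: per1_def A_def)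
    qed
    moreover have "(\<lambda>n. A n x) \<longlonglongrightarrow> indicator {p'<..<q'} x" if x: "0 \<le> x" "x < 1" for x
    proof -
      define \<theta> where "\<theta> = \<bar>x - m\<bar>"
      have g\<theta>: "g x = cos (2 * pi * \<theta>) - cos (pi * w)"
        unfolding g_def \<theta>_def by (cases "x \<ge> m") (simp_all add: abs_if right_diff_distrib cos_diff algebra_simps)
      have in_iff: "x \<in> {p'<..<q'} \<longleftrightarrow> 2 * \<theta> < w"
        unfolding \<theta>_def m_def w_def by (auto simp: abs_if field_simps split: if_splits)
      show ?thesis
      proof (cases "x \<in> {p'<..<q'}")
        case True
        then have "2 * \<theta> < w" "0 \<le> \<theta>" using in_iff by (auto simp: \<theta>_def)
        then have "cos (pi * w) < cos (2 * pi * \<theta>)"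
          using w by (intro cos_monotone_0_pi) auto
        then have "g x > 0" by (simp add: g\<theta>)
        then have "filterlim (\<lambda>n. real n * g x) at_top sequentially"
          by (intro filterlim_at_top_mult_tendsto_pos[OF tendsto_const _ filterlim_real_sequentially]) auto
        then show ?thesis using True by (simp add: A_def bump_tendsto)
      next
        case False
        then have \<theta>: "w \<le> 2 * \<theta>" using in_iff by auto
        have \<theta>2: "\<theta> \<le> 1 - w / 2" "0 \<le> \<theta>" using x w by (auto simp: \<theta>_def abs_if)
        have "cos (2 * pi * \<theta>) \<le> cos (pi * w)"
        proof (cases "2 * \<theta> \<le> 1")
          case True
          then show ?thesis using \<theta> w by (intro cos_monotone_0_pi_le) auto
        next
          case False
          \<comment> \<open>Monotonicity of the cosine is available on half a period only; beyond it
            the angle is reflected, which keeps it above \<open>pi * w\<close> because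
            \<open>\<theta> \<le> 1 - w / 2\<close>.\<close>
          have "cos (2 * pi * \<theta>) = cos (2 * pi * (1 - \<theta>))"
            by (simp add: right_diff_distrib cos_diff)
          also have "\<dots> \<le> cos (pi * w)"
            using False \<theta>2 w by (intro cos_monotone_0_pi_le) auto
          finally show ?thesis .
        qed
        then have "real n * g x \<le> 0" for n by (simp add: g\<theta> mult_nonneg_nonpos)
        then have "A n x = 0" for n by (simp add: A_def bump_0)
        then show ?thesis using False by simp
      qed
    qed
    ultimately show thesis
      by (intro that[of A]) (simp_all only: eq, simp_all add: A_def bump_bounds)
  qed
qed

lemma cpt_bump:
  assumes "-h < p" "p < q" "q < 0" "c \<ge> 0"
  shows "cpt h (\<lambda>z. bump (c * ((z - p) * (q - z))))"
  unfolding cpt_def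
proof (rule conjI, goal_cases)
  case 2
  have "bump (c * ((z - p) * (q - z))) = 0" if "z \<notin> {p..q}" for z
  proof -
    have "(z - p) * (q - z) \<le> 0" using assms that by (cases "z < p") (auto simp: mult_le_0_iff)
    then show ?thesis by (rule bump_0[OF mult_nonneg_nonpos[OF assms(4)]])
  qed
  then show ?case using assms by blast
next
  case 1
  show ?case
    by (intro sm1_comp[OF sm1_bump] sm1_mult sm1_diff sm1_const sm1_ident)
qed

lemma cpt_bump_seq:
  fixes p q h :: real assumes h: "h > 0"
  obtains A where "\<And>n. cpt h (A n)" "\<And>n x. 0 \<le> A n x \<and> A n x \<le> 1"
    "\<And>x. (\<lambda>n. A n x) \<longlonglongrightarrow> indicator ({p<..<q} \<inter> {-h<..<0}) x"
proof -
  define p' where "p' = max p (-h)"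
  define q' where "q' = min q 0"
  have eq: "{p<..<q} \<inter> {-h<..<0} = {p'<..<q'}" by (auto simp: p'_def q'_def)
  show thesis
  proof (cases "p' < q'")
    case False
    have "cpt h (\<lambda>x. 0)"
      unfolding cpt_def using h
      by (intro conjI sm1_const exI[of _ "-2*h/3"] exI[of _ "-h/3"]) auto
    then show thesis
      by (intro that[of "\<lambda>n x. 0"], unfold eq) (use False in \<open>auto\<close>)
  next
    case True
    \<comment> \<open>The support has to stay inside the open slab, so the interval is shrunk by an
      amount that tends to zero. The offset 3 gives \<open>P n < Q n\<close> already for
      \<open>n = 0\<close>.\<close>
    define P where "P n = p' + (q' - p') / real (n + 3)" for n
    define Q where "Q n = q' - (q' - p') / real (n + 3)" for n
    define A where "A n z = bump (real n * ((z - P n) * (Q n - z)))" for n z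
    have PQ: "p' < P n" "P n < Q n" "Q n < q'" for n
    proof -
      have "(q' - p') / real (n + 3) < (q' - p') / 2"
        using True by (intro divide_strict_left_mono) auto
      moreover have "0 < (q' - p') / real (n + 3)" using True by simp
      moreover define \<delta> where "\<delta> = (q' - p') / real (n + 3)"
      ultimately show "p' < P n" "P n < Q n" "Q n < q'"
        unfolding P_def Q_def \<delta>_def[symmetric] by (simp_all add: field_simps)
    qed
    have "cpt h (A n)" for n
      unfolding A_def using PQ[of n] by (intro cpt_bump) (auto simp: p'_def q'_def)
    moreover have "(\<lambda>n. A n z) \<longlonglongrightarrow> indicator {p'<..<q'} z" for z
    proof (cases "z \<in> {p'<..<q'}")
      case True
      have "(\<lambda>n. (q' - p') / real (n + 3)) \<longlonglongrightarrow> 0"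
        by (rule LIMSEQ_ignore_initial_segment[OF lim_const_over_n])
      then have "(\<lambda>n. (z - P n) * (Q n - z)) \<longlonglongrightarrow> (z - (p' + 0)) * ((q' - 0) - z)"
        unfolding P_def Q_def by (intro tendsto_intros)
      then have "filterlim (\<lambda>n. ((z - P n) * (Q n - z)) * real n) at_top sequentially"
        by (rule filterlim_tendsto_pos_mult_at_top) (use True in \<open>auto intro: filterlim_real_sequentially\<close>)
      then show ?thesis using True by (simp add: A_def bump_tendsto mult.commute)
    next
      case False
      have "(z - P n) * (Q n - z) \<le> 0" for n
        using False PQ[of n] by (auto simp: mult_le_0_iff)
      then have "A n z = 0" for n by (simp add: A_def bump_0 mult_nonneg_nonpos)
      then show ?thesis using False by simp
    qed
    ultimately show thesis
      by (intro that[of A]) (simp_all only: eq, simp_all add: A_def bump_bounds)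
  qed
qed

definition tpr :: "(real \<Rightarrow> real) \<Rightarrow> (real \<Rightarrow> real) \<Rightarrow> (real \<Rightarrow> real) \<Rightarrow> point \<Rightarrow> real" where
  "tpr a b c = (\<lambda>(x, y, z). a x * b y * c z)"

lemma box_point: "(x, y, z) \<in> box (p1, p2, p3) (q1, q2, q3 :: real) \<longleftrightarrow>
    p1 < x \<and> x < q1 \<and> p2 < y \<and> y < q2 \<and> p3 < z \<and> (z::real) < q3" for x y :: real
  by (auto simp: mem_box Basis_prod_def)

lemma AE_Om_iff: "(AE p in Om h. P p) \<longleftrightarrow> (AE p in lborel. p \<in> cell h \<longrightarrow> P p)"
  unfolding Om_eq by (rule AE_restrict_space_iff) simp

lemma itv_X: "itv 0 1 {0..<1} XM" and itv_Z: "h > 0 \<Longrightarrow> itv (-h) 0 {-h<..<0} (ZM h)"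
  by (auto simp: itv_def XM_def ZM_def)

interpretation X: itv 0 1 "{0..<1}" XM by (rule itv_X)

lemma finite_measure_ZM: "finite_measure (ZM h)"
  unfolding ZM_def using emeasure_bounded_finite[of "{-h<..<0}"]
  by (intro finite_measureI) (auto simp: emeasure_restrict_space space_restrict_space)

lemma finite_measure_Om: "finite_measure (Om h)"
proof -
  interpret finite_measure "ZM h" by (rule finite_measure_ZM)
  show ?thesis unfolding Om_def
    by (intro finite_measure_pair_measure X.finite_measure_axioms finite_measure_axioms)
qed

lemma Om_id_measurable [measurable]: "(\<lambda>p. p) \<in> borel_measurable (Om h)"
  unfolding Om_eq by (rule measurable_restrict_space1) simp

lemma borel_measurable_Om: "f \<in> borel_measurable borel \<Longrightarrow> f \<in> borel_measurable (Om h)"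
  by (rule measurable_compose[OF Om_id_measurable])

lemma tpr_measurable:
  assumes [measurable]: "a \<in> borel_measurable borel" "b \<in> borel_measurable borel" "c \<in> borel_measurable borel"
  shows "tpr a b c \<in> borel_measurable (Om h)"
  by (rule borel_measurable_Om, unfold borel_prod[symmetric] tpr_def) measurable

text \<open>The horizontal bumps tend to zero on the faces \<open>x = 0\<close> and
  \<open>y = 0\<close>, even in a box that crosses them. These faces are therefore excluded before
  passing to the limit.\<close>

lemma AE_Om_interior: "AE p in Om h. 0 < fst p \<and> 0 < fst (snd p)"
proof -
  have 1: "AE p in lborel. p \<notin> {0::real} \<times> (UNIV :: (real \<times> real) set)"
    unfolding lborel_prod[symmetric, where 'a=real and 'b="real \<times> real"]
    by (rule AE_not_in, rule lborel.times_in_null_sets1) (auto simp: null_sets_def)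
  moreover have "AE p in lborel. p \<notin> (UNIV :: real set) \<times> {0::real} \<times> (UNIV :: real set)"
    unfolding lborel_prod[symmetric, where 'a=real and 'b="real \<times> real"]
      lborel_prod[symmetric, where 'a=real and 'b="real"]
    by (rule AE_not_in, rule sigma_finite_measure.times_in_null_sets2,
        simp only: lborel_prod, rule lborel.sigma_finite_measure_axioms, simp,
        rule lborel.times_in_null_sets1) (auto simp: null_sets_def)
  ultimately show ?thesis
    unfolding AE_Om_iff by eventually_elim (auto simp: cell_def less_le)
qed

text \<open>Products of bumps converge boundedly to indicators of boxes. Boxes are stable under
  intersection and generate the Borel sets, so the integral of \<open>k\<close> vanishes over every
  Borel set, in particular over the sets where \<open>k\<close> is positive or negative.\<close>

lemma fundamental_lemma:
  assumes h: "h > 0" and k: "integrable (Om h) k"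
    and 0: "\<And>a b c. per1 a \<Longrightarrow> per1 b \<Longrightarrow> cpt h c \<Longrightarrow> (\<integral>p. k p * tpr a b c p \<partial>Om h) = 0"
  shows "AE p in Om h. k p = 0"
proof -
  have km[measurable]: "k \<in> borel_measurable (Om h)" using k by auto
  have box: "(\<integral>p. indicator (box l u) p * k p \<partial>Om h) = 0" for l u
  proof -
    obtain p1 p2 p3 q1 q2 q3 where lu: "l = (p1, p2, p3)" "u = (q1, q2, q3)" by (cases l, cases u) auto
    obtain A where A: "\<And>n. per1 (A n)" "\<And>n x. 0 \<le> A n x \<and> A n x \<le> 1"
      "\<And>x. 0 \<le> x \<Longrightarrow> x < 1 \<Longrightarrow> (\<lambda>n. A n x) \<longlonglongrightarrow> indicator ({p1<..<q1} \<inter> {0<..<1}) x"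
      using per1_bump_seq[of p1 q1] by blast
    obtain B where B: "\<And>n. per1 (B n)" "\<And>n x. 0 \<le> B n x \<and> B n x \<le> 1"
      "\<And>x. 0 \<le> x \<Longrightarrow> x < 1 \<Longrightarrow> (\<lambda>n. B n x) \<longlonglongrightarrow> indicator ({p2<..<q2} \<inter> {0<..<1}) x"
      using per1_bump_seq[of p2 q2] by blast
    obtain C where C: "\<And>n. cpt h (C n)" "\<And>n x. 0 \<le> C n x \<and> C n x \<le> 1"
      "\<And>x. (\<lambda>n. C n x) \<longlonglongrightarrow> indicator ({p3<..<q3} \<inter> {-h<..<0}) x"
      using cpt_bump_seq[OF h, of p3 q3] by blast
    have "(\<lambda>n. \<integral>p. k p * tpr (A n) (B n) (C n) p \<partial>Om h) \<longlonglongrightarrow> (\<integral>p. indicator (box l u) p * k p \<partial>Om h)"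
    proof (rule integral_dominated_convergence[where w="\<lambda>p. \<bar>k p\<bar>"])
      have [measurable]: "indicator (box l u) \<in> borel_measurable (Om h)"
        by (rule borel_measurable_Om) auto
      show "(\<lambda>p. indicator (box l u) p * k p) \<in> borel_measurable (Om h)" by measurable
      have "A n \<in> borel_measurable borel" "B n \<in> borel_measurable borel" "C n \<in> borel_measurable borel" for n
        using A(1)[of n] B(1)[of n] C(1)[of n]
        by (auto simp: per1_def cpt_def intro!: borel_measurable_continuous_onI sm1_continuous)
      then have [measurable]: "tpr (A n) (B n) (C n) \<in> borel_measurable (Om h)" for n
        by (intro tpr_measurable)
      show "(\<lambda>p. k p * tpr (A n) (B n) (C n) p) \<in> borel_measurable (Om h)" for n
        by measurable
      show "integrable (Om h) (\<lambda>p. \<bar>k p\<bar>)" using k by simp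
      show "AE p in Om h. norm (k p * tpr (A n) (B n) (C n) p) \<le> \<bar>k p\<bar>" for n
      proof (rule AE_I2)
        fix p :: point obtain x y z where p: "p = (x, y, z)" by (cases p) auto
        have "A n x * B n y * C n z \<le> 1 * 1 * 1"
            by (intro mult_mono) (use A(2)[of n x] B(2)[of n y] C(2)[of n z] in auto)
          moreover have "0 \<le> A n x * B n y * C n z"
            using A(2)[of n x] B(2)[of n y] C(2)[of n z] by auto
          ultimately show "norm (k p * tpr (A n) (B n) (C n) p) \<le> \<bar>k p\<bar>"
          by (simp add: p tpr_def abs_mult mult_left_le)
      qed
      show "AE p in Om h. (\<lambda>n. k p * tpr (A n) (B n) (C n) p) \<longlonglongrightarrow> indicator (box l u) p * k p"
        using AE_Om_interior[of h] AE_space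
      proof eventually_elim
        fix p assume p0: "0 < fst p \<and> 0 < fst (snd p)" and "p \<in> space (Om h)"
        obtain x y z where p: "p = (x, y, z)" by (cases p) auto
        have xyz: "0 < x" "x < 1" "0 < y" "y < 1" "-h < z" "z < 0"
          using p0 \<open>p \<in> space (Om h)\<close> by (auto simp: p cell_def)
        have "(\<lambda>n. k p * (A n x * B n y * C n z)) \<longlonglongrightarrow> k p * (indicator ({p1<..<q1} \<inter> {0<..<1}) x
            * indicator ({p2<..<q2} \<inter> {0<..<1}) y * indicator ({p3<..<q3} \<inter> {-h<..<0}) z)"
          using xyz by (intro tendsto_intros A B C) auto
        moreover have "indicator ({p1<..<q1} \<inter> {0<..<1}) x
            * indicator ({p2<..<q2} \<inter> {0<..<1}) y * indicator ({p3<..<q3} \<inter> {-h<..<0}) z = (indicator (box l u) p :: real)"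
          using xyz by (auto simp: p lu indicator_def box_point)
        ultimately show "(\<lambda>n. k p * tpr (A n) (B n) (C n) p) \<longlonglongrightarrow> indicator (box l u) p * k p"
          by (simp add: p tpr_def mult.commute)
      qed
    qed
    moreover have "(\<integral>p. k p * tpr (A n) (B n) (C n) p \<partial>Om h) = 0" for n
      by (rule 0) (rule A B C)+
    ultimately show ?thesis by (simp add: LIMSEQ_const_iff)
  qed
  have ind: "integrable (Om h) (\<lambda>p. indicator B p * k p)" if "B \<in> sets borel" for B
  proof (rule Bochner_Integration.integrable_bound[OF k])
    have [measurable]: "indicator B \<in> borel_measurable (Om h)"
      using that by (intro borel_measurable_Om) auto
    show "(\<lambda>p. indicator B p * k p) \<in> borel_measurable (Om h)" by measurable
  qed (auto simp: indicator_def)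
  \<comment> \<open>The cell is contained in a box; the value of the total integral is what the
    complement step of the induction on Borel sets requires.\<close>
  have tot: "(\<integral>p. k p \<partial>Om h) = 0"
  proof -
    have "(\<integral>p. k p \<partial>Om h) = (\<integral>p. indicator (box (-1, -1, -h - 1) (2, 2, 1)) p * k p \<partial>Om h)"
      by (rule Bochner_Integration.integral_cong) (auto simp: cell_def box_point indicator_def)
    then show ?thesis by (simp add: box)
  qed
  have all: "(\<integral>p. indicator B p * k p \<partial>Om h) = 0" if "B \<in> sets borel" for B
  proof -
    have "B \<in> sigma_sets UNIV (range (\<lambda>(a, b). box a b))"
      using that by (simp add: borel_eq_box)
    then show ?thesis
    proof (induction rule: sigma_sets_induct_disjoint[rotated 2, consumes 1, case_names basic empty compl union stable closed])
      case (basic A) then show ?case using box by auto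
    next
      case (compl A)
      then have "A \<in> sets borel" by (simp add: borel_eq_box)
      have "(\<integral>p. indicator (UNIV - A) p * k p \<partial>Om h) = (\<integral>p. k p - indicator A p * k p \<partial>Om h)"
        by (rule Bochner_Integration.integral_cong) (auto simp: indicator_def)
      also have "\<dots> = 0"
        using k ind[OF \<open>A \<in> sets borel\<close>] tot compl by (simp add: Bochner_Integration.integral_diff)
      finally show ?case .
    next
      case (union A)
      then have A: "\<And>i. A i \<in> sets borel" by (auto simp: borel_eq_box)
      have A': "A i \<inter> cell h \<in> sets (Om h)" for i
        using A[of i] by (auto simp: Om_eq sets_restrict_space_iff)
      have "(LINT p:(\<Union>i. A i \<inter> cell h)|Om h. k p) = (\<Sum>i. LINT p:(A i \<inter> cell h)|Om h. k p)"
      proof (rule lebesgue_integral_countable_add)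
        show "set_integrable (Om h) (\<Union>i. A i \<inter> cell h) k"
          unfolding set_integrable_def using A' k
          by (intro integrable_mult_indicator sets.countable_UN) auto
      qed (use A' union in \<open>auto simp: disjoint_family_on_def\<close>)
      moreover have "(LINT p:(B \<inter> cell h)|Om h. k p) = (\<integral>p. indicator B p * k p \<partial>Om h)" for B
        unfolding set_lebesgue_integral_def by (rule Bochner_Integration.integral_cong) (auto simp: indicator_def)
      moreover have "(\<Union>i. A i \<inter> cell h) = (\<Union>i. A i) \<inter> cell h" by blast
      ultimately show ?case using union(3) by simp
    qed (auto simp: Int_stable_def box_Int_box)
  qed
  have "AE p in Om h. indicator {p \<in> cell h. k p > 0} p * k p = 0"
    "AE p in Om h. indicator {p \<in> cell h. k p < 0} p * - k p = 0"
  proof -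
    have m: "{p \<in> cell h. k p > 0} \<in> sets (Om h)" "{p \<in> cell h. k p < 0} \<in> sets (Om h)"
      unfolding space_Om[symmetric] by measurable
    then have B: "{p \<in> cell h. k p > 0} \<in> sets borel" "{p \<in> cell h. k p < 0} \<in> sets borel"
      by (auto simp: Om_eq sets_restrict_space_iff)
    show "AE p in Om h. indicator {p \<in> cell h. k p > 0} p * k p = 0"
      using all[OF B(1)] ind[OF B(1)]
      by (subst integral_nonneg_eq_0_iff_AE[symmetric]) (auto simp: indicator_def)
    show "AE p in Om h. indicator {p \<in> cell h. k p < 0} p * - k p = 0"
      using all[OF B(2)] ind[OF B(2)]
      by (subst integral_nonneg_eq_0_iff_AE[symmetric]) (auto simp: indicator_def)
  qed
  then show ?thesis using AE_space
    by eventually_elim (auto simp: indicator_def split: if_splits)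
qed

subsection \<open>Weak derivatives along lines\<close>

lemma sm1_primitive_ex:
  assumes "sm1 g"
  obtains f where "sm1 f" "\<And>x. (f has_real_derivative g x) (at x)" "f x0 = 0"
proof -
  have c: "continuous_on UNIV g" using assms by (rule sm1_continuous)
  define F where "F x = (LBINT t=ereal x0..ereal x. g t)" for x
  have "(F has_real_derivative g x) (at x)" for x
  proof -
    define l where "l = min x x0 - 1"
    define u where "u = max x x0 + 1"
    have "(F has_vector_derivative g x) (at x within {l..u})"
      unfolding F_def
      by (rule interval_integral_FTC2[of l x0 u])
         (use c in \<open>auto simp: l_def u_def intro: continuous_on_subset\<close>)
    then have "(F has_vector_derivative g x) (at x)"
      by (subst (asm) at_within_interior) (auto simp: l_def u_def)
    then show ?thesis by (simp add: has_real_derivative_iff_has_vector_derivative)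
  qed
  moreover from this have "sm1 F" by (rule sm1_primitive[OF assms])
  moreover have "F x0 = 0" by (simp add: F_def)
  ultimately show thesis by (intro that[of F])
qed

text \<open>The three coordinate directions share one theory. \<open>J\<close> assembles a point
  from its position on the base and the parameter on the line, and \<open>Ji\<close> takes it apart.
  Test functions are products of members of \<open>BB\<close> and \<open>TT\<close>;
  \<open>TT_prim\<close>, \<open>TT_diff\<close> and \<open>c0\<close> are what the du Bois-Reymond
  argument asks of the factor along the line, and \<open>TT_one\<close> says that constants are
  admissible on a closed line.\<close>

locale dir = itv a b S T for a b S T +
  fixes h :: real and B :: "(real \<times> real) measure" and J :: "(real \<times> real) \<times> real \<Rightarrow> point"
    and Ji :: "point \<Rightarrow> (real \<times> real) \<times> real" and per :: bool
    and BB :: "(real \<times> real \<Rightarrow> real) set" and TT :: "(real \<Rightarrow> real) set" and c0 :: "real \<Rightarrow> real"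
  assumes h: "h > 0" and B: "finite_measure B"
    and J [measurable]: "J \<in> measurable (B \<Otimes>\<^sub>M T) (Om h)"
    and Ji [measurable]: "Ji \<in> measurable (Om h) (B \<Otimes>\<^sub>M T)"
    and Ji_J [simp]: "\<And>q. Ji (J q) = q" and J_Ji [simp]: "\<And>p. J (Ji p) = p"
    and distr_J: "distr (B \<Otimes>\<^sub>M T) (Om h) J = Om h"
    and BB_meas: "\<And>\<beta>. \<beta> \<in> BB \<Longrightarrow> \<beta> \<in> borel_measurable B"
    and BB_bounded: "\<And>\<beta>. \<beta> \<in> BB \<Longrightarrow> \<exists>K. \<forall>c\<in>space B. \<bar>\<beta> c\<bar> \<le> K"
    and TT_sm1: "\<And>\<phi>. \<phi> \<in> TT \<Longrightarrow> sm1 \<phi>"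
    and TT_prim: "\<And>\<phi> \<Phi>. \<phi> \<in> TT \<Longrightarrow> sm1 \<Phi> \<Longrightarrow> \<Phi> a = 0 \<Longrightarrow> (\<integral>t. \<phi> t \<partial>T) = 0 \<Longrightarrow>
        (\<And>t. (\<Phi> has_real_derivative \<phi> t) (at t)) \<Longrightarrow> \<Phi> \<in> TT"
    and TT_diff: "\<And>\<phi> c. \<phi> \<in> TT \<Longrightarrow> (\<lambda>t. \<phi> t - c * c0 t) \<in> TT"
    and TT_c0: "c0 \<in> TT" "(\<integral>t. c0 t \<partial>T) = 1"
    and TT_one: "per \<Longrightarrow> (\<lambda>t. 1) \<in> TT"
    and tests: "\<And>a b c. per1 a \<Longrightarrow> per1 b \<Longrightarrow> cpt h c \<Longrightarrow>
        \<exists>\<beta>\<in>BB. \<exists>\<phi>\<in>TT. \<forall>q. tpr a b c (J q) = \<beta> (fst q) * \<phi> (snd q)"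
begin

sublocale B: finite_measure B by (rule B)
sublocale BT: pair_sigma_finite B T ..
sublocale O: finite_measure "Om h" by (rule finite_measure_Om)

text \<open>Integrability of the derivative is asked on almost every single line, not on the domain.
  Thus products can be differentiated before anything is known about their norms.\<close>

definition wd :: "(point \<Rightarrow> real) \<Rightarrow> (point \<Rightarrow> real) \<Rightarrow> bool" where
  "wd f g \<longleftrightarrow> (AE c in B. ac per (\<lambda>t. f (J (c, t))) (\<lambda>t. g (J (c, t))))"

lemma distr_Ji: "distr (Om h) (B \<Otimes>\<^sub>M T) Ji = B \<Otimes>\<^sub>M T"
proof -
  have "distr (Om h) (B \<Otimes>\<^sub>M T) Ji = distr (distr (B \<Otimes>\<^sub>M T) (Om h) J) (B \<Otimes>\<^sub>M T) Ji"
    by (simp add: distr_J)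
  also have "\<dots> = distr (B \<Otimes>\<^sub>M T) (B \<Otimes>\<^sub>M T) (\<lambda>x. x)"
    by (subst distr_distr) (auto simp: comp_def)
  finally show ?thesis by simp
qed

lemma integral_J:
  fixes f :: "point \<Rightarrow> real"
  assumes "f \<in> borel_measurable (Om h)"
  shows "(\<integral>p. f p \<partial>Om h) = (\<integral>q. f (J q) \<partial>(B \<Otimes>\<^sub>M T))"
  using integral_distr[OF J assms] by (simp add: distr_J)

lemma integrable_J:
  fixes f :: "point \<Rightarrow> real"
  assumes "integrable (Om h) f"
  shows "integrable (B \<Otimes>\<^sub>M T) (\<lambda>q. f (J q))"
  using integrable_distr[OF J, of f] assms by (simp add: distr_J)

lemma integral_iterated:
  fixes f :: "point \<Rightarrow> real"
  assumes "integrable (Om h) f"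
  shows "(\<integral>p. f p \<partial>Om h) = (\<integral>c. (\<integral>t. f (J (c, t)) \<partial>T) \<partial>B)"
  using BT.integral_fst'[OF integrable_J[OF assms]] integral_J[of f] assms by auto

lemma AE_J:
  assumes "AE p in Om h. P p"
  shows "AE c in B. AE t in T. P (J (c, t))"
proof -
  have "AE p in distr (B \<Otimes>\<^sub>M T) (Om h) J. P p" unfolding distr_J by (rule assms)
  from BT.AE_pair[OF AE_distrD[OF J this]] show ?thesis .
qed

lemma AE_J_rev:
  assumes [measurable]: "Measurable.pred (Om h) P" and "AE c in B. AE t in T. P (J (c, t))"
  shows "AE p in Om h. P p"
proof -
  have "AE q in B \<Otimes>\<^sub>M T. P (J q)"
    by (rule BT.AE_pair_measure) (use assms in auto)
  then have "AE p in distr (B \<Otimes>\<^sub>M T) (Om h) J. P p"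
    by (subst AE_distr_iff) (use assms(1) in \<open>simp_all add: pred_def del: space_Om\<close>)
  then show ?thesis unfolding distr_J .
qed

lemma slice_measurable:
  fixes f :: "point \<Rightarrow> real"
  assumes [measurable]: "f \<in> borel_measurable (Om h)" and "c \<in> space B"
  shows "(\<lambda>t. f (J (c, t))) \<in> borel_measurable T"
  using assms(2) by measurable

lemma wd_cong:
  assumes "wd f g" "AE p in Om h. f p = f2 p" "AE p in Om h. g p = g2 p"
    and m: "f2 \<in> borel_measurable (Om h)" "g2 \<in> borel_measurable (Om h)"
  shows "wd f2 g2"
  using assms(1) AE_J[OF assms(2)] AE_J[OF assms(3)] AE_space unfolding wd_def
proof eventually_elim
  case (elim c)
  show ?case
    by (rule ac_cong_AE[OF elim(1-3)]) (use elim m in \<open>auto intro: slice_measurable\<close>)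
qed

lemma wd_add:
  assumes "wd f g" "wd f2 g2" shows "wd (\<lambda>p. f p + f2 p) (\<lambda>p. g p + g2 p)"
  using assms unfolding wd_def by eventually_elim (rule ac_add)

lemma wd_cmult:
  assumes "wd f g" shows "wd (\<lambda>p. c * f p) (\<lambda>p. c * g p)"
  using assms unfolding wd_def by eventually_elim (rule ac_cmult)

lemma wd_mult:
  assumes "wd f g" "wd f2 g2" shows "wd (\<lambda>p. f p * f2 p) (\<lambda>p. g p * f2 p + f p * g2 p)"
  using assms unfolding wd_def by eventually_elim (rule ac_mult)

lemma integrable_bounded_mult:
  fixes f u :: "point \<Rightarrow> real"
  assumes "integrable (Om h) f" "u \<in> borel_measurable (Om h)" "\<And>p. p \<in> cell h \<Longrightarrow> \<bar>u p\<bar> \<le> K"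
  shows "integrable (Om h) (\<lambda>p. u p * f p)"
proof (rule Bochner_Integration.integrable_bound)
  show "integrable (Om h) (\<lambda>p. K * f p)" using assms by simp
  show "(\<lambda>p. u p * f p) \<in> borel_measurable (Om h)" using assms by measurable
  show "AE p in Om h. norm (u p * f p) \<le> norm (K * f p)"
    by (rule AE_I2) (auto simp: abs_mult intro!: mult_right_mono order_trans[OF assms(3) abs_ge_self])
qed

text \<open>Regularity of the test function is asked along the lines only, with boundedness and
  measurability across them. This admits test functions whose transversal factor is a vertical
  primitive, as in \<open>vprim_wd_x\<close>.\<close>

lemma wd_by_parts:
  assumes wd: "wd f g" and f: "integrable (Om h) f" and g: "integrable (Om h) g"
    and m: "\<psi> \<in> borel_measurable (Om h)" "\<psi>' \<in> borel_measurable (Om h)"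
    and bd: "\<And>p. p \<in> cell h \<Longrightarrow> \<bar>\<psi> p\<bar> \<le> K" "\<And>p. p \<in> cell h \<Longrightarrow> \<bar>\<psi>' p\<bar> \<le> K"
    and d: "\<And>c t. c \<in> space B \<Longrightarrow> ((\<lambda>t. \<psi> (J (c, t))) has_real_derivative \<psi>' (J (c, t))) (at t)"
    and cont: "\<And>c. c \<in> space B \<Longrightarrow> continuous_on UNIV (\<lambda>t. \<psi>' (J (c, t)))"
    and bc: "\<And>c. c \<in> space B \<Longrightarrow> \<psi> (J (c, a)) = \<psi> (J (c, b))"
      "\<And>c. c \<in> space B \<Longrightarrow> per \<or> \<psi> (J (c, a)) = 0"
  shows "(\<integral>p. \<psi>' p * f p \<partial>Om h) = - (\<integral>p. \<psi> p * g p \<partial>Om h)"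
proof -
  have i: "integrable (Om h) (\<lambda>p. \<psi>' p * f p)" "integrable (Om h) (\<lambda>p. \<psi> p * g p)"
    using integrable_bounded_mult[OF f m(2) bd(2)] integrable_bounded_mult[OF g m(1) bd(1)] by auto
  have "(\<integral>p. \<psi>' p * f p + \<psi> p * g p \<partial>Om h)
      = (\<integral>c. (\<integral>t. \<psi>' (J (c, t)) * f (J (c, t)) + \<psi> (J (c, t)) * g (J (c, t)) \<partial>T) \<partial>B)"
    by (rule integral_iterated) (intro Bochner_Integration.integrable_add i)
  also have "\<dots> = (\<integral>c. 0 \<partial>B)"
  proof (rule Bochner_Integration.integral_cong_AE)
    have [measurable]: "f \<in> borel_measurable (Om h)" "g \<in> borel_measurable (Om h)" using f g by auto
    note m[measurable]
    show "(\<lambda>c. \<integral>t. \<psi>' (J (c, t)) * f (J (c, t)) + \<psi> (J (c, t)) * g (J (c, t)) \<partial>T) \<in> borel_measurable B"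
      by measurable
    show "AE c in B. (\<integral>t. \<psi>' (J (c, t)) * f (J (c, t)) + \<psi> (J (c, t)) * g (J (c, t)) \<partial>T) = 0"
      using wd AE_space unfolding wd_def
    proof eventually_elim
      case (elim c)
      show ?case
        using ac_by_parts(2)[OF elim(1) d[OF elim(2)] cont[OF elim(2)] bc(1)[OF elim(2)] bc(2)[OF elim(2)]]
        by (simp add: ac_simps)
    qed
  qed simp
  finally show ?thesis using i by simp
qed

lemma fundamental:
  assumes k: "integrable (B \<Otimes>\<^sub>M T) k"
    and 0: "\<And>\<beta> \<phi>. \<beta> \<in> BB \<Longrightarrow> \<phi> \<in> TT \<Longrightarrow> (\<integral>q. k q * (\<beta> (fst q) * \<phi> (snd q)) \<partial>(B \<Otimes>\<^sub>M T)) = 0"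
  shows "AE q in B \<Otimes>\<^sub>M T. k q = 0"
proof -
  have [measurable]: "k \<in> borel_measurable (B \<Otimes>\<^sub>M T)" using k by auto
  have "AE p in Om h. k (Ji p) = 0"
  proof (rule fundamental_lemma[OF h])
    have "integrable (distr (Om h) (B \<Otimes>\<^sub>M T) Ji) k" using k by (simp add: distr_Ji)
    then show "integrable (Om h) (\<lambda>p. k (Ji p))" by (subst (asm) integrable_distr_eq) auto
    fix a b c :: "real \<Rightarrow> real" assume abc: "per1 a" "per1 b" "cpt h c"
    then obtain \<beta> \<phi> where *: "\<beta> \<in> BB" "\<phi> \<in> TT" "\<And>q. tpr a b c (J q) = \<beta> (fst q) * \<phi> (snd q)"
      using tests by metis
    have "tpr a b c \<in> borel_measurable (Om h)"
      using abc unfolding per1_def cpt_def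
      by (intro tpr_measurable) (auto intro: borel_measurable_continuous_onI sm1_continuous)
    then show "(\<integral>p. k (Ji p) * tpr a b c p \<partial>Om h) = 0"
      using 0[OF *(1,2)] by (subst integral_J) (auto simp: *(3))
  qed
  from AE_distrD[OF J, unfolded distr_J, OF this] show ?thesis by simp
qed

lemma integrable_fst_B:
  fixes u :: "real \<times> real \<Rightarrow> real"
  assumes "integrable B u" shows "integrable (B \<Otimes>\<^sub>M T) (\<lambda>q. u (fst q))"
proof (rule BT.Fubini_integrable)
  show "(\<lambda>q. u (fst q)) \<in> borel_measurable (B \<Otimes>\<^sub>M T)" using assms by measurable
  show "integrable B (\<lambda>x. \<integral>y. norm (u (fst (x, y))) \<partial>T)" using assms by simp
qed simp

lemma TT_facts:
  assumes "\<phi> \<in> TT"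
  shows "\<phi> \<in> borel_measurable T" "\<phi> \<in> borel_measurable borel" "\<exists>K. \<forall>t\<in>S. \<bar>\<phi> t\<bar> \<le> K" "continuous_on UNIV \<phi>"
proof -
  show c: "continuous_on UNIV \<phi>" using TT_sm1[OF assms] by (rule sm1_continuous)
  show "\<phi> \<in> borel_measurable T" "\<phi> \<in> borel_measurable borel"
    using c by (auto intro!: borel_measurable_T borel_measurable_continuous_onI)
  show "\<exists>K. \<forall>t\<in>S. \<bar>\<phi> t\<bar> \<le> K" using continuous_bounded_T[OF c] by metis
qed

text \<open>The du Bois-Reymond lemma along the lines in direction \<open>J\<close>.\<close>

lemma weak_imp_wd:
  assumes f: "integrable (Om h) f" and g: "integrable (Om h) g"
    and weak: "\<And>\<beta> \<phi>. \<beta> \<in> BB \<Longrightarrow> \<phi> \<in> TT \<Longrightarrow>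
      (\<integral>p. \<beta> (fst (Ji p)) * deriv \<phi> (snd (Ji p)) * f p \<partial>Om h) = - (\<integral>p. \<beta> (fst (Ji p)) * \<phi> (snd (Ji p)) * g p \<partial>Om h)"
  shows "wd f g"
proof -
  define F where "F c t = f (J (c, t))" for c t
  define g' where "g' c t = g (J (c, t))" for c t
  define G where "G c t = prim (g' c) t" for c t
  \<comment> \<open>The candidate for the constant of integration on the line over \<open>c\<close>:
    the mean of \<open>F - G\<close> with respect to \<open>c0\<close>, which has integral
    one.\<close>
  define m where "m c = (\<integral>t. (F c t - G c t) * c0 t \<partial>T)" for c
  have [measurable]: "f \<in> borel_measurable (Om h)" "g \<in> borel_measurable (Om h)" using f g by auto
  have iF: "integrable (B \<Otimes>\<^sub>M T) (\<lambda>(c, t). F c t)" and ig: "integrable (B \<Otimes>\<^sub>M T) (\<lambda>(c, t). g' c t)"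
    using integrable_J[OF f] integrable_J[OF g] by (auto simp: F_def g'_def split_beta')
  then have mF[measurable]: "(\<lambda>(c, t). F c t) \<in> borel_measurable (B \<Otimes>\<^sub>M T)"
    and mg[measurable]: "(\<lambda>(c, t). g' c t) \<in> borel_measurable (B \<Otimes>\<^sub>M T)" by auto
  have mG[measurable]: "(\<lambda>(c, t). G c t) \<in> borel_measurable (B \<Otimes>\<^sub>M T)"
    unfolding G_def split_beta'
  proof (rule prim_measurable_pair)
    have "(\<lambda>(q, s). g' (fst q) s) \<in> borel_measurable ((B \<Otimes>\<^sub>M T) \<Otimes>\<^sub>M T)"
      unfolding g'_def by measurable
    then show "(\<lambda>(x, y). g' (fst x) y) \<in> borel_measurable ((B \<Otimes>\<^sub>M T) \<Otimes>\<^sub>M T)" .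
  qed measurable
  have iG: "integrable (B \<Otimes>\<^sub>M T) (\<lambda>(c, t). G c t)"
  proof (rule Bochner_Integration.integrable_bound)
    have "integrable B (\<lambda>c. \<integral>t. \<bar>g' c t\<bar> \<partial>T)"
      using BT.integrable_fst'[OF integrable_abs[OF ig]] by simp
    then show "integrable (B \<Otimes>\<^sub>M T) (\<lambda>q. \<integral>t. \<bar>g' (fst q) t\<bar> \<partial>T)" by (rule integrable_fst_B)
    have "AE c in B. AE t in T. norm (G c t) \<le> norm (\<integral>t. \<bar>g' c t\<bar> \<partial>T)"
      using BT.AE_integrable_fst'[OF ig]
      by eventually_elim (auto simp: G_def intro!: AE_I2 order_trans[OF prim_bound])
    then show "AE q in B \<Otimes>\<^sub>M T. norm (case q of (c, t) \<Rightarrow> G c t) \<le> norm (\<integral>t. \<bar>g' (fst q) t\<bar> \<partial>T)"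
      by (intro BT.AE_pair_measure) auto
  qed measurable
  obtain K0 where K0: "\<And>t. t \<in> S \<Longrightarrow> \<bar>c0 t\<bar> \<le> K0" using TT_facts(3)[OF TT_c0(1)] by auto
  have im: "integrable B m"
  proof -
    have "integrable (B \<Otimes>\<^sub>M T) (\<lambda>q. (F (fst q) (snd q) - G (fst q) (snd q)) * c0 (snd q))"
    proof (rule Bochner_Integration.integrable_bound)
      show "integrable (B \<Otimes>\<^sub>M T) (\<lambda>q. K0 * (F (fst q) (snd q) - G (fst q) (snd q)))"
        using iF iG by (simp add: split_beta')
      show "(\<lambda>q. (F (fst q) (snd q) - G (fst q) (snd q)) * c0 (snd q)) \<in> borel_measurable (B \<Otimes>\<^sub>M T)"
        using mF mG TT_facts(1)[OF TT_c0(1)] unfolding split_beta' by measurable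
      show "AE q in B \<Otimes>\<^sub>M T. norm ((F (fst q) (snd q) - G (fst q) (snd q)) * c0 (snd q))
          \<le> norm (K0 * (F (fst q) (snd q) - G (fst q) (snd q)))"
      proof (rule AE_I2)
        fix q assume "q \<in> space (B \<Otimes>\<^sub>M T)"
        then have "snd q \<in> S" by (auto simp: space_pair_measure)
        from K0[OF this] have "\<bar>c0 (snd q)\<bar> \<le> \<bar>K0\<bar>" by linarith
        then show "norm ((F (fst q) (snd q) - G (fst q) (snd q)) * c0 (snd q))
          \<le> norm (K0 * (F (fst q) (snd q) - G (fst q) (snd q)))"
          by (simp add: abs_mult mult.commute mult_right_mono)
      qed
    qed
    from BT.integrable_fst'[OF this] show ?thesis by (simp add: m_def[abs_def])
  qed
  then have mm[measurable]: "m \<in> borel_measurable B" by auto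
  define H where "H q = F (fst q) (snd q) - G (fst q) (snd q) - m (fst q)" for q
  have iH: "integrable (B \<Otimes>\<^sub>M T) H"
    unfolding H_def using iF iG integrable_fst_B[OF im] by (simp add: split_beta')
  have "AE q in B \<Otimes>\<^sub>M T. H q = 0"
  proof (rule fundamental[OF iH])
    fix \<beta> \<phi> assume \<beta>: "\<beta> \<in> BB" and \<phi>: "\<phi> \<in> TT"
    obtain K\<beta> where K\<beta>: "\<And>c. c \<in> space B \<Longrightarrow> \<bar>\<beta> c\<bar> \<le> K\<beta>" using BB_bounded[OF \<beta>] by auto
    obtain K\<phi> where K\<phi>: "\<And>c. c \<in> S \<Longrightarrow> \<bar>\<phi> c\<bar> \<le> K\<phi>" using TT_facts(3)[OF \<phi>] by auto
    note [measurable] = BB_meas[OF \<beta>] TT_facts(1)[OF \<phi>]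
    have int_prod: "integrable (B \<Otimes>\<^sub>M T) (\<lambda>q. k q * (\<beta> (fst q) * \<eta> (snd q)))"
      if k: "integrable (B \<Otimes>\<^sub>M T) k" and \<eta>: "\<eta> \<in> borel_measurable T" "\<And>t. t \<in> S \<Longrightarrow> \<bar>\<eta> t\<bar> \<le> K" for k \<eta> K
    proof (rule Bochner_Integration.integrable_bound)
      show "integrable (B \<Otimes>\<^sub>M T) (\<lambda>q. (K\<beta> * K) * k q)" using k by simp
      note \<eta>(1)[measurable]
      have [measurable]: "k \<in> borel_measurable (B \<Otimes>\<^sub>M T)" using k by auto
      show "(\<lambda>q. k q * (\<beta> (fst q) * \<eta> (snd q))) \<in> borel_measurable (B \<Otimes>\<^sub>M T)" by measurable
      show "AE q in B \<Otimes>\<^sub>M T. norm (k q * (\<beta> (fst q) * \<eta> (snd q))) \<le> norm (K\<beta> * K * k q)"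
      proof (rule AE_I2)
        fix q assume "q \<in> space (B \<Otimes>\<^sub>M T)"
        then have q: "fst q \<in> space B" "snd q \<in> S" by (auto simp: space_pair_measure)
        have "\<bar>\<beta> (fst q)\<bar> * \<bar>\<eta> (snd q)\<bar> \<le> K\<beta> * K"
          using K\<beta>[OF q(1)] \<eta>(2)[OF q(2)] by (intro mult_mono) auto
        also have "\<dots> \<le> \<bar>K\<beta> * K\<bar>" by simp
        finally show "norm (k q * (\<beta> (fst q) * \<eta> (snd q))) \<le> norm (K\<beta> * K * k q)"
          by (simp add: abs_mult mult.commute mult_left_mono)
      qed
    qed
    \<comment> \<open>The test function \<open>\<phi>\<close> is split into \<open>I * c0\<close>
      and a part of integral zero. The latter is the derivative of a test function
      \<open>\<Phi>\<close>, to which the weak identity applies; on the former \<open>H\<close>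
      vanishes by the choice of \<open>m\<close>.\<close>
    define I where "I = (\<integral>t. \<phi> t \<partial>T)"
    define \<phi>0 where "\<phi>0 = (\<lambda>t. \<phi> t - I * c0 t)"
    have \<phi>0: "\<phi>0 \<in> TT" unfolding \<phi>0_def by (rule TT_diff[OF \<phi>])
    obtain \<Phi> where \<Phi>: "sm1 \<Phi>" "\<And>t. (\<Phi> has_real_derivative \<phi>0 t) (at t)" "\<Phi> a = 0"
      using sm1_primitive_ex[OF TT_sm1[OF \<phi>0], of a] by metis
    have I0: "(\<integral>t. \<phi>0 t \<partial>T) = 0"
      unfolding \<phi>0_def using integrable_continuous_T[OF TT_facts(4)[OF \<phi>]]
        integrable_continuous_T[OF TT_facts(4)[OF TT_c0(1)]] by (simp add: I_def TT_c0)
    have \<Phi>T: "\<Phi> \<in> TT" by (rule TT_prim[OF \<phi>0 \<Phi>(1,3) I0 \<Phi>(2)])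
    have \<Phi>b: "\<Phi> b = 0" using integral_deriv[OF \<Phi>(2) TT_facts(4)[OF \<phi>0]] I0 \<Phi>(3) by simp
    have d\<Phi>: "deriv \<Phi> = \<phi>0" by (intro ext DERIV_imp_deriv \<Phi>)
    obtain K1 where K1: "\<And>t. t \<in> S \<Longrightarrow> \<bar>\<phi>0 t\<bar> \<le> K1" using TT_facts(3)[OF \<phi>0] by auto
    obtain K2 where K2: "\<And>t. t \<in> S \<Longrightarrow> \<bar>\<Phi> t\<bar> \<le> K2" using TT_facts(3)[OF \<Phi>T] by auto
    note [measurable] = TT_facts(1)[OF \<phi>0] TT_facts(1)[OF \<Phi>T]
    have inner: "AE c in B. (\<integral>t. H (c, t) * (\<beta> c * \<phi> t) \<partial>T) =
        (\<integral>t. F c t * (\<beta> c * \<phi>0 t) + g' c t * (\<beta> c * \<Phi> t) \<partial>T)"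
      using BT.AE_integrable_fst'[OF ig] BT.AE_integrable_fst'[OF iF] BT.AE_integrable_fst'[OF iG]
    proof eventually_elim
      case (elim c)
      then have ic: "integrable T (g' c)" "integrable T (F c)" "integrable T (G c)" by auto
      have i\<eta>: "integrable T (\<lambda>t. u t * \<eta> t)" if ua: "integrable T u" and ub: "\<eta> \<in> TT" for u \<eta> :: "real \<Rightarrow> real"
      proof -
        obtain K where K: "\<And>t. t \<in> S \<Longrightarrow> \<bar>\<eta> t\<bar> \<le> K" using TT_facts(3)[OF ub] by auto
        have "\<bar>u t * \<eta> t\<bar> \<le> \<bar>K * u t\<bar>" if t: "t \<in> S" for t
          using order_trans[OF K[OF t] abs_ge_self] by (simp add: abs_mult mult.commute[of "\<bar>K\<bar>"] mult_left_mono)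
        note le = this
        show ?thesis
        proof (rule Bochner_Integration.integrable_bound)
          show "integrable T (\<lambda>t. K * u t)" using ua by simp
          show "(\<lambda>t. u t * \<eta> t) \<in> borel_measurable T" using ua TT_facts(1)[OF ub] by measurable
          show "AE t in T. norm (u t * \<eta> t) \<le> norm (K * u t)" using le by (intro AE_I2) auto
        qed
      qed
      \<comment> \<open>The flag is \<open>False\<close> also for closed lines: periodicity is
        settled only afterwards, and \<open>\<Phi>\<close> vanishes at both ends anyway.\<close>
      have "ac False (G c) (g' c)"
        unfolding ac_def using ic
        by (auto simp: G_def intro!: exI[of _ 0])
      from ac_by_parts[OF this \<Phi>(2) TT_facts(4)[OF \<phi>0]]
      have "(\<integral>t. g' c t * \<Phi> t + G c t * \<phi>0 t \<partial>T) = 0" using \<Phi>(3) \<Phi>b by simp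
      then have parts: "(\<integral>t. g' c t * \<Phi> t \<partial>T) = - (\<integral>t. G c t * \<phi>0 t \<partial>T)"
        using i\<eta>[OF ic(1) \<Phi>T] i\<eta>[OF ic(3) \<phi>0] by simp
      have iD: "integrable T (\<lambda>t. F c t - G c t)" using ic by simp
      have c0i: "integrable T c0" by (rule integrable_continuous_T[OF TT_facts(4)[OF TT_c0(1)]])
      have "(\<integral>t. H (c, t) * \<phi> t \<partial>T) = (\<integral>t. (F c t - G c t) * \<phi>0 t - m c * \<phi>0 t
            + I * ((F c t - G c t) * c0 t - m c * c0 t) \<partial>T)"
        by (rule Bochner_Integration.integral_cong) (auto simp: H_def \<phi>0_def algebra_simps)
      also have "\<dots> = (\<integral>t. (F c t - G c t) * \<phi>0 t - m c * \<phi>0 t \<partial>T)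
            + (\<integral>t. I * ((F c t - G c t) * c0 t - m c * c0 t) \<partial>T)"
        using i\<eta>[OF iD \<phi>0] i\<eta>[OF iD TT_c0(1)] integrable_continuous_T[OF TT_facts(4)[OF \<phi>0]] c0i
        by (intro Bochner_Integration.integral_add) auto
      also have "(\<integral>t. I * ((F c t - G c t) * c0 t - m c * c0 t) \<partial>T) = 0"
        using i\<eta>[OF iD TT_c0(1)] c0i by (simp add: m_def TT_c0(2))
      also have "(\<integral>t. (F c t - G c t) * \<phi>0 t - m c * \<phi>0 t \<partial>T) = (\<integral>t. (F c t - G c t) * \<phi>0 t \<partial>T)"
        using i\<eta>[OF iD \<phi>0] integrable_continuous_T[OF TT_facts(4)[OF \<phi>0]] by (simp add: I0)
      also have "\<dots> = (\<integral>t. F c t * \<phi>0 t \<partial>T) - (\<integral>t. G c t * \<phi>0 t \<partial>T)"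
        using i\<eta>[OF ic(2) \<phi>0] i\<eta>[OF ic(3) \<phi>0] by (simp add: left_diff_distrib)
      also have "\<dots> = (\<integral>t. F c t * \<phi>0 t + g' c t * \<Phi> t \<partial>T)"
        using i\<eta>[OF ic(2) \<phi>0] i\<eta>[OF ic(1) \<Phi>T] parts by simp
      finally have *: "(\<integral>t. H (c, t) * \<phi> t \<partial>T) = (\<integral>t. F c t * \<phi>0 t + g' c t * \<Phi> t \<partial>T)" by simp
      have "(\<integral>t. H (c, t) * (\<beta> c * \<phi> t) \<partial>T) = \<beta> c * (\<integral>t. H (c, t) * \<phi> t \<partial>T)"
        by (subst integral_mult_right_zero[symmetric]) (simp add: ac_simps)
      also have "\<dots> = (\<integral>t. F c t * (\<beta> c * \<phi>0 t) + g' c t * (\<beta> c * \<Phi> t) \<partial>T)"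
        unfolding * by (subst integral_mult_right_zero[symmetric]) (simp add: algebra_simps)
      finally show ?case .
    qed
    have i1: "integrable (B \<Otimes>\<^sub>M T) (\<lambda>q. F (fst q) (snd q) * (\<beta> (fst q) * \<phi>0 (snd q)))"
      using int_prod[OF iF TT_facts(1)[OF \<phi>0] K1] by (simp add: split_beta')
    have i2: "integrable (B \<Otimes>\<^sub>M T) (\<lambda>q. g' (fst q) (snd q) * (\<beta> (fst q) * \<Phi> (snd q)))"
      using int_prod[OF ig TT_facts(1)[OF \<Phi>T] K2] by (simp add: split_beta')
    have "(\<integral>q. H q * (\<beta> (fst q) * \<phi> (snd q)) \<partial>(B \<Otimes>\<^sub>M T)) = (\<integral>c. (\<integral>t. H (c, t) * (\<beta> c * \<phi> t) \<partial>T) \<partial>B)"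
      using BT.integral_fst'[OF int_prod[OF iH TT_facts(1)[OF \<phi>] K\<phi>]] by simp
    also have "\<dots> = (\<integral>c. (\<integral>t. F c t * (\<beta> c * \<phi>0 t) + g' c t * (\<beta> c * \<Phi> t) \<partial>T) \<partial>B)"
    proof (rule Bochner_Integration.integral_cong_AE[OF _ _ inner])
      show "(\<lambda>c. \<integral>t. H (c, t) * (\<beta> c * \<phi> t) \<partial>T) \<in> borel_measurable B"
        using iH by (auto intro!: B.borel_measurable_lebesgue_integral simp: H_def)
      show "(\<lambda>c. \<integral>t. F c t * (\<beta> c * \<phi>0 t) + g' c t * (\<beta> c * \<Phi> t) \<partial>T) \<in> borel_measurable B"
        by measurable
    qed
    also have "\<dots> = (\<integral>q. F (fst q) (snd q) * (\<beta> (fst q) * \<phi>0 (snd q))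
        + g' (fst q) (snd q) * (\<beta> (fst q) * \<Phi> (snd q)) \<partial>(B \<Otimes>\<^sub>M T))"
      using BT.integral_fst'[OF Bochner_Integration.integrable_add[OF i1 i2]] by simp
    also have "\<dots> = (\<integral>q. F (fst q) (snd q) * (\<beta> (fst q) * \<phi>0 (snd q)) \<partial>(B \<Otimes>\<^sub>M T))
        + (\<integral>q. g' (fst q) (snd q) * (\<beta> (fst q) * \<Phi> (snd q)) \<partial>(B \<Otimes>\<^sub>M T))"
      using i1 i2 by simp
    also have "(\<integral>q. F (fst q) (snd q) * (\<beta> (fst q) * \<phi>0 (snd q)) \<partial>(B \<Otimes>\<^sub>M T))
       = (\<integral>p. \<beta> (fst (Ji p)) * deriv \<Phi> (snd (Ji p)) * f p \<partial>Om h)"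
      by (subst integral_J) (auto simp: F_def d\<Phi> ac_simps)
    also have "(\<integral>q. g' (fst q) (snd q) * (\<beta> (fst q) * \<Phi> (snd q)) \<partial>(B \<Otimes>\<^sub>M T))
       = (\<integral>p. \<beta> (fst (Ji p)) * \<Phi> (snd (Ji p)) * g p \<partial>Om h)"
      by (subst integral_J) (auto simp: g'_def ac_simps)
    finally show "(\<integral>q. H q * (\<beta> (fst q) * \<phi> (snd q)) \<partial>(B \<Otimes>\<^sub>M T)) = 0"
      using weak[OF \<beta> \<Phi>T] by simp
  qed
  then have "AE q in B \<Otimes>\<^sub>M T. F (fst q) (snd q) = m (fst q) + G (fst q) (snd q)"
    by eventually_elim (simp add: H_def)
  from BT.AE_pair[OF this] have H0: "AE c in B. AE t in T. F c t = m c + G c t"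
    by simp
  \<comment> \<open>On closed lines the constant 1 is a test function with derivative zero. Testing
    with it shows that \<open>g\<close> has mean zero on almost every line.\<close>
  have per0: "AE c in B. per \<longrightarrow> (\<integral>t. g' c t \<partial>T) = 0"
  proof (cases per)
    case True
    define k where "k c = (\<integral>t. g' c t \<partial>T)" for c
    have ik: "integrable B k" unfolding k_def using BT.integrable_fst'[OF ig] by simp
    have "AE q in B \<Otimes>\<^sub>M T. k (fst q) = 0"
    proof (rule fundamental[OF integrable_fst_B[OF ik]])
      fix \<beta> \<phi> assume \<beta>: "\<beta> \<in> BB" and \<phi>: "\<phi> \<in> TT"
      obtain K\<beta> where K\<beta>: "\<And>c. c \<in> space B \<Longrightarrow> \<bar>\<beta> c\<bar> \<le> K\<beta>" using BB_bounded[OF \<beta>] by auto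
      note [measurable] = BB_meas[OF \<beta>] TT_facts(1)[OF \<phi>]
      have "integrable B (\<lambda>c. k c * \<beta> c)"
      proof (rule Bochner_Integration.integrable_bound)
        show "integrable B (\<lambda>c. K\<beta> * k c)" using ik by simp
        show "(\<lambda>c. k c * \<beta> c) \<in> borel_measurable B" using ik by measurable
        show "AE c in B. norm (k c * \<beta> c) \<le> norm (K\<beta> * k c)"
          by (rule AE_I2) (auto simp: abs_mult mult.commute intro!: mult_right_mono order_trans[OF K\<beta> abs_ge_self])
      qed
      have ibg: "integrable (B \<Otimes>\<^sub>M T) (\<lambda>q. \<beta> (fst q) * g' (fst q) (snd q))"
      proof (rule Bochner_Integration.integrable_bound)
        show "integrable (B \<Otimes>\<^sub>M T) (\<lambda>q. K\<beta> * g' (fst q) (snd q))" using ig by (simp add: split_beta')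
        show "AE c in B \<Otimes>\<^sub>M T. norm (\<beta> (fst c) * g' (fst c) (snd c)) \<le> norm (K\<beta> * g' (fst c) (snd c))"
          by (rule AE_I2) (auto simp: abs_mult space_pair_measure intro!: mult_right_mono order_trans[OF K\<beta> abs_ge_self])
      qed measurable
      have "(\<integral>q. k (fst q) * (\<beta> (fst q) * \<phi> (snd q)) \<partial>(B \<Otimes>\<^sub>M T)) = (\<integral>c. (\<integral>t. k c * (\<beta> c * \<phi> t) \<partial>T) \<partial>B)"
      proof -
        have "integrable (B \<Otimes>\<^sub>M T) (\<lambda>q. k (fst q) * (\<beta> (fst q) * \<phi> (snd q)))"
        proof (rule BT.Fubini_integrable)
          have [measurable]: "k \<in> borel_measurable B" using ik by auto
          show "(\<lambda>q. k (fst q) * (\<beta> (fst q) * \<phi> (snd q))) \<in> borel_measurable (B \<Otimes>\<^sub>M T)" by measurable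
          have "(\<lambda>x. \<integral>y. norm (k (fst (x, y)) * (\<beta> (fst (x, y)) * \<phi> (snd (x, y)))) \<partial>T)
            = (\<lambda>x. \<bar>k x * \<beta> x\<bar> * (\<integral>y. \<bar>\<phi> y\<bar> \<partial>T))"
            by (auto simp: abs_mult mult.assoc)
          then show "integrable B (\<lambda>x. \<integral>y. norm (k (fst (x, y)) * (\<beta> (fst (x, y)) * \<phi> (snd (x, y)))) \<partial>T)"
            using \<open>integrable B (\<lambda>c. k c * \<beta> c)\<close> by simp
          show "AE x in B. integrable T (\<lambda>y. k (fst (x, y)) * (\<beta> (fst (x, y)) * \<phi> (snd (x, y))))"
            using integrable_continuous_T[OF TT_facts(4)[OF \<phi>]] by simp
        qed
        from BT.integral_fst'[OF this] show ?thesis by simp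
      qed
      also have "\<dots> = (\<integral>c. (\<beta> c * k c) * (\<integral>t. \<phi> t \<partial>T) \<partial>B)"
        by (intro Bochner_Integration.integral_cong refl) (simp add: ac_simps)
      also have "\<dots> = (\<integral>t. \<phi> t \<partial>T) * (\<integral>c. \<beta> c * k c \<partial>B)"
        by (simp add: mult.commute)
      also have "(\<integral>c. \<beta> c * k c \<partial>B) = (\<integral>c. (\<integral>t. \<beta> c * g' c t \<partial>T) \<partial>B)"
        by (simp add: k_def)
      also have "\<dots> = (\<integral>q. \<beta> (fst q) * g' (fst q) (snd q) \<partial>(B \<Otimes>\<^sub>M T))"
        using BT.integral_fst'[OF ibg] by simp
      also have "\<dots> = (\<integral>p. \<beta> (fst (Ji p)) * g p \<partial>Om h)"
        by (subst integral_J) (auto simp: g'_def)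
      also have "\<dots> = 0"
        using weak[OF \<beta> TT_one[OF True]] by simp
      finally show "(\<integral>q. k (fst q) * (\<beta> (fst q) * \<phi> (snd q)) \<partial>(B \<Otimes>\<^sub>M T)) = 0" by simp
    qed
    from BT.AE_pair[OF this] have "AE c in B. AE t in T. k c = 0" by simp
    moreover have "ae_filter T \<noteq> bot" using ab emeasure_T by (simp add: ae_filter_eq_bot_iff)
    ultimately have "AE c in B. k c = 0" by (simp add: eventually_const)
    then show ?thesis by eventually_elim (simp add: k_def)
  qed simp
  show ?thesis
    unfolding wd_def using H0 per0 BT.AE_integrable_fst'[OF ig] AE_space
  proof eventually_elim
    case (elim c)
    then have "AE t in T. f (J (c, t)) = m c + prim (\<lambda>t. g (J (c, t))) t"
      by (simp add: F_def G_def g'_def[abs_def])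
    then have "\<exists>C. AE t in T. f (J (c, t)) = C + prim (\<lambda>t. g (J (c, t))) t" by (rule exI)
    with elim show ?case
      unfolding ac_def using slice_measurable[of f c] by (simp add: g'_def)
  qed
qed

end

subsection \<open>The three coordinate directions\<close>

lemma nn_integral_Om:
  assumes "f \<in> borel_measurable (Om h)"
  shows "(\<integral>\<^sup>+p. f p \<partial>Om h) = (\<integral>\<^sup>+x. \<integral>\<^sup>+y. \<integral>\<^sup>+z. f (x, y, z) \<partial>ZM h \<partial>XM \<partial>XM)"
proof -
  interpret Z: finite_measure "ZM h" by (rule finite_measure_ZM)
  interpret XZ: pair_sigma_finite XM "ZM h" ..
  interpret XZ: sigma_finite_measure "XM \<Otimes>\<^sub>M ZM h" by (rule XZ.sigma_finite_measure_axioms)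
  note m[measurable] = assms[unfolded Om_def]
  have "(\<integral>\<^sup>+p. f p \<partial>Om h) = (\<integral>\<^sup>+x. \<integral>\<^sup>+q. f (x, q) \<partial>(XM \<Otimes>\<^sub>M ZM h) \<partial>XM)"
    unfolding Om_def by (rule XZ.nn_integral_fst[symmetric]) measurable
  also have "\<dots> = (\<integral>\<^sup>+x. \<integral>\<^sup>+y. \<integral>\<^sup>+z. f (x, y, z) \<partial>ZM h \<partial>XM \<partial>XM)"
    by (intro nn_integral_cong, subst Z.nn_integral_fst[symmetric]) auto
  finally show ?thesis .
qed

lemma distr_eqI:
  assumes J: "J \<in> measurable M N"
    and "\<And>f. f \<in> borel_measurable N \<Longrightarrow> (\<integral>\<^sup>+q. f (J q) \<partial>M) = (\<integral>\<^sup>+p. f p \<partial>N)"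
  shows "distr M N J = N"
proof (rule measure_eqI)
  fix A assume "A \<in> sets (distr M N J)"
  then have A: "A \<in> sets N" by simp
  have "emeasure (distr M N J) A = (\<integral>\<^sup>+p. indicator A p \<partial>distr M N J)"
    using A by simp
  also have "\<dots> = (\<integral>\<^sup>+q. indicator A (J q) \<partial>M)"
    by (rule nn_integral_distr[OF J]) (use A in auto)
  also have "\<dots> = (\<integral>\<^sup>+p. indicator A p \<partial>N)"
    by (rule assms(2)) (use A in auto)
  finally show "emeasure (distr M N J) A = emeasure N A" using A by simp
qed simp

lemma cptI:
  "sm1 c \<Longrightarrow> -h < p \<Longrightarrow> p < q \<Longrightarrow> q < 0 \<Longrightarrow> (\<And>z. z \<notin> {p..q} \<Longrightarrow> c z = 0) \<Longrightarrow> cpt h c"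
  unfolding cpt_def by blast

lemma cpt_diff:
  assumes "cpt h f" "cpt h g" shows "cpt h (\<lambda>t. f t - c * g t)"
proof -
  from assms obtain p q p' q' where *: "-h < p" "p < q" "q < 0" "-h < p'" "p' < q'" "q' < 0"
    "\<And>z. z \<notin> {p..q} \<Longrightarrow> f z = 0" "\<And>z. z \<notin> {p'..q'} \<Longrightarrow> g z = 0" and s: "sm1 f" "sm1 g"
    by (auto simp: cpt_def)
  have "f z - c * g z = 0" if "z \<notin> {min p p'..max q q'}" for z
  proof -
    have "z \<notin> {p..q}" "z \<notin> {p'..q'}" using that by auto
    then show ?thesis using * by simp
  qed
  moreover have "-h < min p p'" "min p p' < max q q'" "max q q' < 0" using * by auto
  ultimately show ?thesis
    using s by (intro cptI[of _ _ "min p p'" "max q q'"] sm1_diff sm1_mult sm1_const)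
qed

text \<open>The difference \<open>F (x + 1) - F x\<close> has derivative zero, and its constant
  value is the integral of \<open>f\<close> over one period.\<close>

lemma per1_primitive:
  assumes "per1 f" "sm1 F" "F 0 = 0" "(\<integral>t. f t \<partial>XM) = 0"
    and d: "\<And>t. (F has_real_derivative f t) (at t)"
  shows "per1 F"
proof -
  have "((\<lambda>x. F (x + 1) - F x) has_real_derivative 0) (at x)" for x
    using assms(1) by (auto intro!: derivative_eq_intros DERIV_chain2[OF d] d simp: per1_def)
  then obtain c where c: "\<And>x. F (x + 1) - F x = c"
    using has_field_derivative_zero_constant[of UNIV "\<lambda>x. F (x + 1) - F x"] by auto
  have "F 1 - F 0 = 0"
    using X.integral_deriv[OF d sm1_continuous] assms by (simp add: per1_def)
  then have "c = 0" using c[of 0] by simp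
  then show ?thesis using c assms(2) by (simp add: per1_def)
qed

text \<open>The primitive is constant on either side of the support of \<open>f\<close>. The left
  constant is zero by normalisation at \<open>-h\<close>, the right one because the integral of
  \<open>f\<close> vanishes.\<close>

lemma cpt_primitive:
  assumes h: "h > 0" and f: "cpt h f" and F: "sm1 F" "F (-h) = 0" "(\<integral>t. f t \<partial>ZM h) = 0"
    and d: "\<And>t. (F has_real_derivative f t) (at t)"
  shows "cpt h F"
proof -
  interpret Z: itv "-h" 0 "{-h<..<0}" "ZM h" by (rule itv_Z[OF h])
  from f obtain p q where *: "-h < p" "p < q" "q < 0" "\<And>z. z \<notin> {p..q} \<Longrightarrow> f z = 0" and s: "sm1 f"
    by (auto simp: cpt_def)
  have F0: "F 0 = 0" using Z.integral_deriv[OF d sm1_continuous[OF s]] F by simp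
  have const: "\<exists>c. \<forall>z\<in>A. F z = c" if "convex A" "A \<inter> {p..q} = {}" for A
  proof (rule has_field_derivative_zero_constant[OF that(1)])
    fix z assume "z \<in> A"
    then have "f z = 0" using that by (intro *) auto
    then show "(F has_real_derivative 0) (at z within A)"
      using d[of z] by (auto intro: has_field_derivative_at_within)
  qed
  have "F z = 0" if z: "z \<notin> {p..q}" for z
  proof (cases "z < p")
    case True
    obtain c where "\<forall>z\<in>{..<p}. F z = c" using const[of "{..<p}"] by fastforce
    then show ?thesis using True *(1) F(2) by (metis lessThan_iff)
  next
    case False
    then have "z > q" using z by auto
    obtain c where "\<forall>z\<in>{q<..}. F z = c" using const[of "{q<..}"] by fastforce
    then show ?thesis using \<open>z > q\<close> *(3) F0 by (metis greaterThan_iff)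
  qed
  then show ?thesis using F(1) * unfolding cpt_def by blast
qed

lemma cpt_normalised:
  assumes h: "h > 0"
  obtains c0 where "cpt h c0" "(\<integral>t. c0 t \<partial>ZM h) = 1"
proof -
  interpret Z: itv "-h" 0 "{-h<..<0}" "ZM h" by (rule itv_Z[OF h])
  define g where "g z = bump (1 * ((z - (-2*h/3)) * (-h/3 - z)))" for z
  have g: "cpt h g" unfolding g_def using h by (intro cpt_bump) auto
  have ig: "integrable (ZM h) g"
    using g by (intro Z.integrable_continuous_T sm1_continuous) (auto simp: cpt_def)
  have pos: "g z > 0" if "-2*h/3 < z" "z < -h/3" for z
    using that by (simp add: g_def bump_def eta_def)
  have "(\<integral>t. g t \<partial>ZM h) \<noteq> 0"
  proof
    assume "(\<integral>t. g t \<partial>ZM h) = 0"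
    then have "AE z in ZM h. g z = 0"
      by (rule integral_nonneg_eq_0_iff_AE[OF ig, THEN iffD1, rotated]) (simp add: g_def bump_bounds)
    then have "AE z in lborel. z \<notin> {-2*h/3<..<-h/3}"
      unfolding Z.AE_T_iff by eventually_elim (use pos h in fastforce)
    then have "emeasure lborel {-2*h/3<..<-h/3} = 0"
      by (subst (asm) AE_iff_measurable[where N="{-2*h/3<..<-h/3}"]) auto
    then show False using h by simp
  qed
  then have "(\<integral>t. g t / (\<integral>t. g t \<partial>ZM h) \<partial>ZM h) = 1" by simp
  moreover have "cpt h (\<lambda>t. g t / (\<integral>t. g t \<partial>ZM h))"
  proof -
    \<comment> \<open>A multiple of \<open>g\<close> written as a difference, so that the closure of
      \<open>cpt\<close> under differences applies.\<close>
    have "cpt h (\<lambda>t. g t - (1 - 1 / (\<integral>t. g t \<partial>ZM h)) * g t)" by (rule cpt_diff[OF g g])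
    then show ?thesis by (simp add: algebra_simps)
  qed
  ultimately show thesis by (intro that)
qed

lemma sm1_bounded_on:
  assumes "sm1 f" obtains K where "\<And>t. t \<in> {l..u} \<Longrightarrow> \<bar>f t\<bar> \<le> K"
proof -
  have "bounded (f ` {l..u})"
    by (intro compact_imp_bounded compact_continuous_image sm1_continuous assms) auto
  then show ?thesis using that unfolding bounded_iff by fastforce
qed

locale slab =
  fixes h :: real
  assumes h: "h > 0"
begin

definition c0 :: "real \<Rightarrow> real" where
  "c0 = (SOME c. cpt h c \<and> (\<integral>t. c t \<partial>ZM h) = 1)"

lemma c0: "cpt h c0" "(\<integral>t. c0 t \<partial>ZM h) = 1"
proof -
  have "\<exists>c. cpt h c \<and> (\<integral>t. c t \<partial>ZM h) = 1" using cpt_normalised[OF h] by metis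
  from someI_ex[OF this] show "cpt h c0" "(\<integral>t. c0 t \<partial>ZM h) = 1" unfolding c0_def by auto
qed

sublocale Z: itv "-h" 0 "{-h<..<0}" "ZM h" by (rule itv_Z[OF h])
sublocale XX: pair_sigma_finite XM XM ..
sublocale XZ: pair_sigma_finite XM "ZM h" ..

definition "Jx = (\<lambda>q :: (real \<times> real) \<times> real. (snd q, fst (fst q), snd (fst q)))"
definition "Jy = (\<lambda>q :: (real \<times> real) \<times> real. (fst (fst q), snd q, snd (fst q)))"
definition "Jz = (\<lambda>q :: (real \<times> real) \<times> real. (fst (fst q), snd (fst q), snd q))"
definition "Ix = (\<lambda>p :: point. ((fst (snd p), snd (snd p)), fst p))"
definition "Iy = (\<lambda>p :: point. ((fst p, snd (snd p)), fst (snd p)))"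
definition "Iz = (\<lambda>p :: point. ((fst p, fst (snd p)), snd (snd p)))"

lemma J_inverse: "Ix (Jx q) = q" "Jx (Ix p) = p" "Iy (Jy q) = q" "Jy (Iy p) = p" "Iz (Jz q) = q" "Jz (Iz p) = p"
  by (simp_all add: Jx_def Jy_def Jz_def Ix_def Iy_def Iz_def)

definition tensor :: "(real \<Rightarrow> real) \<Rightarrow> (real \<Rightarrow> real) \<Rightarrow> real \<times> real \<Rightarrow> real" where
  "tensor b c = (\<lambda>q. b (fst q) * c (snd q))"

lemma J_measurable [measurable]:
  "Jx \<in> measurable ((XM \<Otimes>\<^sub>M ZM h) \<Otimes>\<^sub>M XM) (Om h)" "Jy \<in> measurable ((XM \<Otimes>\<^sub>M ZM h) \<Otimes>\<^sub>M XM) (Om h)"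
  "Jz \<in> measurable ((XM \<Otimes>\<^sub>M XM) \<Otimes>\<^sub>M ZM h) (Om h)" "Ix \<in> measurable (Om h) ((XM \<Otimes>\<^sub>M ZM h) \<Otimes>\<^sub>M XM)"
  "Iy \<in> measurable (Om h) ((XM \<Otimes>\<^sub>M ZM h) \<Otimes>\<^sub>M XM)" "Iz \<in> measurable (Om h) ((XM \<Otimes>\<^sub>M XM) \<Otimes>\<^sub>M ZM h)"
  unfolding Jx_def Jy_def Jz_def Ix_def Iy_def Iz_def Om_def by measurable

lemma distr_Jx: "distr ((XM \<Otimes>\<^sub>M ZM h) \<Otimes>\<^sub>M XM) (Om h) Jx = Om h"
proof (rule distr_eqI)
  interpret XZX: pair_sigma_finite XM "XM \<Otimes>\<^sub>M ZM h"
    by (intro pair_sigma_finite.intro XZ.sigma_finite_measure_axioms X.sigma_finite_measure_axioms)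
  fix f :: "point \<Rightarrow> ennreal" assume f[measurable]: "f \<in> borel_measurable (Om h)"
  have [measurable]: "f \<in> borel_measurable (XM \<Otimes>\<^sub>M XM \<Otimes>\<^sub>M ZM h)" using f by (simp add: Om_def)
  have "(\<integral>\<^sup>+q. f (Jx q) \<partial>((XM \<Otimes>\<^sub>M ZM h) \<Otimes>\<^sub>M XM)) = (\<integral>\<^sup>+q. \<integral>\<^sup>+x. f (Jx (q, x)) \<partial>XM \<partial>(XM \<Otimes>\<^sub>M ZM h))"
    by (rule X.nn_integral_fst[symmetric]) measurable
  also have "\<dots> = (\<integral>\<^sup>+q. \<integral>\<^sup>+x. f (x, q) \<partial>XM \<partial>(XM \<Otimes>\<^sub>M ZM h))"
    by (simp add: Jx_def)
  also have "\<dots> = (\<integral>\<^sup>+p. f p \<partial>Om h)"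
    unfolding Om_def by (subst XZX.nn_integral_snd) auto
  finally show "(\<integral>\<^sup>+q. f (Jx q) \<partial>((XM \<Otimes>\<^sub>M ZM h) \<Otimes>\<^sub>M XM)) = (\<integral>\<^sup>+p. f p \<partial>Om h)" .
qed measurable

lemma distr_Jy: "distr ((XM \<Otimes>\<^sub>M ZM h) \<Otimes>\<^sub>M XM) (Om h) Jy = Om h"
proof (rule distr_eqI)
  fix f :: "point \<Rightarrow> ennreal" assume f[measurable]: "f \<in> borel_measurable (Om h)"
  have [measurable]: "f \<in> borel_measurable (XM \<Otimes>\<^sub>M XM \<Otimes>\<^sub>M ZM h)" using f by (simp add: Om_def)
  have "(\<integral>\<^sup>+q. f (Jy q) \<partial>((XM \<Otimes>\<^sub>M ZM h) \<Otimes>\<^sub>M XM)) = (\<integral>\<^sup>+q. \<integral>\<^sup>+y. f (Jy (q, y)) \<partial>XM \<partial>(XM \<Otimes>\<^sub>M ZM h))"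
    by (rule X.nn_integral_fst[symmetric]) measurable
  also have "\<dots> = (\<integral>\<^sup>+x. \<integral>\<^sup>+z. \<integral>\<^sup>+y. f (Jy ((x, z), y)) \<partial>XM \<partial>ZM h \<partial>XM)"
    by (rule Z.nn_integral_fst[symmetric]) measurable
  also have "\<dots> = (\<integral>\<^sup>+x. \<integral>\<^sup>+z. \<integral>\<^sup>+y. f (x, y, z) \<partial>XM \<partial>ZM h \<partial>XM)"
    by (simp add: Jy_def)
  also have "\<dots> = (\<integral>\<^sup>+x. \<integral>\<^sup>+y. \<integral>\<^sup>+z. f (x, y, z) \<partial>ZM h \<partial>XM \<partial>XM)"
    by (intro nn_integral_cong XZ.Fubini') measurable
  finally show "(\<integral>\<^sup>+q. f (Jy q) \<partial>((XM \<Otimes>\<^sub>M ZM h) \<Otimes>\<^sub>M XM)) = (\<integral>\<^sup>+p. f p \<partial>Om h)"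
    by (simp add: nn_integral_Om)
qed measurable

lemma distr_Jz: "distr ((XM \<Otimes>\<^sub>M XM) \<Otimes>\<^sub>M ZM h) (Om h) Jz = Om h"
proof (rule distr_eqI)
  fix f :: "point \<Rightarrow> ennreal" assume f[measurable]: "f \<in> borel_measurable (Om h)"
  have [measurable]: "f \<in> borel_measurable (XM \<Otimes>\<^sub>M XM \<Otimes>\<^sub>M ZM h)" using f by (simp add: Om_def)
  have "(\<integral>\<^sup>+q. f (Jz q) \<partial>((XM \<Otimes>\<^sub>M XM) \<Otimes>\<^sub>M ZM h)) = (\<integral>\<^sup>+q. \<integral>\<^sup>+z. f (Jz (q, z)) \<partial>ZM h \<partial>(XM \<Otimes>\<^sub>M XM))"
    by (rule Z.nn_integral_fst[symmetric]) measurable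
  also have "\<dots> = (\<integral>\<^sup>+x. \<integral>\<^sup>+y. \<integral>\<^sup>+z. f (Jz ((x, y), z)) \<partial>ZM h \<partial>XM \<partial>XM)"
    by (rule X.nn_integral_fst[symmetric]) measurable
  finally show "(\<integral>\<^sup>+q. f (Jz q) \<partial>((XM \<Otimes>\<^sub>M XM) \<Otimes>\<^sub>M ZM h)) = (\<integral>\<^sup>+p. f p \<partial>Om h)"
    by (simp add: nn_integral_Om Jz_def)
qed measurable

definition "BXZ = {tensor b c | b c. per1 b \<and> cpt h c}"
definition "BXX = {tensor a b | a b. per1 a \<and> per1 b}"

lemma tensor_bounded:
  assumes "sm1 b" "sm1 c"
  shows "\<exists>K. \<forall>q\<in>{l..u} \<times> {l'..u'}. \<bar>tensor b c q\<bar> \<le> K"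
proof -
  obtain K where K: "\<And>t. t \<in> {l..u} \<Longrightarrow> \<bar>b t\<bar> \<le> K" using sm1_bounded_on[OF assms(1), of l u] by auto
  obtain K' where K': "\<And>t. t \<in> {l'..u'} \<Longrightarrow> \<bar>c t\<bar> \<le> K'" using sm1_bounded_on[OF assms(2), of l' u'] by auto
  have "\<bar>b s\<bar> * \<bar>c t\<bar> \<le> K * K'" if "s \<in> {l..u}" "t \<in> {l'..u'}" for s t
    using K[OF that(1)] K'[OF that(2)] by (intro mult_mono) auto
  then show ?thesis by (auto simp: tensor_def abs_mult intro!: exI[of _ "K * K'"])
qed

lemma tensor_measurable:
  assumes "sm1 b" "sm1 c"
  shows "tensor b c \<in> borel_measurable (XM \<Otimes>\<^sub>M ZM h)" "tensor b c \<in> borel_measurable (XM \<Otimes>\<^sub>M XM)"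
proof -
  have [measurable]: "b \<in> borel_measurable XM" "c \<in> borel_measurable XM" "c \<in> borel_measurable (ZM h)"
    using assms by (auto intro!: X.borel_measurable_T Z.borel_measurable_T borel_measurable_continuous_onI sm1_continuous)
  show "tensor b c \<in> borel_measurable (XM \<Otimes>\<^sub>M ZM h)" "tensor b c \<in> borel_measurable (XM \<Otimes>\<^sub>M XM)"
    unfolding tensor_def by measurable
qed

lemma finite_measure_pairs: "finite_measure (XM \<Otimes>\<^sub>M ZM h)" "finite_measure (XM \<Otimes>\<^sub>M XM)"
  by (intro finite_measure_pair_measure X.finite_measure_axioms Z.finite_measure_axioms)+

lemma X_mass: "(\<integral>t. 1 \<partial>XM) = (1::real)"
  using X.measure_T by simp

text \<open>A horizontal line is a circle of length one: its test functions are the periodic ones,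
  and the constant 1 is the normalised function that plays the role of \<open>c0\<close>.\<close>

sublocale dx: dir 0 1 "{0..<1}" XM h "XM \<Otimes>\<^sub>M ZM h" Jx Ix True BXZ "Collect per1" "\<lambda>_. 1"
proof (rule dir.intro[OF itv_X dir_axioms.intro], goal_cases)
  case (8 \<beta>) then show ?case by (auto simp: BXZ_def per1_def cpt_def intro: tensor_measurable)
next
  case (9 \<beta>)
  then obtain b c where bc: "\<beta> = tensor b c" "sm1 b" "sm1 c" by (auto simp: BXZ_def per1_def cpt_def)
  show ?case using tensor_bounded[OF bc(2,3), of 0 1 "-h" 0] unfolding bc(1) by (rule ex_forward) (auto simp: space_pair_measure)
next
  case (11 \<phi> \<Phi>) then show ?case using per1_primitive[of \<phi> \<Phi>] by simp
next
  case (12 \<phi> c) then show ?case by (auto simp: per1_def intro!: sm1_diff sm1_const)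
next
  case (16 a b c)
  then show ?case
    by (intro bexI[of _ "tensor b c"] bexI[of _ a]) (auto simp: BXZ_def tpr_def Jx_def tensor_def)
qed (use h X_mass in \<open>auto simp: finite_measure_pairs distr_Jx per1_def sm1_const J_measurable J_inverse\<close>)

sublocale dy: dir 0 1 "{0..<1}" XM h "XM \<Otimes>\<^sub>M ZM h" Jy Iy True BXZ "Collect per1" "\<lambda>_. 1"
proof (rule dir.intro[OF itv_X dir_axioms.intro], goal_cases)
  case (8 \<beta>) then show ?case by (auto simp: BXZ_def per1_def cpt_def intro: tensor_measurable)
next
  case (9 \<beta>)
  then obtain b c where bc: "\<beta> = tensor b c" "sm1 b" "sm1 c" by (auto simp: BXZ_def per1_def cpt_def)
  show ?case using tensor_bounded[OF bc(2,3), of 0 1 "-h" 0] unfolding bc(1) by (rule ex_forward) (auto simp: space_pair_measure)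
next
  case (11 \<phi> \<Phi>) then show ?case using per1_primitive[of \<phi> \<Phi>] by simp
next
  case (12 \<phi> c) then show ?case by (auto simp: per1_def intro!: sm1_diff sm1_const)
next
  case (16 a b c)
  then show ?case
    by (intro bexI[of _ "tensor a c"] bexI[of _ b]) (auto simp: BXZ_def tpr_def Jy_def tensor_def)
qed (use h X_mass in \<open>auto simp: finite_measure_pairs distr_Jy per1_def sm1_const J_measurable J_inverse\<close>)

text \<open>Vertical lines are open: test functions have compact support, the flag
  \<open>per\<close> is \<open>False\<close> so that nothing is imposed at top and bottom, and the
  normalised function has to be a bump.\<close>

sublocale dz: dir "-h" 0 "{-h<..<0}" "ZM h" h "XM \<Otimes>\<^sub>M XM" Jz Iz False BXX "Collect (cpt h)" c0
proof (rule dir.intro[OF itv_Z[OF h] dir_axioms.intro], goal_cases)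
  case (8 \<beta>) then show ?case by (auto simp: BXX_def per1_def cpt_def intro: tensor_measurable)
next
  case (9 \<beta>)
  then obtain b c where bc: "\<beta> = tensor b c" "sm1 b" "sm1 c" by (auto simp: BXX_def per1_def cpt_def)
  show ?case using tensor_bounded[OF bc(2,3), of 0 1 0 1] unfolding bc(1) by (rule ex_forward) (auto simp: space_pair_measure)
next
  case (11 \<phi> \<Phi>) then show ?case using cpt_primitive[OF h, of \<phi> \<Phi>] by simp
next
  case (12 \<phi> c) then show ?case by (auto intro!: cpt_diff c0)
next
  case (10 \<phi>) then show ?case by (simp add: cpt_def)
next
  case (16 a b c)
  then show ?case
    by (intro bexI[of _ "tensor a b"] bexI[of _ c]) (auto simp: BXX_def tpr_def Jz_def tensor_def)
qed (use h in \<open>auto simp: finite_measure_pairs distr_Jz c0 J_measurable J_inverse\<close>)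

end

subsection \<open>Smooth functions and test functions\<close>

lemma has_derivative_frechet:
  "f differentiable_on UNIV \<Longrightarrow> (f has_derivative frechet_derivative f (at x)) (at x)"
  by (metis UNIV_I differentiable_on_def frechet_derivative_works)

lemma Ck_SucI:
  assumes "\<And>x. (f has_derivative f' x) (at x)" "\<And>e. e \<in> Basis \<Longrightarrow> Ck n (\<lambda>x. f' x e)"
  shows "Ck (Suc n) f"
proof -
  have "frechet_derivative f (at x) = f' x" for x
    using frechet_derivative_at[OF assms(1)] by simp
  then show ?thesis using assms by (auto simp: differentiable_on_def differentiable_def)
qed

lemma Ck_add: "Ck n f \<Longrightarrow> Ck n g \<Longrightarrow> Ck n (\<lambda>x. f x + g x)"
proof (induction n arbitrary: f g)
  case (Suc n)
  have "Ck n (\<lambda>x. frechet_derivative f (at x) e + frechet_derivative g (at x) e)" if "e \<in> Basis" for e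
    using Suc that by simp
  then show ?case
    using Suc.prems by (intro Ck_SucI[where f'="\<lambda>x t. frechet_derivative f (at x) t + frechet_derivative g (at x) t"]
        has_derivative_add has_derivative_frechet) auto
qed (auto intro: continuous_intros)

lemma Ck_linear:
  assumes L: "bounded_linear L"
  shows "Ck n f \<Longrightarrow> Ck n (\<lambda>x. L (f x))"
proof (induction n arbitrary: f)
  case (Suc n)
  then show ?case
    by (intro Ck_SucI[where f'="\<lambda>x t. L (frechet_derivative f (at x) t)"]
        bounded_linear.has_derivative[OF L] has_derivative_frechet) auto
qed (auto intro: bounded_linear.continuous_on[OF L])

lemma Ck_translate: "Ck n f \<Longrightarrow> Ck n (\<lambda>x. f (x + c))"
proof (induction n arbitrary: f)
  case 0
  then show ?case by (auto intro!: continuous_on_compose2[of UNIV f] continuous_intros)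
next
  case (Suc n)
  show ?case
  proof (rule Ck_SucI)
    fix x
    have "((\<lambda>x. x + c) has_derivative (\<lambda>t. t)) (at x)" by (auto intro!: derivative_eq_intros)
    from has_derivative_compose[OF this has_derivative_frechet]
    show "((\<lambda>x. f (x + c)) has_derivative frechet_derivative f (at (x + c))) (at x)"
      using Suc.prems by auto
  qed (use Suc in auto)
qed

lemma smooth_add: "smooth f \<Longrightarrow> smooth g \<Longrightarrow> smooth (\<lambda>x. f x + g x)"
  and smooth_linear: "bounded_linear L \<Longrightarrow> smooth f \<Longrightarrow> smooth (\<lambda>x. L (f x))"
  and smooth_translate: "smooth f \<Longrightarrow> smooth (\<lambda>x. f (x + c))"
  by (auto simp: smooth_def intro: Ck_add Ck_linear Ck_translate)

lemma smooth_has_derivative: "smooth f \<Longrightarrow> (f has_derivative frechet_derivative f (at x)) (at x)"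
  using Ck.simps(2)[of 0 f] unfolding smooth_def by (blast intro: has_derivative_frechet)

lemma smooth_continuous: "smooth f \<Longrightarrow> continuous_on A f"
  using Ck.simps(1)[of f] unfolding smooth_def by (blast intro: continuous_on_subset)

lemma smooth_partial: "smooth f \<Longrightarrow> e \<in> Basis \<Longrightarrow> smooth (partial e f)"
  unfolding smooth_def partial_def using Ck.simps(2) by blast

lemma smooth_line:
  assumes "smooth f"
  shows "((\<lambda>t. f (p + t *\<^sub>R e)) has_vector_derivative partial e f (p + t *\<^sub>R e)) (at t)"
proof -
  have "((\<lambda>t. p + t *\<^sub>R e) has_derivative (\<lambda>s. s *\<^sub>R e)) (at t)"
    by (auto intro!: derivative_eq_intros)
  from has_derivative_compose[OF this smooth_has_derivative[OF assms]]
  have "((\<lambda>t. f (p + t *\<^sub>R e)) has_derivative (\<lambda>s. frechet_derivative f (at (p + t *\<^sub>R e)) (s *\<^sub>R e))) (at t)" .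
  moreover have "frechet_derivative f (at (p + t *\<^sub>R e)) (s *\<^sub>R e) = s *\<^sub>R partial e f (p + t *\<^sub>R e)" for s
    unfolding partial_def
    by (rule linear_scale[OF linear_frechet_derivative]) (use smooth_has_derivative[OF assms] in \<open>auto simp: differentiable_def\<close>)
  ultimately show ?thesis by (simp add: has_vector_derivative_def)
qed

lemma smooth_bounded:
  fixes f :: "'a::euclidean_space \<Rightarrow> 'b::real_normed_vector"
  assumes "smooth f" "bounded A"
  obtains K where "\<And>p. p \<in> A \<Longrightarrow> norm (f p) \<le> K"
proof -
  have "compact (closure A)" using assms by simp
  then have "bounded (f ` closure A)"
    by (intro compact_imp_bounded compact_continuous_image smooth_continuous assms)
  then obtain K where "\<And>p. p \<in> closure A \<Longrightarrow> norm (f p) \<le> K" by (auto simp: bounded_iff)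
  then show thesis using that closure_subset by blast
qed

lemma bounded_cell: "bounded (cell h)"
proof -
  have "cell h \<subseteq> cbox (0, 0, -h) (1, 1, 0)"
    by (auto simp: cell_def mem_box Basis_prod_def)
  then show ?thesis using bounded_cbox bounded_subset by blast
qed

lemma smooth_measurable: "smooth f \<Longrightarrow> f \<in> borel_measurable (Om h)"
  by (intro borel_measurable_Om borel_measurable_continuous_onI smooth_continuous)

abbreviation "ex \<equiv> (1, 0, 0) :: point"
abbreviation "ey \<equiv> (0, 1, 0) :: point"
abbreviation "ez \<equiv> (0, 0, 1) :: point"

lemma Basis_point: "(Basis :: point set) = {ex, ey, ez}"
  by (auto simp: Basis_prod_def zero_prod_def)

text \<open>Periodicity is given on the slab only. The slab is open, so near each of its points the
  translated function coincides with the original one and has the same derivative.\<close>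

lemma hperiodic_partial:
  assumes f: "smooth f" "hperiodic h f" shows "hperiodic h (partial e f)"
proof -
  have *: "partial e f (p + d) = partial e f p"
    if d: "\<And>q. snd (snd q) \<in> {-h<..<0} \<Longrightarrow> f (q + d) = f q" and p: "snd (snd p) \<in> {-h<..<0}" for p d
  proof -
    have "((\<lambda>q. q + d) has_derivative (\<lambda>t. t)) (at p)" by (auto intro!: derivative_eq_intros)
    from has_derivative_compose[OF this smooth_has_derivative[OF f(1)]]
    have "((\<lambda>q. f (q + d)) has_derivative frechet_derivative f (at (p + d))) (at p)" .
    then have "(f has_derivative frechet_derivative f (at (p + d))) (at p)"
    proof (rule has_derivative_transform_within_open)
      show "open ((\<lambda>q::point. snd (snd q)) -` {-h<..<0})"
        by (intro open_vimage continuous_intros)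
    qed (use d p in auto)
    then have "frechet_derivative f (at (p + d)) = frechet_derivative f (at p)"
      by (rule frechet_derivative_at)
    then show ?thesis by (simp add: partial_def)
  qed
  show ?thesis
    unfolding hperiodic_def
    using *[of ex] *[of ey] f(2)[unfolded hperiodic_def] by (auto simp: add.commute)
qed

lemma test_function_partial:
  assumes \<phi>: "test_function h \<phi>" and e: "e \<in> Basis" shows "test_function h (partial e \<phi>)"
proof -
  obtain a b where ab: "-h < a" "a < b" "b < 0" and 0: "\<And>x y z. z \<notin> {a..b} \<Longrightarrow> \<phi> (x, y, z) = 0"
    using \<phi> by (auto simp: test_function_def)
  have "partial e \<phi> (x, y, z) = 0" if z: "z \<notin> {a..b}" for x y z
  proof -
    have "((\<lambda>q. 0) has_derivative (\<lambda>t. 0 :: real)) (at (x, y, z))" by simp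
    then have "(\<phi> has_derivative (\<lambda>t. 0)) (at (x, y, z))"
    proof (rule has_derivative_transform_within_open)
      show "open ((\<lambda>q::point. snd (snd q)) -` (- {a..b}))"
        by (intro open_vimage continuous_intros)
    qed (use 0 z in auto)
    from frechet_derivative_at[OF this] show ?thesis unfolding partial_def by metis
  qed
  then show ?thesis
    using \<phi> e ab smooth_partial hperiodic_partial unfolding test_function_def by blast
qed

lemma test_function_partials:
  assumes "test_function h \<phi>" shows "test_function h (partials \<alpha> \<phi>)"
proof -
  have *: "test_function h \<psi> \<Longrightarrow> test_function h ((partial e ^^ n) \<psi>)" if "e \<in> Basis" for e n \<psi>
    by (induction n) (auto intro: test_function_partial that)
  show ?thesis
    by (cases \<alpha>) (auto simp: Basis_point intro!: * assms)
qed

lemma tpr_has_derivative: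
  assumes "sm1 a" "sm1 b" "sm1 c"
  shows "(tpr a b c has_derivative (\<lambda>t. fst t *\<^sub>R tpr (deriv a) b c p + fst (snd t) *\<^sub>R tpr a (deriv b) c p
     + snd (snd t) *\<^sub>R tpr a b (deriv c) p)) (at p)"
proof -
  have d: "((\<lambda>q. f (g q)) has_derivative (\<lambda>t. deriv f (g p) * g t)) (at p)"
    if "sm1 f" "bounded_linear g" for f :: "real \<Rightarrow> real" and g :: "point \<Rightarrow> real"
    using has_derivative_compose[OF bounded_linear.has_derivative[OF that(2) has_derivative_ident]
        sm1_has_deriv[OF that(1), unfolded has_field_derivative_def]] by simp
  note d1 = d[OF assms(1) bounded_linear_fst]
  note d2 = d[OF assms(2), of "\<lambda>p. fst (snd p)"]
  note d3 = d[OF assms(3), of "\<lambda>p. snd (snd p)"]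
  have "tpr a b c = (\<lambda>q. a (fst q) * b (fst (snd q)) * c (snd (snd q)))"
    by (auto simp: tpr_def split_beta')
  moreover have "((\<lambda>q. a (fst q) * b (fst (snd q)) * c (snd (snd q))) has_derivative
     (\<lambda>t. fst t *\<^sub>R tpr (deriv a) b c p + fst (snd t) *\<^sub>R tpr a (deriv b) c p
     + snd (snd t) *\<^sub>R tpr a b (deriv c) p)) (at p)"
    by (rule has_derivative_eq_rhs[OF has_derivative_mult[OF has_derivative_mult[OF d1 d2] d3]])
       (auto simp: tpr_def split_beta' algebra_simps intro!: bounded_linear_intros)
  ultimately show ?thesis by simp
qed

lemma partial_tpr:
  assumes "sm1 a" "sm1 b" "sm1 c"
  shows "partial ex (tpr a b c) = tpr (deriv a) b c" "partial ey (tpr a b c) = tpr a (deriv b) c"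
    "partial ez (tpr a b c) = tpr a b (deriv c)"
  using frechet_derivative_at[OF tpr_has_derivative[OF assms], symmetric] by (auto simp: partial_def)

lemma Ck_tpr: "sm1 a \<Longrightarrow> sm1 b \<Longrightarrow> sm1 c \<Longrightarrow> Ck n (tpr a b c)"
proof (induction n arbitrary: a b c)
  case 0
  then show ?case
    using has_derivative_continuous[OF tpr_has_derivative[OF 0]] by (simp add: continuous_at_imp_continuous_on)
next
  case (Suc n)
  show ?case
    by (rule Ck_SucI[OF tpr_has_derivative[OF Suc.prems]]) (auto simp: Basis_point intro!: Suc.IH Suc.prems sm1_deriv)
qed

lemma per1_deriv: "per1 a \<Longrightarrow> per1 (deriv a)"
proof -
  assume a: "per1 a"
  then have "((\<lambda>x. a (x + 1)) has_real_derivative deriv a (x + 1)) (at x)" for x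
    using DERIV_shift[of a "deriv a (x + 1)" x 1] sm1_has_deriv[of a "x + 1"] by (simp add: per1_def add.commute)
  moreover have "(\<lambda>x. a (x + 1)) = a" using a by (auto simp: per1_def)
  ultimately have "(a has_real_derivative deriv a (x + 1)) (at x)" for x by simp
  then have "deriv a x = deriv a (x + 1)" for x by (rule DERIV_imp_deriv)
  then show ?thesis using a by (simp add: per1_def sm1_deriv)
qed

lemma cpt_deriv: "cpt h c \<Longrightarrow> cpt h (deriv c)"
proof -
  assume c: "cpt h c"
  then obtain p q where *: "-h < p" "p < q" "q < 0" "\<And>z. z \<notin> {p..q} \<Longrightarrow> c z = 0" by (auto simp: cpt_def)
  have "deriv c z = 0" if "z \<notin> {p..q}" for z
  proof (rule DERIV_imp_deriv, rule has_field_derivative_transform_within_open)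
    show "((\<lambda>z. 0) has_real_derivative 0) (at z)" by simp
    show "open (- {p..q})" by auto
  qed (use * that in auto)
  then show ?thesis using c * by (intro cptI[of _ _ p q]) (auto simp: cpt_def intro: sm1_deriv)
qed

lemma tpr_test:
  assumes "per1 a" "per1 b" "cpt h c" shows "test_function h (tpr a b c)"
proof -
  have "smooth (tpr a b c)" using assms by (auto simp: smooth_def per1_def cpt_def intro: Ck_tpr)
  moreover have "hperiodic h (tpr a b c)" using assms by (auto simp: hperiodic_def tpr_def per1_def)
  ultimately show ?thesis
    using assms(3) unfolding test_function_def cpt_def tpr_def by fastforce
qed

lemma partials_tpr:
  assumes "sm1 a" "sm1 b" "sm1 c"
  shows "partials (i, j, k) (tpr a b c) = tpr ((deriv ^^ i) a) ((deriv ^^ j) b) ((deriv ^^ k) c)"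
proof -
  have z: "(partial ez ^^ k) (tpr a b c) = tpr a b ((deriv ^^ k) c)"
    by (induction k) (use assms in \<open>auto simp: partial_tpr sm1_deriv_funpow\<close>)
  have y: "(partial ey ^^ j) (tpr a b c') = tpr a ((deriv ^^ j) b) c'" if "sm1 c'" for c'
    by (induction j) (use assms that in \<open>auto simp: partial_tpr sm1_deriv_funpow\<close>)
  have x: "(partial ex ^^ i) (tpr a b' c') = tpr ((deriv ^^ i) a) b' c'" if "sm1 b'" "sm1 c'" for b' c'
    by (induction i) (use assms that in \<open>auto simp: partial_tpr sm1_deriv_funpow\<close>)
  show ?thesis using assms by (simp add: x y z sm1_deriv_funpow)
qed

subsection \<open>Square integrable functions\<close>

lemma L2_integrable:
  fixes f :: "point \<Rightarrow> 'b::euclidean_space"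
  assumes "f \<in> L2 h" shows "integrable (Om h) f"
proof -
  interpret finite_measure "Om h" by (rule finite_measure_Om)
  have f: "f \<in> borel_measurable (Om h)" "integrable (Om h) (\<lambda>p. (norm (f p))\<^sup>2)" using assms by (auto simp: L2_iff)
  show ?thesis
  proof (rule Bochner_Integration.integrable_bound)
    show "integrable (Om h) (\<lambda>p. 1 + (norm (f p))\<^sup>2)" using f by simp
    have "norm (f p) \<le> 1 + (norm (f p))\<^sup>2" for p
      using sum_squares_bound[of 1 "norm (f p)"] norm_ge_zero[of "f p"]
      by (simp del: norm_ge_zero)
    then show "AE p in Om h. norm (f p) \<le> norm (1 + (norm (f p))\<^sup>2)"
      by (auto intro!: AE_I2 simp: order_trans[OF _ abs_ge_self])
  qed (rule f)
qed

lemma L2_component: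
  fixes f :: field
  shows "f \<in> L2 h \<longleftrightarrow> (\<forall>i. (\<lambda>p. f p $ i) \<in> L2 h)"
proof
  assume f: "f \<in> L2 h"
  then have [measurable]: "f \<in> borel_measurable (Om h)" by (simp add: L2_iff)
  show "\<forall>i. (\<lambda>p. f p $ i) \<in> L2 h"
  proof
    fix i
    have m: "(\<lambda>p. f p $ i) \<in> borel_measurable (Om h)"
      by (rule borel_measurable_continuous_on[OF _ \<open>f \<in> borel_measurable (Om h)\<close>, of "\<lambda>v. v $ i"]) (intro continuous_intros)
    have "integrable (Om h) (\<lambda>p. (f p $ i)\<^sup>2)"
    proof (rule Bochner_Integration.integrable_bound)
      show "integrable (Om h) (\<lambda>p. (norm (f p))\<^sup>2)" using f by (simp add: L2_iff)
      show "AE p in Om h. norm ((f p $ i)\<^sup>2) \<le> norm ((norm (f p))\<^sup>2)"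
        by (auto intro!: AE_I2 simp: power2_le_iff_abs_le component_le_norm_cart)
    qed (use m in measurable)
    then show "(\<lambda>p. f p $ i) \<in> L2 h"
      using f m by (auto simp: L2_iff hperiodic_def)
  qed
next
  assume f: "\<forall>i. (\<lambda>p. f p $ i) \<in> L2 h"
  then have m: "\<And>i. (\<lambda>p. f p $ i) \<in> borel_measurable (Om h)" by (auto simp: L2_iff)
  have fm: "f \<in> borel_measurable (Om h)"
  proof (subst borel_measurable_euclidean_space, intro ballI)
    fix b :: "real^2" assume "b \<in> Basis"
    then obtain i where "b = axis i 1" by (auto simp: Basis_vec_def)
    then show "(\<lambda>x. f x \<bullet> b) \<in> borel_measurable (Om h)" using m[of i] by (simp add: inner_axis)
  qed
  have "(norm (f p))\<^sup>2 = (\<Sum>i\<in>UNIV. (f p $ i)\<^sup>2)" for p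
    by (simp add: norm_vec_def L2_set_def sum_nonneg)
  moreover have "integrable (Om h) (\<lambda>p. \<Sum>i\<in>UNIV. (f p $ i)\<^sup>2)"
    using f by (intro Bochner_Integration.integrable_sum) (auto simp: L2_iff)
  moreover have "hperiodic h f" using f by (auto simp: L2_iff hperiodic_def vec_eq_iff)
  ultimately show "f \<in> L2 h" using fm by (simp add: L2_iff)
qed

lemma norm_field: "(norm v)\<^sup>2 = (v $ 1)\<^sup>2 + (v $ 2)\<^sup>2" for v :: "real^2"
  by (simp add: norm_vec_def L2_set_def sum_nonneg sum_2)

lemma L2_norm_field:
  fixes f :: field assumes "f \<in> L2 h"
  shows "(L2_norm h f)\<^sup>2 = (L2_norm h (\<lambda>p. f p $ 1))\<^sup>2 + (L2_norm h (\<lambda>p. f p $ 2))\<^sup>2"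
proof -
  have "integrable (Om h) (\<lambda>p. (f p $ i)\<^sup>2)" for i
    using assms L2_component[of f h] by (auto simp: L2_iff)
  then show ?thesis by (simp add: L2_norm_eq norm_field)
qed

lemma L2_norm_nonneg: "0 \<le> L2_norm h f"
  by (simp add: L2_norm_eq)

lemma L2_norm_cong_AE:
  fixes f g :: "point \<Rightarrow> 'b::euclidean_space"
  assumes "f \<in> borel_measurable (Om h)" "g \<in> borel_measurable (Om h)" "AE p in Om h. f p = g p"
  shows "L2_norm h f = L2_norm h g"
  unfolding L2_norm_eq
  by (intro arg_cong[where f=sqrt] Bochner_Integration.integral_cong_AE) (use assms in \<open>auto elim: eventually_mono\<close>)

section \<open>Integration by parts on the domain, and weak derivatives as derivatives along
  lines\<close>

context slab
begin

lemma integrable_smooth_mult: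
  fixes f :: "point \<Rightarrow> 'b::euclidean_space"
  assumes f: "integrable (Om h) f" and \<psi>: "smooth (\<psi> :: point \<Rightarrow> real)"
  shows "integrable (Om h) (\<lambda>p. \<psi> p *\<^sub>R f p)"
proof -
  obtain K where K: "\<And>p. p \<in> cell h \<Longrightarrow> norm (\<psi> p) \<le> K" using smooth_bounded[OF \<psi> bounded_cell, of h] by blast
  show ?thesis
  proof (rule Bochner_Integration.integrable_bound)
  show "integrable (Om h) (\<lambda>p. K *\<^sub>R f p)" using f by simp
  show "(\<lambda>p. \<psi> p *\<^sub>R f p) \<in> borel_measurable (Om h)"
    using f smooth_measurable[OF \<psi>] by measurable
  show "AE p in Om h. norm (\<psi> p *\<^sub>R f p) \<le> norm (K *\<^sub>R f p)"
    by (rule AE_I2) (use K in \<open>auto intro!: mult_right_mono order_trans[OF _ abs_ge_self]\<close>)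
  qed
qed

lemma smooth_line_xyz:
  fixes \<psi> :: "point \<Rightarrow> real"
  assumes "smooth \<psi>"
  shows "((\<lambda>t. \<psi> (Jx (c, t))) has_real_derivative partial ex \<psi> (Jx (c, t))) (at t)"
    "((\<lambda>t. \<psi> (Jy (c, t))) has_real_derivative partial ey \<psi> (Jy (c, t))) (at t)"
    "((\<lambda>t. \<psi> (Jz (c, t))) has_real_derivative partial ez \<psi> (Jz (c, t))) (at t)"
    "continuous_on UNIV (\<lambda>t. \<psi> (Jx (c, t)))" "continuous_on UNIV (\<lambda>t. \<psi> (Jy (c, t)))"
    "continuous_on UNIV (\<lambda>t. \<psi> (Jz (c, t)))"
proof -
  show "((\<lambda>t. \<psi> (Jx (c, t))) has_real_derivative partial ex \<psi> (Jx (c, t))) (at t)"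
    using smooth_line[OF assms, of "(0, fst c, snd c)" ex t]
    by (simp add: zero_prod_def[symmetric] has_real_derivative_iff_has_vector_derivative Jx_def)
  show "((\<lambda>t. \<psi> (Jy (c, t))) has_real_derivative partial ey \<psi> (Jy (c, t))) (at t)"
    using smooth_line[OF assms, of "(fst c, 0, snd c)" ey t]
    by (simp add: has_real_derivative_iff_has_vector_derivative Jy_def)
  show "((\<lambda>t. \<psi> (Jz (c, t))) has_real_derivative partial ez \<psi> (Jz (c, t))) (at t)"
    using smooth_line[OF assms, of "(fst c, snd c, 0)" ez t]
    by (simp add: has_real_derivative_iff_has_vector_derivative Jz_def)
  have *: "continuous_on UNIV (\<lambda>t. \<psi> (f t))" if "continuous_on UNIV f" for f :: "real \<Rightarrow> point"
    by (rule continuous_on_compose2[OF smooth_continuous[OF assms, of UNIV] that]) simp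
  show "continuous_on UNIV (\<lambda>t. \<psi> (Jx (c, t)))" unfolding Jx_def by (intro * continuous_intros)
  show "continuous_on UNIV (\<lambda>t. \<psi> (Jy (c, t)))" unfolding Jy_def by (intro * continuous_intros)
  show "continuous_on UNIV (\<lambda>t. \<psi> (Jz (c, t)))" unfolding Jz_def by (intro * continuous_intros)
qed

lemma Basis_ex [simp]: "ex \<in> Basis" "ey \<in> Basis" "ez \<in> Basis"
  by (auto simp: Basis_point)

lemma smooth_bounds2:
  fixes \<psi> \<psi>' :: "point \<Rightarrow> real"
  assumes "smooth \<psi>" "smooth \<psi>'"
  obtains K where "\<And>p. p \<in> cell h \<Longrightarrow> \<bar>\<psi> p\<bar> \<le> K" "\<And>p. p \<in> cell h \<Longrightarrow> \<bar>\<psi>' p\<bar> \<le> K"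
proof -
  obtain K where K: "\<And>p. p \<in> cell h \<Longrightarrow> norm (\<psi> p) \<le> K" using smooth_bounded[OF assms(1) bounded_cell, of h] by blast
  obtain K' where K': "\<And>p. p \<in> cell h \<Longrightarrow> norm (\<psi>' p) \<le> K'" using smooth_bounded[OF assms(2) bounded_cell, of h] by blast
  show thesis using K K' that[of "max K K'"] by fastforce
qed

lemma by_parts_x:
  assumes wd: "dx.wd f g" and i: "integrable (Om h) f" "integrable (Om h) g" and \<psi>: "smooth \<psi>" "hperiodic h \<psi>"
  shows "(\<integral>p. partial ex \<psi> p * f p \<partial>Om h) = - (\<integral>p. \<psi> p * g p \<partial>Om h)"
proof -
  have s: "smooth (partial ex \<psi>)" using \<psi> by (intro smooth_partial) auto
  obtain K where K: "\<And>p. p \<in> cell h \<Longrightarrow> \<bar>\<psi> p\<bar> \<le> K" "\<And>p. p \<in> cell h \<Longrightarrow> \<bar>partial ex \<psi> p\<bar> \<le> K"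
    using smooth_bounds2[OF \<psi>(1) s] by blast
  show ?thesis
  proof (rule dx.wd_by_parts[OF wd i smooth_measurable[OF \<psi>(1)] smooth_measurable[OF s] K
        smooth_line_xyz(1)[OF \<psi>(1)] smooth_line_xyz(4)[OF s]])
    fix c assume "c \<in> space (XM \<Otimes>\<^sub>M ZM h)"
    then have "snd c \<in> {-h<..<0}" by (auto simp: space_pair_measure)
    then have "\<psi> (0 + 1, fst c, snd c) = \<psi> (0, fst c, snd c)" using \<psi>(2) unfolding hperiodic_def by blast
    then show "\<psi> (Jx (c, 0)) = \<psi> (Jx (c, 1))" by (simp add: Jx_def)
  qed (assumption | rule disjI1 TrueI)+
qed

lemma by_parts_y:
  assumes wd: "dy.wd f g" and i: "integrable (Om h) f" "integrable (Om h) g" and \<psi>: "smooth \<psi>" "hperiodic h \<psi>"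
  shows "(\<integral>p. partial ey \<psi> p * f p \<partial>Om h) = - (\<integral>p. \<psi> p * g p \<partial>Om h)"
proof -
  have s: "smooth (partial ey \<psi>)" using \<psi> by (intro smooth_partial) auto
  obtain K where K: "\<And>p. p \<in> cell h \<Longrightarrow> \<bar>\<psi> p\<bar> \<le> K" "\<And>p. p \<in> cell h \<Longrightarrow> \<bar>partial ey \<psi> p\<bar> \<le> K"
    using smooth_bounds2[OF \<psi>(1) s] by blast
  show ?thesis
  proof (rule dy.wd_by_parts[OF wd i smooth_measurable[OF \<psi>(1)] smooth_measurable[OF s] K
        smooth_line_xyz(2)[OF \<psi>(1)] smooth_line_xyz(5)[OF s]])
    fix c assume "c \<in> space (XM \<Otimes>\<^sub>M ZM h)"
    then have "snd c \<in> {-h<..<0}" by (auto simp: space_pair_measure)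
    then have "\<psi> (fst c, 0 + 1, snd c) = \<psi> (fst c, 0, snd c)" using \<psi>(2) unfolding hperiodic_def by blast
    then show "\<psi> (Jy (c, 0)) = \<psi> (Jy (c, 1))" by (simp add: Jy_def)
  qed (assumption | rule disjI1 TrueI)+
qed

lemma by_parts_z:
  assumes wd: "dz.wd f g" and i: "integrable (Om h) f" "integrable (Om h) g" and \<phi>: "test_function h \<psi>"
  shows "(\<integral>p. partial ez \<psi> p * f p \<partial>Om h) = - (\<integral>p. \<psi> p * g p \<partial>Om h)"
proof -
  have \<psi>: "smooth \<psi>" using \<phi> by (simp add: test_function_def)
  have s: "smooth (partial ez \<psi>)" using \<psi> by (intro smooth_partial) auto
  obtain K where K: "\<And>p. p \<in> cell h \<Longrightarrow> \<bar>\<psi> p\<bar> \<le> K" "\<And>p. p \<in> cell h \<Longrightarrow> \<bar>partial ez \<psi> p\<bar> \<le> K"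
    using smooth_bounds2[OF \<psi> s] by blast
  have 0: "\<psi> (x, y, -h) = 0" "\<psi> (x, y, 0) = 0" for x y
    using \<phi> unfolding test_function_def by force+
  show ?thesis
    by (rule dz.wd_by_parts[OF wd i smooth_measurable[OF \<psi>] smooth_measurable[OF s] K
        smooth_line_xyz(3)[OF \<psi>] smooth_line_xyz(6)[OF s]]) (auto simp: Jz_def 0)
qed

lemma weak_imp_wd_x:
  assumes "integrable (Om h) f" "integrable (Om h) g"
    and weak: "\<And>a b c. per1 a \<Longrightarrow> per1 b \<Longrightarrow> cpt h c \<Longrightarrow>
      (\<integral>p. tpr (deriv a) b c p * f p \<partial>Om h) = - (\<integral>p. tpr a b c p * g p \<partial>Om h)"
  shows "dx.wd f g"
proof (rule dx.weak_imp_wd[OF assms(1,2)])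
  fix \<beta> \<phi> assume "\<beta> \<in> BXZ" "\<phi> \<in> Collect per1"
  then obtain b c where "\<beta> = tensor b c" "per1 \<phi>" "per1 b" "cpt h c" by (auto simp: BXZ_def)
  then show "(\<integral>p. \<beta> (fst (Ix p)) * deriv \<phi> (snd (Ix p)) * f p \<partial>Om h) = - (\<integral>p. \<beta> (fst (Ix p)) * \<phi> (snd (Ix p)) * g p \<partial>Om h)"
    using weak[of \<phi> b c] by (simp add: tensor_def Ix_def tpr_def split_beta' ac_simps)
qed

lemma weak_imp_wd_y:
  assumes "integrable (Om h) f" "integrable (Om h) g"
    and weak: "\<And>a b c. per1 a \<Longrightarrow> per1 b \<Longrightarrow> cpt h c \<Longrightarrow>
      (\<integral>p. tpr a (deriv b) c p * f p \<partial>Om h) = - (\<integral>p. tpr a b c p * g p \<partial>Om h)"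
  shows "dy.wd f g"
proof (rule dy.weak_imp_wd[OF assms(1,2)])
  fix \<beta> \<phi> assume "\<beta> \<in> BXZ" "\<phi> \<in> Collect per1"
  then obtain b c where "\<beta> = tensor b c" "per1 \<phi>" "per1 b" "cpt h c" by (auto simp: BXZ_def)
  then show "(\<integral>p. \<beta> (fst (Iy p)) * deriv \<phi> (snd (Iy p)) * f p \<partial>Om h) = - (\<integral>p. \<beta> (fst (Iy p)) * \<phi> (snd (Iy p)) * g p \<partial>Om h)"
    using weak[of b \<phi> c] by (simp add: tensor_def Iy_def tpr_def split_beta' ac_simps)
qed

lemma weak_imp_wd_z:
  assumes "integrable (Om h) f" "integrable (Om h) g"
    and weak: "\<And>a b c. per1 a \<Longrightarrow> per1 b \<Longrightarrow> cpt h c \<Longrightarrow>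
      (\<integral>p. tpr a b (deriv c) p * f p \<partial>Om h) = - (\<integral>p. tpr a b c p * g p \<partial>Om h)"
  shows "dz.wd f g"
proof (rule dz.weak_imp_wd[OF assms(1,2)])
  fix \<beta> \<phi> assume "\<beta> \<in> BXX" "\<phi> \<in> Collect (cpt h)"
  then obtain a b where "\<beta> = tensor a b" "cpt h \<phi>" "per1 a" "per1 b" by (auto simp: BXX_def)
  then show "(\<integral>p. \<beta> (fst (Iz p)) * deriv \<phi> (snd (Iz p)) * f p \<partial>Om h) = - (\<integral>p. \<beta> (fst (Iz p)) * \<phi> (snd (Iz p)) * g p \<partial>Om h)"
    using weak[of a b \<phi>] by (simp add: tensor_def Iz_def tpr_def split_beta' ac_simps)
qed

subsection \<open>Higher weak derivatives\<close>

lemma integral_field_component: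
  fixes f :: field
  assumes "integrable (Om h) f" "smooth (\<psi> :: point \<Rightarrow> real)"
  shows "(\<integral>p. \<psi> p *\<^sub>R f p \<partial>Om h) $ i = (\<integral>p. \<psi> p * f p $ i \<partial>Om h)"
  using integral_bounded_linear[OF bounded_linear_vec_nth[of i] integrable_smooth_mult[OF assms]]
  by simp

lemma has_weak_deriv_iff:
  fixes f g :: field
  shows "has_weak_deriv h \<alpha> f g \<longleftrightarrow> f \<in> L2 h \<and> g \<in> L2 h \<and> (\<forall>\<phi> i. test_function h \<phi> \<longrightarrow>
     (\<integral>p. partials \<alpha> \<phi> p * f p $ i \<partial>Om h) = (-1) ^ mi_order \<alpha> * (\<integral>p. \<phi> p * g p $ i \<partial>Om h))"
proof -
  have "((LINT p:cell h|lborel. partials \<alpha> \<phi> p *\<^sub>R f p) = (-1) ^ mi_order \<alpha> *\<^sub>R (LINT p:cell h|lborel. \<phi> p *\<^sub>R g p))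
     \<longleftrightarrow> (\<forall>i. (\<integral>p. partials \<alpha> \<phi> p * f p $ i \<partial>Om h) = (-1) ^ mi_order \<alpha> * (\<integral>p. \<phi> p * g p $ i \<partial>Om h))"
    if "f \<in> L2 h" "g \<in> L2 h" "test_function h \<phi>" for \<phi>
  proof -
    have "smooth \<phi>" "smooth (partials \<alpha> \<phi>)"
      using that(3) test_function_partials[OF that(3)] by (auto simp: test_function_def)
    then show ?thesis
      unfolding set_integral_cell vec_eq_iff vector_scaleR_component real_scaleR_def
      using integral_field_component[OF L2_integrable[OF that(1)]] integral_field_component[OF L2_integrable[OF that(2)]]
      by simp
  qed
  then show ?thesis unfolding has_weak_deriv_def by blast
qed

lemma has_weak_deriv_0: "f \<in> L2 h \<Longrightarrow> has_weak_deriv h (0, 0, 0) f f"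
  by (simp add: has_weak_deriv_def)

lemma weak_deriv_unique:
  fixes f g g' :: field
  assumes "has_weak_deriv h \<alpha> f g" "has_weak_deriv h \<alpha> f g'"
  shows "AE p in Om h. g p = g' p"
proof -
  have g: "g \<in> L2 h" "g' \<in> L2 h" using assms by (auto simp: has_weak_deriv_def)
  have "AE p in Om h. g p $ i - g' p $ i = 0" for i
  proof (rule fundamental_lemma[OF h])
    have ig: "integrable (Om h) (\<lambda>p. g p $ i)" "integrable (Om h) (\<lambda>p. g' p $ i)"
      using g by (auto simp: L2_component intro: L2_integrable)
    then show "integrable (Om h) (\<lambda>p. g p $ i - g' p $ i)" by simp
    fix a b c assume abc: "per1 a" "per1 b" "cpt h c"
    then have t: "test_function h (tpr a b c)" by (rule tpr_test)
    then have s: "smooth (tpr a b c)" by (simp add: test_function_def)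
    have "(\<integral>p. tpr a b c p * g p $ i \<partial>Om h) = (\<integral>p. tpr a b c p * g' p $ i \<partial>Om h)"
    proof -
      have "(-1) ^ mi_order \<alpha> * (\<integral>p. tpr a b c p * g p $ i \<partial>Om h) = (-1) ^ mi_order \<alpha> * (\<integral>p. tpr a b c p * g' p $ i \<partial>Om h)"
        using assms[unfolded has_weak_deriv_iff, THEN conjunct2, THEN conjunct2, rule_format, OF t, of i]
        by simp
      then show ?thesis by simp
    qed
    then show "(\<integral>p. (g p $ i - g' p $ i) * tpr a b c p \<partial>Om h) = 0"
      using integrable_smooth_mult[OF ig(1) s] integrable_smooth_mult[OF ig(2) s]
      by (simp add: right_diff_distrib mult.commute[of _ "tpr a b c _"])
  qed
  then have "AE p in Om h. \<forall>i. g p $ i - g' p $ i = 0" by (simp add: AE_all_countable)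
  then show ?thesis by eventually_elim (simp add: vec_eq_iff)
qed

lemma weak_deriv:
  assumes "has_weak_deriv h \<alpha> f g" shows "has_weak_deriv h \<alpha> f (weak_deriv h \<alpha> f)"
  unfolding weak_deriv_def by (rule someI[of _ g]) (rule assms)

text \<open>By uniqueness the norm does not depend on which weak derivative the choice operator
  returns; \<open>Sobolev_norm\<close> can thus be bounded through derivatives that were constructed
  explicitly.\<close>

lemma L2_norm_weak_deriv:
  fixes f g :: field
  assumes "has_weak_deriv h \<alpha> f g" shows "L2_norm h (weak_deriv h \<alpha> f) = L2_norm h g"
  using weak_deriv_unique[OF weak_deriv[OF assms] assms] weak_deriv[OF assms] assms
  by (intro L2_norm_cong_AE) (auto simp: has_weak_deriv_def L2_iff)

lemma component_integrable:
  fixes f :: field shows "f \<in> L2 h \<Longrightarrow> integrable (Om h) (\<lambda>p. f p $ i)"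
  by (auto simp: L2_component intro: L2_integrable)

text \<open>In \<open>partials\<close> the vertical derivatives act first. An additional one
  therefore falls directly on the test function and can be moved by parts without interchanging
  partial derivatives. The same principle for \<open>y\<close> and \<open>x\<close> forces the later
  indices to be zero.\<close>

lemma has_weak_deriv_step_z:
  fixes f g g' :: field
  assumes "has_weak_deriv h (a, b, c) f g" "g' \<in> L2 h" "\<And>i. dz.wd (\<lambda>p. g p $ i) (\<lambda>p. g' p $ i)"
  shows "has_weak_deriv h (a, b, Suc c) f g'"
  unfolding has_weak_deriv_iff
proof (intro conjI allI impI)
  show "f \<in> L2 h" "g' \<in> L2 h" using assms by (auto simp: has_weak_deriv_def)
  have g: "g \<in> L2 h" using assms by (auto simp: has_weak_deriv_def)
  fix \<phi> i assume \<phi>: "test_function h \<phi>"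
  have "partials (a, b, Suc c) \<phi> = partials (a, b, c) (partial ez \<phi>)"
    by (simp add: funpow_swap1)
  then have "(\<integral>p. partials (a, b, Suc c) \<phi> p * f p $ i \<partial>Om h)
     = (-1) ^ mi_order (a, b, c) * (\<integral>p. partial ez \<phi> p * g p $ i \<partial>Om h)"
    using assms(1) test_function_partial[OF \<phi>, of ez] unfolding has_weak_deriv_iff by simp
  then show "(\<integral>p. partials (a, b, Suc c) \<phi> p * f p $ i \<partial>Om h) =
      (-1) ^ mi_order (a, b, Suc c) * (\<integral>p. \<phi> p * g' p $ i \<partial>Om h)"
    using by_parts_z[OF assms(3) component_integrable[OF g] component_integrable[OF assms(2)] \<phi>] by simp
qed

lemma has_weak_deriv_step_y:
  fixes f g g' :: field
  assumes "has_weak_deriv h (a, b, 0) f g" "g' \<in> L2 h" "\<And>i. dy.wd (\<lambda>p. g p $ i) (\<lambda>p. g' p $ i)"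
  shows "has_weak_deriv h (a, Suc b, 0) f g'"
  unfolding has_weak_deriv_iff
proof (intro conjI allI impI)
  show "f \<in> L2 h" "g' \<in> L2 h" using assms by (auto simp: has_weak_deriv_def)
  have g: "g \<in> L2 h" using assms by (auto simp: has_weak_deriv_def)
  fix \<phi> i assume \<phi>: "test_function h \<phi>"
  then have s: "smooth \<phi>" "hperiodic h \<phi>" by (auto simp: test_function_def)
  have "partials (a, Suc b, 0) \<phi> = partials (a, b, 0) (partial ey \<phi>)"
    by (simp add: funpow_swap1)
  then have "(\<integral>p. partials (a, Suc b, 0) \<phi> p * f p $ i \<partial>Om h)
     = (-1) ^ mi_order (a, b, 0) * (\<integral>p. partial ey \<phi> p * g p $ i \<partial>Om h)"
    using assms(1) test_function_partial[OF \<phi>, of ey] unfolding has_weak_deriv_iff by simp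
  then show "(\<integral>p. partials (a, Suc b, 0) \<phi> p * f p $ i \<partial>Om h) =
      (-1) ^ mi_order (a, Suc b, 0) * (\<integral>p. \<phi> p * g' p $ i \<partial>Om h)"
    using by_parts_y[OF assms(3) component_integrable[OF g] component_integrable[OF assms(2)] s] by simp
qed

lemma has_weak_deriv_step_x:
  fixes f g g' :: field
  assumes "has_weak_deriv h (a, 0, 0) f g" "g' \<in> L2 h" "\<And>i. dx.wd (\<lambda>p. g p $ i) (\<lambda>p. g' p $ i)"
  shows "has_weak_deriv h (Suc a, 0, 0) f g'"
  unfolding has_weak_deriv_iff
proof (intro conjI allI impI)
  show "f \<in> L2 h" "g' \<in> L2 h" using assms by (auto simp: has_weak_deriv_def)
  have g: "g \<in> L2 h" using assms by (auto simp: has_weak_deriv_def)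
  fix \<phi> i assume \<phi>: "test_function h \<phi>"
  then have s: "smooth \<phi>" "hperiodic h \<phi>" by (auto simp: test_function_def)
  have "partials (Suc a, 0, 0) \<phi> = partials (a, 0, 0) (partial ex \<phi>)"
    by (simp add: funpow_swap1)
  then have "(\<integral>p. partials (Suc a, 0, 0) \<phi> p * f p $ i \<partial>Om h)
     = (-1) ^ mi_order (a, 0, 0) * (\<integral>p. partial ex \<phi> p * g p $ i \<partial>Om h)"
    using assms(1) test_function_partial[OF \<phi>, of ex] unfolding has_weak_deriv_iff by simp
  then show "(\<integral>p. partials (Suc a, 0, 0) \<phi> p * f p $ i \<partial>Om h) =
      (-1) ^ mi_order (Suc a, 0, 0) * (\<integral>p. \<phi> p * g' p $ i \<partial>Om h)"
    using by_parts_x[OF assms(3) component_integrable[OF g] component_integrable[OF assms(2)] s] by simp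
qed

text \<open>On product test functions the derivatives in different directions act on different
  factors and hence commute, so a weak derivative of higher order is a derivative of the one below
  it in each direction. Products are enough as test functions to conclude \<open>wd\<close>.\<close>

lemma wd_weak_deriv:
  fixes v g g' :: field
  assumes g: "has_weak_deriv h (a, b, c) v g"
  shows "has_weak_deriv h (Suc a, b, c) v g' \<Longrightarrow> dx.wd (\<lambda>p. g p $ i) (\<lambda>p. g' p $ i)"
    and "has_weak_deriv h (a, Suc b, c) v g' \<Longrightarrow> dy.wd (\<lambda>p. g p $ i) (\<lambda>p. g' p $ i)"
    and "has_weak_deriv h (a, b, Suc c) v g' \<Longrightarrow> dz.wd (\<lambda>p. g p $ i) (\<lambda>p. g' p $ i)"
proof -
  have *: "(\<integral>p. tpr q' r' s' p * g p $ i \<partial>Om h) = - (\<integral>p. tpr q r s p * g' p $ i \<partial>Om h)"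
    if g': "has_weak_deriv h \<alpha> v g'" "mi_order \<alpha> = Suc (a + b + c)"
      and t: "test_function h (tpr q' r' s')" "test_function h (tpr q r s)"
      and eq: "partials (a, b, c) (tpr q' r' s') = partials \<alpha> (tpr q r s)" for \<alpha> q r s q' r' s'
  proof -
    have "(\<integral>p. partials \<alpha> (tpr q r s) p * v p $ i \<partial>Om h) = (-1) ^ (a + b + c) * (\<integral>p. tpr q' r' s' p * g p $ i \<partial>Om h)"
      using g t(1) unfolding has_weak_deriv_iff eq[symmetric] by simp
    moreover have "(\<integral>p. partials \<alpha> (tpr q r s) p * v p $ i \<partial>Om h) = (-1) ^ Suc (a + b + c) * (\<integral>p. tpr q r s p * g' p $ i \<partial>Om h)"
      using g' t(2) unfolding has_weak_deriv_iff by simp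
    ultimately have "(-1) ^ (a + b + c) * (\<integral>p. tpr q' r' s' p * g p $ i \<partial>Om h)
       = (-1) ^ (a + b + c) * - (\<integral>p. tpr q r s p * g' p $ i \<partial>Om h)" by simp
    then show ?thesis by (subst (asm) mult_left_cancel) auto
  qed
  have gi: "integrable (Om h) (\<lambda>p. g p $ i)" using g by (auto simp: has_weak_deriv_def intro: component_integrable)
  note sm = per1_def cpt_def
  {
    assume g': "has_weak_deriv h (Suc a, b, c) v g'"
    show "dx.wd (\<lambda>p. g p $ i) (\<lambda>p. g' p $ i)"
    proof (rule weak_imp_wd_x[OF gi])
      show "integrable (Om h) (\<lambda>p. g' p $ i)" using g' by (auto simp: has_weak_deriv_def intro: component_integrable)
      fix q r s assume t: "per1 q" "per1 r" "cpt h s"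
      show "(\<integral>p. tpr (deriv q) r s p * g p $ i \<partial>Om h) = - (\<integral>p. tpr q r s p * g' p $ i \<partial>Om h)"
      proof (rule *[OF g'])
        show "partials (a, b, c) (tpr (deriv q) r s) = partials (Suc a, b, c) (tpr q r s)"
          using t by (subst (1 2) partials_tpr) (auto simp: sm sm1_deriv funpow_swap1)
      qed (use t in \<open>auto intro!: tpr_test per1_deriv\<close>)
    qed
  next
    assume g': "has_weak_deriv h (a, Suc b, c) v g'"
    show "dy.wd (\<lambda>p. g p $ i) (\<lambda>p. g' p $ i)"
    proof (rule weak_imp_wd_y[OF gi])
      show "integrable (Om h) (\<lambda>p. g' p $ i)" using g' by (auto simp: has_weak_deriv_def intro: component_integrable)
      fix q r s assume t: "per1 q" "per1 r" "cpt h s"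
      show "(\<integral>p. tpr q (deriv r) s p * g p $ i \<partial>Om h) = - (\<integral>p. tpr q r s p * g' p $ i \<partial>Om h)"
      proof (rule *[OF g'])
        show "partials (a, b, c) (tpr q (deriv r) s) = partials (a, Suc b, c) (tpr q r s)"
          using t by (subst (1 2) partials_tpr) (auto simp: sm sm1_deriv funpow_swap1)
      qed (use t in \<open>auto intro!: tpr_test per1_deriv\<close>)
    qed
  next
    assume g': "has_weak_deriv h (a, b, Suc c) v g'"
    show "dz.wd (\<lambda>p. g p $ i) (\<lambda>p. g' p $ i)"
    proof (rule weak_imp_wd_z[OF gi])
      show "integrable (Om h) (\<lambda>p. g' p $ i)" using g' by (auto simp: has_weak_deriv_def intro: component_integrable)
      fix q r s assume t: "per1 q" "per1 r" "cpt h s"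
      show "(\<integral>p. tpr q r (deriv s) p * g p $ i \<partial>Om h) = - (\<integral>p. tpr q r s p * g' p $ i \<partial>Om h)"
      proof (rule *[OF g'])
        show "partials (a, b, c) (tpr q r (deriv s)) = partials (a, b, Suc c) (tpr q r s)"
          using t by (subst (1 2) partials_tpr) (auto simp: sm sm1_deriv funpow_swap1)
      qed (use t in \<open>auto intro!: tpr_test cpt_deriv\<close>)
    qed
  }
qed

end

subsection \<open>The Hilbert space of square integrable functions\<close>

lemma L2_D:
  assumes "f \<in> L2 h"
  shows "hperiodic h f" "f \<in> borel_measurable (Om h)" "integrable (Om h) (\<lambda>p. (norm (f p))\<^sup>2)"
  using assms by (auto simp: L2_iff)

lemma L2_scale:
  fixes f :: "point \<Rightarrow> 'b::euclidean_space"
  shows "f \<in> L2 h \<Longrightarrow> (\<lambda>p. c *\<^sub>R f p) \<in> L2 h"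
  by (auto simp: L2_iff hperiodic_def power_mult_distrib)

lemma L2_add:
  fixes f g :: "point \<Rightarrow> 'b::euclidean_space"
  assumes "f \<in> L2 h" "g \<in> L2 h" shows "(\<lambda>p. f p + g p) \<in> L2 h"
proof -
  note f = L2_D[OF assms(1)] and g = L2_D[OF assms(2)]
  have "integrable (Om h) (\<lambda>p. (norm (f p + g p))\<^sup>2)"
  proof (rule Bochner_Integration.integrable_bound)
    show "integrable (Om h) (\<lambda>p. 2 * ((norm (f p))\<^sup>2 + (norm (g p))\<^sup>2))" using f g by simp
    show "(\<lambda>p. (norm (f p + g p))\<^sup>2) \<in> borel_measurable (Om h)" using f(2) g(2) by measurable
    have "(norm (f p + g p))\<^sup>2 \<le> 2 * ((norm (f p))\<^sup>2 + (norm (g p))\<^sup>2)" for p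
    proof -
      have "(norm (f p + g p))\<^sup>2 \<le> (norm (f p) + norm (g p))\<^sup>2"
        by (intro power_mono norm_triangle_ineq) auto
      also have "\<dots> \<le> 2 * ((norm (f p))\<^sup>2 + (norm (g p))\<^sup>2)"
        using sum_squares_bound[of "norm (f p)" "norm (g p)"] by (simp add: power2_sum)
      finally show ?thesis .
    qed
    then show "AE p in Om h. norm ((norm (f p + g p))\<^sup>2) \<le> norm (2 * ((norm (f p))\<^sup>2 + (norm (g p))\<^sup>2))"
      by (auto intro!: AE_I2)
  qed
  then show ?thesis using f g by (auto simp: L2_iff hperiodic_def)
qed

lemma L2_diff:
  fixes f g :: "point \<Rightarrow> 'b::euclidean_space"
  assumes "f \<in> L2 h" "g \<in> L2 h" shows "(\<lambda>p. f p - g p) \<in> L2 h"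
  using L2_add[OF assms(1) L2_scale[OF assms(2), of "-1"]] by simp

lemma L2_inner_integrable:
  fixes f g :: "point \<Rightarrow> 'b::euclidean_space"
  assumes "f \<in> L2 h" "g \<in> L2 h" shows "integrable (Om h) (\<lambda>p. f p \<bullet> g p)"
proof -
  have "f p \<bullet> g p = ((norm (f p + g p))\<^sup>2 - (norm (f p))\<^sup>2 - (norm (g p))\<^sup>2) / 2" for p
    by (simp add: power2_norm_eq_inner inner_add_left inner_add_right inner_commute)
  then have "(\<lambda>p. f p \<bullet> g p) = (\<lambda>p. ((norm (f p + g p))\<^sup>2 - (norm (f p))\<^sup>2 - (norm (g p))\<^sup>2) / 2)" by blast
  then show ?thesis using L2_D(3)[OF L2_add[OF assms]] L2_D(3)[OF assms(1)] L2_D(3)[OF assms(2)] by simp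
qed

lemma L2_inner_rules:
  fixes f g u :: "point \<Rightarrow> 'b::euclidean_space"
  assumes "f \<in> L2 h" "g \<in> L2 h" "u \<in> L2 h"
  shows "L2_inner h (\<lambda>p. f p + g p) u = L2_inner h f u + L2_inner h g u"
    "L2_inner h (\<lambda>p. f p - g p) u = L2_inner h f u - L2_inner h g u"
    "L2_inner h u (\<lambda>p. f p + g p) = L2_inner h u f + L2_inner h u g"
    "L2_inner h u (\<lambda>p. f p - g p) = L2_inner h u f - L2_inner h u g"
  using assms[THEN L2_inner_integrable, OF assms(1)] L2_inner_integrable[OF assms(1,3)] L2_inner_integrable[OF assms(2,3)]
    L2_inner_integrable[OF assms(3,1)] L2_inner_integrable[OF assms(3,2)]
  by (simp_all add: L2_inner_eq inner_add_left inner_add_right inner_diff_left inner_diff_right)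

lemma L2_inner_scale:
  fixes f u :: "point \<Rightarrow> 'b::euclidean_space"
  shows "L2_inner h (\<lambda>p. c *\<^sub>R f p) u = c * L2_inner h f u" "L2_inner h u (\<lambda>p. c *\<^sub>R f p) = c * L2_inner h u f"
  by (simp_all add: L2_inner_eq)

lemma L2_inner_commute: "L2_inner h f g = L2_inner h g f"
  by (simp add: L2_inner_eq inner_commute)

lemma L2_norm_square: "(L2_norm h f)\<^sup>2 = L2_inner h f f"
  by (simp add: L2_inner_eq L2_norm_eq power2_norm_eq_inner)

lemma quadratic_nonneg:
  fixes a b c :: real
  assumes "\<And>t. 0 \<le> a - 2 * t * b + t\<^sup>2 * c" "c \<ge> 0" shows "b\<^sup>2 \<le> a * c"
proof (cases "c = 0")
  case True
  have "b = 0"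
  proof (rule ccontr)
    assume "b \<noteq> 0"
    \<comment> \<open>At this \<open>t\<close> the expression equals \<open>-1\<close>.\<close>
    then show False using assms(1)[of "(a + 1) / (2 * b)"] True by simp
  qed
  then show ?thesis using True by simp
next
  case False
  then have "c > 0" using assms by simp
  have "0 \<le> (a - 2 * (b / c) * b + (b / c)\<^sup>2 * c) * c" using assms by (intro mult_nonneg_nonneg)
  also have "\<dots> = a * c - b\<^sup>2" using False by (simp add: field_simps power2_eq_square)
  finally show ?thesis by simp
qed

lemma L2_expand:
  fixes f g :: "point \<Rightarrow> 'b::euclidean_space"
  assumes "f \<in> L2 h" "g \<in> L2 h"
  shows "(L2_norm h (\<lambda>p. f p - t *\<^sub>R g p))\<^sup>2 = (L2_norm h f)\<^sup>2 - 2 * t * L2_inner h f g + t\<^sup>2 * (L2_norm h g)\<^sup>2"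
proof -
  note g = L2_scale[OF assms(2), of t]
  show ?thesis
    unfolding L2_norm_square L2_inner_rules(2)[OF assms(1) g L2_diff[OF assms(1) g]]
      L2_inner_rules(4)[OF assms(1) g assms(1)] L2_inner_rules(4)[OF assms(1) g g]
    unfolding L2_inner_scale L2_inner_rules(4)[OF assms(1) g assms(2)]
    by (simp add: L2_inner_commute[of h g f] power2_eq_square algebra_simps)
qed

lemma L2_Cauchy_Schwarz:
  fixes f g :: "point \<Rightarrow> 'b::euclidean_space"
  assumes "f \<in> L2 h" "g \<in> L2 h" shows "\<bar>L2_inner h f g\<bar> \<le> L2_norm h f * L2_norm h g"
proof -
  have "(L2_inner h f g)\<^sup>2 \<le> (L2_norm h f)\<^sup>2 * (L2_norm h g)\<^sup>2"
    by (rule quadratic_nonneg) (use L2_expand[OF assms] zero_le_power2 in \<open>metis\<close>, simp)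
  then have "\<bar>L2_inner h f g\<bar>\<^sup>2 \<le> (L2_norm h f * L2_norm h g)\<^sup>2"
    by (simp add: power_mult_distrib)
  then show ?thesis by (rule power2_le_imp_le) (simp add: L2_norm_nonneg)
qed

lemma L2_triangle:
  fixes f g :: "point \<Rightarrow> 'b::euclidean_space"
  assumes "f \<in> L2 h" "g \<in> L2 h" shows "L2_norm h (\<lambda>p. f p + g p) \<le> L2_norm h f + L2_norm h g"
proof (rule power2_le_imp_le)
  have "(L2_norm h (\<lambda>p. f p + g p))\<^sup>2 = (L2_norm h f)\<^sup>2 + 2 * L2_inner h f g + (L2_norm h g)\<^sup>2"
    using L2_expand[OF assms, of "-1"] by simp
  then show "(L2_norm h (\<lambda>p. f p + g p))\<^sup>2 \<le> (L2_norm h f + L2_norm h g)\<^sup>2"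
    using L2_Cauchy_Schwarz[OF assms] by (simp add: power2_sum)
qed (simp add: L2_norm_nonneg)

lemma L2_norm_minus_commute:
  fixes f g :: "point \<Rightarrow> 'b::euclidean_space"
  shows "L2_norm h (\<lambda>p. f p - g p) = L2_norm h (\<lambda>p. g p - f p)"
  by (simp add: L2_norm_eq norm_minus_commute)

lemma nn_integral_L2:
  fixes f :: "point \<Rightarrow> 'b::euclidean_space"
  assumes "f \<in> L2 h"
  shows "(\<integral>\<^sup>+p. ennreal ((norm (f p))\<^sup>2) \<partial>Om h) = ennreal ((L2_norm h f)\<^sup>2)"
  using L2_D(3)[OF assms] by (subst nn_integral_eq_integral) (auto simp: L2_norm_eq)

lemma ennreal_square_le_imp_le:
  assumes "x\<^sup>2 \<le> (ennreal c)\<^sup>2" "0 \<le> c" shows "x \<le> ennreal c"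
proof (cases x)
  case (real r)
  then have "ennreal (r\<^sup>2) \<le> ennreal (c\<^sup>2)" using assms by (simp add: ennreal_power)
  then have "r\<^sup>2 \<le> c\<^sup>2" by (simp add: ennreal_le_iff)
  then have "r \<le> c" by (rule power2_le_imp_le) fact
  then show ?thesis using real by (simp add: ennreal_leI)
next
  case top
  then show ?thesis using assms by (simp add: ennreal_power top_unique power_eq_top_ennreal)
qed

lemma L2_norm_L1:
  fixes f :: "point \<Rightarrow> 'b::euclidean_space"
  assumes "f \<in> L2 h"
  shows "(\<integral>\<^sup>+p. ennreal (norm (f p)) \<partial>Om h) \<le> ennreal (sqrt (measure (Om h) (cell h)) * L2_norm h f)"
proof -
  interpret finite_measure "Om h" by (rule finite_measure_Om)
  have [measurable]: "f \<in> borel_measurable (Om h)" using assms by (rule L2_D)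
  have "(\<integral>\<^sup>+p. ennreal (norm (f p)) * 1 \<partial>Om h)\<^sup>2 \<le> (\<integral>\<^sup>+p. (ennreal (norm (f p)))\<^sup>2 \<partial>Om h) * (\<integral>\<^sup>+p. 1\<^sup>2 \<partial>Om h)"
    by (rule Cauchy_Schwarz_nn_integral) auto
  also have "\<dots> = ennreal ((L2_norm h f)\<^sup>2) * ennreal (measure (Om h) (cell h))"
    using nn_integral_L2[OF assms] by (simp add: ennreal_power emeasure_eq_measure)
  also have "\<dots> = (ennreal (sqrt (measure (Om h) (cell h)) * L2_norm h f))\<^sup>2"
    by (simp add: ennreal_power ennreal_mult[symmetric] power_mult_distrib L2_norm_nonneg mult.commute)
  finally show ?thesis
    by (intro ennreal_square_le_imp_le) (auto simp: L2_norm_nonneg)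
qed

lemma L2_bounded:
  fixes f :: "point \<Rightarrow> 'b::euclidean_space"
  assumes "hperiodic h f" "f \<in> borel_measurable (Om h)" "\<And>p. p \<in> cell h \<Longrightarrow> norm (f p) \<le> K"
  shows "f \<in> L2 h"
proof -
  interpret finite_measure "Om h" by (rule finite_measure_Om)
  have "integrable (Om h) (\<lambda>p. (norm (f p))\<^sup>2)"
    by (rule integrable_const_bound[where B="K\<^sup>2"]) (use assms in \<open>auto intro!: power_mono\<close>)
  then show ?thesis using assms by (simp add: L2_iff)
qed

lemma smooth_L2:
  fixes f :: "point \<Rightarrow> 'b::euclidean_space"
  assumes "smooth f" "hperiodic h f" shows "f \<in> L2 h"
proof -
  obtain K where "\<And>p. p \<in> cell h \<Longrightarrow> norm (f p) \<le> K" using smooth_bounded[OF assms(1) bounded_cell, of h] by blast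
  then show ?thesis using assms by (intro L2_bounded[of h f K] smooth_measurable)
qed

text \<open>The representative in the period cell. Composition with it turns any function into a
  horizontally periodic one without changing it on the cell.\<close>

definition wrap :: "point \<Rightarrow> point" where
  "wrap p = (frac (fst p), frac (fst (snd p)), snd (snd p))"

lemma wrap_cell: "p \<in> cell h \<Longrightarrow> wrap p = p"
  by (auto simp: wrap_def cell_def frac_eq)

lemma hperiodic_wrap: "hperiodic h (\<lambda>p. f (wrap p))"
  by (simp add: hperiodic_def wrap_def frac_1_eq)

lemma tendsto_0_le_abs:
  fixes f g :: "nat \<Rightarrow> real"
  assumes "\<And>n. \<bar>f n\<bar> \<le> g n" "g \<longlonglongrightarrow> 0" shows "f \<longlonglongrightarrow> 0"
proof (rule Lim_null_comparison)
  show "\<forall>\<^sub>F n in sequentially. norm (f n) \<le> g n" using assms(1) by simp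
qed (rule assms(2))

lemma tendsto_0_le_nonneg:
  fixes f g :: "nat \<Rightarrow> real"
  assumes "\<And>n. 0 \<le> f n" "\<And>n. f n \<le> g n" "g \<longlonglongrightarrow> 0" shows "f \<longlonglongrightarrow> 0"
  by (rule tendsto_0_le_abs[OF _ assms(3)]) (use assms(1,2) in simp)

text \<open>Riesz and Fischer: with a geometric rate the series of differences converges absolutely
  almost everywhere, and Fatou's lemma carries the rate over to the limit. Sequences with a built-in
  rate suffice, because the minimising sequence for the projection can be chosen in this
  way.\<close>

lemma L2_complete:
  fixes f :: "nat \<Rightarrow> point \<Rightarrow> 'b::euclidean_space"
  assumes f: "\<And>n. f n \<in> L2 h" and K: "K \<ge> 0"
    and le: "\<And>n. L2_norm h (\<lambda>p. f (Suc n) p - f n p) \<le> K * (1/2) ^ n"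
  obtains g where "g \<in> L2 h" "(\<lambda>n. L2_norm h (\<lambda>p. f n p - g p)) \<longlonglongrightarrow> 0"
proof -
  define c where "c = sqrt (measure (Om h) (cell h))"
  have c: "c \<ge> 0" by (simp add: c_def)
  have [measurable]: "f n \<in> borel_measurable (Om h)" for n using f by (rule L2_D)
  have "(\<integral>\<^sup>+p. (\<Sum>n. ennreal (norm (f (Suc n) p - f n p))) \<partial>Om h) =
      (\<Sum>n. \<integral>\<^sup>+p. ennreal (norm (f (Suc n) p - f n p)) \<partial>Om h)"
    by (rule nn_integral_suminf) measurable
  also have "\<dots> \<le> (\<Sum>n. ennreal (c * (K * (1/2) ^ n)))"
  proof (rule suminf_le)
    fix n
    have "(\<integral>\<^sup>+p. ennreal (norm (f (Suc n) p - f n p)) \<partial>Om h) \<le> ennreal (c * L2_norm h (\<lambda>p. f (Suc n) p - f n p))"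
      unfolding c_def by (intro L2_norm_L1 L2_diff f)
    also have "\<dots> \<le> ennreal (c * (K * (1/2) ^ n))"
      by (intro ennreal_leI mult_left_mono le c)
    finally show "(\<integral>\<^sup>+p. ennreal (norm (f (Suc n) p - f n p)) \<partial>Om h) \<le> ennreal (c * (K * (1/2) ^ n))" .
  qed auto
  also have "\<dots> < \<infinity>"
  proof -
    have "summable (\<lambda>n. c * (K * (1/2) ^ n))" by (intro summable_mult summable_geometric) simp
    then show ?thesis using c K by (subst suminf_ennreal2) auto
  qed
  finally have "AE p in Om h. (\<Sum>n. ennreal (norm (f (Suc n) p - f n p))) \<noteq> \<infinity>"
    by (intro nn_integral_PInf_AE) (auto simp: less_top)
  then have conv: "AE p in Om h. convergent (\<lambda>n. f n p)"
  proof eventually_elim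
    case (elim p)
    then have "summable (\<lambda>n. norm (f (Suc n) p - f n p))"
      by (intro summable_suminf_not_top) auto
    then have "summable (\<lambda>n. f (Suc n) p - f n p)" by (rule summable_norm_cancel)
    then have "convergent (\<lambda>n. f 0 p + (\<Sum>k<n. f (Suc k) p - f k p))"
      by (intro convergent_add convergent_const) (simp add: summable_iff_convergent)
    moreover have "f 0 p + (\<Sum>k<n. f (Suc k) p - f k p) = f n p" for n
      using sum_lessThan_telescope[of "\<lambda>k. f k p" n] by simp
    ultimately show ?case by simp
  qed
  \<comment> \<open>Wrapping makes the limit periodic on the whole slab, also where the sequence
    diverges, as membership in \<open>L2\<close> demands.\<close>
  define g where "g p = lim (\<lambda>n. f n (wrap p))" for p
  have g_cell: "g p = lim (\<lambda>n. f n p)" if "p \<in> cell h" for p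
    using that by (simp add: g_def wrap_cell)
  have gm[measurable]: "g \<in> borel_measurable (Om h)"
    by (subst measurable_cong[of _ _ "\<lambda>p. lim (\<lambda>n. f n p)"]) (auto simp: g_cell)
  \<comment> \<open>The subtracted term is the remainder of the geometric series; with it the
    induction closes.\<close>
  have tail: "L2_norm h (\<lambda>p. f (n + m) p - f n p) \<le> 2 * K * (1/2) ^ n - 2 * K * (1/2) ^ (n + m)" for n m
  proof (induction m)
    case 0
    then show ?case by (simp add: L2_norm_eq)
  next
    case (Suc m)
    have "L2_norm h (\<lambda>p. f (n + Suc m) p - f n p) =
        L2_norm h (\<lambda>p. (f (Suc (n + m)) p - f (n + m) p) + (f (n + m) p - f n p))" by simp
    also have "\<dots> \<le> L2_norm h (\<lambda>p. f (Suc (n + m)) p - f (n + m) p) + L2_norm h (\<lambda>p. f (n + m) p - f n p)"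
      by (intro L2_triangle L2_diff f)
    also have "\<dots> \<le> K * (1/2) ^ (n + m) + (2 * K * (1/2) ^ n - 2 * K * (1/2) ^ (n + m))"
      by (intro add_mono le Suc)
    finally show ?case by simp
  qed
  have bound: "(\<integral>\<^sup>+p. ennreal ((norm (f n p - g p))\<^sup>2) \<partial>Om h) \<le> ennreal ((2 * K * (1/2) ^ n)\<^sup>2)" for n
  proof -
    have "(\<integral>\<^sup>+p. ennreal ((norm (f n p - g p))\<^sup>2) \<partial>Om h) =
      (\<integral>\<^sup>+p. liminf (\<lambda>m. ennreal ((norm (f (n + m) p - f n p))\<^sup>2)) \<partial>Om h)"
    proof (rule nn_integral_cong_AE)
      show "AE p in Om h. ennreal ((norm (f n p - g p))\<^sup>2) = liminf (\<lambda>m. ennreal ((norm (f (n + m) p - f n p))\<^sup>2))"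
        using conv AE_space
      proof eventually_elim
        case (elim p)
        then have "(\<lambda>m. f m p) \<longlonglongrightarrow> g p" by (simp add: g_cell convergent_LIMSEQ_iff)
        then have "(\<lambda>m. f (n + m) p) \<longlonglongrightarrow> g p" using LIMSEQ_ignore_initial_segment[of _ _ n] by (simp add: add.commute)
        then have "(\<lambda>m. ennreal ((norm (f (n + m) p - f n p))\<^sup>2)) \<longlonglongrightarrow> ennreal ((norm (g p - f n p))\<^sup>2)"
          by (intro tendsto_intros)
        from lim_imp_Liminf[OF _ this] show ?case by (simp add: norm_minus_commute[of "f n p" "g p"])
      qed
    qed
    also have "\<dots> \<le> liminf (\<lambda>m. \<integral>\<^sup>+p. ennreal ((norm (f (n + m) p - f n p))\<^sup>2) \<partial>Om h)"
      by (rule nn_integral_liminf) measurable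
    also have "\<dots> \<le> liminf (\<lambda>m. ennreal ((2 * K * (1/2) ^ n)\<^sup>2))"
    proof (rule Liminf_mono, rule always_eventually, rule allI)
      fix m
      have "L2_norm h (\<lambda>p. f (n + m) p - f n p) \<le> 2 * K * (1/2) ^ n"
        using tail[of n m] K by (smt (verit) mult_nonneg_nonneg zero_le_power zero_le_divide_1_iff)
      then have "(L2_norm h (\<lambda>p. f (n + m) p - f n p))\<^sup>2 \<le> (2 * K * (1/2) ^ n)\<^sup>2"
        by (intro power_mono) (auto simp: L2_norm_nonneg)
      then show "(\<integral>\<^sup>+p. ennreal ((norm (f (n + m) p - f n p))\<^sup>2) \<partial>Om h) \<le> ennreal ((2 * K * (1/2) ^ n)\<^sup>2)"
        by (subst nn_integral_L2[OF L2_diff[OF f f]]) (rule ennreal_leI)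
    qed
    also have "\<dots> = ennreal ((2 * K * (1/2) ^ n)\<^sup>2)" by (simp add: Liminf_const)
    finally show ?thesis .
  qed
  have hp: "hperiodic h (\<lambda>p. f 0 p - g p)"
    using L2_D(1)[OF f, of 0] hperiodic_wrap[of h "\<lambda>p. lim (\<lambda>n. f n p)"] by (simp add: hperiodic_def g_def)
  have "integrable (Om h) (\<lambda>p. (norm (f 0 p - g p))\<^sup>2)"
  proof (rule integrableI_bounded)
    have "(\<integral>\<^sup>+p. ennreal (norm ((norm (f 0 p - g p))\<^sup>2)) \<partial>Om h) = (\<integral>\<^sup>+p. ennreal ((norm (f 0 p - g p))\<^sup>2) \<partial>Om h)" by simp
    also have "\<dots> < \<infinity>" using bound[of 0] by (rule le_less_trans) simp
    finally show "(\<integral>\<^sup>+p. ennreal (norm ((norm (f 0 p - g p))\<^sup>2)) \<partial>Om h) < \<infinity>" .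
  qed measurable
  then have "(\<lambda>p. f 0 p - g p) \<in> L2 h" using hp by (simp add: L2_iff)
  from L2_diff[OF f[of 0] this] have g: "g \<in> L2 h" by simp
  have "L2_norm h (\<lambda>p. f n p - g p) \<le> 2 * K * (1/2) ^ n" for n
  proof (rule power2_le_imp_le)
    show "(L2_norm h (\<lambda>p. f n p - g p))\<^sup>2 \<le> (2 * K * (1/2) ^ n)\<^sup>2"
      using bound[of n] unfolding nn_integral_L2[OF L2_diff[OF f g]] by (simp add: ennreal_le_iff)
  qed (use K in auto)
  moreover have "(\<lambda>n. 2 * K * (1/2) ^ n) \<longlonglongrightarrow> 0"
    by (intro tendsto_mult_right_zero LIMSEQ_power_zero) simp
  ultimately have "(\<lambda>n. L2_norm h (\<lambda>p. f n p - g p)) \<longlonglongrightarrow> 0"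
    by (rule tendsto_0_le_nonneg[OF L2_norm_nonneg])
  with g show thesis by (rule that)
qed

subsection \<open>Solenoidal fields and the projection\<close>

context slab
begin

lemma vertical_average_eq:
  fixes v :: field
  assumes "smooth v"
  shows "vertical_average h v q = (1 / h) *\<^sub>R integral (cbox (-h) 0) (\<lambda>z. v (fst q, snd q, z))"
proof -
  have c: "continuous_on {-h..0} (\<lambda>z. v (fst q, snd q, z))"
    by (rule continuous_on_compose2[OF smooth_continuous[OF assms, of UNIV]]) (auto intro!: continuous_intros)
  then have "set_integrable lborel {-h..0} (\<lambda>z. v (fst q, snd q, z))"
    by (rule borel_integrable_atLeastAtMost')
  from interval_integral_eq_integral[OF _ this]
  have "(LINT z:{-h<..<0}|lborel. v (fst q, snd q, z)) = integral {-h..0} (\<lambda>z. v (fst q, snd q, z))"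
    using h by (simp add: interval_integral_Ioo)
  then show ?thesis by (simp add: vertical_average_def split_beta')
qed

text \<open>\<open>div2\<close> is built from Frechet derivatives, which are additive and compatible
  with translations only for differentiable functions. Differentiation under the integral provides
  this for averages of smooth fields.\<close>

lemma vertical_average_differentiable:
  fixes v :: field
  assumes "smooth v"
  shows "vertical_average h v differentiable (at q)"
proof -
  define fx where "fx q z = (blinfun_scaleR_left (partial ex v (fst q, snd q, z)) o\<^sub>L fst_blinfun)
    + (blinfun_scaleR_left (partial ey v (fst q, snd q, z)) o\<^sub>L snd_blinfun)" for q :: "real \<times> real" and z :: real
  have "((\<lambda>q. integral (cbox (-h) 0) ((\<lambda>q z. v (fst q, snd q, z)) q)) has_derivative
      integral (cbox (-h) 0) (fx q)) (at q within UNIV)"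
  proof (rule leibniz_rule)
    fix q :: "real \<times> real" and z :: real
    have "((\<lambda>q. (fst q, snd q, z)) has_derivative (\<lambda>t. (fst t, snd t, 0))) (at q)"
      by (auto intro!: derivative_eq_intros)
    from has_derivative_compose[OF this smooth_has_derivative[OF assms]]
    have d: "((\<lambda>q. v (fst q, snd q, z)) has_derivative
       (\<lambda>t. frechet_derivative v (at (fst q, snd q, z)) (fst t, snd t, 0))) (at q)" .
    have "linear (frechet_derivative v (at p))" for p
      by (intro linear_frechet_derivative differentiableI[OF smooth_has_derivative[OF assms]])
    then have "frechet_derivative v (at p) (s *\<^sub>R ex + t *\<^sub>R ey) = s *\<^sub>R partial ex v p + t *\<^sub>R partial ey v p" for p s t
      by (simp add: partial_def linear_add linear_scale del: scaleR_Pair add_Pair)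
    then have "(\<lambda>t. frechet_derivative v (at (fst q, snd q, z)) (fst t, snd t, 0)) = blinfun_apply (fx q z)"
      by (auto simp: fx_def blinfun.add_left)
    with d show "((\<lambda>q. v (fst q, snd q, z)) has_derivative blinfun_apply (fx q z)) (at q within UNIV)" by simp
  next
    fix q :: "real \<times> real"
    show "(\<lambda>z. v (fst q, snd q, z)) integrable_on cbox (-h) 0"
      by (rule integrable_continuous, rule continuous_on_compose2[OF smooth_continuous[OF assms, of UNIV]])
         (auto intro!: continuous_intros)
  next
    have "smooth (partial ex v)" "smooth (partial ey v)" using assms by (auto intro: smooth_partial)
    note c = this[THEN smooth_continuous, of UNIV]
    show "continuous_on (UNIV \<times> cbox (-h) 0) (\<lambda>(q, z). fx q z)"
      unfolding fx_def split_beta'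
      by (intro continuous_intros bounded_bilinear.continuous_on[OF bounded_bilinear_blinfun_compose]
          bounded_linear.continuous_on[OF bounded_linear_blinfun_scaleR_left]
          continuous_on_compose2[OF c(1)] continuous_on_compose2[OF c(2)]) auto
  qed auto
  then have "(\<lambda>q. integral (cbox (-h) 0) (\<lambda>z. v (fst q, snd q, z))) differentiable (at q)"
    by (auto simp: differentiable_def)
  then have "(\<lambda>q. (1 / h) *\<^sub>R integral (cbox (-h) 0) (\<lambda>z. v (fst q, snd q, z))) differentiable (at q)"
    by (rule differentiable_scaleR[OF differentiable_const])
  moreover have "vertical_average h v = (\<lambda>q. (1 / h) *\<^sub>R integral (cbox (-h) 0) (\<lambda>z. v (fst q, snd q, z)))"
    by (intro ext vertical_average_eq assms)
  ultimately show ?thesis by simp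
qed

lemma smooth_solenoidal_comb:
  assumes u: "u \<in> smooth_solenoidal h" and v: "v \<in> smooth_solenoidal h"
  shows "(\<lambda>p. r *\<^sub>R u p + s *\<^sub>R v p) \<in> smooth_solenoidal h"
proof -
  have su: "smooth u" and sv: "smooth v" using u v by (auto simp: smooth_solenoidal_def)
  have s: "smooth (\<lambda>p. r *\<^sub>R u p + s *\<^sub>R v p)"
    by (intro smooth_add smooth_linear[OF bounded_linear_scaleR_right] su sv)
  moreover have "hperiodic h (\<lambda>p. r *\<^sub>R u p + s *\<^sub>R v p)"
    using u v by (simp add: smooth_solenoidal_def hperiodic_def)
  moreover have "div2 (vertical_average h (\<lambda>p. r *\<^sub>R u p + s *\<^sub>R v p)) q = 0" for q
  proof -
    have int: "(\<lambda>z. w (fst q, snd q, z)) integrable_on cbox (-h) 0" if "smooth w" for w :: field and q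
      by (rule integrable_continuous, rule continuous_on_compose2[OF smooth_continuous[OF that, of UNIV]])
         (auto intro!: continuous_intros)
    have eq: "vertical_average h (\<lambda>p. r *\<^sub>R u p + s *\<^sub>R v p) =
       (\<lambda>q. r *\<^sub>R vertical_average h u q + s *\<^sub>R vertical_average h v q)"
    proof
      fix q
      have "integral (cbox (-h) 0) (\<lambda>z. r *\<^sub>R u (fst q, snd q, z) + s *\<^sub>R v (fst q, snd q, z))
        = r *\<^sub>R integral (cbox (-h) 0) (\<lambda>z. u (fst q, snd q, z)) + s *\<^sub>R integral (cbox (-h) 0) (\<lambda>z. v (fst q, snd q, z))"
        using int[OF su, of q] int[OF sv, of q]
        by (subst Henstock_Kurzweil_Integration.integral_add) (auto intro: integrable_cmul)
      then show "vertical_average h (\<lambda>p. r *\<^sub>R u p + s *\<^sub>R v p) q = r *\<^sub>R vertical_average h u q + s *\<^sub>R vertical_average h v q"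
        by (simp add: vertical_average_eq s su sv scaleR_add_right)
    qed
    obtain U V where UV: "(vertical_average h u has_derivative U) (at q)" "(vertical_average h v has_derivative V) (at q)"
      using vertical_average_differentiable[OF su, of q] vertical_average_differentiable[OF sv, of q]
      by (auto simp: differentiable_def)
    have "((\<lambda>q. r *\<^sub>R vertical_average h u q + s *\<^sub>R vertical_average h v q) has_derivative (\<lambda>t. r *\<^sub>R U t + s *\<^sub>R V t)) (at q)"
      using UV by (auto intro!: derivative_eq_intros)
    note D = frechet_derivative_at[OF this] frechet_derivative_at[OF UV(1)] frechet_derivative_at[OF UV(2)]
    have "div2 (vertical_average h (\<lambda>p. r *\<^sub>R u p + s *\<^sub>R v p)) q = r * div2 (vertical_average h u) q + s * div2 (vertical_average h v) q"
      unfolding div2_def partial_def eq D[symmetric] by (simp add: algebra_simps)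
    moreover have "div2 (vertical_average h u) q = 0" "div2 (vertical_average h v) q = 0"
      using u v by (auto simp: smooth_solenoidal_def simp del: split_paired_All)
    ultimately show ?thesis by simp
  qed
  ultimately show ?thesis by (simp add: smooth_solenoidal_def)
qed

lemma smooth_solenoidal_L2: "u \<in> smooth_solenoidal h \<Longrightarrow> u \<in> L2 h"
  by (auto simp: smooth_solenoidal_def intro: smooth_L2)

lemma L2_sigma_L2: "u \<in> L2_sigma h \<Longrightarrow> u \<in> L2 h"
  by (simp add: L2_sigma_def)

lemma smooth_solenoidal_sigma: "u \<in> smooth_solenoidal h \<Longrightarrow> u \<in> L2_sigma h"
  using smooth_solenoidal_L2 by (auto simp: L2_sigma_def L2_norm_eq intro!: bexI[of _ u])

lemma L2_sigmaE:
  assumes "u \<in> L2_sigma h" "e > 0"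
  obtains v where "v \<in> smooth_solenoidal h" "L2_norm h (\<lambda>p. u p - v p) < e"
  using assms by (auto simp: L2_sigma_def)

lemma zero_solenoidal: "(\<lambda>p. 0) \<in> smooth_solenoidal h"
proof -
  have "smooth (\<lambda>p::point. 0 :: real^2)"
    unfolding smooth_def
  proof
    fix n show "Ck n (\<lambda>p::point. 0 :: real^2)" by (induction n) auto
  qed
  moreover have "vertical_average h (\<lambda>p. 0) = (\<lambda>q. 0)" by (auto simp: vertical_average_def set_lebesgue_integral_def)
  ultimately show ?thesis by (simp add: smooth_solenoidal_def hperiodic_def div2_def partial_def)
qed

text \<open>The distance to the smooth solenoidal fields is minimised. Choosing the squared distance
  of \<open>v n\<close> within \<open>4^-n\<close> of the infimum, the parallelogram law makes
  consecutive members close at a geometric rate, so that \<open>L2_complete\<close> yields a limit;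
  orthogonality is passed from smooth fields to their closure by Cauchy-Schwarz.\<close>

lemma projection_exists:
  assumes u: "u \<in> L2 h"
  shows "\<exists>p. p \<in> L2_sigma h \<and> (\<forall>\<phi>\<in>L2_sigma h. L2_inner h (\<lambda>x. u x - p x) \<phi> = 0)"
proof -
  define D where "D = (\<lambda>v. (L2_norm h (\<lambda>p. u p - v p))\<^sup>2) ` smooth_solenoidal h"
  define d where "d = Inf D"
  have D0: "D \<noteq> {}" "bdd_below D" using zero_solenoidal by (auto simp: D_def intro!: bdd_belowI[of _ 0])
  have dle: "d \<le> (L2_norm h (\<lambda>p. u p - v p))\<^sup>2" if "v \<in> smooth_solenoidal h" for v
    unfolding d_def using that D0 by (intro cInf_lower) (auto simp: D_def)
  have "\<exists>v\<in>smooth_solenoidal h. (L2_norm h (\<lambda>p. u p - v p))\<^sup>2 < d + ((1/2) ^ n)\<^sup>2" for n :: nat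
  proof -
    have "\<exists>x\<in>D. x < d + ((1/2) ^ n)\<^sup>2" using cInf_lessD[OF D0(1), of "d + ((1/2) ^ n)\<^sup>2"] by (auto simp: d_def)
    then show ?thesis by (auto simp: D_def)
  qed
  then have "\<forall>n. \<exists>v. v \<in> smooth_solenoidal h \<and> (L2_norm h (\<lambda>p. u p - v p))\<^sup>2 < d + ((1/2) ^ n)\<^sup>2"
    by blast
  from choice[OF this] obtain v where v: "\<And>n. v n \<in> smooth_solenoidal h"
      "\<And>n. (L2_norm h (\<lambda>p. u p - v n p))\<^sup>2 < d + ((1/2) ^ n)\<^sup>2"
    by blast
  have vL: "v n \<in> L2 h" for n by (rule smooth_solenoidal_L2[OF v(1)])
  have step: "L2_norm h (\<lambda>p. v (Suc n) p - v n p) \<le> 2 * (1/2) ^ n" for n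
  proof (rule power2_le_imp_le)
    let ?a = "\<lambda>p. u p - v n p" and ?b = "\<lambda>p. u p - v (Suc n) p"
    have a: "?a \<in> L2 h" and b: "?b \<in> L2 h" by (intro L2_diff u vL)+
    have "(L2_norm h (\<lambda>p. ?a p - 1 *\<^sub>R ?b p))\<^sup>2 + (L2_norm h (\<lambda>p. ?a p - (-1) *\<^sub>R ?b p))\<^sup>2
        = 2 * (L2_norm h ?a)\<^sup>2 + 2 * (L2_norm h ?b)\<^sup>2"
      unfolding L2_expand[OF a b] by simp
    moreover have "(\<lambda>p. ?a p - 1 *\<^sub>R ?b p) = (\<lambda>p. v (Suc n) p - v n p)" by simp
    \<comment> \<open>Half the sum of two residuals is the residual of the midpoint, which is again
      a smooth solenoidal field and hence has squared norm at least \<open>d\<close>.\<close>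
    moreover have "4 * d \<le> (L2_norm h (\<lambda>p. ?a p - (-1) *\<^sub>R ?b p))\<^sup>2"
    proof -
      have "d \<le> (L2_norm h (\<lambda>p. u p - ((1/2) *\<^sub>R v n p + (1/2) *\<^sub>R v (Suc n) p)))\<^sup>2"
        by (intro dle smooth_solenoidal_comb v)
      moreover have "(L2_norm h (\<lambda>p. ?a p - (-1) *\<^sub>R ?b p))\<^sup>2 =
          (L2_norm h (\<lambda>p. 2 *\<^sub>R (u p - ((1/2) *\<^sub>R v n p + (1/2) *\<^sub>R v (Suc n) p))))\<^sup>2"
        by (intro arg_cong[where f="\<lambda>f. (L2_norm h f)\<^sup>2"] ext) (simp add: algebra_simps scaleR_2)
      moreover have "\<dots> = 4 * (L2_norm h (\<lambda>p. u p - ((1/2) *\<^sub>R v n p + (1/2) *\<^sub>R v (Suc n) p)))\<^sup>2"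
        by (simp add: L2_norm_eq power_mult_distrib)
      ultimately show ?thesis by simp
    qed
    moreover have "((1/2) ^ Suc n)\<^sup>2 \<le> ((1/2) ^ n :: real)\<^sup>2" by (intro power_mono) auto
    moreover note v(2)[of n] v(2)[of "Suc n"]
    ultimately have "(L2_norm h (\<lambda>p. ?a p - 1 *\<^sub>R ?b p))\<^sup>2 \<le> 4 * ((1/2) ^ n)\<^sup>2"
      "(\<lambda>p. ?a p - 1 *\<^sub>R ?b p) = (\<lambda>p. v (Suc n) p - v n p)"
      by (simp_all only:)
    then have "(L2_norm h (\<lambda>p. v (Suc n) p - v n p))\<^sup>2 \<le> 4 * ((1/2) ^ n)\<^sup>2" by (simp only:)
    then show "(L2_norm h (\<lambda>p. v (Suc n) p - v n p))\<^sup>2 \<le> (2 * (1/2) ^ n)\<^sup>2"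
      by (simp add: power_mult_distrib)
  qed simp
  obtain p where p: "p \<in> L2 h" "(\<lambda>n. L2_norm h (\<lambda>x. v n x - p x)) \<longlonglongrightarrow> 0"
    using L2_complete[of v h 2, OF vL _ step] by auto
  have psig: "p \<in> L2_sigma h"
  proof -
    have "\<exists>w\<in>smooth_solenoidal h. L2_norm h (\<lambda>x. p x - w x) < e" if "e > 0" for e
    proof -
      have "\<forall>\<^sub>F n in sequentially. L2_norm h (\<lambda>x. v n x - p x) < e"
        using order_tendstoD(2)[OF p(2) that] .
      then obtain n where "L2_norm h (\<lambda>x. v n x - p x) < e" by (auto simp: eventually_sequentially)
      then show ?thesis using v(1)[of n] by (auto simp: L2_norm_minus_commute[of h p])
    qed
    then show ?thesis using p(1) by (simp add: L2_sigma_def)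
  qed
  have up: "(\<lambda>x. u x - p x) \<in> L2 h" by (intro L2_diff u p)
  have orth: "L2_inner h (\<lambda>x. u x - p x) w = 0" if w: "w \<in> smooth_solenoidal h" for w
  proof -
    note wL = smooth_solenoidal_L2[OF w]
    have lim: "(\<lambda>n. L2_inner h (\<lambda>x. u x - v n x) w) \<longlonglongrightarrow> L2_inner h (\<lambda>x. u x - p x) w"
    proof (rule Lim_transform)
      have "\<bar>L2_inner h (\<lambda>x. u x - p x) w - L2_inner h (\<lambda>x. u x - v n x) w\<bar> \<le> L2_norm h (\<lambda>x. v n x - p x) * L2_norm h w" for n
      proof -
        have "L2_inner h (\<lambda>x. u x - p x) w - L2_inner h (\<lambda>x. u x - v n x) w = L2_inner h (\<lambda>x. v n x - p x) w"
          using L2_inner_rules(2)[OF u p(1) wL] L2_inner_rules(2)[OF u vL[of n] wL] L2_inner_rules(2)[OF vL[of n] p(1) wL] by simp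
        then show ?thesis using L2_Cauchy_Schwarz[OF L2_diff[OF vL[of n] p(1)] wL] by simp
      qed
      moreover have "(\<lambda>n. L2_norm h (\<lambda>x. v n x - p x) * L2_norm h w) \<longlonglongrightarrow> 0"
        using tendsto_mult_left_zero[OF p(2)] .
      ultimately have "(\<lambda>n. L2_inner h (\<lambda>x. u x - p x) w - L2_inner h (\<lambda>x. u x - v n x) w) \<longlonglongrightarrow> 0"
        by (rule tendsto_0_le_abs)
      from tendsto_minus[OF this] show "(\<lambda>n. L2_inner h (\<lambda>x. u x - v n x) w - L2_inner h (\<lambda>x. u x - p x) w) \<longlonglongrightarrow> 0" by simp
    qed simp
    \<comment> \<open>Perturbing \<open>v n\<close> by \<open>t *\<^sub>R w\<close> cannot lower the
      squared distance below \<open>d\<close>, from which \<open>v n\<close> is less than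
      \<open>4^-n\<close> away. In the limit the quadratic in \<open>t\<close> has constant term
      zero, and \<open>quadratic_nonneg\<close> forces its linear coefficient to vanish.\<close>
    have "0 \<le> 0 - 2 * t * L2_inner h (\<lambda>x. u x - p x) w + t\<^sup>2 * (L2_norm h w)\<^sup>2" for t
    proof (rule tendsto_lowerbound)
      show "(\<lambda>n. ((1/2) ^ n)\<^sup>2 - 2 * t * L2_inner h (\<lambda>x. u x - v n x) w + t\<^sup>2 * (L2_norm h w)\<^sup>2) \<longlonglongrightarrow>
         0 - 2 * t * L2_inner h (\<lambda>x. u x - p x) w + t\<^sup>2 * (L2_norm h w)\<^sup>2"
      proof (intro tendsto_intros lim)
        have "(\<lambda>n. (1/4 :: real) ^ n) \<longlonglongrightarrow> 0" by (intro LIMSEQ_power_zero) simp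
        then show "(\<lambda>n. ((1/2 :: real) ^ n)\<^sup>2) \<longlonglongrightarrow> 0" by (simp add: power_mult[symmetric] mult.commute power_mult power2_eq_square power_mult_distrib[symmetric])
      qed
      show "\<forall>\<^sub>F n in sequentially. 0 \<le> ((1/2) ^ n)\<^sup>2 - 2 * t * L2_inner h (\<lambda>x. u x - v n x) w + t\<^sup>2 * (L2_norm h w)\<^sup>2"
      proof (rule always_eventually, rule allI)
        fix n
        have "d \<le> (L2_norm h (\<lambda>p. u p - (1 *\<^sub>R v n p + t *\<^sub>R w p)))\<^sup>2"
          by (intro dle smooth_solenoidal_comb v w)
        also have "(\<lambda>p. u p - (1 *\<^sub>R v n p + t *\<^sub>R w p)) = (\<lambda>p. (u p - v n p) - t *\<^sub>R w p)" by (auto simp: algebra_simps)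
        also have "(L2_norm h \<dots>)\<^sup>2 = (L2_norm h (\<lambda>p. u p - v n p))\<^sup>2 - 2 * t * L2_inner h (\<lambda>p. u p - v n p) w + t\<^sup>2 * (L2_norm h w)\<^sup>2"
          by (rule L2_expand[OF L2_diff[OF u vL] wL])
        finally show "0 \<le> ((1/2) ^ n)\<^sup>2 - 2 * t * L2_inner h (\<lambda>x. u x - v n x) w + t\<^sup>2 * (L2_norm h w)\<^sup>2"
          using v(2)[of n] by simp
      qed
    qed simp
    from quadratic_nonneg[OF this] show ?thesis by simp
  qed
  have "L2_inner h (\<lambda>x. u x - p x) \<phi> = 0" if \<phi>: "\<phi> \<in> L2_sigma h" for \<phi>
  proof (rule ccontr)
    note \<phi>L = L2_sigma_L2[OF \<phi>]
    define N where "N = L2_norm h (\<lambda>x. u x - p x)"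
    have N: "N \<ge> 0" by (simp add: N_def L2_norm_nonneg)
    define e where "e = \<bar>L2_inner h (\<lambda>x. u x - p x) \<phi>\<bar>"
    assume "L2_inner h (\<lambda>x. u x - p x) \<phi> \<noteq> 0"
    then have e: "e > 0" by (simp add: e_def)
    then obtain w where w: "w \<in> smooth_solenoidal h" "L2_norm h (\<lambda>x. \<phi> x - w x) < e / (N + 1)"
      using L2_sigmaE[OF \<phi>, of "e / (N + 1)"] N by auto
    note wL = smooth_solenoidal_L2[OF w(1)]
    have "e = \<bar>L2_inner h (\<lambda>x. u x - p x) (\<lambda>x. \<phi> x - w x)\<bar>"
      using L2_inner_rules(4)[OF \<phi>L wL up] orth[OF w(1)] by (simp add: e_def)
    also have "\<dots> \<le> N * L2_norm h (\<lambda>x. \<phi> x - w x)"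
      unfolding N_def by (rule L2_Cauchy_Schwarz[OF up L2_diff[OF \<phi>L wL]])
    also have "\<dots> \<le> N * (e / (N + 1))" using w(2) N by (intro mult_left_mono) auto
    also have "\<dots> < e" using e N by (simp add: field_simps)
    finally show False by simp
  qed
  then show ?thesis using psig by blast
qed

lemma helmholtz:
  assumes "u \<in> L2 h"
  shows "helmholtz_proj h u \<in> L2_sigma h" "helmholtz_proj h u \<in> L2 h"
    "\<And>\<phi>. \<phi> \<in> L2_sigma h \<Longrightarrow> L2_inner h u \<phi> = L2_inner h (helmholtz_proj h u) \<phi>"
proof -
  note * = someI_ex[OF projection_exists[OF assms], folded helmholtz_proj_def]
  show 1: "helmholtz_proj h u \<in> L2_sigma h" using * by blast
  then show 2: "helmholtz_proj h u \<in> L2 h" by (rule L2_sigma_L2)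
  show "L2_inner h u \<phi> = L2_inner h (helmholtz_proj h u) \<phi>" if "\<phi> \<in> L2_sigma h" for \<phi>
    using * that L2_inner_rules(2)[OF assms 2 L2_sigma_L2[OF that]] by simp
qed

lemma helmholtz_norm_le:
  assumes "u \<in> L2 h" shows "L2_norm h (helmholtz_proj h u) \<le> L2_norm h u"
proof -
  note p = helmholtz[OF assms]
  have "(L2_norm h (helmholtz_proj h u))\<^sup>2 = L2_inner h u (helmholtz_proj h u)"
    using p(3)[OF p(1)] by (simp add: L2_norm_square)
  also have "\<dots> \<le> L2_norm h u * L2_norm h (helmholtz_proj h u)"
    using L2_Cauchy_Schwarz[OF assms p(2)] by simp
  finally have *: "L2_norm h (helmholtz_proj h u) * L2_norm h (helmholtz_proj h u) \<le> L2_norm h u * L2_norm h (helmholtz_proj h u)"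
    by (simp add: power2_eq_square)
  show ?thesis
  proof (cases "L2_norm h (helmholtz_proj h u) = 0")
    case False
    then have "L2_norm h (helmholtz_proj h u) > 0" using L2_norm_nonneg[of h "helmholtz_proj h u"] by linarith
    then show ?thesis using * by simp
  qed (simp add: L2_norm_nonneg)
qed

end

subsection \<open>Horizontal shifts commute with the projection\<close>

lemma frac_measurable: "(\<lambda>x. frac (x + s)) \<in> measurable XM XM"
proof -
  have "(\<lambda>x::real. frac (x + s)) \<in> borel_measurable borel"
    unfolding frac_def
    by (intro borel_measurable_diff borel_measurable_add measurable_compose[OF _ borel_measurable_real_floor])
       simp_all
  then have "(\<lambda>x. frac (x + s)) \<in> borel_measurable XM" by (rule X.borel_measurable_T)
  then have "(\<lambda>x. frac (x + s)) \<in> measurable XM (restrict_space lborel {0..<1})"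
    by (intro measurable_restrict_space2) (auto simp: frac_ge_0 frac_lt_1)
  then show ?thesis unfolding XM_def[symmetric] .
qed

lemma nn_integral_XM:
  assumes "g \<in> borel_measurable XM"
  shows "(\<integral>\<^sup>+x. g x \<partial>XM) = (\<integral>\<^sup>+x. g x * indicator {0..<1} x \<partial>lborel)"
  unfolding XM_def by (rule nn_integral_restrict_space) auto

text \<open>A rotation of the circle cuts the unit interval at \<open>1 - frac s\<close> and
  translates the two pieces; translation invariance is applied to each.\<close>

lemma nn_integral_frac:
  assumes g: "g \<in> borel_measurable XM"
  shows "(\<integral>\<^sup>+x. g (frac (x + s)) \<partial>XM) = (\<integral>\<^sup>+x. g x \<partial>XM)"
proof -
  define r where "r = frac s"
  have r: "0 \<le> r" "r < 1" by (auto simp: r_def frac_lt_1)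
  define G where "G x = g x * indicator {0..<1} x" for x
  have G[measurable]: "G \<in> borel_measurable borel"
    using g unfolding G_def XM_def by (subst (asm) borel_measurable_restrict_space_iff_ennreal) auto
  have m: "(\<lambda>x. G (x + c) * indicator A (x + c)) \<in> borel_measurable lborel" if "A \<in> sets borel" for A c
      by (intro borel_measurable_times_ennreal measurable_compose[OF _ G] measurable_compose[OF _ borel_measurable_indicator[OF that]])
         simp_all
  have fr: "frac (x + s) = (if x < 1 - r then x + r else x + r - 1)" if "0 \<le> x" "x < 1" for x
  proof -
    have "frac (x + s) = frac (x + r)"
    proof -
      have "x + s = (x + r) + of_int \<lfloor>s\<rfloor>" by (simp add: r_def frac_def)
      then have "frac (x + s) = frac ((x + r) + of_int \<lfloor>s\<rfloor>)" by (simp only:)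
      then show ?thesis by (simp only: frac_add_of_int_right)
    qed
    also have "\<dots> = (if x < 1 - r then x + r else x + r - 1)"
    proof (cases "x < 1 - r")
      case True
      then show ?thesis using that r by (simp add: frac_eq)
    next
      case False
      have "frac (x + r) = frac ((x + r - 1) + of_int 1)" by simp
      also have "\<dots> = frac (x + r - 1)" by (simp only: frac_add_of_int_right)
      also have "\<dots> = x + r - 1" using False that r by (subst frac_eq) auto
      finally show ?thesis using False by simp
    qed
    finally show ?thesis .
  qed
  have "(\<integral>\<^sup>+x. g (frac (x + s)) \<partial>XM) = (\<integral>\<^sup>+x. g (frac (x + s)) * indicator {0..<1} x \<partial>lborel)"
    by (rule nn_integral_XM) (rule measurable_compose[OF frac_measurable g])
  also have "\<dots> = (\<integral>\<^sup>+x. G (x + r) * indicator {r..<1} (x + r) + G (x + r - 1) * indicator {0..<r} (x + r - 1) \<partial>lborel)"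
  proof (rule nn_integral_cong)
    fix x :: real
    show "g (frac (x + s)) * indicator {0..<1} x =
       G (x + r) * indicator {r..<1} (x + r) + G (x + r - 1) * indicator {0..<r} (x + r - 1)"
    proof (cases "0 \<le> x \<and> x < 1")
      case True
      then show ?thesis using fr[of x] r by (auto simp: G_def indicator_def)
    next
      case False
      then show ?thesis using r by (auto simp: G_def indicator_def)
    qed
  qed
  also have "\<dots> = (\<integral>\<^sup>+x. G (x + r) * indicator {r..<1} (x + r) \<partial>lborel) + (\<integral>\<^sup>+x. G (x + r - 1) * indicator {0..<r} (x + r - 1) \<partial>lborel)"
  proof (rule nn_integral_add)
    show "(\<lambda>x. G (x + r) * indicator {r..<1} (x + r)) \<in> borel_measurable lborel" by (rule m) simp
    show "(\<lambda>x. G (x + r - 1) * indicator {0..<r} (x + r - 1)) \<in> borel_measurable lborel"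
      using m[of "{0..<r}" "r - 1"] by (simp add: add_diff_eq)
  qed
  also have "(\<integral>\<^sup>+x. G (x + r) * indicator {r..<1} (x + r) \<partial>lborel) = (\<integral>\<^sup>+x. G x * indicator {r..<1} x \<partial>lborel)"
    by (subst nn_integral_real_affine[where c=1 and t=r, of "\<lambda>x. G x * indicator {r..<1} x"]) (auto simp: add.commute)
  also have "(\<integral>\<^sup>+x. G (x + r - 1) * indicator {0..<r} (x + r - 1) \<partial>lborel) = (\<integral>\<^sup>+x. G x * indicator {0..<r} x \<partial>lborel)"
    by (subst nn_integral_real_affine[where c=1 and t="r - 1", of "\<lambda>x. G x * indicator {0..<r} x"]) (auto simp: algebra_simps)
  also have "(\<integral>\<^sup>+x. G x * indicator {r..<1} x \<partial>lborel) + (\<integral>\<^sup>+x. G x * indicator {0..<r} x \<partial>lborel)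
     = (\<integral>\<^sup>+x. G x * indicator {r..<1} x + G x * indicator {0..<r} x \<partial>lborel)"
    by (rule nn_integral_add[symmetric]) (use m[of _ 0] in auto)
  also have "\<dots> = (\<integral>\<^sup>+x. g x * indicator {0..<1} x \<partial>lborel)"
    using r by (intro nn_integral_cong) (auto simp: G_def indicator_def)
  also have "\<dots> = (\<integral>\<^sup>+x. g x \<partial>XM)" by (rule nn_integral_XM[OF g, symmetric])
  finally show ?thesis .
qed

lemma hperiodic_int:
  assumes f: "hperiodic h f" and z: "z \<in> {-h<..<0}"
  shows "f (x + of_int n, y, z) = f (x, y, z)" "f (x, y + of_int n, z) = f (x, y, z)"
proof -
  have x: "f (x + 1, y, z) = f (x, y, z)" "f (x, y + 1, z) = f (x, y, z)" for x y
    using f z by (auto simp: hperiodic_def)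
  show "f (x + of_int n, y, z) = f (x, y, z)"
  proof (induction n rule: int_induct[where k=0])
    case (step1 i)
    then show ?case using x(1)[of "x + of_int i" y] by (simp add: add.assoc)
  next
    case (step2 i)
    then show ?case using x(1)[of "x + of_int i - 1" y] by (simp add: algebra_simps)
  qed simp
  show "f (x, y + of_int n, z) = f (x, y, z)"
  proof (induction n rule: int_induct[where k=0])
    case (step1 i)
    then show ?case using x(2)[of x "y + of_int i"] by (simp add: add.assoc)
  next
    case (step2 i)
    then show ?case using x(2)[of x "y + of_int i - 1"] by (simp add: algebra_simps)
  qed simp
qed

lemma hperiodic_eq_wrap:
  assumes f: "hperiodic h f" and z: "snd (snd p) \<in> {-h<..<0}"
  shows "f p = f (wrap p)"
proof -
  obtain x y z where p: "p = (x, y, z)" by (cases p) auto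
  have "f p = f (frac x + of_int \<lfloor>x\<rfloor>, frac y + of_int \<lfloor>y\<rfloor>, z)" by (simp add: p frac_def)
  also have "\<dots> = f (frac x, frac y, z)"
    using z by (simp add: p hperiodic_int[OF f])
  finally show ?thesis by (simp add: p wrap_def)
qed

definition shift :: "point \<Rightarrow> real \<Rightarrow> (point \<Rightarrow> 'b) \<Rightarrow> point \<Rightarrow> 'b" where
  "shift e s f = (\<lambda>p. f (p + s *\<^sub>R e))"

lemma partial_shift: "smooth f \<Longrightarrow> partial e' (shift e s f) = shift e s (partial e' f)"
proof
  fix p assume f: "smooth f"
  have "((\<lambda>p. p + s *\<^sub>R e) has_derivative (\<lambda>t. t)) (at p)" by (auto intro!: derivative_eq_intros)
  from has_derivative_compose[OF this smooth_has_derivative[OF f]]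
  have "((\<lambda>p. f (p + s *\<^sub>R e)) has_derivative frechet_derivative f (at (p + s *\<^sub>R e))) (at p)" .
  from frechet_derivative_at[OF this] show "partial e' (shift e s f) p = shift e s (partial e' f) p"
    by (simp add: partial_def shift_def)
qed

lemma shift_smooth: "smooth f \<Longrightarrow> smooth (shift e s f)"
  unfolding shift_def by (rule smooth_translate)

lemma partial_linear:
  assumes "bounded_linear L" "smooth f" shows "partial e (\<lambda>p. L (f p)) = (\<lambda>p. L (partial e f p))"
proof
  fix p
  from frechet_derivative_at[OF bounded_linear.has_derivative[OF assms(1) smooth_has_derivative[OF assms(2)]]]
  show "partial e (\<lambda>p. L (f p)) p = L (partial e f p)" unfolding partial_def by metis
qed

lemma smooth_component: "smooth (f :: field) \<Longrightarrow> smooth (\<lambda>p. f p $ i)"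
  by (rule smooth_linear[OF bounded_linear_vec_nth])

lemma inner_field: "u \<bullet> v = u $ 1 * v $ 1 + u $ 2 * v $ 2" for u v :: "real^2"
  by (simp add: inner_vec_def sum_2)

context slab
begin

lemma shift_hperiodic:
  assumes e: "e \<in> {ex, ey}" and "hperiodic h f" shows "hperiodic h (shift e s f)"
  unfolding hperiodic_def
proof (intro allI impI)
  fix x y z assume "z \<in> {-h<..<0}"
  then have *: "f (x + 1, y, z) = f (x, y, z)" "f (x, y + 1, z) = f (x, y, z)" for x y
    using assms(2) by (auto simp: hperiodic_def)
  show "shift e s f (x + 1, y, z) = shift e s f (x, y, z) \<and> shift e s f (x, y + 1, z) = shift e s f (x, y, z)"
    using e *[of "x + s" y] *[of x "y + s"] *[of x y] by (auto simp: shift_def algebra_simps *)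
qed

text \<open>The shift carried out modulo the lattice, so that the cell is mapped into itself and
  invariance can be expressed as a statement on \<open>Om h\<close>. For periodic functions it has
  the same effect as \<open>shift\<close>.\<close>

definition shp :: "point \<Rightarrow> real \<Rightarrow> point \<Rightarrow> point" where
  "shp e s p = wrap (p + s *\<^sub>R e)"

lemma shp_eq:
  assumes "p \<in> cell h"
  shows "shp ex s p = (frac (fst p + s), snd p)" "shp ey s p = (fst p, frac (fst (snd p) + s), snd (snd p))"
proof -
  have "frac (fst p) = fst p" "frac (fst (snd p)) = fst (snd p)"
    using assms by (auto simp: cell_def frac_eq)
  then show "shp ex s p = (frac (fst p + s), snd p)" "shp ey s p = (fst p, frac (fst (snd p) + s), snd (snd p))"
    by (auto simp: shp_def wrap_def prod_eq_iff)
qed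

lemma shp_measurable:
  assumes e: "e \<in> {ex, ey}" shows "shp e s \<in> measurable (Om h) (Om h)"
proof -
  note [measurable] = frac_measurable[of s]
  have "(\<lambda>p. (frac (fst p + s), snd p)) \<in> measurable (Om h) (Om h)"
    "(\<lambda>p. (fst p, frac (fst (snd p) + s), snd (snd p))) \<in> measurable (Om h) (Om h)"
    unfolding Om_def by measurable
  then show ?thesis using e
    by (auto intro: measurable_cong[THEN iffD2, rotated] simp: shp_eq)
qed

lemma shp_distr:
  assumes e: "e \<in> {ex, ey}" shows "distr (Om h) (Om h) (shp e s) = Om h"
proof (rule distr_eqI[OF shp_measurable[OF e]])
  fix f :: "point \<Rightarrow> ennreal" assume f: "f \<in> borel_measurable (Om h)"
  then have [measurable]: "f \<in> borel_measurable (XM \<Otimes>\<^sub>M XM \<Otimes>\<^sub>M ZM h)" by (simp add: Om_def)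
  note [measurable] = frac_measurable[of s]
  have m: "(\<lambda>p. f (frac (fst p + s), snd p)) \<in> borel_measurable (Om h)"
    "(\<lambda>p. f (fst p, frac (fst (snd p) + s), snd (snd p))) \<in> borel_measurable (Om h)"
    unfolding Om_def by measurable
  show "(\<integral>\<^sup>+p. f (shp e s p) \<partial>Om h) = (\<integral>\<^sup>+p. f p \<partial>Om h)"
  proof (cases "e = ex")
    case True
    have "(\<integral>\<^sup>+p. f (shp e s p) \<partial>Om h) = (\<integral>\<^sup>+p. f (frac (fst p + s), snd p) \<partial>Om h)"
      by (rule nn_integral_cong) (simp add: True shp_eq)
    also have "\<dots> = (\<integral>\<^sup>+x. \<integral>\<^sup>+y. \<integral>\<^sup>+z. f (frac (x + s), y, z) \<partial>ZM h \<partial>XM \<partial>XM)"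
      by (subst nn_integral_Om[OF m(1)]) simp
    also have "\<dots> = (\<integral>\<^sup>+x. \<integral>\<^sup>+y. \<integral>\<^sup>+z. f (x, y, z) \<partial>ZM h \<partial>XM \<partial>XM)"
      by (rule nn_integral_frac[of "\<lambda>x. \<integral>\<^sup>+y. \<integral>\<^sup>+z. f (x, y, z) \<partial>ZM h \<partial>XM"]) measurable
    finally show ?thesis by (simp add: nn_integral_Om[OF f])
  next
    case False
    then have ey: "e = ey" using e by auto
    have "(\<integral>\<^sup>+p. f (shp e s p) \<partial>Om h) = (\<integral>\<^sup>+p. f (fst p, frac (fst (snd p) + s), snd (snd p)) \<partial>Om h)"
      by (rule nn_integral_cong) (simp add: ey shp_eq)
    also have "\<dots> = (\<integral>\<^sup>+x. \<integral>\<^sup>+y. \<integral>\<^sup>+z. f (x, frac (y + s), z) \<partial>ZM h \<partial>XM \<partial>XM)"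
      by (subst nn_integral_Om[OF m(2)]) simp
    also have "\<dots> = (\<integral>\<^sup>+x. \<integral>\<^sup>+y. \<integral>\<^sup>+z. f (x, y, z) \<partial>ZM h \<partial>XM \<partial>XM)"
    proof (rule nn_integral_cong)
      fix x assume x: "x \<in> space XM"
      have fx: "f \<in> borel_measurable (XM \<Otimes>\<^sub>M XM \<Otimes>\<^sub>M ZM h)" by fact
      have "(\<lambda>q. f (x, q)) \<in> borel_measurable (XM \<Otimes>\<^sub>M ZM h)"
        by (rule measurable_compose[OF measurable_Pair1'[OF x] fx])
      from Z.borel_measurable_nn_integral_fst[OF this]
      have mx: "(\<lambda>y. \<integral>\<^sup>+z. f (x, y, z) \<partial>ZM h) \<in> borel_measurable XM" .
      show "(\<integral>\<^sup>+y. \<integral>\<^sup>+z. f (x, frac (y + s), z) \<partial>ZM h \<partial>XM) = (\<integral>\<^sup>+y. \<integral>\<^sup>+z. f (x, y, z) \<partial>ZM h \<partial>XM)"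
        by (rule nn_integral_frac[OF mx])
    qed
    finally show ?thesis by (simp add: nn_integral_Om[OF f])
  qed
qed

lemma shift_eq_shp:
  assumes "e \<in> {ex, ey}" "hperiodic h f" "p \<in> cell h"
  shows "shift e s f p = f (shp e s p)"
  unfolding shift_def shp_def using assms(1,3)
  by (intro hperiodic_eq_wrap[OF assms(2)]) (auto simp: cell_def)

lemma shift_L2_inner:
  fixes f g :: field
  assumes e: "e \<in> {ex, ey}" and f: "f \<in> L2 h" and g: "g \<in> L2 h"
  shows "shift e s f \<in> L2 h" "L2_inner h (shift e s f) (shift e s g) = L2_inner h f g"
proof -
  have fm: "f \<in> borel_measurable (Om h)" and gm: "g \<in> borel_measurable (Om h)" using f g by (auto simp: L2_iff)
  have hp: "hperiodic h f" "hperiodic h g" using f g by (auto simp: L2_iff)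
  have m: "shift e s f \<in> borel_measurable (Om h)"
    using measurable_compose[OF shp_measurable[OF e] fm]
    by (subst measurable_cong[of _ _ "\<lambda>p. f (shp e s p)"]) (auto simp: shift_eq_shp[OF e hp(1)])
  have "integrable (distr (Om h) (Om h) (shp e s)) (\<lambda>p. (norm (f p))\<^sup>2)"
    using L2_D(3)[OF f] by (simp add: shp_distr[OF e])
  then have "integrable (Om h) (\<lambda>p. (norm (f (shp e s p)))\<^sup>2)"
    by (subst (asm) integrable_distr_eq) (use fm shp_measurable[OF e] in auto)
  then have "integrable (Om h) (\<lambda>p. (norm (shift e s f p))\<^sup>2)"
    by (subst Bochner_Integration.integrable_cong[OF refl, of _ _ "\<lambda>p. (norm (f (shp e s p)))\<^sup>2"])
       (auto simp: shift_eq_shp[OF e hp(1)])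
  then show "shift e s f \<in> L2 h" using m shift_hperiodic[OF e hp(1)] by (simp add: L2_iff)
  have "L2_inner h (shift e s f) (shift e s g) = (\<integral>p. f (shp e s p) \<bullet> g (shp e s p) \<partial>Om h)"
    unfolding L2_inner_eq
    by (rule Bochner_Integration.integral_cong) (auto simp: shift_eq_shp[OF e] hp)
  also have "\<dots> = (\<integral>p. f p \<bullet> g p \<partial>distr (Om h) (Om h) (shp e s))"
    by (rule integral_distr[symmetric, OF shp_measurable[OF e]]) (use fm gm in measurable)
  finally show "L2_inner h (shift e s f) (shift e s g) = L2_inner h f g"
    by (simp add: shp_distr[OF e] L2_inner_eq)
qed

lemma shift_L2: "e \<in> {ex, ey} \<Longrightarrow> (f :: field) \<in> L2 h \<Longrightarrow> shift e s f \<in> L2 h"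
  by (rule shift_L2_inner(1))

lemma shift_shift: "shift e s (shift e t f) = shift e (s + t) f"
  by (simp add: shift_def algebra_simps)

lemma shift_0 [simp]: "shift e 0 f = f"
  by (simp add: shift_def)

lemma shift_adjoint:
  fixes f g :: field
  assumes e: "e \<in> {ex, ey}" and "f \<in> L2 h" "g \<in> L2 h"
  shows "L2_inner h (shift e s f) g = L2_inner h f (shift e (-s) g)"
  using shift_L2_inner(2)[OF e assms(2) shift_L2_inner(1)[OF e assms(3,3), of "-s"], of s]
  by (simp add: shift_shift)

lemma shift_L2_norm:
  fixes f :: field
  assumes e: "e \<in> {ex, ey}" and "f \<in> L2 h"
  shows "L2_norm h (shift e s f) = L2_norm h f"
  using shift_L2_inner(2)[OF e assms(2,2), of s] L2_norm_nonneg[of h f] L2_norm_nonneg[of h "shift e s f"]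
  by (metis L2_norm_square power2_eq_iff_nonneg)

lemma shift_solenoidal:
  assumes e: "e \<in> {ex, ey}" and v: "v \<in> smooth_solenoidal h"
  shows "shift e s v \<in> smooth_solenoidal h"
proof -
  have sv: "smooth v" and hv: "hperiodic h v" and dv: "\<And>q. div2 (vertical_average h v) q = 0"
    using v by (auto simp: smooth_solenoidal_def simp del: split_paired_All)
  obtain e' :: "real \<times> real" where e': "\<And>q z. (fst q, snd q, z) + s *\<^sub>R e = (fst (q + s *\<^sub>R e'), snd (q + s *\<^sub>R e'), z)"
  proof (cases "e = ex")
    case True
    show thesis by (rule that[of "(1, 0)"]) (simp add: True)
  next
    case False
    then show thesis using e by (intro that[of "(0, 1)"]) simp
  qed
  have eq: "vertical_average h (shift e s v) = (\<lambda>q. vertical_average h v (q + s *\<^sub>R e'))"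
  proof
    fix q
    show "vertical_average h (shift e s v) q = vertical_average h v (q + s *\<^sub>R e')"
      using e'[of q] by (simp add: vertical_average_eq sv shift_smooth[OF sv], simp add: shift_def)
  qed
  have "div2 (vertical_average h (shift e s v)) q = 0" for q
  proof -
    obtain D where D: "(vertical_average h v has_derivative D) (at (q + s *\<^sub>R e'))"
      using vertical_average_differentiable[OF sv, of "q + s *\<^sub>R e'"] by (auto simp: differentiable_def)
    have "((\<lambda>q. q + s *\<^sub>R e') has_derivative (\<lambda>t. t)) (at q)" by (auto intro!: derivative_eq_intros)
    from has_derivative_compose[OF this D]
    have "((\<lambda>q. vertical_average h v (q + s *\<^sub>R e')) has_derivative D) (at q)" .
    from frechet_derivative_at[OF this] frechet_derivative_at[OF D] dv[of "q + s *\<^sub>R e'"]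
    show ?thesis unfolding div2_def partial_def eq by simp
  qed
  then show ?thesis using shift_smooth[OF sv] shift_hperiodic[OF e hv] by (simp add: smooth_solenoidal_def)
qed

lemma shift_sigma:
  assumes e: "e \<in> {ex, ey}" and u: "u \<in> L2_sigma h"
  shows "shift e s u \<in> L2_sigma h"
proof -
  note uL = L2_sigma_L2[OF u]
  have "\<exists>w\<in>smooth_solenoidal h. L2_norm h (\<lambda>p. shift e s u p - w p) < \<epsilon>" if "\<epsilon> > 0" for \<epsilon>
  proof -
    obtain v where v: "v \<in> smooth_solenoidal h" "L2_norm h (\<lambda>p. u p - v p) < \<epsilon>" using L2_sigmaE[OF u \<open>\<epsilon> > 0\<close>] by blast
    have "L2_norm h (shift e s (\<lambda>p. u p - v p)) < \<epsilon>"
      using shift_L2_norm[OF e L2_diff[OF uL smooth_solenoidal_L2[OF v(1)]], of s] v(2) by simp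
    then show ?thesis using shift_solenoidal[OF e v(1), of s] by (auto simp: shift_def)
  qed
  then show ?thesis using shift_L2_inner(1)[OF e uL uL] by (simp add: L2_sigma_def)
qed

text \<open>Taylor's formula with a remainder that depends on a bound for the second derivative
  only. It is uniform in the base point and can therefore be integrated over the domain.\<close>

lemma line_quadratic_bound:
  fixes k k' k'' :: "real \<Rightarrow> real"
  assumes d: "\<And>t. (k has_real_derivative k' t) (at t)" "\<And>t. (k' has_real_derivative k'' t) (at t)"
    and K: "\<And>t. \<bar>t\<bar> \<le> 1 \<Longrightarrow> \<bar>k'' t\<bar> \<le> K" and r: "\<bar>r\<bar> \<le> 1"
  shows "\<bar>k r - k 0 - r * k' 0\<bar> \<le> K * r\<^sup>2"
proof -
  have K0: "K \<ge> 0" using K[of 0] by simp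
  have 1: "\<bar>k' t - k' 0\<bar> \<le> K * \<bar>t\<bar>" if "\<bar>t\<bar> \<le> 1" for t
  proof -
    have "norm (k' t - k' 0) \<le> K * norm (t - 0)"
    proof (rule field_differentiable_bound[of "{-1..1}"])
      fix z :: real assume "z \<in> {-1..1}"
      then show "norm (k'' z) \<le> K" using K[of z] by auto
      show "(k' has_field_derivative k'' z) (at z within {-1..1})" by (rule has_field_derivative_at_within[OF d(2)])
    qed (use that in auto)
    then show ?thesis by simp
  qed
  have "norm ((k r - r * k' 0) - (k 0 - 0 * k' 0)) \<le> (K * \<bar>r\<bar>) * norm (r - 0)"
  proof (rule field_differentiable_bound[where S="{-\<bar>r\<bar>..\<bar>r\<bar>}" and f'="\<lambda>t. k' t - k' 0"])
    fix t assume t: "t \<in> {-\<bar>r\<bar>..\<bar>r\<bar>}"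
    then have "\<bar>t\<bar> \<le> \<bar>r\<bar>" by auto
    then have "K * \<bar>t\<bar> \<le> K * \<bar>r\<bar>" using K0 by (intro mult_left_mono)
    then show "norm (k' t - k' 0) \<le> K * \<bar>r\<bar>" using 1[of t] \<open>\<bar>t\<bar> \<le> \<bar>r\<bar>\<close> r by simp
    show "((\<lambda>t. k t - t * k' 0) has_real_derivative k' t - k' 0) (at t within {-\<bar>r\<bar>..\<bar>r\<bar>})"
      by (auto intro!: derivative_eq_intros has_field_derivative_at_within[OF d(1)])
  qed auto
  then show ?thesis by (simp add: power2_eq_square abs_mult_self_eq mult.assoc algebra_simps)
qed

lemma smooth_line_has_derivative:
  fixes \<psi> :: "point \<Rightarrow> real"
  assumes "smooth \<psi>"
  shows "((\<lambda>t. \<psi> (p + t *\<^sub>R e)) has_real_derivative partial e \<psi> (p + t *\<^sub>R e)) (at t)"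
  using smooth_line[OF assms] by (simp add: has_real_derivative_iff_has_vector_derivative)

lemma shift_deriv_0:
  fixes \<psi> :: "point \<Rightarrow> real"
  assumes w: "integrable (Om h) w" and \<psi>: "smooth \<psi>" and e: "e \<in> Basis"
  shows "((\<lambda>s. \<integral>p. shift e (-s) \<psi> p * w p \<partial>Om h) has_real_derivative - (\<integral>p. partial e \<psi> p * w p \<partial>Om h)) (at 0)"
proof -
  \<comment> \<open>A shift by at most one may leave the cell, so the second derivative is bounded
    on this enlarged set.\<close>
  define A where "A = {p + t *\<^sub>R e | p t. p \<in> cell h \<and> \<bar>t\<bar> \<le> 1}"
  have "bounded A"
  proof -
    obtain R where R: "\<And>p. p \<in> cell h \<Longrightarrow> norm p \<le> R" using bounded_cell[of h] by (auto simp: bounded_iff)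
    have "norm (p + t *\<^sub>R e) \<le> R + 1" if "p \<in> cell h" "\<bar>t\<bar> \<le> 1" for p t
      using norm_triangle_ineq[of p "t *\<^sub>R e"] R[OF that(1)] that(2) e by simp
    then show ?thesis unfolding bounded_iff A_def by blast
  qed
  moreover have s2: "smooth (partial e \<psi>)" "smooth (partial e (partial e \<psi>))"
    using \<psi> e by (auto intro: smooth_partial)
  ultimately obtain K where K: "\<And>q. q \<in> A \<Longrightarrow> norm (partial e (partial e \<psi>) q) \<le> K"
    using smooth_bounded[of "partial e (partial e \<psi>)" A] by blast
  define L where "L s = (\<integral>p. shift e (-s) \<psi> p * w p \<partial>Om h)" for s
  define D where "D = (\<integral>p. partial e \<psi> p * w p \<partial>Om h)"
  define C where "C = (\<integral>p. \<bar>w p\<bar> \<partial>Om h) * K"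
  have iw: "integrable (Om h) (\<lambda>p. f p * w p)" if "smooth f" for f
    using integrable_smooth_mult[OF w that] by simp
  have bound: "\<bar>L s - L 0 + s * D\<bar> \<le> C * s\<^sup>2" if s: "\<bar>s\<bar> \<le> 1" for s
  proof -
    have eq: "L s - L 0 + s * D = (\<integral>p. shift e (-s) \<psi> p * w p - \<psi> p * w p + s * (partial e \<psi> p * w p) \<partial>Om h)"
      unfolding L_def D_def using iw[OF shift_smooth[OF \<psi>]] iw[OF \<psi>] iw[OF s2(1)] by simp
    have "\<bar>L s - L 0 + s * D\<bar> \<le> (\<integral>p. \<bar>shift e (-s) \<psi> p * w p - \<psi> p * w p + s * (partial e \<psi> p * w p)\<bar> \<partial>Om h)"
      unfolding eq by (rule integral_abs_bound)
    also have "\<dots> \<le> (\<integral>p. \<bar>w p\<bar> * (K * s\<^sup>2) \<partial>Om h)"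
    proof (rule integral_mono)
      show "integrable (Om h) (\<lambda>p. \<bar>shift e (-s) \<psi> p * w p - \<psi> p * w p + s * (partial e \<psi> p * w p)\<bar>)"
        using iw[OF shift_smooth[OF \<psi>]] iw[OF \<psi>] iw[OF s2(1)] by simp
      show "integrable (Om h) (\<lambda>p. \<bar>w p\<bar> * (K * s\<^sup>2))" using w by simp
      fix p assume "p \<in> space (Om h)"
      then have p: "p \<in> cell h" by simp
      have "\<bar>\<psi> (p + (-s) *\<^sub>R e) - \<psi> (p + 0 *\<^sub>R e) - (-s) * partial e \<psi> (p + 0 *\<^sub>R e)\<bar> \<le> K * (-s)\<^sup>2"
      proof (rule line_quadratic_bound[OF smooth_line_has_derivative[OF \<psi>] smooth_line_has_derivative[OF s2(1)]])
        fix t :: real assume "\<bar>t\<bar> \<le> 1"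
        then show "\<bar>partial e (partial e \<psi>) (p + t *\<^sub>R e)\<bar> \<le> K"
          using K[of "p + t *\<^sub>R e"] p unfolding A_def real_norm_def by blast
      qed (use s in simp)
      then have "\<bar>shift e (-s) \<psi> p - \<psi> p + s * partial e \<psi> p\<bar> \<le> K * s\<^sup>2" by (simp add: shift_def)
      then have "\<bar>w p\<bar> * \<bar>shift e (-s) \<psi> p - \<psi> p + s * partial e \<psi> p\<bar> \<le> \<bar>w p\<bar> * (K * s\<^sup>2)"
        by (intro mult_left_mono) auto
      then show "\<bar>shift e (-s) \<psi> p * w p - \<psi> p * w p + s * (partial e \<psi> p * w p)\<bar> \<le> \<bar>w p\<bar> * (K * s\<^sup>2)"
        by (simp add: abs_mult[symmetric] algebra_simps)
    qed
    also have "\<dots> = C * s\<^sup>2" by (simp add: C_def)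
    finally show ?thesis .
  qed
  have "((\<lambda>s. (L (0 + s) - L 0) / s - (- D)) \<longlongrightarrow> 0) (at 0)"
  proof (rule Lim_null_comparison)
    have "\<forall>\<^sub>F s :: real in at 0. \<bar>s\<bar> < 1 \<and> s \<noteq> 0"
      unfolding eventually_at by (intro exI[of _ 1]) (auto simp: dist_norm)
    then show "\<forall>\<^sub>F s in at 0. norm ((L (0 + s) - L 0) / s - (- D)) \<le> C * \<bar>s\<bar>"
    proof eventually_elim
      case (elim s)
      have "(L (0 + s) - L 0) / s - (- D) = (L s - L 0 + s * D) / s"
        using elim by (simp add: add_divide_distrib)
      then have "norm ((L (0 + s) - L 0) / s - (- D)) = \<bar>L s - L 0 + s * D\<bar> / \<bar>s\<bar>"
        by simp
      also have "\<dots> \<le> C * s\<^sup>2 / \<bar>s\<bar>" using bound[of s] elim by (intro divide_right_mono) auto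
      also have "C * s\<^sup>2 = C * \<bar>s\<bar> * \<bar>s\<bar>" by (simp add: power2_eq_square)
      also have "\<dots> / \<bar>s\<bar> = C * \<bar>s\<bar>" using elim by simp
      finally show ?case .
    qed
    show "((\<lambda>s. C * \<bar>s\<bar>) \<longlongrightarrow> 0) (at 0)" by (auto intro!: tendsto_eq_intros)
  qed
  then have "((\<lambda>s. (L (0 + s) - L 0) / s) \<longlongrightarrow> - D) (at 0)" by (rule LIM_zero_cancel)
  then show ?thesis unfolding DERIV_def L_def D_def by simp
qed

lemma shift_deriv_field:
  fixes \<psi> w :: field
  assumes w: "w \<in> L2 h" and \<psi>: "smooth \<psi>" "hperiodic h \<psi>" and e: "e \<in> {ex, ey}"
  shows "((\<lambda>s. L2_inner h w (shift e (-s) \<psi>)) has_real_derivative - L2_inner h w (shift e (-s) (partial e \<psi>))) (at s)"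
proof -
  have eB: "e \<in> Basis" using e by auto
  define \<xi> where "\<xi> = shift e (-s) \<psi>"
  have \<xi>: "smooth \<xi>" unfolding \<xi>_def by (rule shift_smooth[OF \<psi>(1)])
  have comp: "L2_inner h w f = (\<integral>p. f p $ 1 * w p $ 1 \<partial>Om h) + (\<integral>p. f p $ 2 * w p $ 2 \<partial>Om h)" if f: "smooth f" for f :: field
    unfolding L2_inner_eq inner_field
    using integrable_smooth_mult[OF component_integrable[OF w] smooth_component[OF f]]
    by (simp add: mult.commute)
  have s: "smooth (shift e t \<xi>)" "smooth (partial e \<xi>)" for t
    using shift_smooth[OF \<xi>] smooth_partial[OF \<xi> eB] by auto
  have pc: "partial e (\<lambda>p. \<xi> p $ i) = (\<lambda>p. partial e \<xi> p $ i)" for i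
    by (rule partial_linear[OF bounded_linear_vec_nth \<xi>])
  have "((\<lambda>t. (\<integral>p. shift e (-t) (\<lambda>p. \<xi> p $ 1) p * w p $ 1 \<partial>Om h) + (\<integral>p. shift e (-t) (\<lambda>p. \<xi> p $ 2) p * w p $ 2 \<partial>Om h))
     has_real_derivative (- (\<integral>p. partial e (\<lambda>p. \<xi> p $ 1) p * w p $ 1 \<partial>Om h)) + (- (\<integral>p. partial e (\<lambda>p. \<xi> p $ 2) p * w p $ 2 \<partial>Om h))) (at 0)"
    by (intro DERIV_add shift_deriv_0 component_integrable[OF w] smooth_component[OF \<xi>] eB)
  then have "((\<lambda>t. L2_inner h w (shift e (-t) \<xi>)) has_real_derivative - L2_inner h w (partial e \<xi>)) (at 0)"
    unfolding comp[OF s(1)] comp[OF s(2)] pc by (simp add: shift_def)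
  moreover have "L2_inner h w (shift e (-t) \<xi>) = L2_inner h w (shift e (-(t + s)) \<psi>)" for t
    unfolding \<xi>_def shift_shift by (simp add: algebra_simps)
  moreover have "partial e \<xi> = shift e (-s) (partial e \<psi>)" unfolding \<xi>_def by (rule partial_shift[OF \<psi>(1)])
  ultimately have "((\<lambda>t. L2_inner h w (shift e (-(t + s)) \<psi>)) has_real_derivative - L2_inner h w (shift e (-s) (partial e \<psi>))) (at 0)"
    by simp
  then show ?thesis
    using DERIV_shift[of "\<lambda>s. L2_inner h w (shift e (-s) \<psi>)" _ 0 s] by simp
qed

text \<open>The projection of \<open>\<Phi>\<close> is not known to be differentiable, so the
  derivative is taken with respect to the shift parameter. Shifts preserve \<open>L2_sigma\<close>,
  and their adjoints are the opposite shifts; hence pairing \<open>u\<close> with the shifted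
  projection of \<open>\<Phi>\<close> is the same as pairing the projection of \<open>u\<close> with
  the shifted \<open>\<Phi>\<close>. The first form is differentiated through smooth approximations,
  the second directly, and the two derivatives at zero are compared.\<close>

lemma helmholtz_commute:
  fixes u g :: field
  assumes u: "u \<in> L2 h" and g: "g \<in> L2 h" and e: "e \<in> {ex, ey}"
    and weak: "\<And>\<psi> i. smooth \<psi> \<Longrightarrow> hperiodic h \<psi> \<Longrightarrow>
       (\<integral>p. partial e \<psi> p * u p $ i \<partial>Om h) = - (\<integral>p. \<psi> p * g p $ i \<partial>Om h)"
    and \<Phi>: "smooth (\<Phi> :: field)" "hperiodic h \<Phi>"
  shows "L2_inner h (helmholtz_proj h u) (partial e \<Phi>) = - L2_inner h (helmholtz_proj h g) \<Phi>"
proof -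
  have eB: "e \<in> Basis" using e by auto
  note \<Phi>L = smooth_L2[OF \<Phi>]
  note Pu = helmholtz[OF u] and Pg = helmholtz[OF g] and P\<Phi> = helmholtz[OF \<Phi>L]
  let ?Q = "helmholtz_proj h \<Phi>"
  have weakf: "L2_inner h u (partial e \<psi>) = - L2_inner h g \<psi>" if \<psi>: "smooth \<psi>" "hperiodic h \<psi>" for \<psi> :: field
  proof -
    have comp: "L2_inner h w f = (\<integral>p. f p $ 1 * w p $ 1 \<partial>Om h) + (\<integral>p. f p $ 2 * w p $ 2 \<partial>Om h)"
      if f: "smooth f" and w: "w \<in> L2 h" for f w :: field
      unfolding L2_inner_eq inner_field
      using integrable_smooth_mult[OF component_integrable[OF w] smooth_component[OF f]]
      by (simp add: mult.commute)
    have "(\<integral>p. partial e \<psi> p $ i * u p $ i \<partial>Om h) = - (\<integral>p. \<psi> p $ i * g p $ i \<partial>Om h)" for i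
      using weak[OF smooth_component[OF \<psi>(1), of i]] \<psi>(2) partial_linear[OF bounded_linear_vec_nth \<psi>(1), of e i]
      by (simp add: hperiodic_def)
    then show ?thesis
      unfolding comp[OF smooth_partial[OF \<psi>(1) eB] u] comp[OF \<psi>(1) g] by simp
  qed
  have "\<forall>n. \<exists>v. v \<in> smooth_solenoidal h \<and> L2_norm h (\<lambda>p. ?Q p - v p) < 1 / real (Suc n)"
  proof
    fix n
    show "\<exists>v. v \<in> smooth_solenoidal h \<and> L2_norm h (\<lambda>p. ?Q p - v p) < 1 / real (Suc n)"
      by (rule L2_sigmaE[OF P\<Phi>(1), of "1 / real (Suc n)"]) auto
  qed
  from choice[OF this] obtain v where v: "\<And>n. v n \<in> smooth_solenoidal h"
    "\<And>n. L2_norm h (\<lambda>p. ?Q p - v n p) < 1 / real (Suc n)" by blast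
  have sv: "smooth (v n)" "hperiodic h (v n)" for n using v(1)[of n] by (auto simp: smooth_solenoidal_def)
  note vL = smooth_L2[OF sv]
  have close: "\<bar>L2_inner h w (shift e t (v n)) - L2_inner h w (shift e t ?Q)\<bar> \<le> L2_norm h w * (1 / real (Suc n))"
    if w: "w \<in> L2 h" for w n t
  proof -
    have "L2_inner h w (shift e t (v n)) - L2_inner h w (shift e t ?Q) = - L2_inner h w (shift e t (\<lambda>p. ?Q p - v n p))"
      using L2_inner_rules(4)[OF shift_L2[OF e P\<Phi>(2)] shift_L2[OF e vL] w, of t t n] by (simp add: shift_def)
    also have "\<bar>\<dots>\<bar> \<le> L2_norm h w * L2_norm h (shift e t (\<lambda>p. ?Q p - v n p))"
      unfolding abs_minus_cancel
      by (rule L2_Cauchy_Schwarz[OF w shift_L2[OF e]]) (intro L2_diff P\<Phi> vL)+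
    also have "\<dots> \<le> L2_norm h w * (1 / real (Suc n))"
      using v(2)[of n] shift_L2_norm[OF e L2_diff[OF P\<Phi>(2) vL], of t n]
      by (intro mult_left_mono) (auto simp: L2_norm_nonneg)
    finally show ?thesis .
  qed
  define f where "f n s = L2_inner h u (shift e (-s) (v n))" for n s
  define f' where "f' n s = L2_inner h g (shift e (-s) (v n))" for n s
  define M where "M s = L2_inner h g (shift e (-s) ?Q)" for s
  have df: "(f n has_real_derivative f' n s) (at s)" for n s
  proof -
    have "- L2_inner h u (shift e (-s) (partial e (v n))) = f' n s"
      using weakf[OF shift_smooth[OF sv(1)] shift_hperiodic[OF e sv(2)], of "-s" n]
      by (simp add: f'_def partial_shift[OF sv(1)])
    then show ?thesis using shift_deriv_field[OF u sv e, of n s] by (simp add: f_def[abs_def])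
  qed
  have lim: "(\<lambda>n. f n s) \<longlonglongrightarrow> L2_inner h u (shift e (-s) ?Q)" for s
  proof -
    have "(\<lambda>n. f n s - L2_inner h u (shift e (-s) ?Q)) \<longlonglongrightarrow> 0"
    proof (rule tendsto_0_le_abs)
      show "\<bar>f n s - L2_inner h u (shift e (-s) ?Q)\<bar> \<le> L2_norm h u * (1 / real (Suc n))" for n
        unfolding f_def by (rule close[OF u])
      show "(\<lambda>n. L2_norm h u * (1 / real (Suc n))) \<longlonglongrightarrow> 0"
        by (intro tendsto_mult_right_zero LIMSEQ_inverse_real_of_nat[unfolded inverse_eq_divide])
    qed
    then show ?thesis by (simp add: LIM_zero_iff)
  qed
  \<comment> \<open>Shifts are isometries, so the derivatives \<open>f' n\<close> converge to
    \<open>M\<close> uniformly in \<open>s\<close>, and the limit may be interchanged with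
    differentiation.\<close>
  have "\<exists>G. \<forall>s\<in>UNIV. (\<lambda>n. f n s) \<longlonglongrightarrow> G s \<and> (G has_derivative (\<lambda>t. M s * t)) (at s within UNIV)"
  proof (rule has_derivative_sequence[where f'="\<lambda>n s t. f' n s * t"])
    show "(f n has_derivative (\<lambda>t. f' n s * t)) (at s within UNIV)" for n s
      using df[of n s] by (simp add: has_field_derivative_def)
    show "(\<lambda>n. f n 0) \<longlonglongrightarrow> L2_inner h u (shift e (-0) ?Q)" by (rule lim)
  next
    fix \<epsilon> :: real assume "\<epsilon> > 0"
    have "(\<lambda>n. L2_norm h g * (1 / real (Suc n))) \<longlonglongrightarrow> 0"
      by (intro tendsto_mult_right_zero LIMSEQ_inverse_real_of_nat[unfolded inverse_eq_divide])
    from order_tendstoD(2)[OF this \<open>\<epsilon> > 0\<close>]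
    show "\<forall>\<^sub>F n in sequentially. \<forall>s\<in>UNIV. \<forall>t. norm (f' n s * t - M s * t) \<le> \<epsilon> * norm t"
    proof eventually_elim
      case (elim n)
      have "\<bar>f' n s - M s\<bar> \<le> \<epsilon>" for s
        using close[OF g, of "-s" n] elim unfolding f'_def M_def by linarith
      then show ?case by (auto simp: left_diff_distrib[symmetric] abs_mult intro!: mult_right_mono)
    qed
  qed auto
  then obtain G where G: "\<And>s. (\<lambda>n. f n s) \<longlonglongrightarrow> G s" "\<And>s. (G has_derivative (\<lambda>t. M s * t)) (at s)" by auto
  have "G = (\<lambda>s. L2_inner h (helmholtz_proj h u) (shift e (-s) \<Phi>))"
  proof
    fix s
    have "G s = L2_inner h u (shift e (-s) ?Q)" by (rule LIMSEQ_unique[OF G(1) lim])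
    also have "\<dots> = L2_inner h (helmholtz_proj h u) (shift e (-s) ?Q)"
      by (rule Pu(3)[OF shift_sigma[OF e P\<Phi>(1)]])
    also have "\<dots> = L2_inner h (shift e s (helmholtz_proj h u)) ?Q"
      by (rule shift_adjoint[OF e Pu(2) P\<Phi>(2), symmetric])
    also have "\<dots> = L2_inner h (shift e s (helmholtz_proj h u)) \<Phi>"
      using P\<Phi>(3)[OF shift_sigma[OF e Pu(1)], of s] by (simp add: L2_inner_commute)
    also have "\<dots> = L2_inner h (helmholtz_proj h u) (shift e (-s) \<Phi>)"
      by (rule shift_adjoint[OF e Pu(2) \<Phi>L])
    finally show "G s = L2_inner h (helmholtz_proj h u) (shift e (-s) \<Phi>)" .
  qed
  then have "((\<lambda>s. L2_inner h (helmholtz_proj h u) (shift e (-s) \<Phi>)) has_real_derivative M 0) (at 0)"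
    using G(2)[of 0] by (simp add: has_field_derivative_def)
  from DERIV_unique[OF this shift_deriv_field[OF Pu(2) \<Phi> e]]
  have "L2_inner h (helmholtz_proj h u) (partial e \<Phi>) = - M 0" by simp
  also have "M 0 = L2_inner h (helmholtz_proj h g) ?Q" unfolding M_def using Pg(3)[OF P\<Phi>(1)] by simp
  also have "\<dots> = L2_inner h (helmholtz_proj h g) \<Phi>"
    using P\<Phi>(3)[OF Pg(1)] by (simp add: L2_inner_commute)
  finally show ?thesis .
qed

lemma L2_inner_axis:
  fixes f :: field and \<psi> :: "point \<Rightarrow> real"
  shows "L2_inner h f (\<lambda>p. \<psi> p *\<^sub>R axis i 1) = (\<integral>p. \<psi> p * f p $ i \<partial>Om h)"
  by (simp add: L2_inner_eq inner_axis)

lemma helmholtz_commute_scalar: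
  fixes u g :: field
  assumes u: "u \<in> L2 h" and g: "g \<in> L2 h" and e: "e \<in> {ex, ey}"
    and weak: "\<And>\<psi> i. smooth \<psi> \<Longrightarrow> hperiodic h \<psi> \<Longrightarrow>
       (\<integral>p. partial e \<psi> p * u p $ i \<partial>Om h) = - (\<integral>p. \<psi> p * g p $ i \<partial>Om h)"
    and \<psi>: "smooth \<psi>" "hperiodic h \<psi>"
  shows "(\<integral>p. partial e \<psi> p * helmholtz_proj h u p $ i \<partial>Om h) = - (\<integral>p. \<psi> p * helmholtz_proj h g p $ i \<partial>Om h)"
proof -
  have L: "bounded_linear (\<lambda>t. t *\<^sub>R (axis i 1 :: real^2))" by (rule bounded_linear_scaleR_left)
  have "hperiodic h (\<lambda>p. \<psi> p *\<^sub>R (axis i 1 :: real^2))" using \<psi>(2) by (simp add: hperiodic_def)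
  from helmholtz_commute[OF u g e weak smooth_linear[OF L \<psi>(1)] this]
  show ?thesis unfolding partial_linear[OF L \<psi>(1)] L2_inner_axis by simp
qed

lemma tpr_smooth_hperiodic:
  assumes "per1 a" "per1 b" "cpt h c" shows "smooth (tpr a b c)" "hperiodic h (tpr a b c)"
  using tpr_test[OF assms] by (auto simp: test_function_def)

lemma helmholtz_wd_x:
  fixes u g :: field
  assumes u: "u \<in> L2 h" and g: "g \<in> L2 h" and wd: "\<And>i. dx.wd (\<lambda>p. u p $ i) (\<lambda>p. g p $ i)"
  shows "dx.wd (\<lambda>p. helmholtz_proj h u p $ i) (\<lambda>p. helmholtz_proj h g p $ i)"
proof (rule weak_imp_wd_x)
  show "integrable (Om h) (\<lambda>p. helmholtz_proj h u p $ i)" "integrable (Om h) (\<lambda>p. helmholtz_proj h g p $ i)"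
    using helmholtz(2)[OF u] helmholtz(2)[OF g] by (auto intro: component_integrable)
  fix a b c assume t: "per1 a" "per1 b" "cpt h c"
  then have "tpr (deriv a) b c = partial ex (tpr a b c)"
    by (subst partial_tpr) (auto simp: per1_def cpt_def)
  then show "(\<integral>p. tpr (deriv a) b c p * helmholtz_proj h u p $ i \<partial>Om h) = - (\<integral>p. tpr a b c p * helmholtz_proj h g p $ i \<partial>Om h)"
    using helmholtz_commute_scalar[OF u g _ by_parts_x[OF wd component_integrable[OF u] component_integrable[OF g]] tpr_smooth_hperiodic[OF t], of i]
    by simp
qed

lemma helmholtz_wd_y:
  fixes u g :: field
  assumes u: "u \<in> L2 h" and g: "g \<in> L2 h" and wd: "\<And>i. dy.wd (\<lambda>p. u p $ i) (\<lambda>p. g p $ i)"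
  shows "dy.wd (\<lambda>p. helmholtz_proj h u p $ i) (\<lambda>p. helmholtz_proj h g p $ i)"
proof (rule weak_imp_wd_y)
  show "integrable (Om h) (\<lambda>p. helmholtz_proj h u p $ i)" "integrable (Om h) (\<lambda>p. helmholtz_proj h g p $ i)"
    using helmholtz(2)[OF u] helmholtz(2)[OF g] by (auto intro: component_integrable)
  fix a b c assume t: "per1 a" "per1 b" "cpt h c"
  then have "tpr a (deriv b) c = partial ey (tpr a b c)"
    by (subst partial_tpr) (auto simp: per1_def cpt_def)
  then show "(\<integral>p. tpr a (deriv b) c p * helmholtz_proj h u p $ i \<partial>Om h) = - (\<integral>p. tpr a b c p * helmholtz_proj h g p $ i \<partial>Om h)"
    using helmholtz_commute_scalar[OF u g _ by_parts_y[OF wd component_integrable[OF u] component_integrable[OF g]] tpr_smooth_hperiodic[OF t], of i]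
    by simp
qed

text \<open>A vertical derivative with compact support has vertical average zero, so it is solenoidal.\<close>

lemma vertical_derivative_solenoidal:
  assumes t: "per1 a" "per1 b" "cpt h c"
  shows "(\<lambda>p. tpr a b (deriv c) p *\<^sub>R axis i 1) \<in> smooth_solenoidal h"
proof -
  have L: "bounded_linear (\<lambda>t. t *\<^sub>R (axis i 1 :: real^2))" by (rule bounded_linear_scaleR_left)
  note T = tpr_smooth_hperiodic[OF t(1,2) cpt_deriv[OF t(3)]]
  have sc: "sm1 c" and c0: "c (-h) = 0" "c 0 = 0" using t(3) h by (auto simp: cpt_def)
  have "vertical_average h (\<lambda>p. tpr a b (deriv c) p *\<^sub>R (axis i 1 :: real^2)) q = 0" for q
  proof -
    have "(LINT z:{-h<..<0}|lborel. tpr a b (deriv c) (fst q, snd q, z) *\<^sub>R (axis i 1 :: real^2)) =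
        (\<integral>z. tpr a b (deriv c) (fst q, snd q, z) *\<^sub>R (axis i 1 :: real^2) \<partial>ZM h)"
      unfolding ZM_def set_lebesgue_integral_def by (subst integral_restrict_space) auto
    also have "\<dots> = (\<integral>z. (a (fst q) * b (snd q)) * deriv c z \<partial>ZM h) *\<^sub>R (axis i 1 :: real^2)"
      using Z.integrable_continuous_T[OF sm1_continuous[OF sm1_deriv[OF sc]]]
      by (subst integral_scaleR_left[symmetric]) (auto simp: tpr_def)
    also have "(\<integral>z. (a (fst q) * b (snd q)) * deriv c z \<partial>ZM h) = 0"
      using Z.integral_deriv[OF sm1_has_deriv[OF sc] sm1_continuous[OF sm1_deriv[OF sc]]] c0 by simp
    finally show ?thesis by (simp add: vertical_average_def split_beta')
  qed
  then have "vertical_average h (\<lambda>p. tpr a b (deriv c) p *\<^sub>R (axis i 1 :: real^2)) = (\<lambda>q. 0)" by blast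
  then show ?thesis
    using smooth_linear[OF L T(1)] T(2) by (simp add: smooth_solenoidal_def hperiodic_def div2_def partial_def)
qed

lemma helmholtz_wd_z:
  fixes u g :: field
  assumes u: "u \<in> L2 h" and g: "g \<in> L2 h" and wd: "\<And>i. dz.wd (\<lambda>p. u p $ i) (\<lambda>p. g p $ i)"
  shows "dz.wd (\<lambda>p. helmholtz_proj h u p $ i) (\<lambda>p. g p $ i)"
proof -
  note P = helmholtz[OF u]
  note i = component_integrable[OF u, of i] component_integrable[OF P(2), of i]
  have "dz.wd (\<lambda>p. u p $ i - helmholtz_proj h u p $ i) (\<lambda>p. 0)"
  proof (rule weak_imp_wd_z)
    show "integrable (Om h) (\<lambda>p. u p $ i - helmholtz_proj h u p $ i)" using i by simp
    fix a b c assume t: "per1 a" "per1 b" "cpt h c"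
    have s: "smooth (tpr a b (deriv c))" by (rule tpr_smooth_hperiodic[OF t(1,2) cpt_deriv[OF t(3)]])
    have "(\<integral>p. tpr a b (deriv c) p * u p $ i \<partial>Om h) = (\<integral>p. tpr a b (deriv c) p * helmholtz_proj h u p $ i \<partial>Om h)"
      using P(3)[OF smooth_solenoidal_sigma[OF vertical_derivative_solenoidal[OF t]], of i] by (simp add: L2_inner_axis)
    then show "(\<integral>p. tpr a b (deriv c) p * (u p $ i - helmholtz_proj h u p $ i) \<partial>Om h) = - (\<integral>p. tpr a b c p * 0 \<partial>Om h)"
      using integrable_smooth_mult[OF i(1) s] integrable_smooth_mult[OF i(2) s] by (simp add: right_diff_distrib)
  qed simp
  from dz.wd_add[OF wd[of i] dz.wd_cmult[OF this, of "-1"]] show ?thesis by simp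
qed

end

subsection \<open>Anisotropic estimates\<close>

lemma ennreal_power2_le:
  fixes x y :: ennreal
  assumes "x\<^sup>2 \<le> y\<^sup>2" shows "x \<le> y"
proof (cases y)
  case (real r)
  then show ?thesis using ennreal_square_le_imp_le[of x r] assms by simp
qed simp

context slab
begin

abbreviation "XXM \<equiv> XM \<Otimes>\<^sub>M XM"

lemma Jz_measurable2 [measurable]:
  assumes "f \<in> borel_measurable (Om h)"
  shows "(\<lambda>q. f (Jz q)) \<in> borel_measurable (XXM \<Otimes>\<^sub>M ZM h)"
  by (rule measurable_compose[OF J_measurable(3) assms])

lemma slice_z_measurable:
  assumes "f \<in> borel_measurable (Om h)" and "z \<in> space (ZM h)"
  shows "(\<lambda>q. f (Jz (q, z))) \<in> borel_measurable XXM"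
  by (rule measurable_compose[OF measurable_Pair2'[OF assms(2)] Jz_measurable2[OF assms(1)]])

lemma nn_integral_z:
  assumes f: "f \<in> borel_measurable (Om h)"
  shows "(\<integral>\<^sup>+p. f p \<partial>Om h) = (\<integral>\<^sup>+z. \<integral>\<^sup>+q. f (Jz (q, z)) \<partial>XXM \<partial>ZM h)"
proof -
  have "(\<integral>\<^sup>+p. f p \<partial>Om h) = (\<integral>\<^sup>+q. f (Jz q) \<partial>(XXM \<Otimes>\<^sub>M ZM h))"
    using nn_integral_distr[OF J_measurable(3), of f] f by (simp add: distr_Jz)
  also have "\<dots> = (\<integral>\<^sup>+z. \<integral>\<^sup>+q. f (Jz (q, z)) \<partial>XXM \<partial>ZM h)"
    by (rule dz.BT.nn_integral_snd[symmetric, OF Jz_measurable2[OF f]])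
  finally show ?thesis .
qed

lemma nn_integral_q:
  assumes f: "f \<in> borel_measurable (Om h)"
  shows "(\<integral>\<^sup>+p. f p \<partial>Om h) = (\<integral>\<^sup>+q. \<integral>\<^sup>+z. f (Jz (q, z)) \<partial>ZM h \<partial>XXM)"
proof -
  have "(\<integral>\<^sup>+p. f p \<partial>Om h) = (\<integral>\<^sup>+q. f (Jz q) \<partial>(XXM \<Otimes>\<^sub>M ZM h))"
    using nn_integral_distr[OF J_measurable(3), of f] f by (simp add: distr_Jz)
  also have "\<dots> = (\<integral>\<^sup>+q. \<integral>\<^sup>+z. f (Jz (q, z)) \<partial>ZM h \<partial>XXM)"
    by (rule Z.nn_integral_fst[symmetric, OF Jz_measurable2[OF f]])
  finally show ?thesis .
qed

lemma pair_slice_measurable: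
  assumes "f \<in> borel_measurable (Om h)"
  shows "(\<lambda>(z, q). f (Jz (q, z))) \<in> borel_measurable (ZM h \<Otimes>\<^sub>M XXM)"
  using measurable_compose[OF measurable_pair_swap' Jz_measurable2[OF assms]] by (simp add: split_beta')

lemma sigma_finite_XXM: "sigma_finite_measure XXM"
  using finite_measure_pairs(2) by (rule finite_measure.axioms)

text \<open>The decomposition used for \<open>dz\<close> has vertical lines as its slices. Here the
  slices are horizontal, so the null set is integrated in the opposite order.\<close>

lemma AE_z:
  assumes "AE p in Om h. P p"
  shows "AE z in ZM h. AE q in XXM. P (Jz (q, z))"
proof -
  obtain N where N: "{p \<in> space (Om h). \<not> P p} \<subseteq> N" "emeasure (Om h) N = 0" "N \<in> sets (Om h)"
    using AE_E[OF assms] by blast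
  have Nm: "indicator N \<in> borel_measurable (Om h)" using N(3) by simp
  have "(\<integral>\<^sup>+z. \<integral>\<^sup>+q. indicator N (Jz (q, z)) \<partial>XXM \<partial>ZM h) = 0"
    using nn_integral_z[OF Nm] N by simp
  moreover have m: "(\<lambda>z. \<integral>\<^sup>+q. indicator N (Jz (q, z)) \<partial>XXM) \<in> borel_measurable (ZM h)"
    by (rule sigma_finite_measure.borel_measurable_nn_integral[OF sigma_finite_XXM pair_slice_measurable[OF Nm]])
  ultimately have "AE z in ZM h. (\<integral>\<^sup>+q. indicator N (Jz (q, z)) \<partial>XXM) = 0"
    by (subst (asm) nn_integral_0_iff_AE) auto
  then show ?thesis using AE_space
  proof eventually_elim
    case (elim z)
    have mz: "(\<lambda>q. indicator N (Jz (q, z)) :: ennreal) \<in> borel_measurable XXM"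
      by (rule slice_z_measurable[OF Nm elim(2)])
    have "AE q in XXM. (indicator N (Jz (q, z)) :: ennreal) = 0"
      using elim(1) nn_integral_0_iff_AE[OF mz] by simp
    then show ?case using AE_space
    proof eventually_elim
      case (elim q)
      have "Jz (q, z) \<in> space (Om h)"
        using elim(2) \<open>z \<in> space (ZM h)\<close> by (intro measurable_space[OF J_measurable(3)]) (simp add: space_pair_measure)
      then show ?case using elim(1) N(1) by (auto simp: indicator_def split: if_splits)
    qed
  qed
qed

text \<open>\<open>L24 g A\<close> states that the integral over \<open>z\<close> of the square of the \<open>L\<^sup>4\<close> norm of the horizontal
  slices of \<open>g\<close> is at most \<open>A\<close>; the square root is avoided by the majorant \<open>\<theta>\<close>.\<close>

definition L24 :: "(point \<Rightarrow> real) \<Rightarrow> real \<Rightarrow> bool" where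
  "L24 g A \<longleftrightarrow> g \<in> borel_measurable (Om h) \<and> 0 \<le> A \<and> (\<exists>\<theta>. \<theta> \<in> borel_measurable (ZM h) \<and>
     (AE z in ZM h. (\<integral>\<^sup>+q. ennreal ((g (Jz (q, z))) ^ 4) \<partial>XXM) \<le> (\<theta> z)\<^sup>2) \<and>
     (\<integral>\<^sup>+z. \<theta> z \<partial>ZM h) \<le> ennreal A)"

lemma L24_measurable: "L24 g A \<Longrightarrow> g \<in> borel_measurable (Om h)" and L24_nonneg: "L24 g A \<Longrightarrow> 0 \<le> A"
  by (auto simp: L24_def)

lemma L24_mono: "L24 g A \<Longrightarrow> A \<le> B \<Longrightarrow> L24 g B"
  unfolding L24_def by (meson ennreal_leI order_trans)

lemma L24_cmult:
  assumes "L24 g A" shows "L24 (\<lambda>p. c * g p) (c\<^sup>2 * A)"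
proof -
  obtain \<theta> where \<theta>[measurable]: "\<theta> \<in> borel_measurable (ZM h)"
    and 1: "AE z in ZM h. (\<integral>\<^sup>+q. ennreal ((g (Jz (q, z))) ^ 4) \<partial>XXM) \<le> (\<theta> z)\<^sup>2"
    and 2: "(\<integral>\<^sup>+z. \<theta> z \<partial>ZM h) \<le> ennreal A" and A: "0 \<le> A" and g: "g \<in> borel_measurable (Om h)"
    using assms unfolding L24_def by blast
  have "AE z in ZM h. (\<integral>\<^sup>+q. ennreal ((c * g (Jz (q, z))) ^ 4) \<partial>XXM) \<le> (ennreal (c\<^sup>2) * \<theta> z)\<^sup>2"
    using 1 AE_space
  proof eventually_elim
    case (elim z)
    have m: "(\<lambda>q. ennreal ((g (Jz (q, z))) ^ 4)) \<in> borel_measurable XXM"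
      using slice_z_measurable[OF g elim(2)] by measurable
    have "(\<integral>\<^sup>+q. ennreal ((c * g (Jz (q, z))) ^ 4) \<partial>XXM) = (\<integral>\<^sup>+q. ennreal (c ^ 4) * ennreal ((g (Jz (q, z))) ^ 4) \<partial>XXM)"
      by (simp add: power_mult_distrib ennreal_mult')
    also have "\<dots> = ennreal (c ^ 4) * (\<integral>\<^sup>+q. ennreal ((g (Jz (q, z))) ^ 4) \<partial>XXM)"
      by (rule nn_integral_cmult[OF m])
    also have "\<dots> \<le> ennreal (c ^ 4) * (\<theta> z)\<^sup>2" using elim(1) by (intro mult_left_mono) auto
    also have "\<dots> = (ennreal (c\<^sup>2) * \<theta> z)\<^sup>2" by (simp add: power_mult_distrib ennreal_power flip: power_mult)
    finally show ?case .
  qed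
  moreover have "(\<integral>\<^sup>+z. ennreal (c\<^sup>2) * \<theta> z \<partial>ZM h) \<le> ennreal (c\<^sup>2 * A)"
    using 2 A by (simp add: nn_integral_cmult ennreal_mult mult_left_mono)
  ultimately show ?thesis
    unfolding L24_def using g A by (intro conjI exI[of _ "\<lambda>z. ennreal (c\<^sup>2) * \<theta> z"]) auto
qed

lemma power4_sum_le: "(a + b) ^ 4 \<le> 8 * (a ^ 4 + b ^ 4)" for a b :: real
proof -
  have 1: "(a + b)\<^sup>2 \<le> 2 * (a\<^sup>2 + b\<^sup>2)" for a b :: real using sum_squares_bound[of a b] by (simp add: power2_sum)
  have "(a + b) ^ 4 = ((a + b)\<^sup>2)\<^sup>2" by simp
  also have "\<dots> \<le> (2 * (a\<^sup>2 + b\<^sup>2))\<^sup>2" by (intro power_mono 1) auto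
  also have "\<dots> = 4 * (a\<^sup>2 + b\<^sup>2)\<^sup>2" unfolding power_mult_distrib[of 2] by simp
  also have "\<dots> \<le> 4 * (2 * ((a\<^sup>2)\<^sup>2 + (b\<^sup>2)\<^sup>2))" by (intro mult_left_mono 1) auto
  finally show ?thesis by simp
qed

lemma L24_add:
  assumes "L24 f A" "L24 g B" shows "L24 (\<lambda>p. f p + g p) (3 * (A + B))"
proof -
  obtain \<theta> where \<theta>[measurable]: "\<theta> \<in> borel_measurable (ZM h)"
    and f1: "AE z in ZM h. (\<integral>\<^sup>+q. ennreal ((f (Jz (q, z))) ^ 4) \<partial>XXM) \<le> (\<theta> z)\<^sup>2"
    and f2: "(\<integral>\<^sup>+z. \<theta> z \<partial>ZM h) \<le> ennreal A" and A: "0 \<le> A" and f: "f \<in> borel_measurable (Om h)"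
    using assms unfolding L24_def by blast
  obtain \<eta> where \<eta>[measurable]: "\<eta> \<in> borel_measurable (ZM h)"
    and g1: "AE z in ZM h. (\<integral>\<^sup>+q. ennreal ((g (Jz (q, z))) ^ 4) \<partial>XXM) \<le> (\<eta> z)\<^sup>2"
    and g2: "(\<integral>\<^sup>+z. \<eta> z \<partial>ZM h) \<le> ennreal B" and B: "0 \<le> B" and g: "g \<in> borel_measurable (Om h)"
    using assms unfolding L24_def by blast
  have "AE z in ZM h. (\<integral>\<^sup>+q. ennreal ((f (Jz (q, z)) + g (Jz (q, z))) ^ 4) \<partial>XXM) \<le> (3 * (\<theta> z + \<eta> z))\<^sup>2"
    using f1 g1 AE_space
  proof eventually_elim
    case (elim z)
    have m: "(\<lambda>q. ennreal ((f (Jz (q, z))) ^ 4)) \<in> borel_measurable XXM" "(\<lambda>q. ennreal ((g (Jz (q, z))) ^ 4)) \<in> borel_measurable XXM"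
      using slice_z_measurable[OF f elim(3)] slice_z_measurable[OF g elim(3)] by measurable
    have "(\<integral>\<^sup>+q. ennreal ((f (Jz (q, z)) + g (Jz (q, z))) ^ 4) \<partial>XXM)
       \<le> (\<integral>\<^sup>+q. 8 * (ennreal ((f (Jz (q, z))) ^ 4) + ennreal ((g (Jz (q, z))) ^ 4)) \<partial>XXM)"
    proof (rule nn_integral_mono)
      fix q
      have "ennreal ((f (Jz (q, z)) + g (Jz (q, z))) ^ 4) \<le> ennreal (8 * ((f (Jz (q, z))) ^ 4 + (g (Jz (q, z))) ^ 4))"
        by (rule ennreal_leI[OF power4_sum_le])
      also have "\<dots> = 8 * (ennreal ((f (Jz (q, z))) ^ 4) + ennreal ((g (Jz (q, z))) ^ 4))"
        by (subst ennreal_mult) (auto simp: ennreal_plus)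
      finally show "ennreal ((f (Jz (q, z)) + g (Jz (q, z))) ^ 4) \<le> 8 * (ennreal ((f (Jz (q, z))) ^ 4) + ennreal ((g (Jz (q, z))) ^ 4))" .
    qed
    also have "\<dots> = 8 * ((\<integral>\<^sup>+q. ennreal ((f (Jz (q, z))) ^ 4) \<partial>XXM) + (\<integral>\<^sup>+q. ennreal ((g (Jz (q, z))) ^ 4) \<partial>XXM))"
      using m by (subst nn_integral_cmult) (auto simp: nn_integral_add)
    \<comment> \<open>The constant 8 from the convexity of the fourth power is rounded up to a
      perfect square, since the majorant enters squared.\<close>
    also have "\<dots> \<le> 9 * ((\<theta> z)\<^sup>2 + (\<eta> z)\<^sup>2)"
      using elim by (intro mult_mono add_mono) auto
    also have "\<dots> \<le> 9 * (\<theta> z + \<eta> z)\<^sup>2"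
      by (intro mult_left_mono) (auto simp: power2_eq_square distrib_left distrib_right add.assoc intro!: add_left_mono add_increasing)
    also have "\<dots> = (3 * (\<theta> z + \<eta> z))\<^sup>2" unfolding power_mult_distrib[of 3] by simp
    finally show ?case .
  qed
  moreover have "(\<integral>\<^sup>+z. 3 * (\<theta> z + \<eta> z) \<partial>ZM h) \<le> ennreal (3 * (A + B))"
  proof -
    have "(\<integral>\<^sup>+z. 3 * (\<theta> z + \<eta> z) \<partial>ZM h) = 3 * ((\<integral>\<^sup>+z. \<theta> z \<partial>ZM h) + (\<integral>\<^sup>+z. \<eta> z \<partial>ZM h))"
      by (simp add: nn_integral_cmult nn_integral_add)
    also have "\<dots> \<le> 3 * (ennreal A + ennreal B)" using f2 g2 by (intro mult_left_mono add_mono) auto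
    also have "\<dots> = ennreal (3 * (A + B))" using A B by (subst ennreal_mult) auto
    finally show ?thesis .
  qed
  ultimately show ?thesis
    unfolding L24_def using f g A B by (intro conjI exI[of _ "\<lambda>z. 3 * (\<theta> z + \<eta> z)"]) auto
qed

lemma L24_abs: "L24 g A \<Longrightarrow> L24 (\<lambda>p. \<bar>g p\<bar>) A"
  unfolding L24_def by (auto simp: power_abs)

text \<open>The hypothesis on \<open>f\<close> is a domination by a vertical integral, not a
  representation as one. It thus covers \<open>w(v)\<close>, with the divergence as
  \<open>\<psi>\<close>, as well as functions with a vertical derivative, by the one-dimensional
  Sobolev inequality. The bound is constant in \<open>z\<close>, so the square of \<open>g\<close>
  is the only factor left to be integrated vertically. The factor \<open>h\<close> is the length of
  the vertical lines, from the Cauchy-Schwarz inequality there.\<close>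

lemma vertical_product_estimate:
  assumes \<psi>: "L24 \<psi> A" and g: "L24 g B" and f: "f \<in> borel_measurable (Om h)"
    and le: "AE c in XXM. AE z in ZM h. ennreal \<bar>f (Jz (c, z))\<bar> \<le> (\<integral>\<^sup>+t. ennreal \<bar>\<psi> (Jz (c, t))\<bar> \<partial>ZM h)"
  shows "(\<integral>\<^sup>+p. ennreal ((f p * g p)\<^sup>2) \<partial>Om h) \<le> ennreal (h * A * B)"
proof -
  obtain \<theta> where \<theta>[measurable]: "\<theta> \<in> borel_measurable (ZM h)"
    and f1: "AE z in ZM h. (\<integral>\<^sup>+q. ennreal ((\<psi> (Jz (q, z))) ^ 4) \<partial>XXM) \<le> (\<theta> z)\<^sup>2"
    and f2: "(\<integral>\<^sup>+z. \<theta> z \<partial>ZM h) \<le> ennreal A" and A: "0 \<le> A" and \<psi>m: "\<psi> \<in> borel_measurable (Om h)"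
    using \<psi> unfolding L24_def by blast
  obtain \<eta> where \<eta>[measurable]: "\<eta> \<in> borel_measurable (ZM h)"
    and g1: "AE z in ZM h. (\<integral>\<^sup>+q. ennreal ((g (Jz (q, z))) ^ 4) \<partial>XXM) \<le> (\<eta> z)\<^sup>2"
    and g2: "(\<integral>\<^sup>+z. \<eta> z \<partial>ZM h) \<le> ennreal B" and B: "0 \<le> B" and gm: "g \<in> borel_measurable (Om h)"
    using g unfolding L24_def by blast
  have gJ: "(\<lambda>q. g (Jz q)) \<in> borel_measurable (XXM \<Otimes>\<^sub>M ZM h)" by (rule Jz_measurable2[OF gm])
  have \<psi>J: "(\<lambda>q. \<psi> (Jz q)) \<in> borel_measurable (XXM \<Otimes>\<^sub>M ZM h)" by (rule Jz_measurable2[OF \<psi>m])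
  have sq: "(\<integral>\<^sup>+t. ennreal \<bar>\<psi> (Jz (c, t))\<bar> \<partial>ZM h)\<^sup>2 \<le> ennreal h * (\<integral>\<^sup>+t. ennreal ((\<psi> (Jz (c, t)))\<^sup>2) \<partial>ZM h)"
    if c: "c \<in> space XXM" for c
  proof -
    have m: "(\<lambda>t. \<psi> (Jz (c, t))) \<in> borel_measurable (ZM h)" by (rule measurable_compose[OF measurable_Pair1'[OF c] \<psi>J])
    have "(\<integral>\<^sup>+t. ennreal \<bar>\<psi> (Jz (c, t))\<bar> * 1 \<partial>ZM h)\<^sup>2 \<le> (\<integral>\<^sup>+t. (ennreal \<bar>\<psi> (Jz (c, t))\<bar>)\<^sup>2 \<partial>ZM h) * (\<integral>\<^sup>+t. 1\<^sup>2 \<partial>ZM h)"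
      by (rule Cauchy_Schwarz_nn_integral) (use m in measurable)
    also have "(\<integral>\<^sup>+t. 1\<^sup>2 \<partial>ZM h) = ennreal h" using Z.emeasure_T by simp
    finally show ?thesis by (simp add: ennreal_power mult.commute)
  qed
  have "(\<integral>\<^sup>+p. ennreal ((f p * g p)\<^sup>2) \<partial>Om h) = (\<integral>\<^sup>+c. \<integral>\<^sup>+z. ennreal ((f (Jz (c, z)) * g (Jz (c, z)))\<^sup>2) \<partial>ZM h \<partial>XXM)"
    by (rule nn_integral_q) (use f gm in measurable)
  also have "\<dots> \<le> (\<integral>\<^sup>+c. \<integral>\<^sup>+z. ennreal h * ((\<integral>\<^sup>+t. ennreal ((\<psi> (Jz (c, t)))\<^sup>2) \<partial>ZM h) * ennreal ((g (Jz (c, z)))\<^sup>2)) \<partial>ZM h \<partial>XXM)"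
  proof (rule nn_integral_mono_AE)
    show "AE c in XXM. (\<integral>\<^sup>+z. ennreal ((f (Jz (c, z)) * g (Jz (c, z)))\<^sup>2) \<partial>ZM h) \<le>
       (\<integral>\<^sup>+z. ennreal h * ((\<integral>\<^sup>+t. ennreal ((\<psi> (Jz (c, t)))\<^sup>2) \<partial>ZM h) * ennreal ((g (Jz (c, z)))\<^sup>2)) \<partial>ZM h)"
      using le AE_space
    proof eventually_elim
      case (elim c)
      show ?case
      proof (rule nn_integral_mono_AE)
        show "AE z in ZM h. ennreal ((f (Jz (c, z)) * g (Jz (c, z)))\<^sup>2) \<le>
           ennreal h * ((\<integral>\<^sup>+t. ennreal ((\<psi> (Jz (c, t)))\<^sup>2) \<partial>ZM h) * ennreal ((g (Jz (c, z)))\<^sup>2))"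
          using elim(1)
        proof eventually_elim
          case (elim z)
          have "ennreal ((f (Jz (c, z)) * g (Jz (c, z)))\<^sup>2) = (ennreal \<bar>f (Jz (c, z))\<bar>)\<^sup>2 * ennreal ((g (Jz (c, z)))\<^sup>2)"
            by (simp add: power_mult_distrib ennreal_mult ennreal_power)
          also have "\<dots> \<le> (\<integral>\<^sup>+t. ennreal \<bar>\<psi> (Jz (c, t))\<bar> \<partial>ZM h)\<^sup>2 * ennreal ((g (Jz (c, z)))\<^sup>2)"
            by (intro mult_right_mono power_mono_ennreal elim) auto
          also have "\<dots> \<le> ennreal h * (\<integral>\<^sup>+t. ennreal ((\<psi> (Jz (c, t)))\<^sup>2) \<partial>ZM h) * ennreal ((g (Jz (c, z)))\<^sup>2)"
            by (intro mult_right_mono sq \<open>c \<in> space XXM\<close>) auto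
          finally show ?case by (simp add: mult.assoc)
        qed
      qed
    qed
  qed
  also have "\<dots> = ennreal h * (\<integral>\<^sup>+c. (\<integral>\<^sup>+t. \<integral>\<^sup>+z. ennreal ((\<psi> (Jz (c, t)))\<^sup>2) * ennreal ((g (Jz (c, z)))\<^sup>2) \<partial>ZM h \<partial>ZM h) \<partial>XXM)"
  proof -
    have "(\<integral>\<^sup>+z. ennreal h * ((\<integral>\<^sup>+t. ennreal ((\<psi> (Jz (c, t)))\<^sup>2) \<partial>ZM h) * ennreal ((g (Jz (c, z)))\<^sup>2)) \<partial>ZM h)
      = ennreal h * (\<integral>\<^sup>+t. \<integral>\<^sup>+z. ennreal ((\<psi> (Jz (c, t)))\<^sup>2) * ennreal ((g (Jz (c, z)))\<^sup>2) \<partial>ZM h \<partial>ZM h)"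
      if c: "c \<in> space XXM" for c
    proof -
      have m: "(\<lambda>t. ennreal ((\<psi> (Jz (c, t)))\<^sup>2)) \<in> borel_measurable (ZM h)" "(\<lambda>t. ennreal ((g (Jz (c, t)))\<^sup>2)) \<in> borel_measurable (ZM h)"
        using measurable_compose[OF measurable_Pair1'[OF c] \<psi>J] measurable_compose[OF measurable_Pair1'[OF c] gJ] by measurable
      show ?thesis using m by (simp add: nn_integral_cmult nn_integral_multc)
    qed
    then have "(\<integral>\<^sup>+c. \<integral>\<^sup>+z. ennreal h * ((\<integral>\<^sup>+t. ennreal ((\<psi> (Jz (c, t)))\<^sup>2) \<partial>ZM h) * ennreal ((g (Jz (c, z)))\<^sup>2)) \<partial>ZM h \<partial>XXM)
      = (\<integral>\<^sup>+c. ennreal h * (\<integral>\<^sup>+t. \<integral>\<^sup>+z. ennreal ((\<psi> (Jz (c, t)))\<^sup>2) * ennreal ((g (Jz (c, z)))\<^sup>2) \<partial>ZM h \<partial>ZM h) \<partial>XXM)"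
      by (intro nn_integral_cong)
    also have "\<dots> = ennreal h * (\<integral>\<^sup>+c. (\<integral>\<^sup>+t. \<integral>\<^sup>+z. ennreal ((\<psi> (Jz (c, t)))\<^sup>2) * ennreal ((g (Jz (c, z)))\<^sup>2) \<partial>ZM h \<partial>ZM h) \<partial>XXM)"
    proof (rule nn_integral_cmult)
      have [measurable]: "(\<lambda>q. \<psi> (Jz (fst (fst q), snd (fst q)))) \<in> borel_measurable ((XXM \<Otimes>\<^sub>M ZM h) \<Otimes>\<^sub>M ZM h)"
        using measurable_compose[OF measurable_fst \<psi>J, of "ZM h"] by simp
      have [measurable]: "(\<lambda>q. g (Jz (fst (fst q), snd q))) \<in> borel_measurable ((XXM \<Otimes>\<^sub>M ZM h) \<Otimes>\<^sub>M ZM h)"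
        by (rule measurable_compose[OF _ gJ]) measurable
      have "(\<lambda>(q, z). ennreal ((\<psi> (Jz (fst q, snd q)))\<^sup>2) * ennreal ((g (Jz (fst q, z)))\<^sup>2)) \<in> borel_measurable ((XXM \<Otimes>\<^sub>M ZM h) \<Otimes>\<^sub>M ZM h)"
        unfolding split_beta' by measurable
      from Z.borel_measurable_nn_integral[OF this]
      have "(\<lambda>(c, t). \<integral>\<^sup>+z. ennreal ((\<psi> (Jz (c, t)))\<^sup>2) * ennreal ((g (Jz (c, z)))\<^sup>2) \<partial>ZM h) \<in> borel_measurable (XXM \<Otimes>\<^sub>M ZM h)"
        by (simp add: split_beta')
      from Z.borel_measurable_nn_integral[OF this]
      show "(\<lambda>c. \<integral>\<^sup>+t. \<integral>\<^sup>+z. ennreal ((\<psi> (Jz (c, t)))\<^sup>2) * ennreal ((g (Jz (c, z)))\<^sup>2) \<partial>ZM h \<partial>ZM h) \<in> borel_measurable XXM" .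
    qed
    finally show ?thesis .
  qed
  also have "(\<integral>\<^sup>+c. (\<integral>\<^sup>+t. \<integral>\<^sup>+z. ennreal ((\<psi> (Jz (c, t)))\<^sup>2) * ennreal ((g (Jz (c, z)))\<^sup>2) \<partial>ZM h \<partial>ZM h) \<partial>XXM)
    = (\<integral>\<^sup>+t. \<integral>\<^sup>+z. (\<integral>\<^sup>+c. ennreal ((\<psi> (Jz (c, t)))\<^sup>2) * ennreal ((g (Jz (c, z)))\<^sup>2) \<partial>XXM) \<partial>ZM h \<partial>ZM h)"
  proof -
    have [measurable]: "(\<lambda>q. \<psi> (Jz (fst (fst q), snd (fst q)))) \<in> borel_measurable ((XXM \<Otimes>\<^sub>M ZM h) \<Otimes>\<^sub>M ZM h)"
      using measurable_compose[OF measurable_fst \<psi>J, of "ZM h"] by simp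
    have [measurable]: "(\<lambda>q. g (Jz (fst (fst q), snd q))) \<in> borel_measurable ((XXM \<Otimes>\<^sub>M ZM h) \<Otimes>\<^sub>M ZM h)"
      by (rule measurable_compose[OF _ gJ]) measurable
    have "(\<lambda>(q, z). ennreal ((\<psi> (Jz (fst q, snd q)))\<^sup>2) * ennreal ((g (Jz (fst q, z)))\<^sup>2)) \<in> borel_measurable ((XXM \<Otimes>\<^sub>M ZM h) \<Otimes>\<^sub>M ZM h)"
      unfolding split_beta' by measurable
    from Z.borel_measurable_nn_integral[OF this]
    have m1: "(\<lambda>(c, t). \<integral>\<^sup>+z. ennreal ((\<psi> (Jz (c, t)))\<^sup>2) * ennreal ((g (Jz (c, z)))\<^sup>2) \<partial>ZM h) \<in> borel_measurable (XXM \<Otimes>\<^sub>M ZM h)"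
      by (simp add: split_beta')
    have "(\<integral>\<^sup>+c. (\<integral>\<^sup>+t. \<integral>\<^sup>+z. ennreal ((\<psi> (Jz (c, t)))\<^sup>2) * ennreal ((g (Jz (c, z)))\<^sup>2) \<partial>ZM h \<partial>ZM h) \<partial>XXM)
      = (\<integral>\<^sup>+t. (\<integral>\<^sup>+c. \<integral>\<^sup>+z. ennreal ((\<psi> (Jz (c, t)))\<^sup>2) * ennreal ((g (Jz (c, z)))\<^sup>2) \<partial>ZM h \<partial>XXM) \<partial>ZM h)"
      by (rule dz.BT.Fubini'[OF m1, symmetric])
    also have "\<dots> = (\<integral>\<^sup>+t. \<integral>\<^sup>+z. (\<integral>\<^sup>+c. ennreal ((\<psi> (Jz (c, t)))\<^sup>2) * ennreal ((g (Jz (c, z)))\<^sup>2) \<partial>XXM) \<partial>ZM h \<partial>ZM h)"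
    proof (rule nn_integral_cong, rule dz.BT.Fubini'[symmetric])
      fix t assume t: "t \<in> space (ZM h)"
      have [measurable]: "(\<lambda>c. \<psi> (Jz (c, t))) \<in> borel_measurable XXM" by (rule slice_z_measurable[OF \<psi>m t])
      show "(\<lambda>(c, z). ennreal ((\<psi> (Jz (c, t)))\<^sup>2) * ennreal ((g (Jz (c, z)))\<^sup>2)) \<in> borel_measurable (XXM \<Otimes>\<^sub>M ZM h)"
        using gJ unfolding split_beta' prod.collapse by measurable
    qed
    finally show ?thesis .
  qed
  \<comment> \<open>The heights \<open>t\<close> and \<open>z\<close> are now independent. For each
    pair the horizontal integral is split into two integrals of fourth powers, whose majorants
    depend on one height each and separate.\<close>
  also have "\<dots> \<le> (\<integral>\<^sup>+t. \<integral>\<^sup>+z. \<theta> t * \<eta> z \<partial>ZM h \<partial>ZM h)"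
  proof (rule nn_integral_mono_AE)
    show "AE t in ZM h. (\<integral>\<^sup>+z. (\<integral>\<^sup>+c. ennreal ((\<psi> (Jz (c, t)))\<^sup>2) * ennreal ((g (Jz (c, z)))\<^sup>2) \<partial>XXM) \<partial>ZM h) \<le> (\<integral>\<^sup>+z. \<theta> t * \<eta> z \<partial>ZM h)"
      using f1 AE_space
    proof eventually_elim
      fix t assume t: "(\<integral>\<^sup>+q. ennreal ((\<psi> (Jz (q, t))) ^ 4) \<partial>XXM) \<le> (\<theta> t)\<^sup>2" "t \<in> space (ZM h)"
      show "(\<integral>\<^sup>+z. (\<integral>\<^sup>+c. ennreal ((\<psi> (Jz (c, t)))\<^sup>2) * ennreal ((g (Jz (c, z)))\<^sup>2) \<partial>XXM) \<partial>ZM h) \<le> (\<integral>\<^sup>+z. \<theta> t * \<eta> z \<partial>ZM h)"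
      proof (rule nn_integral_mono_AE)
        show "AE z in ZM h. (\<integral>\<^sup>+c. ennreal ((\<psi> (Jz (c, t)))\<^sup>2) * ennreal ((g (Jz (c, z)))\<^sup>2) \<partial>XXM) \<le> \<theta> t * \<eta> z"
          using g1 AE_space
        proof eventually_elim
          case (elim z)
          have mm: "(\<lambda>c. \<psi> (Jz (c, t))) \<in> borel_measurable XXM" "(\<lambda>c. g (Jz (c, z))) \<in> borel_measurable XXM"
            by (rule slice_z_measurable[OF \<psi>m t(2)]) (rule slice_z_measurable[OF gm elim(2)])
          have "(\<integral>\<^sup>+c. ennreal ((\<psi> (Jz (c, t)))\<^sup>2) * ennreal ((g (Jz (c, z)))\<^sup>2) \<partial>XXM)\<^sup>2 \<le>
             (\<integral>\<^sup>+c. (ennreal ((\<psi> (Jz (c, t)))\<^sup>2))\<^sup>2 \<partial>XXM) * (\<integral>\<^sup>+c. (ennreal ((g (Jz (c, z)))\<^sup>2))\<^sup>2 \<partial>XXM)"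
            by (rule Cauchy_Schwarz_nn_integral) (use mm in measurable)
          also have "\<dots> \<le> (\<theta> t)\<^sup>2 * (\<eta> z)\<^sup>2"
            using t(1) elim(1) by (intro mult_mono) (auto simp: ennreal_power)
          also have "\<dots> = (\<theta> t * \<eta> z)\<^sup>2" by (simp add: power_mult_distrib)
          finally show ?case by (rule ennreal_power2_le)
        qed
      qed
    qed
  qed
  also have "\<dots> = (\<integral>\<^sup>+t. \<theta> t \<partial>ZM h) * (\<integral>\<^sup>+z. \<eta> z \<partial>ZM h)"
    by (simp add: nn_integral_cmult nn_integral_multc)
  also have "\<dots> \<le> ennreal A * ennreal B" by (intro mult_mono f2 g2) auto
  finally have "(\<integral>\<^sup>+p. ennreal ((f p * g p)\<^sup>2) \<partial>Om h) \<le> ennreal h * (ennreal A * ennreal B)"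
    by (meson mult_left_mono zero_le)
  also have "\<dots> = ennreal (h * A * B)" using h A B by (simp add: ennreal_mult mult.assoc)
  finally show ?thesis .
qed

end

section \<open>Ladyzhenskaya's inequality and domination by vertical integrals\<close>

context slab
begin

text \<open>The one-dimensional bound along \<open>x\<close> majorises the square of
  \<open>g\<close> by a function \<open>P\<close> of \<open>(y, z)\<close>, the one along
  \<open>y\<close> by a function \<open>Q\<close> of \<open>(x, z)\<close>. The fourth power is at
  most \<open>P * Q\<close>, whose integral over a slice factors. Both factors are below the slice
  integral of \<open>w\<close>, which contains both horizontal derivatives and hence serves as the
  majorant.\<close>

lemma ladyzhenskaya:
  assumes wx: "dx.wd g gx" and wy: "dy.wd g gy"
    and g: "g \<in> L2 h" and gx: "gx \<in> L2 h" and gy: "gy \<in> L2 h"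
  shows "L24 g (L2_norm h g * (L2_norm h g + 2 * L2_norm h gx + 2 * L2_norm h gy))"
proof -
  have [measurable]: "g \<in> borel_measurable (Om h)" "gx \<in> borel_measurable (Om h)" "gy \<in> borel_measurable (Om h)"
    using g gx gy by (auto simp: L2_iff)
  define u where "u p = ennreal ((g p)\<^sup>2 + 2 * \<bar>g p * gx p\<bar>)" for p
  define v where "v p = ennreal ((g p)\<^sup>2 + 2 * \<bar>g p * gy p\<bar>)" for p
  define w where "w p = ennreal ((g p)\<^sup>2 + 2 * \<bar>g p * gx p\<bar> + 2 * \<bar>g p * gy p\<bar>)" for p
  have um[measurable]: "u \<in> borel_measurable (Om h)" and vm[measurable]: "v \<in> borel_measurable (Om h)"
    and wm[measurable]: "w \<in> borel_measurable (Om h)"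
    unfolding u_def v_def w_def by measurable
  define P where "P q = (\<integral>\<^sup>+x. u (Jx (q, x)) \<partial>XM)" for q
  define Q where "Q q = (\<integral>\<^sup>+y. v (Jy (q, y)) \<partial>XM)" for q
  have uJ: "(\<lambda>q. u (Jx q)) \<in> borel_measurable ((XM \<Otimes>\<^sub>M ZM h) \<Otimes>\<^sub>M XM)"
    by (rule measurable_compose[OF J_measurable(1) um])
  have vJ: "(\<lambda>q. v (Jy q)) \<in> borel_measurable ((XM \<Otimes>\<^sub>M ZM h) \<Otimes>\<^sub>M XM)"
    by (rule measurable_compose[OF J_measurable(2) vm])
  have Pm: "P \<in> borel_measurable (XM \<Otimes>\<^sub>M ZM h)" unfolding P_def
    by (rule X.borel_measurable_nn_integral) (use uJ in \<open>simp add: split_beta'\<close>)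
  have Qm: "Q \<in> borel_measurable (XM \<Otimes>\<^sub>M ZM h)" unfolding Q_def
    by (rule X.borel_measurable_nn_integral) (use vJ in \<open>simp add: split_beta'\<close>)
  have PO: "(\<lambda>p. P (snd p)) \<in> borel_measurable (Om h)"
    unfolding Om_def by (rule measurable_compose[OF measurable_snd Pm])
  have QO: "(\<lambda>p. Q (fst p, snd (snd p))) \<in> borel_measurable (Om h)"
    unfolding Om_def by (rule measurable_compose[OF _ Qm]) measurable
  have sup: "AE t in XM. ennreal ((f t)\<^sup>2) \<le> (\<integral>\<^sup>+s. ennreal ((f s)\<^sup>2 + 2 * \<bar>f s * f' s\<bar>) \<partial>XM)"
    if "X.ac True f f'" for f f'
    using X.ac_square_bound(1)[OF that]
  proof eventually_elim
    case (elim t)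
    note i = X.ac_square_bound(2,3)[OF that]
    have "(\<integral>\<^sup>+s. ennreal ((f s)\<^sup>2 + 2 * \<bar>f s * f' s\<bar>) \<partial>XM) = ennreal (\<integral>s. (f s)\<^sup>2 + 2 * \<bar>f s * f' s\<bar> \<partial>XM)"
      by (rule nn_integral_eq_integral) (use i in auto)
    also have "(\<integral>s. (f s)\<^sup>2 + 2 * \<bar>f s * f' s\<bar> \<partial>XM) = (\<integral>s. (f s)\<^sup>2 \<partial>XM) + 2 * (\<integral>s. \<bar>f s * f' s\<bar> \<partial>XM)"
      using i by simp
    finally have E: "(\<integral>\<^sup>+s. ennreal ((f s)\<^sup>2 + 2 * \<bar>f s * f' s\<bar>) \<partial>XM) =
      ennreal ((\<integral>s. (f s)\<^sup>2 \<partial>XM) + 2 * (\<integral>s. \<bar>f s * f' s\<bar> \<partial>XM))" .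
    show ?case unfolding E by (rule ennreal_leI) (use elim in simp)
  qed
  have "AE c in XM \<Otimes>\<^sub>M ZM h. AE t in XM. ennreal ((g (Jx (c, t)))\<^sup>2) \<le> P (snd (Jx (c, t)))"
    using wx unfolding dx.wd_def
  proof eventually_elim
    case (elim c)
    have "snd (Jx (c, t)) = c" for t by (simp add: Jx_def)
    then show ?case using sup[OF elim] unfolding P_def u_def by simp
  qed
  then have AP: "AE p in Om h. ennreal ((g p)\<^sup>2) \<le> P (snd p)"
    by (intro dx.AE_J_rev) (use PO in measurable)
  have "AE c in XM \<Otimes>\<^sub>M ZM h. AE t in XM. ennreal ((g (Jy (c, t)))\<^sup>2) \<le> Q (fst (Jy (c, t)), snd (snd (Jy (c, t))))"
    using wy unfolding dy.wd_def
  proof eventually_elim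
    case (elim c)
    have "(fst (Jy (c, t)), snd (snd (Jy (c, t)))) = c" for t by (simp add: Jy_def)
    then show ?case using sup[OF elim] unfolding Q_def v_def by simp
  qed
  then have AQ: "AE p in Om h. ennreal ((g p)\<^sup>2) \<le> Q (fst p, snd (snd p))"
    by (intro dy.AE_J_rev) (use QO in measurable)
  define \<theta> where "\<theta> z = (\<integral>\<^sup>+q. w (Jz (q, z)) \<partial>XXM)" for z
  have \<theta>m: "\<theta> \<in> borel_measurable (ZM h)" unfolding \<theta>_def
    by (rule sigma_finite_measure.borel_measurable_nn_integral[OF sigma_finite_XXM pair_slice_measurable[OF wm]])
  have "AE p in Om h. ennreal ((g p) ^ 4) \<le> P (snd p) * Q (fst p, snd (snd p))"
    using AP AQ
  proof eventually_elim
    case (elim p)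
    have "ennreal ((g p) ^ 4) = ennreal ((g p)\<^sup>2) * ennreal ((g p)\<^sup>2)"
      by (simp add: ennreal_mult[symmetric] flip: power_add)
    also have "\<dots> \<le> P (snd p) * Q (fst p, snd (snd p))" by (intro mult_mono elim) auto
    finally show ?case .
  qed
  from AE_z[OF this] have "AE z in ZM h. (\<integral>\<^sup>+q. ennreal ((g (Jz (q, z))) ^ 4) \<partial>XXM) \<le> (\<theta> z)\<^sup>2"
    using AE_space
  proof eventually_elim
    case (elim z)
    have Pz: "(\<lambda>y. P (y, z)) \<in> borel_measurable XM" and Qz: "(\<lambda>y. Q (y, z)) \<in> borel_measurable XM"
      by (rule measurable_compose[OF measurable_Pair2'[OF elim(2)] Pm] measurable_compose[OF measurable_Pair2'[OF elim(2)] Qm])+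
    have uz: "(\<lambda>q. u (Jz (q, z))) \<in> borel_measurable XXM" and vz: "(\<lambda>q. v (Jz (q, z))) \<in> borel_measurable XXM"
      by (rule slice_z_measurable[OF um elim(2)] slice_z_measurable[OF vm elim(2)])+
    have "(\<integral>\<^sup>+q. ennreal ((g (Jz (q, z))) ^ 4) \<partial>XXM) \<le> (\<integral>\<^sup>+q. P (snd q, z) * Q (fst q, z) \<partial>XXM)"
      by (rule nn_integral_mono_AE) (use elim(1) in \<open>simp add: Jz_def\<close>)
    also have "\<dots> = (\<integral>\<^sup>+x. \<integral>\<^sup>+y. P (y, z) * Q (x, z) \<partial>XM \<partial>XM)"
      using Pz Qz by (subst X.nn_integral_fst[symmetric]) auto
    also have "\<dots> = (\<integral>\<^sup>+y. P (y, z) \<partial>XM) * (\<integral>\<^sup>+x. Q (x, z) \<partial>XM)"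
      using Pz Qz by (simp add: nn_integral_multc nn_integral_cmult)
    also have "\<dots> \<le> \<theta> z * \<theta> z"
    proof (intro mult_mono)
      have "(\<integral>\<^sup>+y. P (y, z) \<partial>XM) = (\<integral>\<^sup>+y. \<integral>\<^sup>+x. u (Jz ((x, y), z)) \<partial>XM \<partial>XM)"
        unfolding P_def by (simp add: Jx_def Jz_def)
      also have "\<dots> = (\<integral>\<^sup>+q. u (Jz (q, z)) \<partial>XXM)"
        using uz by (subst XX.nn_integral_snd[symmetric]) auto
      also have "\<dots> \<le> \<theta> z" unfolding \<theta>_def u_def w_def by (intro nn_integral_mono ennreal_leI) auto
      finally show "(\<integral>\<^sup>+y. P (y, z) \<partial>XM) \<le> \<theta> z" .
      have "(\<integral>\<^sup>+x. Q (x, z) \<partial>XM) = (\<integral>\<^sup>+x. \<integral>\<^sup>+y. v (Jz ((x, y), z)) \<partial>XM \<partial>XM)"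
        unfolding Q_def by (simp add: Jy_def Jz_def)
      also have "\<dots> = (\<integral>\<^sup>+q. v (Jz (q, z)) \<partial>XXM)"
        using vz by (subst X.nn_integral_fst[symmetric]) auto
      also have "\<dots> \<le> \<theta> z" unfolding \<theta>_def v_def w_def by (intro nn_integral_mono ennreal_leI) auto
      finally show "(\<integral>\<^sup>+x. Q (x, z) \<partial>XM) \<le> \<theta> z" .
    qed auto
    finally show ?case by (simp add: power2_eq_square)
  qed
  moreover have "(\<integral>\<^sup>+z. \<theta> z \<partial>ZM h) \<le> ennreal (L2_norm h g * (L2_norm h g + 2 * L2_norm h gx + 2 * L2_norm h gy))"
  proof -
    have abs_L2: "(\<lambda>p. \<bar>f p\<bar>) \<in> L2 h" "L2_norm h (\<lambda>p. \<bar>f p\<bar>) = L2_norm h f" if "f \<in> L2 h" for f :: "point \<Rightarrow> real"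
      using that by (auto simp: L2_iff hperiodic_def L2_norm_eq)
    have prod: "integrable (Om h) (\<lambda>p. \<bar>g p * f p\<bar>)" "(\<integral>p. \<bar>g p * f p\<bar> \<partial>Om h) \<le> L2_norm h g * L2_norm h f"
      if f: "f \<in> L2 h" for f
      using L2_inner_integrable[OF abs_L2(1)[OF g] abs_L2(1)[OF f]] L2_Cauchy_Schwarz[OF abs_L2(1)[OF g] abs_L2(1)[OF f]]
      by (auto simp: abs_mult L2_inner_eq abs_L2[OF g] abs_L2[OF f])
    have ig: "integrable (Om h) (\<lambda>p. (g p)\<^sup>2)" "(\<integral>p. (g p)\<^sup>2 \<partial>Om h) = (L2_norm h g)\<^sup>2"
      using g by (auto simp: L2_iff L2_norm_eq)
    have "(\<integral>\<^sup>+z. \<theta> z \<partial>ZM h) = (\<integral>\<^sup>+p. w p \<partial>Om h)" unfolding \<theta>_def by (rule nn_integral_z[OF wm, symmetric])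
    also have "\<dots> = ennreal (\<integral>p. (g p)\<^sup>2 + 2 * \<bar>g p * gx p\<bar> + 2 * \<bar>g p * gy p\<bar> \<partial>Om h)"
      unfolding w_def by (rule nn_integral_eq_integral) (use ig prod(1)[OF gx] prod(1)[OF gy] in auto)
    also have "(\<integral>p. (g p)\<^sup>2 + 2 * \<bar>g p * gx p\<bar> + 2 * \<bar>g p * gy p\<bar> \<partial>Om h) =
       (L2_norm h g)\<^sup>2 + 2 * (\<integral>p. \<bar>g p * gx p\<bar> \<partial>Om h) + 2 * (\<integral>p. \<bar>g p * gy p\<bar> \<partial>Om h)"
      using ig prod(1)[OF gx] prod(1)[OF gy] by simp
    also have "ennreal \<dots> \<le> ennreal (L2_norm h g * (L2_norm h g + 2 * L2_norm h gx + 2 * L2_norm h gy))"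
      using prod(2)[OF gx] prod(2)[OF gy] by (intro ennreal_leI) (simp add: power2_eq_square distrib_left)
    finally show ?thesis .
  qed
  ultimately show ?thesis
    unfolding L24_def using \<theta>m by (auto simp: L2_norm_nonneg intro!: exI[of _ \<theta>])
qed

text \<open>The one-dimensional Sobolev inequality on vertical lines brings a factor without
  vertical integration into the form required by \<open>vertical_product_estimate\<close>, at the
  price of one vertical derivative.\<close>

lemma wd_z_dominated:
  assumes wz: "dz.wd f fz" and m: "f \<in> borel_measurable (Om h)" "fz \<in> borel_measurable (Om h)"
  shows "AE c in XXM. AE z in ZM h. ennreal \<bar>f (Jz (c, z))\<bar> \<le> (\<integral>\<^sup>+t. ennreal \<bar>(1 / h) * \<bar>f (Jz (c, t))\<bar> + \<bar>fz (Jz (c, t))\<bar>\<bar> \<partial>ZM h)"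
  using wz unfolding dz.wd_def
proof eventually_elim
  case (elim c)
  note i = Z.ac_bound(1)[OF elim] Z.acD(1)[OF elim]
  show ?case using Z.ac_bound(2)[OF elim]
  proof eventually_elim
    case (elim z)
    have "\<bar>f (Jz (c, z))\<bar> \<le> (1 / h) * (\<integral>t. \<bar>f (Jz (c, t))\<bar> \<partial>ZM h) + (\<integral>t. \<bar>fz (Jz (c, t))\<bar> \<partial>ZM h)"
      using elim h by (simp add: field_simps)
    also have "\<dots> = (\<integral>t. (1 / h) * \<bar>f (Jz (c, t))\<bar> + \<bar>fz (Jz (c, t))\<bar> \<partial>ZM h)"
      using i by simp
    also have "ennreal \<dots> = (\<integral>\<^sup>+t. ennreal \<bar>(1 / h) * \<bar>f (Jz (c, t))\<bar> + \<bar>fz (Jz (c, t))\<bar>\<bar> \<partial>ZM h)"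
      using i h by (subst nn_integral_eq_integral[symmetric]) (auto intro!: nn_integral_cong)
    finally show ?case using ennreal_leI by blast
  qed
qed

subsection \<open>The vertical primitive\<close>

text \<open>The operator that produces \<open>w(v)\<close> from the horizontal divergence, sign
  included.\<close>

definition vprim :: "(point \<Rightarrow> real) \<Rightarrow> point \<Rightarrow> real" where
  "vprim G = (\<lambda>p. - (\<integral>\<xi>. indicator {..<snd (snd p)} \<xi> * G (fst p, fst (snd p), \<xi>) \<partial>ZM h))"

lemma vprim_Jz: "vprim G (Jz (c, z)) = - Z.prim (\<lambda>\<xi>. G (Jz (c, \<xi>))) z"
  by (simp add: vprim_def Z.prim_def Jz_def)

lemma vprim_hperiodic:
  assumes "hperiodic h G" shows "hperiodic h (vprim G)"
proof -
  have "(\<integral>\<xi>. indicator {..<z} \<xi> * G (x + 1, y, \<xi>) \<partial>ZM h) = (\<integral>\<xi>. indicator {..<z} \<xi> * G (x, y, \<xi>) \<partial>ZM h)"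
    "(\<integral>\<xi>. indicator {..<z} \<xi> * G (x, y + 1, \<xi>) \<partial>ZM h) = (\<integral>\<xi>. indicator {..<z} \<xi> * G (x, y, \<xi>) \<partial>ZM h)" for x y z
    using assms by (auto intro!: Bochner_Integration.integral_cong simp: hperiodic_def)
  then show ?thesis by (simp add: hperiodic_def vprim_def)
qed

lemma vprim_measurable:
  assumes G: "G \<in> borel_measurable (Om h)" shows "vprim G \<in> borel_measurable (Om h)"
proof -
  have GJ: "(\<lambda>q. G (Jz q)) \<in> borel_measurable (XXM \<Otimes>\<^sub>M ZM h)" by (rule Jz_measurable2[OF G])
  have "(\<lambda>q. Z.prim (\<lambda>\<xi>. G (Jz (fst q, \<xi>))) (snd q)) \<in> borel_measurable (XXM \<Otimes>\<^sub>M ZM h)"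
  proof (rule Z.prim_measurable_pair)
    show "(\<lambda>(q, \<xi>). G (Jz (fst q, \<xi>))) \<in> borel_measurable ((XXM \<Otimes>\<^sub>M ZM h) \<Otimes>\<^sub>M ZM h)"
      unfolding split_beta' by (rule measurable_compose[OF _ GJ]) measurable
    show "snd \<in> borel_measurable (XXM \<Otimes>\<^sub>M ZM h)" by (rule Z.measurable_T_snd)
  qed
  then have "(\<lambda>q. vprim G (Jz q)) \<in> borel_measurable (XXM \<Otimes>\<^sub>M ZM h)"
    using vprim_Jz[of G "fst q" "snd q" for q] by simp
  from measurable_compose[OF J_measurable(6) this] show ?thesis by (simp add: J_inverse)
qed

lemma AE_slice_integrable:
  fixes G :: "point \<Rightarrow> real"
  assumes "integrable (Om h) G" shows "AE c in XXM. integrable (ZM h) (\<lambda>\<xi>. G (Jz (c, \<xi>)))"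
  using dz.BT.AE_integrable_fst'[OF dz.integrable_J[OF assms]] by simp

lemma vprim_integrable:
  assumes G: "integrable (Om h) G" shows "integrable (Om h) (vprim G)"
proof -
  have Gm: "G \<in> borel_measurable (Om h)" using G by auto
  have "integrable XXM (\<lambda>c. \<integral>\<xi>. \<bar>G (Jz (c, \<xi>))\<bar> \<partial>ZM h)"
    using dz.BT.integrable_fst'[OF dz.integrable_J[OF integrable_abs[OF G]]] by simp
  from dz.integrable_fst_B[OF this]
  have i: "integrable (XXM \<Otimes>\<^sub>M ZM h) (\<lambda>q. \<integral>\<xi>. \<bar>G (Jz (fst q, \<xi>))\<bar> \<partial>ZM h)" .
  have vm: "(\<lambda>q. vprim G (Jz q)) \<in> borel_measurable (XXM \<Otimes>\<^sub>M ZM h)" by (rule Jz_measurable2[OF vprim_measurable[OF Gm]])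
  have "integrable (XXM \<Otimes>\<^sub>M ZM h) (\<lambda>q. vprim G (Jz q))"
  proof (rule Bochner_Integration.integrable_bound[OF i vm])
    have "AE c in XXM. AE z in ZM h. norm (vprim G (Jz (c, z))) \<le> norm (\<integral>\<xi>. \<bar>G (Jz (c, \<xi>))\<bar> \<partial>ZM h)"
      using AE_slice_integrable[OF G]
      by eventually_elim (auto simp: vprim_Jz intro!: AE_I2 order_trans[OF Z.prim_bound])
    then show "AE q in XXM \<Otimes>\<^sub>M ZM h. norm (vprim G (Jz q)) \<le> norm (\<integral>\<xi>. \<bar>G (Jz (fst q, \<xi>))\<bar> \<partial>ZM h)"
      by (intro dz.BT.AE_pair_measure) (use vm i in auto)
  qed
  then have "integrable (distr (XXM \<Otimes>\<^sub>M ZM h) (Om h) Jz) (vprim G)"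
    by (subst integrable_distr_eq) (auto intro: vprim_measurable Gm)
  then show ?thesis by (simp add: distr_Jz)
qed

lemma vprim_dominated:
  assumes G: "integrable (Om h) G"
  shows "AE c in XXM. AE z in ZM h. ennreal \<bar>vprim G (Jz (c, z))\<bar> \<le> (\<integral>\<^sup>+t. ennreal \<bar>G (Jz (c, t))\<bar> \<partial>ZM h)"
  using AE_slice_integrable[OF G]
proof eventually_elim
  case (elim c)
  have "ennreal \<bar>vprim G (Jz (c, z))\<bar> \<le> ennreal (\<integral>t. \<bar>G (Jz (c, t))\<bar> \<partial>ZM h)" for z
    using Z.prim_bound[OF elim] by (intro ennreal_leI) (simp add: vprim_Jz)
  then show ?case using elim by (intro AE_I2) (simp add: nn_integral_eq_integral)
qed

lemma vprim_wd_z: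
  assumes G: "integrable (Om h) G" shows "dz.wd (vprim G) (\<lambda>p. - G p)"
  unfolding dz.wd_def using AE_slice_integrable[OF G] AE_space
proof eventually_elim
  case (elim c)
  have "Z.prim (\<lambda>t. - G (Jz (c, t))) z = - Z.prim (\<lambda>t. G (Jz (c, t))) z" for z
    unfolding Z.prim_def by simp
  moreover have "(\<lambda>t. vprim G (Jz (c, t))) \<in> borel_measurable (ZM h)"
    by (rule dz.slice_measurable[OF vprim_measurable elim(2)]) (use G in auto)
  ultimately show ?case
    unfolding Z.ac_def using elim(1) by (auto simp: vprim_Jz intro!: exI[of _ 0])
qed

text \<open>The adjoint of vertical integration from the bottom: by Fubini's theorem on the triangle
  \<open>\<xi> < z\<close> it moves the primitive from a function to the vertical factor of a test
  function.\<close>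

definition tail :: "(real \<Rightarrow> real) \<Rightarrow> real \<Rightarrow> real" where
  "tail c \<xi> = (\<integral>z. indicator {\<xi><..} z * c z \<partial>ZM h)"

lemma tail_measurable:
  assumes "sm1 c" shows "tail c \<in> borel_measurable borel"
proof -
  have [measurable]: "c \<in> borel_measurable (ZM h)"
    by (intro Z.borel_measurable_T borel_measurable_continuous_onI sm1_continuous assms)
  have [measurable]: "snd \<in> borel_measurable (borel \<Otimes>\<^sub>M ZM h)" by (rule Z.measurable_T_snd)
  have "tail c = (\<lambda>\<xi>. \<integral>z. (if \<xi> < z then 1 else 0) * c z \<partial>ZM h)"
    unfolding tail_def by (intro ext Bochner_Integration.integral_cong) (auto simp: indicator_def)
  moreover have "(\<lambda>\<xi>. \<integral>z. (if \<xi> < z then 1 else 0) * c z \<partial>ZM h) \<in> borel_measurable borel"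
  proof (rule Z.borel_measurable_lebesgue_integral)
    have "(\<lambda>q. (if fst q < snd q then 1 else 0) * c (snd q)) \<in> borel_measurable (borel \<Otimes>\<^sub>M ZM h)" by measurable
    then show "(\<lambda>(\<xi>, z). (if \<xi> < z then 1 else 0) * c z) \<in> borel_measurable (borel \<Otimes>\<^sub>M ZM h)" by (simp add: split_beta')
  qed
  ultimately show ?thesis by simp
qed

lemma tail_bound:
  assumes "sm1 c" shows "\<bar>tail c \<xi>\<bar> \<le> (\<integral>z. \<bar>c z\<bar> \<partial>ZM h)"
  unfolding tail_def
proof (rule order_trans[OF integral_abs_bound], rule integral_mono)
  have i: "integrable (ZM h) c" by (rule Z.integrable_continuous_T[OF sm1_continuous[OF assms]])
  show "integrable (ZM h) (\<lambda>z. \<bar>indicator {\<xi><..} z * c z\<bar>)"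
    by (intro integrable_abs Z.integrable_indicator_mult i) auto
  show "integrable (ZM h) (\<lambda>z. \<bar>c z\<bar>)" using i by simp
qed (auto simp: indicator_def)

lemma vprim_pairing:
  assumes a: "sm1 a" and b: "sm1 b" and c: "sm1 c" and K: "integrable (Om h) K"
  shows "(\<integral>p. tpr a b c p * vprim K p \<partial>Om h) = - (\<integral>p. tpr a b (tail c) p * K p \<partial>Om h)"
proof -
  have ab: "a \<in> borel_measurable borel" "b \<in> borel_measurable borel" "c \<in> borel_measurable borel"
    using a b c by (auto intro: borel_measurable_continuous_onI sm1_continuous)
  obtain Ka where Ka: "\<And>t. t \<in> {0..1} \<Longrightarrow> \<bar>a t\<bar> \<le> Ka" using sm1_bounded_on[OF a, of 0 1] by blast
  obtain Kb where Kb: "\<And>t. t \<in> {0..1} \<Longrightarrow> \<bar>b t\<bar> \<le> Kb" using sm1_bounded_on[OF b, of 0 1] by blast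
  obtain Kc where Kc: "\<And>t. t \<in> {-h..0} \<Longrightarrow> \<bar>c t\<bar> \<le> Kc" using sm1_bounded_on[OF c, of "-h" 0] by blast
  have int: "integrable (Om h) (\<lambda>p. tpr a b d p * f p)"
    if f: "integrable (Om h) f" and d: "d \<in> borel_measurable borel" "\<And>t. t \<in> {-h..0} \<Longrightarrow> \<bar>d t\<bar> \<le> Kd" for f d Kd
  proof (rule dx.integrable_bounded_mult[OF f tpr_measurable[OF ab(1,2) d(1)]])
    fix p assume p: "p \<in> cell h"
    show "\<bar>tpr a b d p\<bar> \<le> Ka * Kb * Kd"
      using p unfolding tpr_def split_beta' abs_mult
      by (intro mult_mono mult_nonneg_nonneg Ka Kb d) (use Ka[of 0] Kb[of 0] in \<open>auto simp: cell_def\<close>)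
  qed
  have i1: "integrable (Om h) (\<lambda>p. tpr a b c p * vprim K p)" by (rule int[OF vprim_integrable[OF K] ab(3) Kc])
  have i2: "integrable (Om h) (\<lambda>p. tpr a b (tail c) p * K p)" by (rule int[OF K tail_measurable[OF c] tail_bound[OF c]])
  have "(\<integral>p. tpr a b c p * vprim K p \<partial>Om h) = (\<integral>q. (\<integral>z. tpr a b c (Jz (q, z)) * vprim K (Jz (q, z)) \<partial>ZM h) \<partial>XXM)"
    by (rule dz.integral_iterated[OF i1])
  also have "\<dots> = (\<integral>q. - (\<integral>z. tpr a b (tail c) (Jz (q, z)) * K (Jz (q, z)) \<partial>ZM h) \<partial>XXM)"
  proof (rule Bochner_Integration.integral_cong_AE)
    show "(\<lambda>q. \<integral>z. tpr a b c (Jz (q, z)) * vprim K (Jz (q, z)) \<partial>ZM h) \<in> borel_measurable XXM"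
      using dz.BT.integrable_fst'[OF dz.integrable_J[OF i1]] by auto
    show "(\<lambda>q. - (\<integral>z. tpr a b (tail c) (Jz (q, z)) * K (Jz (q, z)) \<partial>ZM h)) \<in> borel_measurable XXM"
      using dz.BT.integrable_fst'[OF dz.integrable_J[OF i2]] by auto
    show "AE q in XXM. (\<integral>z. tpr a b c (Jz (q, z)) * vprim K (Jz (q, z)) \<partial>ZM h) =
       - (\<integral>z. tpr a b (tail c) (Jz (q, z)) * K (Jz (q, z)) \<partial>ZM h)"
      using AE_slice_integrable[OF K]
    proof eventually_elim
      case (elim q)
      interpret ZZ: pair_sigma_finite "ZM h" "ZM h" ..
      define k where "k \<xi> = K (Jz (q, \<xi>))" for \<xi>
      have k: "integrable (ZM h) k" using elim by (simp add: k_def[abs_def])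
      have km: "k \<in> borel_measurable (ZM h)" using k by auto
      have ci: "integrable (ZM h) c" by (rule Z.integrable_continuous_T[OF sm1_continuous[OF c]])
      have cm: "c \<in> borel_measurable (ZM h)" using ci by auto
      note [measurable] = km cm
      have [measurable]: "fst \<in> borel_measurable (ZM h \<Otimes>\<^sub>M ZM h)" "snd \<in> borel_measurable (ZM h \<Otimes>\<^sub>M ZM h)"
        by (rule Z.measurable_T_fst Z.measurable_T_snd)+
      have I: "integrable (ZM h \<Otimes>\<^sub>M ZM h) (\<lambda>(z, \<xi>). c z * k \<xi>)"
      proof (rule ZZ.Fubini_integrable)
        show "integrable (ZM h) (\<lambda>x. \<integral>y. norm (case (x, y) of (z, \<xi>) \<Rightarrow> c z * k \<xi>) \<partial>ZM h)"
          using ci by (simp add: abs_mult)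
        show "AE x in ZM h. integrable (ZM h) (\<lambda>y. case (x, y) of (z, \<xi>) \<Rightarrow> c z * k \<xi>)" using k by simp
      qed measurable
      have I2: "integrable (ZM h \<Otimes>\<^sub>M ZM h) (\<lambda>(z, \<xi>). (if \<xi> < z then 1 else 0) * (c z * k \<xi>))"
        by (rule Bochner_Integration.integrable_bound[OF I]) (measurable, auto)
      have "(\<integral>z. c z * Z.prim k z \<partial>ZM h) = (\<integral>z. (\<integral>\<xi>. (if \<xi> < z then 1 else 0) * (c z * k \<xi>) \<partial>ZM h) \<partial>ZM h)"
        unfolding Z.prim_def
        by (intro Bochner_Integration.integral_cong refl, simp only: integral_mult_right_zero[symmetric],
            intro Bochner_Integration.integral_cong refl, simp add: indicator_def)
      also have "\<dots> = (\<integral>\<xi>. (\<integral>z. (if \<xi> < z then 1 else 0) * (c z * k \<xi>) \<partial>ZM h) \<partial>ZM h)"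
        by (rule ZZ.Fubini_integral[OF I2, symmetric])
      also have "\<dots> = (\<integral>\<xi>. tail c \<xi> * k \<xi> \<partial>ZM h)"
        unfolding tail_def
        by (intro Bochner_Integration.integral_cong refl, simp only: integral_mult_left_zero[symmetric],
            intro Bochner_Integration.integral_cong refl, simp add: indicator_def)
      finally have *: "(\<integral>z. c z * Z.prim k z \<partial>ZM h) = (\<integral>\<xi>. tail c \<xi> * k \<xi> \<partial>ZM h)" .
      have "(\<integral>z. tpr a b c (Jz (q, z)) * vprim K (Jz (q, z)) \<partial>ZM h) = (\<integral>z. - (a (fst q) * b (snd q)) * (c z * Z.prim k z) \<partial>ZM h)"
        unfolding vprim_Jz k_def[abs_def]
        by (intro Bochner_Integration.integral_cong refl) (simp add: tpr_def Jz_def)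
      also have "\<dots> = - (a (fst q) * b (snd q)) * (\<integral>\<xi>. tail c \<xi> * k \<xi> \<partial>ZM h)"
        unfolding integral_mult_right_zero * ..
      also have "\<dots> = - (\<integral>z. tpr a b (tail c) (Jz (q, z)) * K (Jz (q, z)) \<partial>ZM h)"
      proof -
        have "(\<integral>z. tpr a b (tail c) (Jz (q, z)) * K (Jz (q, z)) \<partial>ZM h) = (\<integral>z. (a (fst q) * b (snd q)) * (tail c z * k z) \<partial>ZM h)"
          by (intro Bochner_Integration.integral_cong refl) (simp add: tpr_def Jz_def k_def)
        then show ?thesis by simp
      qed
      finally show ?case .
    qed
  qed
  also have "\<dots> = - (\<integral>p. tpr a b (tail c) p * K p \<partial>Om h)"
    unfolding dz.integral_iterated[OF i2] by simp
  finally show ?thesis .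
qed

lemma tpr_tail_bounded:
  assumes a: "sm1 a" and b: "sm1 b" and c: "sm1 c"
  obtains M where "\<And>p. p \<in> cell h \<Longrightarrow> \<bar>tpr a b (tail c) p\<bar> \<le> M"
proof -
  obtain Ka where Ka: "\<And>t. t \<in> {0..1} \<Longrightarrow> \<bar>a t\<bar> \<le> Ka" using sm1_bounded_on[OF a, of 0 1] by blast
  obtain Kb where Kb: "\<And>t. t \<in> {0..1} \<Longrightarrow> \<bar>b t\<bar> \<le> Kb" using sm1_bounded_on[OF b, of 0 1] by blast
  have "\<bar>tpr a b (tail c) p\<bar> \<le> Ka * Kb * (\<integral>z. \<bar>c z\<bar> \<partial>ZM h)" if "p \<in> cell h" for p
    using that unfolding tpr_def split_beta' abs_mult
    by (intro mult_mono mult_nonneg_nonneg Ka Kb tail_bound[OF c])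
       (use Ka[of 0] Kb[of 0] in \<open>auto simp: cell_def\<close>)
  then show thesis by (rule that)
qed

text \<open>Moving the primitive onto the test function replaces \<open>c\<close> by
  \<open>tail c\<close>, which in general does not vanish near the bottom. Integration by parts in
  \<open>x\<close> tolerates this, because the vertical factor is a mere bounded coefficient on each
  horizontal line.\<close>

lemma vprim_wd_x:
  assumes wd: "dx.wd G G'" and G: "integrable (Om h) G" "integrable (Om h) G'"
  shows "dx.wd (vprim G) (vprim G')"
proof (rule weak_imp_wd_x[OF vprim_integrable[OF G(1)] vprim_integrable[OF G(2)]])
  fix a b c assume t: "per1 a" "per1 b" "cpt h c"
  then have s: "sm1 a" "sm1 b" "sm1 c" by (auto simp: per1_def cpt_def)
  note sa = sm1_deriv[OF s(1)]
  have bm: "a \<in> borel_measurable borel" "b \<in> borel_measurable borel" "deriv a \<in> borel_measurable borel"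
    using s sa by (auto intro: borel_measurable_continuous_onI sm1_continuous)
  obtain M where M: "\<And>p. p \<in> cell h \<Longrightarrow> \<bar>tpr a b (tail c) p\<bar> \<le> M" using tpr_tail_bounded[OF s] by blast
  obtain M' where M': "\<And>p. p \<in> cell h \<Longrightarrow> \<bar>tpr (deriv a) b (tail c) p\<bar> \<le> M'" using tpr_tail_bounded[OF sa s(2,3)] by blast
  have "(\<integral>p. tpr (deriv a) b (tail c) p * G p \<partial>Om h) = - (\<integral>p. tpr a b (tail c) p * G' p \<partial>Om h)"
  proof (rule dx.wd_by_parts[OF wd G])
    show "tpr a b (tail c) \<in> borel_measurable (Om h)" "tpr (deriv a) b (tail c) \<in> borel_measurable (Om h)"
      by (intro tpr_measurable bm tail_measurable s)+
    show "\<bar>tpr a b (tail c) p\<bar> \<le> max M M'" "\<bar>tpr (deriv a) b (tail c) p\<bar> \<le> max M M'" if "p \<in> cell h" for p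
      using M[OF that] M'[OF that] by auto
    fix q :: "real \<times> real"
    show "((\<lambda>t. tpr a b (tail c) (Jx (q, t))) has_real_derivative tpr (deriv a) b (tail c) (Jx (q, t))) (at t)" for t
      unfolding tpr_def Jx_def by (cases q) (auto intro!: derivative_eq_intros sm1_has_deriv[OF s(1)])
    show "continuous_on UNIV (\<lambda>t. tpr (deriv a) b (tail c) (Jx (q, t)))"
      unfolding tpr_def Jx_def by (cases q) (auto intro!: continuous_intros sm1_continuous[OF sa])
    have "a 1 = a 0" using t(1) unfolding per1_def by (metis add_0)
    then show "tpr a b (tail c) (Jx (q, 0)) = tpr a b (tail c) (Jx (q, 1))"
      by (simp add: tpr_def Jx_def)
  qed (rule disjI1 TrueI)+
  then show "(\<integral>p. tpr (deriv a) b c p * vprim G p \<partial>Om h) = - (\<integral>p. tpr a b c p * vprim G' p \<partial>Om h)"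
    by (simp add: vprim_pairing[OF sa s(2,3) G(1)] vprim_pairing[OF s G(2)])
qed

lemma vprim_wd_y:
  assumes wd: "dy.wd G G'" and G: "integrable (Om h) G" "integrable (Om h) G'"
  shows "dy.wd (vprim G) (vprim G')"
proof (rule weak_imp_wd_y[OF vprim_integrable[OF G(1)] vprim_integrable[OF G(2)]])
  fix a b c assume t: "per1 a" "per1 b" "cpt h c"
  then have s: "sm1 a" "sm1 b" "sm1 c" by (auto simp: per1_def cpt_def)
  note sb = sm1_deriv[OF s(2)]
  have bm: "a \<in> borel_measurable borel" "b \<in> borel_measurable borel" "deriv b \<in> borel_measurable borel"
    using s sb by (auto intro: borel_measurable_continuous_onI sm1_continuous)
  obtain M where M: "\<And>p. p \<in> cell h \<Longrightarrow> \<bar>tpr a b (tail c) p\<bar> \<le> M" using tpr_tail_bounded[OF s] by blast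
  obtain M' where M': "\<And>p. p \<in> cell h \<Longrightarrow> \<bar>tpr a (deriv b) (tail c) p\<bar> \<le> M'" using tpr_tail_bounded[OF s(1) sb s(3)] by blast
  have "(\<integral>p. tpr a (deriv b) (tail c) p * G p \<partial>Om h) = - (\<integral>p. tpr a b (tail c) p * G' p \<partial>Om h)"
  proof (rule dy.wd_by_parts[OF wd G])
    show "tpr a b (tail c) \<in> borel_measurable (Om h)" "tpr a (deriv b) (tail c) \<in> borel_measurable (Om h)"
      by (intro tpr_measurable bm tail_measurable s)+
    show "\<bar>tpr a b (tail c) p\<bar> \<le> max M M'" "\<bar>tpr a (deriv b) (tail c) p\<bar> \<le> max M M'" if "p \<in> cell h" for p
      using M[OF that] M'[OF that] by auto
    fix q :: "real \<times> real"
    show "((\<lambda>t. tpr a b (tail c) (Jy (q, t))) has_real_derivative tpr a (deriv b) (tail c) (Jy (q, t))) (at t)" for t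
      unfolding tpr_def Jy_def by (cases q) (auto intro!: derivative_eq_intros sm1_has_deriv[OF s(2)])
    show "continuous_on UNIV (\<lambda>t. tpr a (deriv b) (tail c) (Jy (q, t)))"
      unfolding tpr_def Jy_def by (cases q) (auto intro!: continuous_intros sm1_continuous[OF sb])
    have "b 1 = b 0" using t(2) unfolding per1_def by (metis add_0)
    then show "tpr a b (tail c) (Jy (q, 0)) = tpr a b (tail c) (Jy (q, 1))"
      by (simp add: tpr_def Jy_def)
  qed (rule disjI1 TrueI)+
  then show "(\<integral>p. tpr a (deriv b) c p * vprim G p \<partial>Om h) = - (\<integral>p. tpr a b c p * vprim G' p \<partial>Om h)"
    by (simp add: vprim_pairing[OF s(1) sb s(3) G(1)] vprim_pairing[OF s G(2)])
qed

end

subsection \<open>The fractional Sobolev embedding on dyadic cells\<close>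

text \<open>\<open>k n p q\<close> is to be read as the indicator that \<open>p\<close> and
  \<open>q\<close> lie in the same dyadic square of level \<open>n\<close>. The axioms describe
  nested equivalence relations whose classes have mass \<open>4^-n\<close>, starting from a single
  class; the embedding uses nothing else about the squares.\<close>

locale dyadic = sigma_finite_measure M for M :: "'a measure" +
  fixes k :: "nat \<Rightarrow> 'a \<Rightarrow> 'a \<Rightarrow> ennreal"
  assumes k_meas: "\<And>n. case_prod (k n) \<in> borel_measurable (M \<Otimes>\<^sub>M M)"
    and k_01: "\<And>n p q. k n p q = 0 \<or> k n p q = 1"
    and k_Suc: "\<And>n p q. k (Suc n) p q \<noteq> 0 \<Longrightarrow> k n p q \<noteq> 0"
    and k_sym: "\<And>n p q. k n p q = k n q p"
    and k_trans: "\<And>n p q s. k n p q \<noteq> 0 \<Longrightarrow> k n p s = k n q s"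
    and k_mass: "\<And>n p. p \<in> space M \<Longrightarrow> (\<integral>\<^sup>+q. k n p q \<partial>M) = ennreal ((1/4) ^ n)"
    and k_0: "\<And>p q. p \<in> space M \<Longrightarrow> q \<in> space M \<Longrightarrow> k 0 p q = 1"
begin

lemma k_slice: "p \<in> space M \<Longrightarrow> k n p \<in> borel_measurable M"
  using measurable_compose[OF measurable_Pair1' k_meas[of n]] by simp

lemma k_square: "k n p q * k n p q = k n p q"
  using k_01[of n p q] by auto

lemma k_le_1: "k n p q \<le> 1"
  using k_01[of n p q] by auto

definition avg :: "nat \<Rightarrow> ('a \<Rightarrow> ennreal) \<Rightarrow> 'a \<Rightarrow> ennreal" where
  "avg n f p = ennreal (4 ^ n) * (\<integral>\<^sup>+q. k n p q * f q \<partial>M)"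

lemma four_pow: "ennreal (4 ^ n) * ennreal ((1/4) ^ n) = 1"
  by (simp add: ennreal_mult[symmetric] power_mult_distrib[symmetric])

lemma avg_const: "p \<in> space M \<Longrightarrow> avg n (\<lambda>q. c) p = c"
  using four_pow[of n] by (simp add: avg_def nn_integral_multc k_slice k_mass mult.assoc[symmetric])

lemma avg_add:
  assumes "f \<in> borel_measurable M" "g \<in> borel_measurable M" "p \<in> space M"
  shows "avg n (\<lambda>q. f q + g q) p = avg n f p + avg n g p"
  using assms k_slice[OF assms(3), of n] by (simp add: avg_def distrib_left nn_integral_add)

lemma avg_mono:
  assumes "\<And>q. q \<in> space M \<Longrightarrow> k n p q \<noteq> 0 \<Longrightarrow> f q \<le> g q" shows "avg n f p \<le> avg n g p"
proof -
  have "k n p q * f q \<le> k n p q * g q" if "q \<in> space M" for q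
    using assms[OF that] k_01[of n p q] by auto
  then have "(\<integral>\<^sup>+q. k n p q * f q \<partial>M) \<le> (\<integral>\<^sup>+q. k n p q * g q \<partial>M)" by (rule nn_integral_mono)
  then show ?thesis unfolding avg_def by (rule mult_left_mono) simp
qed

lemma avg_cong_cell: "k n p q \<noteq> 0 \<Longrightarrow> avg n f p = avg n f q"
  using k_trans[of n p q] by (simp add: avg_def)

lemma avg_square_le:
  assumes f: "f \<in> borel_measurable M" and p: "p \<in> space M"
  shows "(avg n f p)\<^sup>2 \<le> avg n (\<lambda>q. (f q)\<^sup>2) p"
proof -
  note [measurable] = k_slice[OF p] f
  have "(\<integral>\<^sup>+q. k n p q * (k n p q * f q) \<partial>M)\<^sup>2 \<le> (\<integral>\<^sup>+q. (k n p q)\<^sup>2 \<partial>M) * (\<integral>\<^sup>+q. (k n p q * f q)\<^sup>2 \<partial>M)"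
    by (rule Cauchy_Schwarz_nn_integral) measurable
  also have "\<dots> = ennreal ((1/4) ^ n) * (\<integral>\<^sup>+q. k n p q * (f q)\<^sup>2 \<partial>M)"
  proof -
    have "(k n p q * f q)\<^sup>2 = k n p q * (f q)\<^sup>2" "(k n p q)\<^sup>2 = k n p q" for q
      using k_01[of n p q] by auto
    then show ?thesis by (simp add: k_mass[OF p])
  qed
  finally have "(\<integral>\<^sup>+q. k n p q * f q \<partial>M)\<^sup>2 \<le> ennreal ((1/4) ^ n) * (\<integral>\<^sup>+q. k n p q * (f q)\<^sup>2 \<partial>M)"
    by (simp add: mult.assoc[symmetric] k_square)
  then have "(ennreal (4 ^ n))\<^sup>2 * (\<integral>\<^sup>+q. k n p q * f q \<partial>M)\<^sup>2 \<le>
      (ennreal (4 ^ n))\<^sup>2 * (ennreal ((1/4) ^ n) * (\<integral>\<^sup>+q. k n p q * (f q)\<^sup>2 \<partial>M))"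
    by (intro mult_left_mono) auto
  also have "\<dots> = ennreal (4 ^ n) * (ennreal (4 ^ n) * ennreal ((1/4) ^ n)) * (\<integral>\<^sup>+q. k n p q * (f q)\<^sup>2 \<partial>M)"
    by (simp add: power2_eq_square mult.assoc)
  finally show ?thesis by (simp add: avg_def power_mult_distrib four_pow)
qed

lemma avg_le_integral:
  assumes "f \<in> borel_measurable M" shows "avg n f p \<le> ennreal (4 ^ n) * (\<integral>\<^sup>+q. f q \<partial>M)"
proof -
  have "k n p q * f q \<le> f q" for q using mult_right_mono[OF k_le_1[of n p q], of "f q"] by simp
  then have "(\<integral>\<^sup>+q. k n p q * f q \<partial>M) \<le> (\<integral>\<^sup>+q. f q \<partial>M)" by (intro nn_integral_mono)
  then show ?thesis unfolding avg_def by (rule mult_left_mono) simp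
qed

text \<open>The dyadic level depends on the point: it balances the average against the oscillation.\<close>

lemma pointwise_choice:
  fixes g L d :: real
  assumes le: "\<And>n. g\<^sup>2 \<le> 2 * (2 ^ n * L\<^sup>2 + d / 2 ^ n)" and L: "L \<ge> 0" and d: "d \<ge> 0"
  shows "g ^ 4 \<le> 40 * (L\<^sup>2 * d) + 16 * L ^ 4"
proof -
  have g4: "g ^ 4 = (g\<^sup>2)\<^sup>2" by simp
  consider "d \<le> L\<^sup>2" | "d > L\<^sup>2" "L = 0" | "d > L\<^sup>2" "L > 0" using L by linarith
  then show ?thesis
  proof cases
    case 1
    then have "g\<^sup>2 \<le> 4 * L\<^sup>2" using le[of 0] by simp
    then have "(g\<^sup>2)\<^sup>2 \<le> (4 * L\<^sup>2)\<^sup>2" by (intro power_mono) auto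
    also have "(4 * L\<^sup>2)\<^sup>2 = 16 * L ^ 4" by (simp add: power_mult_distrib)
    finally have "g ^ 4 \<le> 16 * L ^ 4" unfolding g4 .
    moreover have "0 \<le> 40 * (L\<^sup>2 * d)" using d by simp
    ultimately show ?thesis by linarith
  next
    \<comment> \<open>Without the growing term every level is admissible, and the oscillation term
      tends to zero as \<open>n\<close> grows.\<close>
    case 2
    have "g\<^sup>2 \<le> 0"
    proof (rule ccontr)
      assume "\<not> g\<^sup>2 \<le> 0"
      then have pos: "g\<^sup>2 > 0" by simp
      obtain n where n: "2 * d / g\<^sup>2 < 2 ^ n" using real_arch_pow[of 2 "2 * d / g\<^sup>2"] by auto
      then have "2 * d < 2 ^ n * g\<^sup>2" using pos by (simp add: field_simps)
      moreover have "g\<^sup>2 * 2 ^ n \<le> 2 * d" using le[of n] 2 by (simp add: field_simps)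
      ultimately show False by (simp add: mult.commute)
    qed
    then show ?thesis using d by simp
  next
    case 3
    have ex: "\<exists>n. d < 4 ^ n * L\<^sup>2"
    proof -
      obtain n where "d / L\<^sup>2 < 4 ^ n" using real_arch_pow[of 4 "d / L\<^sup>2"] by auto
      then show ?thesis using 3 by (auto simp: field_simps)
    qed
    \<comment> \<open>The first level at which \<open>4^n * L^2\<close> exceeds \<open>d\<close>. It
      is positive because \<open>d > L^2\<close>, and at its predecessor \<open>m\<close> the two
      terms of the hypothesis agree up to a factor 4.\<close>
    define N where "N = (LEAST n. d < 4 ^ n * L\<^sup>2)"
    have N: "d < 4 ^ N * L\<^sup>2" unfolding N_def using ex by (rule LeastI_ex)
    have "N \<noteq> 0" using N 3 by (cases N) auto
    then obtain m where m: "N = Suc m" using not0_implies_Suc by blast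
    have lo: "4 ^ m * L\<^sup>2 \<le> d" using not_less_Least[of m "\<lambda>n. d < 4 ^ n * L\<^sup>2"] by (simp add: N_def[symmetric] m)
    have hi: "d < 4 * 4 ^ m * L\<^sup>2" using N by (simp add: m)
    have "(g\<^sup>2)\<^sup>2 \<le> (2 * (2 ^ m * L\<^sup>2 + d / 2 ^ m))\<^sup>2" using le[of m] by (intro power_mono) auto
    also have "\<dots> = 4 * (2 ^ m * L\<^sup>2 + d / 2 ^ m)\<^sup>2" unfolding power_mult_distrib[of 2] by simp
    also have "\<dots> \<le> 4 * (2 * ((2 ^ m * L\<^sup>2)\<^sup>2 + (d / 2 ^ m)\<^sup>2))"
      using sum_squares_bound[of "2 ^ m * L\<^sup>2" "d / 2 ^ m"] by (intro mult_left_mono) (auto simp: power2_sum)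
    also have "(2 ^ m * L\<^sup>2)\<^sup>2 = (4 ^ m * L\<^sup>2) * L\<^sup>2"
      by (simp add: power_mult_distrib power2_eq_square power_mult[symmetric] flip: power_mult_distrib)
    also have "(d / 2 ^ m)\<^sup>2 = d * d / 4 ^ m" by (simp add: power_divide power2_eq_square flip: power_mult_distrib)
    also have "4 * (2 * ((4 ^ m * L\<^sup>2) * L\<^sup>2 + d * d / 4 ^ m)) \<le> 4 * (2 * (d * L\<^sup>2 + d * (4 * L\<^sup>2)))"
    proof (intro mult_left_mono add_mono)
      show "4 ^ m * L\<^sup>2 * L\<^sup>2 \<le> d * L\<^sup>2" using lo by (intro mult_right_mono) auto
      have "d * d / 4 ^ m \<le> d * (4 * 4 ^ m * L\<^sup>2) / 4 ^ m"
        using hi d by (intro divide_right_mono mult_left_mono) auto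
      then show "d * d / 4 ^ m \<le> d * (4 * L\<^sup>2)" by simp
    qed auto
    finally have "g ^ 4 \<le> 40 * (L\<^sup>2 * d)" unfolding g4 by (simp add: mult.commute)
    moreover have "0 \<le> 16 * L ^ 4" by simp
    ultimately show ?thesis by linarith
  qed
qed

text \<open>The embedding of order 1/2 into the fourth power in dimension two. \<open>A\<close> is
  the dyadic form of the squared seminorm, whose kernel is the inverse third power of the distance,
  that is \<open>8^n\<close> at level \<open>n\<close>. The averages \<open>U n\<close> grow at most
  like \<open>2^(n/2)\<close>, the deviations from them are controlled by the level sum
  \<open>D\<close>, whose integral is \<open>A\<close>; \<open>pointwise_choice\<close> combines
  both into a bound that is linear in \<open>D\<close> and can be integrated.\<close>

lemma L4_bound:
  assumes g[measurable]: "g \<in> borel_measurable M"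
  defines "A \<equiv> (\<Sum>n. ennreal (8 ^ n) * (\<integral>\<^sup>+p. \<integral>\<^sup>+q. k n p q * ennreal ((g p - g q)\<^sup>2) \<partial>M \<partial>M))"
    and "B \<equiv> (\<integral>\<^sup>+p. ennreal ((g p)\<^sup>2) \<partial>M)"
  shows "(\<integral>\<^sup>+p. ennreal ((g p) ^ 4) \<partial>M) \<le> (210 * (B + A))\<^sup>2"
proof (cases "A = \<infinity> \<or> B = \<infinity>")
  case True
  then show ?thesis by (auto simp: ennreal_mult_eq_top_iff power2_eq_square)
next
  case False
  obtain \<alpha> where \<alpha>: "A = ennreal \<alpha>" "\<alpha> \<ge> 0" using False by (cases A) auto
  obtain \<beta> where \<beta>: "B = ennreal \<beta>" "\<beta> \<ge> 0" using False by (cases B) auto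
  define U where "U n p = avg n (\<lambda>q. ennreal \<bar>g q\<bar>) p" for n p
  define W where "W n p = avg n (\<lambda>q. ennreal \<bar>g p - g q\<bar>) p" for n p
  define V where "V n p = avg n (\<lambda>q. ennreal ((g p - g q)\<^sup>2)) p" for n p
  have km[measurable]: "(\<lambda>x. k n (fst x) (snd x)) \<in> borel_measurable (M \<Otimes>\<^sub>M M)" for n
    using k_meas[of n] by (simp add: split_beta')
  have gm[measurable]: "(\<lambda>x. g (fst x)) \<in> borel_measurable (M \<Otimes>\<^sub>M M)" "(\<lambda>x. g (snd x)) \<in> borel_measurable (M \<Otimes>\<^sub>M M)"
    by (rule measurable_compose[OF measurable_fst g] measurable_compose[OF measurable_snd g])+
  have Wm[measurable]: "W n \<in> borel_measurable M" for n
    unfolding W_def avg_def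
    by (intro borel_measurable_times_ennreal borel_measurable_const borel_measurable_nn_integral) (simp add: split_beta')
  have Im: "(\<lambda>p. \<integral>\<^sup>+q. k n p q * ennreal ((g p - g q)\<^sup>2) \<partial>M) \<in> borel_measurable M" for n
    by (intro borel_measurable_nn_integral) (simp add: split_beta')
  then have Vm[measurable]: "V n \<in> borel_measurable M" for n
    unfolding V_def avg_def by (intro borel_measurable_times_ennreal borel_measurable_const)
  have WV: "(W n p)\<^sup>2 \<le> V n p" if "p \<in> space M" for n p
    using avg_square_le[of "\<lambda>q. ennreal \<bar>g p - g q\<bar>" p n] that by (simp add: W_def V_def ennreal_power)
  have tri: "ennreal \<bar>g p\<bar> \<le> U n p + W n p" if p: "p \<in> space M" for n p
  proof -
    have "ennreal \<bar>g p\<bar> = avg n (\<lambda>q. ennreal \<bar>g p\<bar>) p" by (simp add: avg_const p)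
    also have "\<dots> \<le> avg n (\<lambda>q. ennreal \<bar>g q\<bar> + ennreal \<bar>g p - g q\<bar>) p"
      by (rule avg_mono) (simp add: ennreal_leI flip: ennreal_plus)
    also have "\<dots> = U n p + W n p" unfolding U_def W_def by (rule avg_add) (use p in auto)
    finally show ?thesis .
  qed
  define D where "D p = (\<Sum>n. ennreal (2 ^ n) * V n p)" for p
  have VI: "(\<integral>\<^sup>+p. ennreal (2 ^ n) * V n p \<partial>M) = ennreal (8 ^ n) * (\<integral>\<^sup>+p. \<integral>\<^sup>+q. k n p q * ennreal ((g p - g q)\<^sup>2) \<partial>M \<partial>M)" for n
    unfolding V_def avg_def using Im[of n]
    by (simp add: nn_integral_cmult mult.assoc[symmetric] ennreal_mult[symmetric] flip: power_mult_distrib)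
  have DI: "(\<integral>\<^sup>+p. D p \<partial>M) = ennreal \<alpha>"
    unfolding D_def \<alpha>(1)[symmetric] A_def by (subst nn_integral_suminf) (auto simp: VI)
  have V_le: "(\<integral>\<^sup>+p. V n p \<partial>M) \<le> ennreal (\<alpha> / 2 ^ n)" for n
  proof -
    have "ennreal (2 ^ n) * V n p \<le> D p" for p
    proof -
      have "sum (\<lambda>n. ennreal (2 ^ n) * V n p) {n} \<le> D p" unfolding D_def by (rule sum_le_suminf) auto
      then show ?thesis by simp
    qed
    then have "(\<integral>\<^sup>+p. ennreal (2 ^ n) * V n p \<partial>M) \<le> ennreal \<alpha>" unfolding DI[symmetric] by (intro nn_integral_mono)
    then have "ennreal (2 ^ n) * (\<integral>\<^sup>+p. V n p \<partial>M) \<le> ennreal \<alpha>" by (simp add: nn_integral_cmult)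
    then have "ennreal (1 / 2 ^ n) * (ennreal (2 ^ n) * (\<integral>\<^sup>+p. V n p \<partial>M)) \<le> ennreal (1 / 2 ^ n) * ennreal \<alpha>"
      by (rule mult_left_mono) simp
    moreover have "ennreal (1 / 2 ^ n) * (ennreal (2 ^ n) * (\<integral>\<^sup>+p. V n p \<partial>M)) = (\<integral>\<^sup>+p. V n p \<partial>M)"
      by (simp add: mult.assoc[symmetric] ennreal_mult[symmetric])
    moreover have "ennreal (1 / 2 ^ n) * ennreal \<alpha> = ennreal (\<alpha> / 2 ^ n)" using \<alpha>(2) by (simp add: ennreal_mult[symmetric])
    ultimately show ?thesis by simp
  qed
  \<comment> \<open>The average of level \<open>n\<close> is constant on its cell, which contains
    the finer cell. Hence the finer average exceeds it by at most the mean of the oscillation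
    \<open>W n\<close>, estimated by Jensen's inequality and the mass of the finer cell.\<close>
  have U_step: "U (Suc n) p \<le> U n p + ennreal (2 * sqrt (2 ^ n * \<alpha>))" if p: "p \<in> space M" for n p
  proof -
    have "U (Suc n) p \<le> avg (Suc n) (\<lambda>q. U n p + W n q) p"
      unfolding U_def
    proof (rule avg_mono)
      fix q assume q: "q \<in> space M" "k (Suc n) p q \<noteq> 0"
      have "avg n (\<lambda>q. ennreal \<bar>g q\<bar>) p = avg n (\<lambda>q. ennreal \<bar>g q\<bar>) q" by (rule avg_cong_cell[OF k_Suc[OF q(2)]])
      then show "ennreal \<bar>g q\<bar> \<le> avg n (\<lambda>q. ennreal \<bar>g q\<bar>) p + W n q" using tri[OF q(1), of n] by (simp add: U_def)
    qed
    also have "\<dots> = U n p + avg (Suc n) (W n) p"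
      by (subst avg_add) (auto simp: p avg_const)
    also have "avg (Suc n) (W n) p \<le> ennreal (2 * sqrt (2 ^ n * \<alpha>))"
    proof (rule ennreal_square_le_imp_le)
      have "(avg (Suc n) (W n) p)\<^sup>2 \<le> avg (Suc n) (\<lambda>q. (W n q)\<^sup>2) p" by (rule avg_square_le[OF Wm p])
      also have "\<dots> \<le> avg (Suc n) (V n) p" by (rule avg_mono) (rule WV)
      also have "\<dots> \<le> ennreal (4 ^ Suc n) * (\<integral>\<^sup>+q. V n q \<partial>M)" by (rule avg_le_integral[OF Vm])
      also have "\<dots> \<le> ennreal (4 ^ Suc n) * ennreal (\<alpha> / 2 ^ n)" by (intro mult_left_mono V_le) auto
      also have "\<dots> = ennreal (4 ^ Suc n * (\<alpha> / 2 ^ n))" using \<alpha>(2) by (intro ennreal_mult[symmetric]) auto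
      also have "4 ^ Suc n * (\<alpha> / 2 ^ n) = (2 * sqrt (2 ^ n * \<alpha>))\<^sup>2"
      proof -
        have "(4::real) ^ n = 2 ^ n * 2 ^ n" by (simp flip: power_mult_distrib)
        then show ?thesis using \<alpha>(2) by (simp add: power_mult_distrib)
      qed
      finally show "(avg (Suc n) (W n) p)\<^sup>2 \<le> (ennreal (2 * sqrt (2 ^ n * \<alpha>)))\<^sup>2" using \<alpha>(2) by (simp add: ennreal_power)
    qed (use \<alpha> in simp)
    finally show ?thesis by (simp add: add_left_mono)
  qed
  \<comment> \<open>The factor 5 gives \<open>2 * sqrt \<alpha> \<le> (2/5) * L\<close>, so one step
    multiplies the bound by at most 7/5, which is below \<open>sqrt 2\<close>.\<close>
  define L where "L = sqrt \<beta> + 5 * sqrt \<alpha>"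
  have L: "L \<ge> 0" using \<alpha> \<beta> by (simp add: L_def)
  have U_le: "U n p \<le> ennreal (sqrt (2 ^ n) * L)" if p: "p \<in> space M" for n p
  proof (induction n)
    case 0
    have "U 0 p \<le> ennreal (sqrt \<beta>)"
    proof (rule ennreal_square_le_imp_le)
      have "(U 0 p)\<^sup>2 \<le> avg 0 (\<lambda>q. (ennreal \<bar>g q\<bar>)\<^sup>2) p" unfolding U_def by (rule avg_square_le) (use p in auto)
      also have "\<dots> = B" using p by (simp add: avg_def k_0 B_def ennreal_power cong: nn_integral_cong)
      finally show "(U 0 p)\<^sup>2 \<le> (ennreal (sqrt \<beta>))\<^sup>2" using \<beta> by (simp add: ennreal_power)
    qed (use \<beta> in simp)
    also have "\<dots> \<le> ennreal (sqrt (2 ^ 0) * L)" using \<alpha> by (intro ennreal_leI) (simp add: L_def)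
    finally show ?case .
  next
    case (Suc n)
    have "U (Suc n) p \<le> ennreal (sqrt (2 ^ n) * L) + ennreal (2 * sqrt (2 ^ n * \<alpha>))"
      using U_step[OF p, of n] Suc by (meson add_right_mono order_trans)
    also have "\<dots> = ennreal (sqrt (2 ^ n) * L + 2 * sqrt (2 ^ n * \<alpha>))" using L \<alpha> by (simp add: ennreal_plus)
    also have "\<dots> \<le> ennreal (sqrt (2 ^ Suc n) * L)"
    proof (rule ennreal_leI)
      have s2: "sqrt 2 \<ge> 7 / 5" by (rule real_le_rsqrt) (simp add: power2_eq_square)
      have "2 * sqrt \<alpha> \<le> (2/5) * L" using \<alpha> \<beta> by (simp add: L_def)
      then have "L + 2 * sqrt \<alpha> \<le> (7/5) * L" by simp
      also have "\<dots> \<le> sqrt 2 * L" using s2 L by (intro mult_right_mono)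
      finally have "sqrt (2 ^ n) * (L + 2 * sqrt \<alpha>) \<le> sqrt (2 ^ n) * (sqrt 2 * L)" by (intro mult_left_mono) auto
      then show "sqrt (2 ^ n) * L + 2 * sqrt (2 ^ n * \<alpha>) \<le> sqrt (2 ^ Suc n) * L"
        by (simp add: real_sqrt_mult algebra_simps)
    qed
    finally show ?case .
  qed
  have "AE p in M. D p \<noteq> \<infinity>"
    by (rule nn_integral_PInf_AE) (auto simp: D_def[abs_def] DI[unfolded D_def])
  then have "AE p in M. ennreal ((g p) ^ 4) \<le> ennreal (40 * L\<^sup>2) * D p + ennreal (16 * L ^ 4)"
    using AE_space
  proof eventually_elim
    case (elim p)
    then obtain d where d: "D p = ennreal d" "d \<ge> 0" by (cases "D p") auto
    have "(g p)\<^sup>2 \<le> 2 * (2 ^ n * L\<^sup>2 + d / 2 ^ n)" for n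
    proof -
      have "sum (\<lambda>n. ennreal (2 ^ n) * V n p) {n} \<le> D p" unfolding D_def by (rule sum_le_suminf) auto
      then have "ennreal (2 ^ n) * V n p \<le> ennreal d" by (simp add: d)
      then have "ennreal (1 / 2 ^ n) * (ennreal (2 ^ n) * V n p) \<le> ennreal (1 / 2 ^ n) * ennreal d"
        by (rule mult_left_mono) simp
      moreover have "ennreal (1 / 2 ^ n) * (ennreal (2 ^ n) * V n p) = V n p"
        by (simp add: mult.assoc[symmetric] ennreal_mult[symmetric])
      moreover have "ennreal (1 / 2 ^ n) * ennreal d = ennreal (d / 2 ^ n)" using d by (simp add: ennreal_mult[symmetric])
      ultimately have V: "V n p \<le> ennreal (d / 2 ^ n)" by simp
      have "W n p \<le> ennreal (sqrt (d / 2 ^ n))"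
        by (rule ennreal_square_le_imp_le) (use order_trans[OF WV[OF elim(2), of n] V] d in \<open>auto simp: ennreal_power\<close>)
      then have "ennreal \<bar>g p\<bar> \<le> ennreal (sqrt (2 ^ n) * L) + ennreal (sqrt (d / 2 ^ n))"
        using tri[OF elim(2), of n] U_le[OF elim(2), of n] by (meson add_mono order_trans)
      also have "\<dots> = ennreal (sqrt (2 ^ n) * L + sqrt (d / 2 ^ n))" using L d by (simp add: ennreal_plus)
      finally have "\<bar>g p\<bar> \<le> sqrt (2 ^ n) * L + sqrt (d / 2 ^ n)" using L d by (subst (asm) ennreal_le_iff) auto
      then have "\<bar>g p\<bar>\<^sup>2 \<le> (sqrt (2 ^ n) * L + sqrt (d / 2 ^ n))\<^sup>2" by (intro power_mono) auto
      also have "\<dots> \<le> 2 * ((sqrt (2 ^ n) * L)\<^sup>2 + (sqrt (d / 2 ^ n))\<^sup>2)"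
        using sum_squares_bound[of "sqrt (2 ^ n) * L" "sqrt (d / 2 ^ n)"] by (simp add: power2_sum)
      also have "\<dots> = 2 * (2 ^ n * L\<^sup>2 + d / 2 ^ n)" using d by (simp add: power_mult_distrib)
      finally show ?thesis by simp
    qed
    from pointwise_choice[OF this L d(2)] have "ennreal ((g p) ^ 4) \<le> ennreal (40 * (L\<^sup>2 * d) + 16 * L ^ 4)"
      by (rule ennreal_leI)
    also have "\<dots> = ennreal (40 * L\<^sup>2) * D p + ennreal (16 * L ^ 4)"
      using d L by (simp add: ennreal_plus ennreal_mult[symmetric] mult.assoc)
    finally show ?case .
  qed
  then have "(\<integral>\<^sup>+p. ennreal ((g p) ^ 4) \<partial>M) \<le> (\<integral>\<^sup>+p. ennreal (40 * L\<^sup>2) * D p + ennreal (16 * L ^ 4) \<partial>M)"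
    by (rule nn_integral_mono_AE)
  also have "\<dots> = ennreal (40 * L\<^sup>2) * ennreal \<alpha> + ennreal (16 * L ^ 4) * emeasure M (space M)"
    unfolding DI[symmetric] by (subst nn_integral_add) (auto simp: nn_integral_cmult D_def[abs_def])
  also have "\<dots> \<le> ennreal (40 * L\<^sup>2) * ennreal \<alpha> + ennreal (16 * L ^ 4)"
  proof -
    have "emeasure M (space M) \<le> 1"
    proof (cases "space M = {}")
      case False
      then obtain p where "p \<in> space M" by auto
      from k_mass[OF this, of 0] show ?thesis using \<open>p \<in> space M\<close> by (simp add: k_0 cong: nn_integral_cong)
    qed simp
    from mult_left_mono[OF this, of "ennreal (16 * L ^ 4)"] show ?thesis by (simp add: add_left_mono)
  qed
  also have "\<dots> = ennreal (40 * L\<^sup>2 * \<alpha> + 16 * L ^ 4)" using L \<alpha> by (simp add: ennreal_plus ennreal_mult)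
  \<comment> \<open>With \<open>L^2 \<le> 50 * (\<beta> + \<alpha>)\<close> the two terms contribute
    \<open>40 * 50\<close> and \<open>16 * 50^2\<close>, in total 42000, which is below
    \<open>210^2\<close>.\<close>
  also have "\<dots> \<le> ennreal ((210 * (\<beta> + \<alpha>))\<^sup>2)"
  proof (rule ennreal_leI)
    have "L\<^sup>2 \<le> 2 * ((sqrt \<beta>)\<^sup>2 + (5 * sqrt \<alpha>)\<^sup>2)"
      unfolding L_def using sum_squares_bound[of "sqrt \<beta>" "5 * sqrt \<alpha>"] by (simp add: power2_sum)
    also have "\<dots> \<le> 50 * (\<beta> + \<alpha>)" using \<alpha> \<beta> by (simp add: power_mult_distrib)
    finally have L2: "L\<^sup>2 \<le> 50 * (\<beta> + \<alpha>)" .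
    have "40 * L\<^sup>2 * \<alpha> \<le> 40 * (50 * (\<beta> + \<alpha>)) * (\<beta> + \<alpha>)"
      using L2 \<alpha> \<beta> by (intro mult_mono) auto
    moreover have "16 * (L\<^sup>2)\<^sup>2 \<le> 16 * (50 * (\<beta> + \<alpha>))\<^sup>2"
      using L2 by (intro mult_left_mono power_mono) auto
    moreover have "40 * (50 * (\<beta> + \<alpha>)) * (\<beta> + \<alpha>) + 16 * (50 * (\<beta> + \<alpha>))\<^sup>2 = 42000 * (\<beta> + \<alpha>)\<^sup>2"
      by (simp add: power2_eq_square algebra_simps)
    moreover have "42000 * (\<beta> + \<alpha>)\<^sup>2 \<le> (210 * (\<beta> + \<alpha>))\<^sup>2" unfolding power_mult_distrib[of 210] by simp
    ultimately show "40 * L\<^sup>2 * \<alpha> + 16 * L ^ 4 \<le> (210 * (\<beta> + \<alpha>))\<^sup>2" by simp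
  qed
  also have "\<dots> = (210 * (B + A))\<^sup>2"
  proof -
    have "210 * (B + A) = ennreal (210 * (\<beta> + \<alpha>))"
      unfolding \<alpha>(1) \<beta>(1) using \<alpha>(2) \<beta>(2) by (subst ennreal_mult) (auto simp: ennreal_plus)
    then show ?thesis using \<alpha>(2) \<beta>(2) by (simp only:) (subst ennreal_power, auto)
  qed
  finally show ?thesis .
qed

text \<open>Both \<open>f p\<close> and \<open>f q\<close> are compared with \<open>g m\<close>, and
  \<open>m\<close> is averaged over the common cell. With slices at two heights as \<open>f\<close>
  and \<open>g\<close>, the oscillation of one slice is bounded by differences between points of two
  slices; averaging over the second height then produces an integral over pairs of points in
  space.\<close>

lemma two_functions:
  assumes f[measurable]: "f \<in> borel_measurable M" and g[measurable]: "g \<in> borel_measurable M"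
  shows "(\<integral>\<^sup>+p. \<integral>\<^sup>+q. k n p q * ennreal ((f p - f q)\<^sup>2) \<partial>M \<partial>M) \<le> 4 * (\<integral>\<^sup>+p. \<integral>\<^sup>+q. k n p q * ennreal ((f p - g q)\<^sup>2) \<partial>M \<partial>M)"
proof -
  interpret MM: pair_sigma_finite M M ..
  define F where "F p = (\<integral>\<^sup>+q. k n p q * ennreal ((f p - g q)\<^sup>2) \<partial>M)" for p
  have [measurable]: "(\<lambda>x. k n (fst x) (snd x)) \<in> borel_measurable (M \<Otimes>\<^sub>M M)"
    using k_meas[of n] by (simp add: split_beta')
  have [measurable]: "(\<lambda>x. f (fst x)) \<in> borel_measurable (M \<Otimes>\<^sub>M M)" "(\<lambda>x. g (snd x)) \<in> borel_measurable (M \<Otimes>\<^sub>M M)"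
    "(\<lambda>x. f (snd x)) \<in> borel_measurable (M \<Otimes>\<^sub>M M)" "(\<lambda>x. g (fst x)) \<in> borel_measurable (M \<Otimes>\<^sub>M M)"
    by (rule measurable_compose[OF measurable_fst] measurable_compose[OF measurable_snd], rule f g)+
  have Fm[measurable]: "F \<in> borel_measurable M"
    unfolding F_def by (intro borel_measurable_nn_integral) (simp add: split_beta')
  have pt: "k n p q * ennreal ((f p - f q)\<^sup>2) \<le> 2 * (k n p q * (ennreal (4 ^ n) * F p) + k n p q * (ennreal (4 ^ n) * F q))"
    if p: "p \<in> space M" and q: "q \<in> space M" for p q
  proof (cases "k n p q = 0")
    case False
    then have k1: "k n p q = 1" using k_01[of n p q] by auto
    note [measurable] = k_slice[OF p]
    have Fq: "F q = (\<integral>\<^sup>+m. k n p m * ennreal ((f q - g m)\<^sup>2) \<partial>M)" unfolding F_def using k_trans[OF False] by simp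
    have "ennreal ((f p - f q)\<^sup>2) * ennreal ((1/4) ^ n) = (\<integral>\<^sup>+m. k n p m * ennreal ((f p - f q)\<^sup>2) \<partial>M)"
      by (simp add: nn_integral_multc k_mass[OF p] mult.commute)
    also have "\<dots> \<le> (\<integral>\<^sup>+m. 2 * (k n p m * ennreal ((f p - g m)\<^sup>2) + k n p m * ennreal ((f q - g m)\<^sup>2)) \<partial>M)"
    proof (rule nn_integral_mono)
      fix m
      have "(f p - f q)\<^sup>2 \<le> 2 * ((f p - g m)\<^sup>2 + (f q - g m)\<^sup>2)"
      proof -
        have "0 \<le> ((f p - g m) + (f q - g m))\<^sup>2" by simp
        then show ?thesis by (simp add: power2_eq_square algebra_simps)
      qed
      then have "ennreal ((f p - f q)\<^sup>2) \<le> ennreal (2 * ((f p - g m)\<^sup>2 + (f q - g m)\<^sup>2))" by (rule ennreal_leI)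
      also have "\<dots> = 2 * (ennreal ((f p - g m)\<^sup>2) + ennreal ((f q - g m)\<^sup>2))"
        by (subst ennreal_mult) (auto simp: ennreal_plus)
      finally have "k n p m * ennreal ((f p - f q)\<^sup>2) \<le> k n p m * (2 * (ennreal ((f p - g m)\<^sup>2) + ennreal ((f q - g m)\<^sup>2)))"
        by (rule mult_left_mono) simp
      also have "\<dots> = 2 * (k n p m * ennreal ((f p - g m)\<^sup>2) + k n p m * ennreal ((f q - g m)\<^sup>2))"
        by (simp add: distrib_left mult.left_commute)
      finally show "k n p m * ennreal ((f p - f q)\<^sup>2) \<le> 2 * (k n p m * ennreal ((f p - g m)\<^sup>2) + k n p m * ennreal ((f q - g m)\<^sup>2))" .
    qed
    also have "\<dots> = 2 * (F p + F q)"
      unfolding Fq unfolding F_def[of p] by (subst nn_integral_cmult) (auto simp: nn_integral_add)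
    finally have "ennreal (4 ^ n) * (ennreal ((f p - f q)\<^sup>2) * ennreal ((1/4) ^ n)) \<le> ennreal (4 ^ n) * (2 * (F p + F q))"
      by (rule mult_left_mono) simp
    moreover have "ennreal (4 ^ n) * (ennreal ((f p - f q)\<^sup>2) * ennreal ((1/4) ^ n)) = ennreal ((f p - f q)\<^sup>2)"
    proof -
      have "ennreal (4 ^ n) * (ennreal ((f p - f q)\<^sup>2) * ennreal ((1/4) ^ n)) =
          (ennreal (4 ^ n) * ennreal ((1/4) ^ n)) * ennreal ((f p - f q)\<^sup>2)" by (simp only: ac_simps)
      then show ?thesis by (simp only: four_pow mult_1)
    qed
    ultimately show ?thesis unfolding k1 by (simp add: distrib_left mult.left_commute)
  qed simp
  have i1: "(\<integral>\<^sup>+p. \<integral>\<^sup>+q. k n p q * (ennreal (4 ^ n) * F p) \<partial>M \<partial>M) = (\<integral>\<^sup>+p. F p \<partial>M)"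
  proof (rule nn_integral_cong)
    fix p assume p: "p \<in> space M"
    show "(\<integral>\<^sup>+q. k n p q * (ennreal (4 ^ n) * F p) \<partial>M) = F p"
    proof -
      have "(\<integral>\<^sup>+q. k n p q * (ennreal (4 ^ n) * F p) \<partial>M) = ennreal ((1/4) ^ n) * (ennreal (4 ^ n) * F p)"
        by (subst nn_integral_multc[OF k_slice[OF p]]) (simp only: k_mass[OF p])
      also have "\<dots> = (ennreal (4 ^ n) * ennreal ((1/4) ^ n)) * F p" by (simp only: ac_simps)
      finally show ?thesis by (simp only: four_pow mult_1)
    qed
  qed
  have m2: "(\<lambda>(p, q). k n p q * (ennreal (4 ^ n) * F q)) \<in> borel_measurable (M \<Otimes>\<^sub>M M)"
    "(\<lambda>(p, q). k n p q * (ennreal (4 ^ n) * F p)) \<in> borel_measurable (M \<Otimes>\<^sub>M M)"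
    unfolding split_beta'
    by (intro borel_measurable_times_ennreal borel_measurable_const measurable_compose[OF measurable_snd Fm]
         measurable_compose[OF measurable_fst Fm], measurable)+
  have "(\<integral>\<^sup>+p. \<integral>\<^sup>+q. k n p q * (ennreal (4 ^ n) * F q) \<partial>M \<partial>M) = (\<integral>\<^sup>+q. \<integral>\<^sup>+p. k n p q * (ennreal (4 ^ n) * F q) \<partial>M \<partial>M)"
    by (rule MM.Fubini'[OF m2(1), symmetric])
  also have "\<dots> = (\<integral>\<^sup>+q. F q \<partial>M)" using i1 by (simp add: k_sym)
  finally have i2: "(\<integral>\<^sup>+p. \<integral>\<^sup>+q. k n p q * (ennreal (4 ^ n) * F q) \<partial>M \<partial>M) = (\<integral>\<^sup>+q. F q \<partial>M)" .
  have "(\<integral>\<^sup>+p. \<integral>\<^sup>+q. k n p q * ennreal ((f p - f q)\<^sup>2) \<partial>M \<partial>M) \<le>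
     (\<integral>\<^sup>+p. \<integral>\<^sup>+q. 2 * (k n p q * (ennreal (4 ^ n) * F p) + k n p q * (ennreal (4 ^ n) * F q)) \<partial>M \<partial>M)"
    by (intro nn_integral_mono pt)
  also have "\<dots> = (\<integral>\<^sup>+p. 2 * ((\<integral>\<^sup>+q. k n p q * (ennreal (4 ^ n) * F p) \<partial>M) + (\<integral>\<^sup>+q. k n p q * (ennreal (4 ^ n) * F q) \<partial>M)) \<partial>M)"
  proof (rule nn_integral_cong)
    fix p assume p: "p \<in> space M"
    note [measurable] = k_slice[OF p]
    show "(\<integral>\<^sup>+q. 2 * (k n p q * (ennreal (4 ^ n) * F p) + k n p q * (ennreal (4 ^ n) * F q)) \<partial>M)
      = 2 * ((\<integral>\<^sup>+q. k n p q * (ennreal (4 ^ n) * F p) \<partial>M) + (\<integral>\<^sup>+q. k n p q * (ennreal (4 ^ n) * F q) \<partial>M))"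
      by (subst nn_integral_cmult, measurable, subst nn_integral_add, auto)
  qed
  also have "\<dots> = 2 * ((\<integral>\<^sup>+p. \<integral>\<^sup>+q. k n p q * (ennreal (4 ^ n) * F p) \<partial>M \<partial>M) + (\<integral>\<^sup>+p. \<integral>\<^sup>+q. k n p q * (ennreal (4 ^ n) * F q) \<partial>M \<partial>M))"
    using borel_measurable_nn_integral[OF m2(1)] borel_measurable_nn_integral[OF m2(2)]
    by (subst nn_integral_cmult, simp, subst nn_integral_add, auto)
  also have "\<dots> = 4 * (\<integral>\<^sup>+p. F p \<partial>M)" unfolding i1 i2 by (simp flip: mult_2 add: mult.assoc[symmetric])
  finally show ?thesis unfolding F_def .
qed

end

section \<open>Dyadic intervals and the distance on the torus\<close>

definition kd :: "nat \<Rightarrow> real \<Rightarrow> real \<Rightarrow> ennreal" where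
  "kd n x y = (if real_of_int \<lfloor>2 ^ n * x\<rfloor> = real_of_int \<lfloor>2 ^ n * y\<rfloor> then 1 else 0)"

lemma kd_measurable:
  assumes u: "u \<in> borel_measurable N" and v: "v \<in> borel_measurable N"
  shows "(\<lambda>x. kd n (u x) (v x)) \<in> borel_measurable N"
proof -
  have [measurable]: "(\<lambda>x. real_of_int \<lfloor>2 ^ n * u x\<rfloor>) \<in> borel_measurable N" "(\<lambda>x. real_of_int \<lfloor>2 ^ n * v x\<rfloor>) \<in> borel_measurable N"
    using u v by (auto intro!: measurable_compose[OF _ borel_measurable_real_floor])
  show ?thesis unfolding kd_def by measurable
qed

lemma kd_01: "kd n x y = 0 \<or> kd n x y = 1"
  by (simp add: kd_def)

lemma kd_sym: "kd n x y = kd n y x"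
  by (auto simp: kd_def)

lemma kd_trans: "kd n x y \<noteq> 0 \<Longrightarrow> kd n x s = kd n y s"
  by (auto simp: kd_def split: if_splits)

lemma kd_Suc: "kd (Suc n) x y \<noteq> 0 \<Longrightarrow> kd n x y \<noteq> 0"
proof -
  have "\<lfloor>2 ^ n * x\<rfloor> = \<lfloor>2 ^ Suc n * x\<rfloor> div 2" for x :: real
    using floor_divide_real_eq_div[of 2 "2 ^ Suc n * x"] by simp
  then show "kd (Suc n) x y \<noteq> 0 \<Longrightarrow> kd n x y \<noteq> 0" by (simp add: kd_def split: if_splits)
qed

lemma kd_close:
  assumes "kd n x y \<noteq> 0" shows "\<bar>x - y\<bar> < 1 / 2 ^ n"
proof -
  have "\<lfloor>2 ^ n * x\<rfloor> = \<lfloor>2 ^ n * y\<rfloor>" using assms by (simp add: kd_def split: if_splits)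
  then have "\<bar>2 ^ n * x - 2 ^ n * y\<bar> < 1" by linarith
  then have "2 ^ n * \<bar>x - y\<bar> < 1" by (simp add: abs_mult flip: right_diff_distrib)
  then show ?thesis by (simp add: field_simps)
qed

lemma kd_interval: "kd n x y = indicator {of_int \<lfloor>2 ^ n * x\<rfloor> / 2 ^ n ..< (of_int \<lfloor>2 ^ n * x\<rfloor> + 1) / 2 ^ n} y"
proof -
  have "\<lfloor>2 ^ n * x\<rfloor> = \<lfloor>2 ^ n * y\<rfloor> \<longleftrightarrow> of_int \<lfloor>2 ^ n * x\<rfloor> \<le> 2 ^ n * y \<and> 2 ^ n * y < of_int \<lfloor>2 ^ n * x\<rfloor> + 1"
    using floor_eq_iff[of "2 ^ n * y" "\<lfloor>2 ^ n * x\<rfloor>"] by auto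
  then show ?thesis by (auto simp: kd_def indicator_def field_simps)
qed

lemma kd_mass_X:
  assumes "x \<in> {0..<1}"
  shows "(\<integral>\<^sup>+y. kd n x y \<partial>XM) = ennreal ((1/2) ^ n)"
proof -
  define j where "j = \<lfloor>2 ^ n * x\<rfloor>"
  have "0 \<le> j" using assms by (simp add: j_def)
  moreover have "j + 1 \<le> 2 ^ n"
  proof -
    have "2 ^ n * x < real_of_int (2 ^ n)" using assms by simp
    then have "j < 2 ^ n" unfolding j_def floor_less_iff .
    then show ?thesis by linarith
  qed
  ultimately have j: "0 \<le> of_int j / (2 ^ n :: real)" "(of_int j + 1) / (2 ^ n :: real) \<le> 1"
  proof -
    assume "0 \<le> j" "j + 1 \<le> 2 ^ n"
    then have "real_of_int 0 \<le> real_of_int j" "real_of_int (j + 1) \<le> real_of_int (2 ^ n)" unfolding of_int_le_iff by auto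
    then show "0 \<le> of_int j / (2 ^ n :: real)" "(of_int j + 1) / (2 ^ n :: real) \<le> 1" by simp_all
  qed
  have "(\<integral>\<^sup>+y. kd n x y \<partial>XM) = (\<integral>\<^sup>+y. kd n x y * indicator {0..<1} y \<partial>lborel)"
    by (rule nn_integral_XM) (intro kd_measurable, auto)
  also have "\<dots> = (\<integral>\<^sup>+y. indicator {of_int j / 2 ^ n ..< (of_int j + 1) / 2 ^ n :: real} y \<partial>lborel)"
    unfolding kd_interval j_def[symmetric] using j by (intro nn_integral_cong) (auto simp: indicator_def simp del: divide_le_eq_1_pos)
  also have "\<dots> = ennreal ((of_int j + 1) / 2 ^ n - of_int j / 2 ^ n)"
    by (subst nn_integral_indicator) (auto simp: divide_right_mono)
  also have "(of_int j + 1) / 2 ^ n - of_int j / 2 ^ n = (1/2 :: real) ^ n"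
    by (simp add: diff_divide_distrib[symmetric] power_divide)
  finally show ?thesis .
qed

text \<open>A geometric sum is at most twice its last term. This sums the weights
  \<open>16^n\<close> over all levels at which two given points still share a cell, with
  \<open>X\<close> of the order of the inverse fourth power of their distance.\<close>

lemma sum_16_le:
  fixes X :: real
  assumes "X \<ge> 0"
  shows "(\<Sum>n<N. if 16 ^ n \<le> X then 16 ^ n else 0) \<le> 2 * X"
proof (induction N)
  case (Suc N)
  show ?case
  proof (cases "16 ^ N \<le> X")
    case True
    have "(\<Sum>n<N. if 16 ^ n \<le> X then 16 ^ n else 0) \<le> (\<Sum>n<N. 16 ^ n :: real)" by (intro sum_mono) auto
    also have "\<dots> \<le> 16 ^ N"
    proof (induction N)
      case (Suc N) have "(0::real) \<le> 16 ^ N" by simp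
      from Suc this show ?case unfolding sum.lessThan_Suc power_Suc by linarith
    qed simp
    finally show ?thesis using True by simp
  qed (use Suc in simp)
qed (use assms in simp)

text \<open>Rounding to the nearest integer does at least as well as the integer zero, so the
  distance on the torus is at most the Euclidean one; this is the direction that bounds dyadic sums
  by the kernel. Positivity uses that horizontal differences within the cell are smaller than
  one.\<close>

lemma tdist_properties:
  assumes p: "p \<in> cell h" and q: "q \<in> cell h"
  shows "p \<noteq> q \<Longrightarrow> tdist p q > 0"
    and "(tdist p q)\<^sup>2 \<le> (fst p - fst q)\<^sup>2 + (fst (snd p) - fst (snd q))\<^sup>2 + (snd (snd p) - snd (snd q))\<^sup>2"
proof -
  obtain x y z where P: "p = (x, y, z)" by (cases p) auto
  obtain x' y' z' where Q: "q = (x', y', z')" by (cases q) auto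
  define a where "a = \<bar>x - x' - of_int (round (x - x'))\<bar>"
  define b where "b = \<bar>y - y' - of_int (round (y - y'))\<bar>"
  have t: "tdist p q = sqrt (a\<^sup>2 + b\<^sup>2 + (z - z')\<^sup>2)" by (simp add: P Q a_def b_def)
  have a: "a \<le> \<bar>x - x'\<bar>" "b \<le> \<bar>y - y'\<bar>"
    unfolding a_def b_def using round_diff_minimal[of "x - x'" 0] round_diff_minimal[of "y - y'" 0] by auto
  have ab: "0 \<le> a" "0 \<le> b" by (auto simp: a_def b_def)
  note power_mono[OF a(1) ab(1), of 2] power_mono[OF a(2) ab(2), of 2]
  then show "(tdist p q)\<^sup>2 \<le> (fst p - fst q)\<^sup>2 + (fst (snd p) - fst (snd q))\<^sup>2 + (snd (snd p) - snd (snd q))\<^sup>2"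
    unfolding t by (simp add: P Q)
  assume "p \<noteq> q"
  have "a\<^sup>2 + b\<^sup>2 + (z - z')\<^sup>2 \<noteq> 0"
  proof
    assume "a\<^sup>2 + b\<^sup>2 + (z - z')\<^sup>2 = 0"
    then have 0: "a\<^sup>2 + b\<^sup>2 = 0" "z = z'" by (auto simp: add_nonneg_eq_0_iff)
    then have "a = 0" "b = 0" by (auto simp: sum_power2_eq_zero_iff)
    then have i: "x - x' = of_int (round (x - x'))" "y - y' = of_int (round (y - y'))" by (auto simp: a_def b_def)
    have zero: "k = 0" if "\<bar>real_of_int k\<bar> < 1" for k using that by linarith
    have "\<bar>x - x'\<bar> < 1" "\<bar>y - y'\<bar> < 1" using p q by (auto simp: P Q cell_def)
    then have "round (x - x') = 0" "round (y - y') = 0" using i zero by metis+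
    then show False using i 0 \<open>p \<noteq> q\<close> by (simp add: P Q)
  qed
  then show "tdist p q > 0" unfolding t by (simp add: less_le)
qed

section \<open>From dyadic squares in the slices to the Slobodeckij integral in space\<close>

context slab
begin

definition kq :: "nat \<Rightarrow> real \<times> real \<Rightarrow> real \<times> real \<Rightarrow> ennreal" where
  "kq n p q = kd n (fst p) (fst q) * kd n (snd p) (snd q)"

text \<open>Heights are rescaled by \<open>h\<close>, so that the whole slab is one cell of level 0
  and vertical and horizontal cells of the same level are of comparable size.\<close>

definition kz :: "nat \<Rightarrow> real \<Rightarrow> real \<Rightarrow> ennreal" where
  "kz n z w = kd n (z / h) (w / h)"

lemma XXM_coords:
  "(\<lambda>x. fst (fst x)) \<in> borel_measurable (XXM \<Otimes>\<^sub>M N)" "(\<lambda>x. snd (fst x)) \<in> borel_measurable (XXM \<Otimes>\<^sub>M N)"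
  "(\<lambda>x. fst (snd x)) \<in> borel_measurable (N \<Otimes>\<^sub>M XXM)" "(\<lambda>x. snd (snd x)) \<in> borel_measurable (N \<Otimes>\<^sub>M XXM)"
  "fst \<in> borel_measurable XXM" "snd \<in> borel_measurable XXM"
proof -
  show *: "fst \<in> borel_measurable XXM" "snd \<in> borel_measurable XXM"
    by (rule X.measurable_T_fst X.measurable_T_snd)+
  show "(\<lambda>x. fst (fst x)) \<in> borel_measurable (XXM \<Otimes>\<^sub>M N)" "(\<lambda>x. snd (fst x)) \<in> borel_measurable (XXM \<Otimes>\<^sub>M N)"
    "(\<lambda>x. fst (snd x)) \<in> borel_measurable (N \<Otimes>\<^sub>M XXM)" "(\<lambda>x. snd (snd x)) \<in> borel_measurable (N \<Otimes>\<^sub>M XXM)"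
    by (rule measurable_compose[OF measurable_fst *(1)] measurable_compose[OF measurable_fst *(2)]
        measurable_compose[OF measurable_snd *(1)] measurable_compose[OF measurable_snd *(2)])+
qed

lemma kq_measurable:
  assumes u: "u \<in> measurable N XXM" and v: "v \<in> measurable N XXM"
  shows "(\<lambda>x. kq n (u x) (v x)) \<in> borel_measurable N"
  unfolding kq_def
  by (intro borel_measurable_times_ennreal kd_measurable)
     (rule measurable_compose[OF u XXM_coords(5)] measurable_compose[OF u XXM_coords(6)]
        measurable_compose[OF v XXM_coords(5)] measurable_compose[OF v XXM_coords(6)])+

lemma kz_measurable:
  assumes u: "u \<in> measurable N (ZM h)" and v: "v \<in> measurable N (ZM h)"
  shows "(\<lambda>x. kz n (u x) (v x)) \<in> borel_measurable N"
  unfolding kz_def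
  by (intro kd_measurable borel_measurable_divide borel_measurable_const)
     (rule measurable_compose[OF u Z.measurable_T_id] measurable_compose[OF v Z.measurable_T_id])+

sublocale dyadic XXM kq
proof (rule dyadic.intro[OF sigma_finite_XXM dyadic_axioms.intro], goal_cases)
  case (1 n)
  have "(\<lambda>x. kq n (fst x) (snd x)) \<in> borel_measurable (XXM \<Otimes>\<^sub>M XXM)" by (rule kq_measurable) measurable
  then show ?case by (simp add: split_beta')
next
  case (2 n p q) then show ?case using kd_01[of n "fst p" "fst q"] kd_01[of n "snd p" "snd q"] by (auto simp: kq_def)
next
  case (3 n p q) then show ?case using kd_Suc[of n "fst p" "fst q"] kd_Suc[of n "snd p" "snd q"] by (auto simp: kq_def)
next
  case (4 n p q) then show ?case by (simp add: kq_def kd_sym)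
next
  case (5 n p q s)
  then have "kd n (fst p) (fst q) \<noteq> 0" "kd n (snd p) (snd q) \<noteq> 0" by (auto simp: kq_def)
  from kd_trans[OF this(1), of "fst s"] kd_trans[OF this(2), of "snd s"] show ?case by (simp add: kq_def)
next
  case (6 n p)
  then have p: "fst p \<in> {0..<1}" "snd p \<in> {0..<1}" by (auto simp: space_pair_measure)
  have m: "kd n x \<in> borel_measurable XM" for x by (rule kd_measurable) auto
  have "(\<integral>\<^sup>+q. kq n p q \<partial>XXM) = (\<integral>\<^sup>+x. \<integral>\<^sup>+y. kd n (fst p) x * kd n (snd p) y \<partial>XM \<partial>XM)"
  proof -
    have "(\<lambda>q. kq n p q) \<in> borel_measurable XXM" by (rule kq_measurable) (use 6 in measurable)
    from X.nn_integral_fst[OF this] show ?thesis by (simp add: kq_def)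
  qed
  also have "\<dots> = ennreal ((1/2) ^ n) * ennreal ((1/2) ^ n)"
    unfolding nn_integral_cmult[OF m] nn_integral_multc[OF m] kd_mass_X[OF p(1)] kd_mass_X[OF p(2)] ..
  also have "\<dots> = ennreal ((1/4) ^ n)" by (simp add: ennreal_mult[symmetric] power_mult_distrib[symmetric])
  finally show ?case .
next
  case (7 p q)
  have "kd 0 x y = 1" if "x \<in> {0..<1}" "y \<in> {0..<1}" for x y
    proof -
    have "\<lfloor>x\<rfloor> = 0" "\<lfloor>y\<rfloor> = 0" using that by (auto simp: floor_eq_iff)
    then show ?thesis by (simp add: kd_def)
  qed
  then show ?case using 7 by (auto simp: kq_def space_pair_measure)
qed

lemma kz_mass:
  assumes z: "z \<in> space (ZM h)"
  shows "(\<integral>\<^sup>+w. kz n z w \<partial>ZM h) = ennreal (h / 2 ^ n)"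
proof -
  define j where "j = \<lfloor>2 ^ n * (z / h)\<rfloor>"
  have z: "-h < z" "z < 0" using z by auto
  have zh: "-1 < z / h" "z / h < 0" using z h by (auto simp: field_simps)
  have "2 ^ n * (z / h) < real_of_int 0" using mult_pos_neg[OF _ zh(2), of "2 ^ n"] by simp
  then have j0: "j < 0" unfolding j_def floor_less_iff .
  have "(2::real) ^ n * (-1) \<le> 2 ^ n * (z / h)" using zh by (intro mult_left_mono) auto
  then have "real_of_int (- (2 ^ n)) \<le> 2 ^ n * (z / h)" by simp
  then have j1: "- (2 ^ n) \<le> j" unfolding j_def le_floor_iff .
  have "real_of_int (j + 1) \<le> real_of_int 0" "real_of_int (- (2 ^ n)) \<le> real_of_int j" using j0 j1 unfolding of_int_le_iff by auto
  then have j: "(of_int j + 1) / 2 ^ n * h \<le> 0" "-h \<le> of_int j / 2 ^ n * h"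
  proof -
    assume a: "real_of_int (j + 1) \<le> real_of_int 0" "real_of_int (- (2 ^ n)) \<le> real_of_int j"
    have "(of_int j + 1) * h \<le> 0" using a(1) h by (intro mult_nonpos_nonneg) auto
    then show "(of_int j + 1) / 2 ^ n * h \<le> 0" by (simp add: divide_le_0_iff)
    have "(-1) * 2 ^ n \<le> real_of_int j" using a(2) by simp
    then have "-1 \<le> of_int j / (2 ^ n :: real)" by (subst pos_le_divide_eq) auto
    from mult_right_mono[OF this, of h] show "-h \<le> of_int j / 2 ^ n * h" using h by simp
  qed
  have "kz n z \<in> borel_measurable (ZM h)" by (rule kz_measurable) (use assms in auto)
  then have "(\<integral>\<^sup>+w. kz n z w \<partial>ZM h) = (\<integral>\<^sup>+w. kz n z w * indicator {-h<..<0} w \<partial>lborel)"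
    unfolding ZM_def by (intro nn_integral_restrict_space) (auto simp: ZM_def)
  also have "\<dots> = (\<integral>\<^sup>+w. indicator {of_int j / 2 ^ n * h ..< (of_int j + 1) / 2 ^ n * h :: real} w \<partial>lborel)"
  proof (rule nn_integral_cong_AE)
    \<comment> \<open>The two indicators can differ at \<open>-h\<close>, which belongs to the
      lowest dyadic interval but not to the open slab.\<close>
    show "AE w in lborel. kz n z w * indicator {-h<..<0} w = indicator {of_int j / 2 ^ n * h ..< (of_int j + 1) / 2 ^ n * h :: real} w"
      using AE_lborel_singleton[of "-h"]
    proof eventually_elim
      case (elim w)
      have "w / h \<in> {of_int j / 2 ^ n ..< (of_int j + 1) / 2 ^ n} \<longleftrightarrow> w \<in> {of_int j / 2 ^ n * h ..< (of_int j + 1) / 2 ^ n * h}"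
        using h by (auto simp: pos_le_divide_eq pos_divide_less_eq)
      then have "kz n z w = indicator {of_int j / 2 ^ n * h ..< (of_int j + 1) / 2 ^ n * h :: real} w"
        unfolding kz_def kd_interval j_def[symmetric] by (simp add: indicator_def)
      moreover have "w \<in> {-h<..<0}" if "w \<in> {of_int j / 2 ^ n * h ..< (of_int j + 1) / 2 ^ n * h}"
        using that j elim by auto
      ultimately show ?case by (auto simp: indicator_def)
    qed
  qed
  also have "\<dots> = ennreal ((of_int j + 1) / 2 ^ n * h - of_int j / 2 ^ n * h)"
    using h by (subst nn_integral_indicator) (auto simp: divide_right_mono mult_right_mono)
  also have "(of_int j + 1) / 2 ^ n * h - of_int j / 2 ^ n * h = h / 2 ^ n"
    by (simp add: diff_divide_distrib[symmetric] left_diff_distrib[symmetric])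
  finally show ?thesis .
qed

definition qz :: "point \<Rightarrow> real \<times> real" where "qz p = (fst p, fst (snd p))"
definition zz :: "point \<Rightarrow> real" where "zz p = snd (snd p)"

lemma qz_measurable: "qz \<in> measurable (Om h) XXM" and zz_measurable: "zz \<in> measurable (Om h) (ZM h)"
  unfolding qz_def[abs_def] zz_def[abs_def] Om_def by measurable

lemma qz_Jz: "qz (Jz (q, z)) = q" "zz (Jz (q, z)) = z"
  by (auto simp: qz_def zz_def Jz_def)

text \<open>The exponent 4 is the Slobodeckij exponent of order one half in dimension 3.\<close>

lemma cell_sum_le_kernel:
  fixes g :: "point \<Rightarrow> real"
  assumes p: "p \<in> cell h" and p': "p' \<in> cell h"
  shows "(\<Sum>n. ennreal (16 ^ n) * (kz n (zz p) (zz p') * kq n (qz p) (qz p') * ennreal ((g p - g p')\<^sup>2)))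
    \<le> ennreal (2 * (2 + h\<^sup>2)\<^sup>2) * ennreal (slobodeckij_kernel (1/2) g (p, p'))"
proof (cases "p = p'")
  case True
  then show ?thesis by simp
next
  case False
  define t where "t = tdist p p'"
  have t: "t > 0" unfolding t_def by (rule tdist_properties(1)[OF p p' False])
  \<comment> \<open>If the points share a cell of level \<open>n\<close>, the horizontal differences
    are below \<open>2^-n\<close> and the vertical one below \<open>h * 2^-n\<close>; hence
    \<open>t^2 \<le> (2 + h^2) / 4^n\<close>, which is \<open>16^n \<le> X\<close>.\<close>
  define X where "X = (2 + h\<^sup>2)\<^sup>2 / t ^ 4"
  have X: "X \<ge> 0" unfolding X_def using t by simp
  have term_le: "ennreal (16 ^ n) * (kz n (zz p) (zz p') * kq n (qz p) (qz p') * ennreal ((g p - g p')\<^sup>2))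
     \<le> ennreal ((if 16 ^ n \<le> X then 16 ^ n else 0) * (g p - g p')\<^sup>2)" for n
  proof (cases "kz n (zz p) (zz p') * kq n (qz p) (qz p') = 0")
    case True
    then show ?thesis by (auto simp: mult.assoc[symmetric])
  next
    case nz: False
    have one: "kz n (zz p) (zz p') * kq n (qz p) (qz p') = 1"
      using nz kd_01 unfolding kz_def kq_def by (metis mult_zero_left mult_zero_right mult_1)
    have d: "\<bar>fst p - fst p'\<bar> < 1 / 2 ^ n" "\<bar>fst (snd p) - fst (snd p')\<bar> < 1 / 2 ^ n" "\<bar>zz p / h - zz p' / h\<bar> < 1 / 2 ^ n"
      using nz unfolding kz_def kq_def qz_def by (auto intro!: kd_close)
    have sq: "u\<^sup>2 \<le> (1 / 2 ^ n)\<^sup>2" if "\<bar>u\<bar> < 1 / 2 ^ n" for u :: real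
      using power_mono[of "\<bar>u\<bar>" "1 / 2 ^ n" 2] that by simp
    have e: "zz p - zz p' = h * (zz p / h - zz p' / h)" using h by (simp add: field_simps)
    have s3: "(zz p - zz p')\<^sup>2 \<le> h\<^sup>2 * (1 / 2 ^ n)\<^sup>2"
      unfolding e power_mult_distrib by (intro mult_left_mono sq d) simp
    have "t\<^sup>2 \<le> (fst p - fst p')\<^sup>2 + (fst (snd p) - fst (snd p'))\<^sup>2 + (zz p - zz p')\<^sup>2"
      unfolding t_def zz_def by (rule tdist_properties(2)[OF p p'])
    also have "\<dots> \<le> (2 + h\<^sup>2) * (1 / 2 ^ n)\<^sup>2"
      using sq[OF d(1)] sq[OF d(2)] s3 by (simp add: distrib_right)
    also have "\<dots> = (2 + h\<^sup>2) / 4 ^ n" proof -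
      have "((2::real) ^ n)\<^sup>2 = 4 ^ n" by (simp add: power_mult_distrib[symmetric] power2_eq_square)
      then show ?thesis by (simp add: power_divide)
    qed
    finally have "4 ^ n * t\<^sup>2 \<le> 2 + h\<^sup>2" by (simp add: field_simps)
    then have "(4 ^ n * t\<^sup>2)\<^sup>2 \<le> (2 + h\<^sup>2)\<^sup>2" by (intro power_mono) auto
    moreover have "(4 ^ n * t\<^sup>2)\<^sup>2 = 16 ^ n * t ^ 4"
      by (simp add: power_mult_distrib flip: power_mult, simp add: power_mult mult.commute[of n 2])
    ultimately have "16 ^ n \<le> X" using t unfolding X_def by (simp add: field_simps)
    then show ?thesis unfolding one by (simp add: ennreal_mult)
  qed
  have "(\<Sum>n. ennreal (16 ^ n) * (kz n (zz p) (zz p') * kq n (qz p) (qz p') * ennreal ((g p - g p')\<^sup>2)))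
    \<le> (\<Sum>n. ennreal ((if 16 ^ n \<le> X then 16 ^ n else 0) * (g p - g p')\<^sup>2))"
    by (rule suminf_le[OF term_le]) auto
  also have "\<dots> \<le> ennreal (2 * X * (g p - g p')\<^sup>2)"
    unfolding suminf_eq_SUP
  proof (rule SUP_least)
    fix N
    have "(\<Sum>n<N. ennreal ((if 16 ^ n \<le> X then 16 ^ n else 0) * (g p - g p')\<^sup>2))
      = ennreal (\<Sum>n<N. (if 16 ^ n \<le> X then 16 ^ n else 0) * (g p - g p')\<^sup>2)"
      by (rule sum_ennreal) auto
    also have "\<dots> \<le> ennreal (2 * X * (g p - g p')\<^sup>2)"
      unfolding sum_distrib_right[symmetric] by (intro ennreal_leI mult_right_mono sum_16_le X) simp
    finally show "(\<Sum>n<N. ennreal ((if 16 ^ n \<le> X then 16 ^ n else 0) * (g p - g p')\<^sup>2)) \<le> ennreal (2 * X * (g p - g p')\<^sup>2)" .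
  qed
  also have "\<dots> = ennreal (2 * (2 + h\<^sup>2)\<^sup>2) * ennreal (slobodeckij_kernel (1/2) g (p, p'))"
  proof -
    have "tdist p p' powr (3 + 2 * (1/2)) = t ^ 4"
      using powr_realpow[OF t, of 4] by (simp add: t_def)
    then show ?thesis unfolding slobodeckij_kernel_def X_def
      by (subst ennreal_mult[symmetric]) (auto simp: field_simps)
  qed
  finally show ?thesis .
qed

text \<open>Slices carry the weight \<open>8^n\<close>. Averaging the second point over heights in
  the same cell, of mass \<open>h / 2^n\<close>, turns this into \<open>16^n\<close>, the weight
  that matches the kernel in dimension three. The majorant \<open>R\<close> lets each component of a
  vector field be treated with the kernel of the whole field.\<close>

lemma frac_L24:
  fixes g :: "point \<Rightarrow> real"
  assumes g: "g \<in> borel_measurable (Om h)" and B: "(\<integral>\<^sup>+p. ennreal ((g p)\<^sup>2) \<partial>Om h) \<le> ennreal B" "0 \<le> B"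
    and R: "R \<in> borel_measurable (Om h \<Otimes>\<^sub>M Om h)" "\<And>p p'. slobodeckij_kernel (1/2) g (p, p') \<le> R (p, p')"
    and K: "(\<integral>\<^sup>+p. \<integral>\<^sup>+p'. ennreal (R (p, p')) \<partial>Om h \<partial>Om h) \<le> ennreal K" "0 \<le> K"
  shows "L24 g (210 * (B + 8 * (2 + h\<^sup>2)\<^sup>2 / h * K))"
proof -
  note XXMm = sigma_finite_measure.borel_measurable_nn_integral[OF sigma_finite_XXM]
  have "sigma_finite_measure (Om h)" using finite_measure_Om by (rule finite_measure.axioms)
  note Omm = sigma_finite_measure.borel_measurable_nn_integral[OF this]
  define H where "H z \<zeta> q q' = ennreal ((g (Jz (q, z)) - g (Jz (q', \<zeta>)))\<^sup>2)" for z \<zeta> q q'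
  define a where "a n z = (\<integral>\<^sup>+q. \<integral>\<^sup>+q'. kq n q q' * H z z q q' \<partial>XXM \<partial>XXM)" for n z
  define b where "b n z \<zeta> = (\<integral>\<^sup>+q. \<integral>\<^sup>+q'. kq n q q' * H z \<zeta> q q' \<partial>XXM \<partial>XXM)" for n z \<zeta>
  define \<theta> where "\<theta> z = 210 * ((\<integral>\<^sup>+q. ennreal ((g (Jz (q, z)))\<^sup>2) \<partial>XXM) + (\<Sum>n. ennreal (8 ^ n) * a n z))" for z
  have gJ: "(\<lambda>x. g (Jz (u x, w x))) \<in> borel_measurable N" if "u \<in> measurable N XXM" "w \<in> measurable N (ZM h)" for u w N
    by (rule measurable_compose[OF measurable_Pair[OF that] Jz_measurable2[OF g]])
  have Hm: "(\<lambda>x. H (z x) (w x) (u x) (v x)) \<in> borel_measurable N"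
    if "u \<in> measurable N XXM" "v \<in> measurable N XXM" "z \<in> measurable N (ZM h)" "w \<in> measurable N (ZM h)" for u v z w N
    unfolding H_def using gJ[OF that(1,3)] gJ[OF that(2,4)] by measurable
  have am: "a n \<in> borel_measurable (ZM h)" for n
    unfolding a_def[abs_def]
    by (intro XXMm, unfold split_beta', intro XXMm, unfold split_beta')
       (intro borel_measurable_times_ennreal kq_measurable Hm; measurable)
  have Bm: "(\<lambda>z. \<integral>\<^sup>+q. ennreal ((g (Jz (q, z)))\<^sup>2) \<partial>XXM) \<in> borel_measurable (ZM h)"
    by (rule XXMm) (rule pair_slice_measurable, use g in measurable)
  have \<theta>m: "\<theta> \<in> borel_measurable (ZM h)"
    unfolding \<theta>_def[abs_def] using am Bm by measurable
  have L4: "(\<integral>\<^sup>+q. ennreal ((g (Jz (q, z))) ^ 4) \<partial>XXM) \<le> (\<theta> z)\<^sup>2" if z: "z \<in> space (ZM h)" for z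
    unfolding \<theta>_def a_def H_def by (rule L4_bound[OF slice_z_measurable[OF g z]])
  define K' where "K' n p p' = kz n (zz p) (zz p') * kq n (qz p) (qz p') * ennreal ((g p - g p')\<^sup>2)" for n p p'
  have K'm: "(\<lambda>x. K' n (u x) (v x)) \<in> borel_measurable N" if "u \<in> measurable N (Om h)" "v \<in> measurable N (Om h)" for u v N n
  proof -
    note m = measurable_compose[OF that(1)] measurable_compose[OF that(2)]
    have 1: "(\<lambda>x. g (u x)) \<in> borel_measurable N" "(\<lambda>x. g (v x)) \<in> borel_measurable N" by (rule m(1)[OF g], rule m(2)[OF g])
    have 2: "(\<lambda>x. ennreal ((g (u x) - g (v x))\<^sup>2)) \<in> borel_measurable N"
      by (intro measurable_compose[OF _ measurable_ennreal] borel_measurable_power borel_measurable_diff 1)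
    show ?thesis unfolding K'_def
      by (intro borel_measurable_times_ennreal kq_measurable kz_measurable)
         (rule m(1)[OF zz_measurable] m(2)[OF zz_measurable] m(1)[OF qz_measurable] m(2)[OF qz_measurable] 2)+
  qed
  define I where "I n = (\<integral>\<^sup>+p. \<integral>\<^sup>+p'. K' n p p' \<partial>Om h \<partial>Om h)" for n
  \<comment> \<open>The factor \<open>h / 2^n\<close> is the mass of the cell over which the
    auxiliary height \<open>\<zeta>\<close> ranges; the factor 4 comes from
    \<open>two_functions\<close>.\<close>
  have step: "ennreal (h / 2 ^ n) * (\<integral>\<^sup>+z. a n z \<partial>ZM h) \<le> 4 * I n" for n
  proof -
    have "ennreal (h / 2 ^ n) * (\<integral>\<^sup>+z. a n z \<partial>ZM h) = (\<integral>\<^sup>+z. ennreal (h / 2 ^ n) * a n z \<partial>ZM h)"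
      by (rule nn_integral_cmult[OF am, symmetric])
    also have "\<dots> \<le> (\<integral>\<^sup>+z. 4 * (\<integral>\<^sup>+q. \<integral>\<^sup>+p'. K' n (Jz (q, z)) p' \<partial>Om h \<partial>XXM) \<partial>ZM h)"
    proof (rule nn_integral_mono)
      fix z assume z: "z \<in> space (ZM h)"
      have kzm: "kz n z \<in> borel_measurable (ZM h)" by (rule kz_measurable) (use z in auto)
      have bm: "b n z \<in> borel_measurable (ZM h)"
        unfolding b_def[abs_def]
        by (intro XXMm, unfold split_beta', intro XXMm, unfold split_beta')
           (intro borel_measurable_times_ennreal kq_measurable Hm, use z in measurable)
      have slice: "(\<lambda>\<zeta>. \<integral>\<^sup>+q. \<integral>\<^sup>+q'. kz n z \<zeta> * (kq n q q' * H z \<zeta> q q') \<partial>XXM \<partial>XXM) = (\<lambda>\<zeta>. \<integral>\<^sup>+q. \<integral>\<^sup>+q'. K' n (Jz (q, z)) (Jz (q', \<zeta>)) \<partial>XXM \<partial>XXM)"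
        by (simp add: K'_def H_def qz_Jz mult.assoc)
      have "ennreal (h / 2 ^ n) * a n z = (\<integral>\<^sup>+\<zeta>. kz n z \<zeta> * a n z \<partial>ZM h)"
        unfolding nn_integral_multc[OF kzm] kz_mass[OF z] ..
      also have "\<dots> \<le> (\<integral>\<^sup>+\<zeta>. 4 * (kz n z \<zeta> * b n z \<zeta>) \<partial>ZM h)"
      proof (rule nn_integral_mono)
        fix \<zeta> assume \<zeta>: "\<zeta> \<in> space (ZM h)"
        have "a n z \<le> 4 * b n z \<zeta>" unfolding a_def b_def H_def
          by (rule two_functions[OF slice_z_measurable[OF g z] slice_z_measurable[OF g \<zeta>]])
        then have "kz n z \<zeta> * a n z \<le> kz n z \<zeta> * (4 * b n z \<zeta>)" by (rule mult_left_mono) simp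
        then show "kz n z \<zeta> * a n z \<le> 4 * (kz n z \<zeta> * b n z \<zeta>)" by (simp add: mult_ac)
      qed
      also have "\<dots> = 4 * (\<integral>\<^sup>+\<zeta>. kz n z \<zeta> * b n z \<zeta> \<partial>ZM h)"
        by (rule nn_integral_cmult) (use kzm bm in measurable)
      also have "(\<integral>\<^sup>+\<zeta>. kz n z \<zeta> * b n z \<zeta> \<partial>ZM h) = (\<integral>\<^sup>+\<zeta>. \<integral>\<^sup>+q. \<integral>\<^sup>+q'. K' n (Jz (q, z)) (Jz (q', \<zeta>)) \<partial>XXM \<partial>XXM \<partial>ZM h)"
      proof (rule nn_integral_cong)
        fix \<zeta> assume \<zeta>: "\<zeta> \<in> space (ZM h)"
        have m2: "(\<lambda>q'. kq n q q' * H z \<zeta> q q') \<in> borel_measurable XXM" if "q \<in> space XXM" for q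
          by (intro borel_measurable_times_ennreal kq_measurable Hm) (use that z \<zeta> in measurable)
        have m1: "(\<lambda>q. \<integral>\<^sup>+q'. kq n q q' * H z \<zeta> q q' \<partial>XXM) \<in> borel_measurable XXM"
          by (intro XXMm, unfold split_beta')
             (intro borel_measurable_times_ennreal kq_measurable Hm, use z \<zeta> in measurable)
        have "kz n z \<zeta> * b n z \<zeta> = (\<integral>\<^sup>+q. kz n z \<zeta> * (\<integral>\<^sup>+q'. kq n q q' * H z \<zeta> q q' \<partial>XXM) \<partial>XXM)"
          unfolding b_def by (rule nn_integral_cmult[OF m1, symmetric])
        also have "\<dots> = (\<integral>\<^sup>+q. \<integral>\<^sup>+q'. kz n z \<zeta> * (kq n q q' * H z \<zeta> q q') \<partial>XXM \<partial>XXM)"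
          by (rule nn_integral_cong) (rule nn_integral_cmult[OF m2, symmetric])
        finally show "kz n z \<zeta> * b n z \<zeta> = (\<integral>\<^sup>+q. \<integral>\<^sup>+q'. K' n (Jz (q, z)) (Jz (q', \<zeta>)) \<partial>XXM \<partial>XXM)"
          unfolding fun_cong[OF slice] .
      qed
      also have "\<dots> = (\<integral>\<^sup>+q. \<integral>\<^sup>+\<zeta>. \<integral>\<^sup>+q'. K' n (Jz (q, z)) (Jz (q', \<zeta>)) \<partial>XXM \<partial>ZM h \<partial>XXM)"
      proof (rule dz.BT.Fubini')
        have J: "(\<lambda>x. Jz (u x, w x)) \<in> measurable N (Om h)" if "u \<in> measurable N XXM" "w \<in> measurable N (ZM h)" for u w N
          by (rule measurable_compose[OF measurable_Pair[OF that] J_measurable(3)])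
        show "(\<lambda>(q, \<zeta>). \<integral>\<^sup>+q'. K' n (Jz (q, z)) (Jz (q', \<zeta>)) \<partial>XXM) \<in> borel_measurable (XXM \<Otimes>\<^sub>M ZM h)"
          unfolding split_beta'
          by (intro XXMm, unfold split_beta') (intro K'm J, use z in measurable)
      qed
      also have "\<dots> = (\<integral>\<^sup>+q. \<integral>\<^sup>+p'. K' n (Jz (q, z)) p' \<partial>Om h \<partial>XXM)"
      proof (rule nn_integral_cong)
        fix q assume q: "q \<in> space XXM"
        have "Jz (q, z) \<in> space (Om h)"
          using q z by (intro measurable_space[OF J_measurable(3)]) (simp add: space_pair_measure)
        then have "K' n (Jz (q, z)) \<in> borel_measurable (Om h)" by (intro K'm) auto
        from nn_integral_z[OF this] show "(\<integral>\<^sup>+\<zeta>. \<integral>\<^sup>+q'. K' n (Jz (q, z)) (Jz (q', \<zeta>)) \<partial>XXM \<partial>ZM h) = (\<integral>\<^sup>+p'. K' n (Jz (q, z)) p' \<partial>Om h)"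
          by simp
      qed
      finally show "ennreal (h / 2 ^ n) * a n z \<le> 4 * (\<integral>\<^sup>+q. \<integral>\<^sup>+p'. K' n (Jz (q, z)) p' \<partial>Om h \<partial>XXM)" by (simp add: mult_left_mono)
    qed
    also have "\<dots> = 4 * I n"
    proof -
      have m: "(\<lambda>p. \<integral>\<^sup>+p'. K' n p p' \<partial>Om h) \<in> borel_measurable (Om h)"
        by (rule Omm) (unfold split_beta', rule K'm; measurable)
      have "(\<lambda>z. \<integral>\<^sup>+q. \<integral>\<^sup>+p'. K' n (Jz (q, z)) p' \<partial>Om h \<partial>XXM) \<in> borel_measurable (ZM h)"
        by (rule XXMm) (rule pair_slice_measurable[OF m])
      then show ?thesis unfolding I_def nn_integral_z[OF m] by (rule nn_integral_cmult)
    qed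
    finally show ?thesis .
  qed
  \<comment> \<open>Division by the mass of the vertical cell raises the weight from
    \<open>8^n\<close> to \<open>16^n / h\<close>.\<close>
  have step': "ennreal (8 ^ n) * (\<integral>\<^sup>+z. a n z \<partial>ZM h) \<le> ennreal (4 / h) * (ennreal (16 ^ n) * I n)" for n
  proof -
    have e: "ennreal (8 ^ n) = ennreal (16 ^ n / h) * ennreal (h / 2 ^ n)"
    proof -
      have "(16::real) ^ n = 8 ^ n * 2 ^ n" by (simp flip: power_mult_distrib)
      then show ?thesis using h by (subst ennreal_mult[symmetric]) auto
    qed
    have "ennreal (8 ^ n) * (\<integral>\<^sup>+z. a n z \<partial>ZM h) \<le> ennreal (16 ^ n / h) * (4 * I n)"
      unfolding e mult.assoc by (rule mult_left_mono[OF step]) simp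
    also have "\<dots> = (ennreal (16 ^ n / h) * ennreal 4) * I n" by (simp add: mult.assoc)
    also have "ennreal (16 ^ n / h) * ennreal 4 = ennreal (4 / h) * ennreal (16 ^ n)"
    proof -
      have "16 ^ n / h * 4 = 4 / h * 16 ^ n" by simp
      moreover have "0 \<le> 16 ^ n / h" "0 \<le> 4 / h" using h by auto
      ultimately show ?thesis by (metis ennreal_mult zero_le_numeral zero_le_power)
    qed
    finally show ?thesis by (simp add: mult.assoc)
  qed
  have sumI: "(\<Sum>n. ennreal (16 ^ n) * I n) \<le> ennreal (2 * (2 + h\<^sup>2)\<^sup>2) * ennreal K"
  proof -
    have m: "(\<lambda>p. \<integral>\<^sup>+p'. ennreal (16 ^ n) * K' n p p' \<partial>Om h) \<in> borel_measurable (Om h)" for n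
      by (rule Omm) (unfold split_beta', intro borel_measurable_times_ennreal K'm borel_measurable_const; measurable)
    have m0: "(\<lambda>p. \<integral>\<^sup>+p'. K' n p p' \<partial>Om h) \<in> borel_measurable (Om h)" for n
      by (rule Omm) (unfold split_beta', rule K'm; measurable)
    have mp: "K' n p \<in> borel_measurable (Om h)" if "p \<in> space (Om h)" for n p by (rule K'm) (use that in auto)
    have "ennreal (16 ^ n) * I n = (\<integral>\<^sup>+p. \<integral>\<^sup>+p'. ennreal (16 ^ n) * K' n p p' \<partial>Om h \<partial>Om h)" for n
      unfolding I_def nn_integral_cmult[OF m0, symmetric] by (rule nn_integral_cong) (rule nn_integral_cmult[OF mp, symmetric])
    then have "(\<Sum>n. ennreal (16 ^ n) * I n) = (\<integral>\<^sup>+p. (\<Sum>n. \<integral>\<^sup>+p'. ennreal (16 ^ n) * K' n p p' \<partial>Om h) \<partial>Om h)"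
      using nn_integral_suminf[OF m] by simp
    also have "\<dots> = (\<integral>\<^sup>+p. \<integral>\<^sup>+p'. (\<Sum>n. ennreal (16 ^ n) * K' n p p') \<partial>Om h \<partial>Om h)"
    proof (rule nn_integral_cong)
      fix p assume "p \<in> space (Om h)"
      then have "(\<lambda>p'. ennreal (16 ^ n) * K' n p p') \<in> borel_measurable (Om h)" for n using mp by measurable
      from nn_integral_suminf[OF this] show "(\<Sum>n. \<integral>\<^sup>+p'. ennreal (16 ^ n) * K' n p p' \<partial>Om h) = (\<integral>\<^sup>+p'. (\<Sum>n. ennreal (16 ^ n) * K' n p p') \<partial>Om h)"
        by simp
    qed
    also have "\<dots> \<le> (\<integral>\<^sup>+p. \<integral>\<^sup>+p'. ennreal (2 * (2 + h\<^sup>2)\<^sup>2) * ennreal (R (p, p')) \<partial>Om h \<partial>Om h)"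
      unfolding K'_def by (intro nn_integral_mono order_trans[OF cell_sum_le_kernel] mult_left_mono ennreal_leI R(2)) auto
    also have "\<dots> = ennreal (2 * (2 + h\<^sup>2)\<^sup>2) * (\<integral>\<^sup>+p. \<integral>\<^sup>+p'. ennreal (R (p, p')) \<partial>Om h \<partial>Om h)"
    proof -
      have m1: "(\<lambda>p'. ennreal (R (p, p'))) \<in> borel_measurable (Om h)" if "p \<in> space (Om h)" for p
        using measurable_compose[OF measurable_Pair1'[OF that] R(1)] by measurable
      have m2: "(\<lambda>p. \<integral>\<^sup>+p'. ennreal (R (p, p')) \<partial>Om h) \<in> borel_measurable (Om h)"
        by (rule Omm) (use R(1) in simp)
      show ?thesis unfolding nn_integral_cmult[OF m2, symmetric] by (rule nn_integral_cong) (rule nn_integral_cmult[OF m1])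
    qed
    also have "\<dots> \<le> ennreal (2 * (2 + h\<^sup>2)\<^sup>2) * ennreal K" by (rule mult_left_mono[OF K(1)]) simp
    finally show ?thesis .
  qed
  have "(\<integral>\<^sup>+z. \<theta> z \<partial>ZM h) = 210 * ((\<integral>\<^sup>+z. \<integral>\<^sup>+q. ennreal ((g (Jz (q, z)))\<^sup>2) \<partial>XXM \<partial>ZM h) + (\<integral>\<^sup>+z. (\<Sum>n. ennreal (8 ^ n) * a n z) \<partial>ZM h))"
    unfolding \<theta>_def using am Bm by (subst nn_integral_cmult, measurable) (subst nn_integral_add, auto)
  also have "(\<integral>\<^sup>+z. \<integral>\<^sup>+q. ennreal ((g (Jz (q, z)))\<^sup>2) \<partial>XXM \<partial>ZM h) = (\<integral>\<^sup>+p. ennreal ((g p)\<^sup>2) \<partial>Om h)"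
    by (rule nn_integral_z[symmetric]) (use g in measurable)
  also have "(\<integral>\<^sup>+z. (\<Sum>n. ennreal (8 ^ n) * a n z) \<partial>ZM h) = (\<Sum>n. ennreal (8 ^ n) * (\<integral>\<^sup>+z. a n z \<partial>ZM h))"
    using am by (subst nn_integral_suminf) (auto simp: nn_integral_cmult)
  also have "\<dots> \<le> (\<Sum>n. ennreal (4 / h) * (ennreal (16 ^ n) * I n))" by (rule suminf_le[OF step']) auto
  also have "\<dots> = ennreal (4 / h) * (\<Sum>n. ennreal (16 ^ n) * I n)" by (rule ennreal_suminf_cmult)
  also have "\<dots> \<le> ennreal (4 / h) * (ennreal (2 * (2 + h\<^sup>2)\<^sup>2) * ennreal K)" by (rule mult_left_mono[OF sumI]) simp
  also have "\<dots> = ennreal (8 * (2 + h\<^sup>2)\<^sup>2 / h * K)"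
    using h K(2) by (simp add: ennreal_mult[symmetric] field_simps)
  finally have "(\<integral>\<^sup>+z. \<theta> z \<partial>ZM h) \<le> 210 * ((\<integral>\<^sup>+p. ennreal ((g p)\<^sup>2) \<partial>Om h) + ennreal (8 * (2 + h\<^sup>2)\<^sup>2 / h * K))"
    by (simp add: mult_left_mono add_left_mono)
  also have "\<dots> \<le> 210 * (ennreal B + ennreal (8 * (2 + h\<^sup>2)\<^sup>2 / h * K))" by (intro mult_left_mono add_right_mono B) simp
  also have "\<dots> = ennreal (210 * (B + 8 * (2 + h\<^sup>2)\<^sup>2 / h * K))"
  proof -
    have X: "0 \<le> 8 * (2 + h\<^sup>2)\<^sup>2 / h * K" using h K(2) by simp
    show ?thesis unfolding ennreal_plus[OF B(2) X, symmetric] by (rule numeral_mult_ennreal) (use B(2) X in simp)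
  qed
  finally have "(\<integral>\<^sup>+z. \<theta> z \<partial>ZM h) \<le> ennreal (210 * (B + 8 * (2 + h\<^sup>2)\<^sup>2 / h * K))" .
  moreover have "AE z in ZM h. (\<integral>\<^sup>+q. ennreal ((g (Jz (q, z))) ^ 4) \<partial>XXM) \<le> (\<theta> z)\<^sup>2"
    using AE_space by eventually_elim (rule L4)
  ultimately show ?thesis unfolding L24_def using g \<theta>m B(2) K(2) h by (intro conjI exI[of _ \<theta>]) auto
qed

end

subsection \<open>Derivatives of the advection\<close>

lemma L2_cong_slab:
  assumes "f \<in> L2 h" "\<And>x y z. z \<in> {-h<..<0} \<Longrightarrow> g (x, y, z) = f (x, y, z)"
  shows "g \<in> L2 h" "L2_norm h g = L2_norm h f"
proof -
  note f = L2_D[OF assms(1)]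
  have e: "g p = f p" if "p \<in> space (Om h)" for p
    using that assms(2) by (cases p) (auto simp: cell_def)
  have "hperiodic h g" using f(1) assms(2) by (simp add: hperiodic_def)
  moreover have "g \<in> borel_measurable (Om h)" using f(2) measurable_cong[of "Om h" g f borel] e by simp
  moreover have "integrable (Om h) (\<lambda>p. (norm (g p))\<^sup>2)"
    using f(3) Bochner_Integration.integrable_cong[OF refl, of "Om h" "\<lambda>p. (norm (g p))\<^sup>2" "\<lambda>p. (norm (f p))\<^sup>2"] e by simp
  ultimately show "g \<in> L2 h" by (simp add: L2_iff)
  show "L2_norm h g = L2_norm h f" unfolding L2_norm_eq
    using Bochner_Integration.integral_cong[OF refl, of "Om h" "\<lambda>p. (norm (g p))\<^sup>2" "\<lambda>p. (norm (f p))\<^sup>2"] e by simp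
qed

lemma L2_norm_component_le:
  fixes f :: field
  assumes "f \<in> L2 h" shows "L2_norm h (\<lambda>p. f p $ i) \<le> L2_norm h f"
proof (rule power2_le_imp_le[OF _ L2_norm_nonneg])
  show "(L2_norm h (\<lambda>p. f p $ i))\<^sup>2 \<le> (L2_norm h f)\<^sup>2"
    using exhaust_2[of i] by (auto simp: L2_norm_field[OF assms])
qed

lemma L2_norm_le_components:
  fixes f :: field
  assumes f: "f \<in> L2 h" and "\<And>i. L2_norm h (\<lambda>p. f p $ i) \<le> B"
  shows "L2_norm h f \<le> 2 * B"
proof -
  have B: "0 \<le> B" using order_trans[OF L2_norm_nonneg assms(2)] .
  have "(L2_norm h f)\<^sup>2 \<le> B\<^sup>2 + B\<^sup>2" unfolding L2_norm_field[OF f]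
    by (intro add_mono power_mono assms L2_norm_nonneg)
  also have "\<dots> \<le> (2 * B)\<^sup>2" by (simp add: power_mult_distrib)
  finally show ?thesis by (rule power2_le_imp_le) (use B in simp)
qed

lemma L2_norm_cmult: "L2_norm h (\<lambda>p. c * f p) = \<bar>c\<bar> * L2_norm h f" for f :: "point \<Rightarrow> real"
  by (simp add: L2_norm_eq power_mult_distrib real_sqrt_mult)

lemma Sobolev_norm_nonneg: "0 \<le> Sobolev_norm h m v"
  by (auto simp: Sobolev_norm_def intro: sum_nonneg)

lemma Sobolev_norm_mono: "m \<le> n \<Longrightarrow> Sobolev_norm h m v \<le> Sobolev_norm h n v"
  unfolding Sobolev_norm_def
  by (intro real_sqrt_le_mono sum_mono2 finite_multiindices) auto

context slab
begin

text \<open>The relations for the three directions obey the same rules for sums, multiples and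
  products, so that statements about all derivatives can be proved once for an arbitrary
  member.\<close>

definition directional :: "((point \<Rightarrow> real) \<Rightarrow> (point \<Rightarrow> real) \<Rightarrow> bool) set" where
  "directional = {dx.wd, dy.wd, dz.wd}"

lemma directional_rules:
  assumes "w \<in> directional"
  shows "w f g \<Longrightarrow> w f2 g2 \<Longrightarrow> w (\<lambda>p. f p + f2 p) (\<lambda>p. g p + g2 p)"
    "w f g \<Longrightarrow> w (\<lambda>p. c * f p) (\<lambda>p. c * g p)"
    "w f g \<Longrightarrow> w f2 g2 \<Longrightarrow> w (\<lambda>p. f p * f2 p) (\<lambda>p. g p * f2 p + f p * g2 p)"
    "w f g \<Longrightarrow> AE p in Om h. f p = f2 p \<Longrightarrow> f2 \<in> borel_measurable (Om h) \<Longrightarrow> g \<in> borel_measurable (Om h) \<Longrightarrow> w f2 g"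
  using assms unfolding directional_def
  by (auto intro: dx.wd_add dy.wd_add dz.wd_add dx.wd_cmult dy.wd_cmult dz.wd_cmult dx.wd_mult dy.wd_mult dz.wd_mult
      dx.wd_cong[where g = g] dy.wd_cong[where g = g] dz.wd_cong[where g = g])

lemma product_L2:
  assumes "L24 \<psi> A" "L24 g B" "f \<in> borel_measurable (Om h)" "hperiodic h f" "hperiodic h g"
    and "AE c in XXM. AE z in ZM h. ennreal \<bar>f (Jz (c, z))\<bar> \<le> (\<integral>\<^sup>+t. ennreal \<bar>\<psi> (Jz (c, t))\<bar> \<partial>ZM h)"
  shows "(\<lambda>p. f p * g p) \<in> L2 h" "L2_norm h (\<lambda>p. f p * g p) \<le> sqrt (h * A * B)"
proof -
  have m: "(\<lambda>p. f p * g p) \<in> borel_measurable (Om h)" using assms(3) L24_measurable[OF assms(2)] by measurable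
  have le: "(\<integral>\<^sup>+p. ennreal ((f p * g p)\<^sup>2) \<partial>Om h) \<le> ennreal (h * A * B)"
    by (rule vertical_product_estimate[OF assms(1,2,3,6)])
  have "integrable (Om h) (\<lambda>p. (f p * g p)\<^sup>2)"
  proof (rule integrableI_bounded)
    show "(\<lambda>p. (f p * g p)\<^sup>2) \<in> borel_measurable (Om h)" using m by measurable
    show "(\<integral>\<^sup>+p. ennreal (norm ((f p * g p)\<^sup>2)) \<partial>Om h) < \<infinity>" using le by (simp add: le_less_trans)
  qed
  then show L: "(\<lambda>p. f p * g p) \<in> L2 h" using m assms(4,5) by (simp add: L2_iff hperiodic_def)
  have "ennreal ((L2_norm h (\<lambda>p. f p * g p))\<^sup>2) \<le> ennreal (h * A * B)"
    using le nn_integral_L2[OF L] by simp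
  then have "(L2_norm h (\<lambda>p. f p * g p))\<^sup>2 \<le> h * A * B"
    using h L24_nonneg[OF assms(1)] L24_nonneg[OF assms(2)] by (simp add: ennreal_le_iff)
  then show "L2_norm h (\<lambda>p. f p * g p) \<le> sqrt (h * A * B)" by (rule real_le_rsqrt)
qed

end

section \<open>Counting derivatives in the factors of the advection\<close>

locale regular_field = slab +
  fixes v :: field and N :: nat
  assumes v: "v \<in> Sobolev h N"
begin

text \<open>The representative of the derivative of order zero is \<open>v\<close> itself, as in the advection term.\<close>

definition D :: "multiindex \<Rightarrow> field" where
  "D \<alpha> = (if \<alpha> = (0, 0, 0) then v else weak_deriv h \<alpha> v)"

abbreviation nrm :: "nat \<Rightarrow> real" where "nrm m \<equiv> Sobolev_norm h m v"

lemma v_L2: "v \<in> L2 h"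
  using v by (simp add: Sobolev_def)

lemma D_weak:
  assumes "mi_order \<alpha> \<le> N" shows "has_weak_deriv h \<alpha> v (D \<alpha>)"
proof (cases "\<alpha> = (0, 0, 0)")
  case True
  then show ?thesis using has_weak_deriv_0[OF v_L2] by (simp add: D_def)
next
  case False
  obtain g where "has_weak_deriv h \<alpha> v g" using v assms unfolding Sobolev_def by blast
  then show ?thesis using False weak_deriv by (simp add: D_def)
qed

lemma D_L2: "mi_order \<alpha> \<le> N \<Longrightarrow> D \<alpha> \<in> L2 h"
  using D_weak by (simp add: has_weak_deriv_def)

lemma D_component_L2: "mi_order \<alpha> \<le> N \<Longrightarrow> (\<lambda>p. D \<alpha> p $ i) \<in> L2 h"
  using D_L2 L2_component by blast

lemma nrm_mono: "m \<le> n \<Longrightarrow> nrm m \<le> nrm n" and nrm_nonneg: "0 \<le> nrm m"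
  by (rule Sobolev_norm_mono Sobolev_norm_nonneg; assumption)+

lemma D_norm_le:
  assumes "mi_order \<alpha> \<le> m" "m \<le> N"
  shows "L2_norm h (\<lambda>p. D \<alpha> p $ i) \<le> nrm m"
proof -
  have "L2_norm h (\<lambda>p. D \<alpha> p $ i) \<le> L2_norm h (D \<alpha>)" by (rule L2_norm_component_le[OF D_L2]) (use assms in simp)
  also have "\<dots> = L2_norm h (weak_deriv h \<alpha> v)"
    using L2_norm_weak_deriv[OF D_weak[of \<alpha>]] assms by simp
  also have "\<dots> = sqrt ((L2_norm h (weak_deriv h \<alpha> v))\<^sup>2)" by (simp add: L2_norm_nonneg)
  also have "\<dots> \<le> nrm m" unfolding Sobolev_norm_def
    by (intro real_sqrt_le_mono member_le_sum finite_multiindices) (use assms in auto)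
  finally show ?thesis .
qed

lemma D_wd:
  assumes "a + b + c < N"
  shows "dx.wd (\<lambda>p. D (a, b, c) p $ i) (\<lambda>p. D (Suc a, b, c) p $ i)"
    "dy.wd (\<lambda>p. D (a, b, c) p $ i) (\<lambda>p. D (a, Suc b, c) p $ i)"
    "dz.wd (\<lambda>p. D (a, b, c) p $ i) (\<lambda>p. D (a, b, Suc c) p $ i)"
  by (rule wd_weak_deriv[OF D_weak D_weak]; use assms in simp)+

fun divD :: "multiindex \<Rightarrow> point \<Rightarrow> real" where
  "divD (a, b, c) = (\<lambda>p. D (Suc a, b, c) p $ 1 + D (a, Suc b, c) p $ 2)"

declare divD.simps [simp del]

lemma divD_wd:
  assumes "a + b + c + 1 < N"
  shows "dx.wd (divD (a, b, c)) (divD (Suc a, b, c))"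
    "dy.wd (divD (a, b, c)) (divD (a, Suc b, c))"
    "dz.wd (divD (a, b, c)) (divD (a, b, Suc c))"
  unfolding divD.simps using assms
  by (auto intro!: dx.wd_add dy.wd_add dz.wd_add D_wd)

lemma divD_L2: "mi_order \<alpha> < N \<Longrightarrow> divD \<alpha> \<in> L2 h"
  by (cases \<alpha> rule: divD.cases) (auto simp: divD.simps intro!: L2_add D_component_L2)

lemma divD_integrable: "mi_order \<alpha> < N \<Longrightarrow> integrable (Om h) (divD \<alpha>)"
  by (rule L2_integrable[OF divD_L2])

text \<open>The second clause arises when \<open>w(v)\<close> is differentiated vertically: the
  result is minus the divergence, which has one order more than its multi-index shows.\<close>

inductive G :: "nat \<Rightarrow> (point \<Rightarrow> real) \<Rightarrow> bool" where
  G_D: "mi_order \<alpha> = c \<Longrightarrow> G c (\<lambda>p. D \<alpha> p $ i)"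
| G_div: "mi_order \<beta> + 1 = c \<Longrightarrow> G c (\<lambda>p. - divD \<beta> p)"

text \<open>The derivative lost in the divergence is regained by the vertical integration.\<close>

inductive F :: "nat \<Rightarrow> (point \<Rightarrow> real) \<Rightarrow> bool" where
  F_G: "G a f \<Longrightarrow> F a f"
| F_w: "F (a + b) (vprim (divD (a, b, 0)))"

lemma G_L2:
  assumes "G c f" "c \<le> N" shows "f \<in> L2 h" "L2_norm h f \<le> 2 * nrm c"
proof -
  have "f \<in> L2 h \<and> L2_norm h f \<le> 2 * nrm c"
    using assms
  proof cases
    case (G_D \<alpha> i)
    then show ?thesis using D_component_L2[of \<alpha> i] D_norm_le[of \<alpha> c i] assms(2) nrm_nonneg[of c] by simp
  next
    case (G_div \<beta>)
    obtain a b d where \<beta>: "\<beta> = (a, b, d)" by (cases \<beta>)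
    have o: "mi_order (Suc a, b, d) = c" "mi_order (a, Suc b, d) = c" using G_div \<beta> by auto
    have d: "divD \<beta> \<in> L2 h" by (rule divD_L2) (use G_div assms(2) in simp)
    have "L2_norm h f = L2_norm h (divD \<beta>)" unfolding G_div using L2_norm_cmult[of h "-1" "divD \<beta>"] by simp
    also have "\<dots> \<le> L2_norm h (\<lambda>p. D (Suc a, b, d) p $ 1) + L2_norm h (\<lambda>p. D (a, Suc b, d) p $ 2)"
      unfolding \<beta> divD.simps by (intro L2_triangle D_component_L2) (use o assms(2) in auto)
    also have "\<dots> \<le> nrm c + nrm c" by (intro add_mono D_norm_le) (use o assms(2) in auto)
    finally show ?thesis using G_div L2_scale[OF d, of "-1"] by simp
  qed
  then show "f \<in> L2 h" "L2_norm h f \<le> 2 * nrm c" by auto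
qed

lemma G_derivative:
  assumes w: "w \<in> directional" and f: "G c f" and c: "c < N"
  obtains g where "G (Suc c) g" "w f g"
  using f
proof cases
  case (G_D \<alpha> i)
  obtain a b d where \<alpha>: "\<alpha> = (a, b, d)" by (cases \<alpha>)
  have o: "a + b + d < N" using G_D \<alpha> c by simp
  have "G (Suc c) (\<lambda>p. D (Suc a, b, d) p $ i)" "G (Suc c) (\<lambda>p. D (a, Suc b, d) p $ i)" "G (Suc c) (\<lambda>p. D (a, b, Suc d) p $ i)"
    by (rule G.G_D, use G_D \<alpha> in simp)+
  then show ?thesis using that D_wd[OF o, of i] w unfolding G_D \<alpha> directional_def by auto
next
  case (G_div \<beta>)
  obtain a b d where \<beta>: "\<beta> = (a, b, d)" by (cases \<beta>)
  have o: "a + b + d + 1 < N" using G_div \<beta> c by simp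
  have "G (Suc c) (\<lambda>p. - divD (Suc a, b, d) p)" "G (Suc c) (\<lambda>p. - divD (a, Suc b, d) p)" "G (Suc c) (\<lambda>p. - divD (a, b, Suc d) p)"
    by (rule G.G_div, use G_div \<beta> in simp)+
  moreover have "w (\<lambda>p. - divD \<beta> p) (\<lambda>p. - g p)" if "w (divD \<beta>) g" for g
    using directional_rules(2)[OF w that, of "-1"] by simp
  ultimately show ?thesis using that divD_wd[OF o] w unfolding G_div(1) \<beta> directional_def by auto
qed

lemma G_L24:
  assumes f: "G c f" and c: "c < N"
  shows "L24 f (20 * (nrm c * nrm (Suc c)))"
proof -
  have d: "dx.wd \<in> directional" "dy.wd \<in> directional" by (auto simp: directional_def)
  obtain fx where fx: "G (Suc c) fx" "dx.wd f fx" by (rule G_derivative[OF d(1) f c])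
  obtain fy where fy: "G (Suc c) fy" "dy.wd f fy" by (rule G_derivative[OF d(2) f c])
  have c': "c \<le> N" "Suc c \<le> N" using c by auto
  note Lf = G_L2[OF f c'(1)] and Lx = G_L2[OF fx(1) c'(2)] and Ly = G_L2[OF fy(1) c'(2)]
  \<comment> \<open>Each of the three functions has norm at most twice the corresponding Sobolev
    norm, and \<open>2 + 4 + 4 = 10\<close>.\<close>
  have "L2_norm h f * (L2_norm h f + 2 * L2_norm h fx + 2 * L2_norm h fy) \<le> (2 * nrm c) * (10 * nrm (Suc c))"
    using Lf(2) Lx(2) Ly(2) nrm_mono[of c "Suc c"] nrm_nonneg[of c]
    by (intro mult_mono) (auto intro!: add_nonneg_nonneg simp: L2_norm_nonneg)
  then show ?thesis using L24_mono[OF ladyzhenskaya[OF fx(2) fy(2) Lf(1) Lx(1) Ly(1)]] by simp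
qed

lemma F_derivative:
  assumes w: "w \<in> directional" and f: "F a f" and a: "a + 2 \<le> N"
  obtains g where "F (Suc a) g" "w f g"
  using f
proof cases
  case F_G
  obtain g where "G (Suc a) g" "w f g" by (rule G_derivative[OF w F_G(1)]) (use a in simp)
  then show ?thesis using that F.F_G by blast
next
  case (F_w c d)
  have i: "integrable (Om h) (divD (c, d, 0))" "integrable (Om h) (divD (Suc c, d, 0))" "integrable (Om h) (divD (c, Suc d, 0))"
    by (rule divD_integrable, use F_w a in simp)+
  have o: "c + d + 0 + 1 < N" using F_w a by simp
  have "dx.wd f (vprim (divD (Suc c, d, 0)))" unfolding F_w by (rule vprim_wd_x[OF divD_wd(1)[OF o] i(1,2)])
  moreover have "dy.wd f (vprim (divD (c, Suc d, 0)))" unfolding F_w by (rule vprim_wd_y[OF divD_wd(2)[OF o] i(1,3)])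
  moreover have "dz.wd f (\<lambda>p. - divD (c, d, 0) p)" unfolding F_w by (rule vprim_wd_z[OF i(1)])
  moreover have "F (Suc a) (vprim (divD (Suc c, d, 0)))" "F (Suc a) (vprim (divD (c, Suc d, 0)))"
    using F.F_w[of "Suc c" d] F.F_w[of c "Suc d"] F_w(1) by auto
  moreover have "F (Suc a) (\<lambda>p. - divD (c, d, 0) p)"
    by (intro F.F_G G.G_div) (use F_w in simp)
  ultimately show ?thesis using that w unfolding directional_def by auto
qed

lemma F_regular:
  assumes f: "F a f" and a: "a < N"
  shows "f \<in> borel_measurable (Om h)" "hperiodic h f"
proof -
  have "f \<in> borel_measurable (Om h) \<and> hperiodic h f"
    using f
  proof cases
    case F_G
    then show ?thesis using L2_D[OF G_L2(1)[OF F_G(1)]] a by simp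
  next
    case (F_w c d)
    have "divD (c, d, 0) \<in> L2 h" by (rule divD_L2) (use F_w a in simp)
    then show ?thesis using vprim_measurable vprim_hperiodic L2_D unfolding F_w by blast
  qed
  then show "f \<in> borel_measurable (Om h)" "hperiodic h f" by auto
qed

text \<open>A derivative of \<open>v\<close> is dominated through its vertical derivative, the
  primitive through its integrand. In both cases functions of order at most \<open>a + 1\<close>
  appear under the integral, and Ladyzhenskaya's inequality for them costs the norms of orders
  \<open>a + 1\<close> and \<open>a + 2\<close>.\<close>

lemma F_dominated:
  assumes f: "F a f" and a: "a + 2 \<le> N"
  obtains \<psi> where "L24 \<psi> (60 * ((1 / h)\<^sup>2 + 1) * (nrm (a + 1) * nrm (a + 2)))"
    "AE c in XXM. AE z in ZM h. ennreal \<bar>f (Jz (c, z))\<bar> \<le> (\<integral>\<^sup>+t. ennreal \<bar>\<psi> (Jz (c, t))\<bar> \<partial>ZM h)"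
  using f
proof cases
  case F_G
  have w: "dz.wd \<in> directional" by (simp add: directional_def)
  obtain g where g: "G (Suc a) g" "dz.wd f g" by (rule G_derivative[OF w F_G(1)]) (use a in simp)
  have "L24 (\<lambda>p. (1 / h) * \<bar>f p\<bar> + \<bar>g p\<bar>) (3 * ((1 / h)\<^sup>2 * (20 * (nrm a * nrm (Suc a))) + 20 * (nrm (Suc a) * nrm (Suc (Suc a)))))"
    by (intro L24_add L24_cmult L24_abs G_L24 F_G g) (use a in auto)
  moreover have "3 * ((1 / h)\<^sup>2 * (20 * (nrm a * nrm (Suc a))) + 20 * (nrm (Suc a) * nrm (Suc (Suc a))))
      \<le> 60 * ((1 / h)\<^sup>2 + 1) * (nrm (a + 1) * nrm (a + 2))"
  proof -
    have "nrm a * nrm (Suc a) \<le> nrm (a + 2) * nrm (a + 1)"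
      by (intro mult_mono nrm_mono nrm_nonneg) auto
    from mult_left_mono[OF this, of "(1 / h)\<^sup>2"] show ?thesis by (simp add: algebra_simps)
  qed
  ultimately have "L24 (\<lambda>p. (1 / h) * \<bar>f p\<bar> + \<bar>g p\<bar>) (60 * ((1 / h)\<^sup>2 + 1) * (nrm (a + 1) * nrm (a + 2)))"
    by (rule L24_mono)
  moreover have "f \<in> borel_measurable (Om h)" "g \<in> borel_measurable (Om h)"
    using L2_D(2)[OF G_L2(1)[OF F_G(1)]] L2_D(2)[OF G_L2(1)[OF g(1)]] a by auto
  ultimately show ?thesis using that wd_z_dominated[OF g(2)] by blast
next
  case (F_w c d)
  have i: "integrable (Om h) (divD (c, d, 0))" by (rule divD_integrable) (use F_w a in simp)
  have "G (Suc a) (\<lambda>p. - divD (c, d, 0) p)" by (rule G.G_div) (use F_w in simp)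
  then have "L24 (\<lambda>p. - divD (c, d, 0) p) (20 * (nrm (Suc a) * nrm (Suc (Suc a))))"
    by (rule G_L24) (use a in simp)
  from L24_cmult[OF this, of "-1"] have "L24 (divD (c, d, 0)) (20 * (nrm (Suc a) * nrm (Suc (Suc a))))" by simp
  moreover have "20 * (nrm (Suc a) * nrm (Suc (Suc a))) \<le> 60 * ((1 / h)\<^sup>2 + 1) * (nrm (a + 1) * nrm (a + 2))"
  proof -
    have "0 \<le> nrm (a + 1) * nrm (a + 2)" "0 \<le> (1 / h)\<^sup>2 * (nrm (a + 1) * nrm (a + 2))" by (simp_all add: nrm_nonneg)
    then show ?thesis by (simp add: algebra_simps)
  qed
  ultimately have "L24 (divD (c, d, 0)) (60 * ((1 / h)\<^sup>2 + 1) * (nrm (a + 1) * nrm (a + 2)))" by (rule L24_mono)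
  then show ?thesis using that vprim_dominated[OF i] unfolding F_w by blast
qed

lemma FG_product:
  assumes "F a f" "G c g" "a + 2 \<le> N" "c < N"
  shows "(\<lambda>p. f p * g p) \<in> L2 h"
    "L2_norm h (\<lambda>p. f p * g p) \<le> sqrt (1200 * h * ((1 / h)\<^sup>2 + 1) * (nrm (a + 1) * nrm (a + 2) * (nrm c * nrm (Suc c))))"
proof -
  obtain \<psi> where \<psi>: "L24 \<psi> (60 * ((1 / h)\<^sup>2 + 1) * (nrm (a + 1) * nrm (a + 2)))"
    "AE c in XXM. AE z in ZM h. ennreal \<bar>f (Jz (c, z))\<bar> \<le> (\<integral>\<^sup>+t. ennreal \<bar>\<psi> (Jz (c, t))\<bar> \<partial>ZM h)"
    by (rule F_dominated[OF assms(1,3)])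
  have a: "a < N" and c: "c \<le> N" using assms by auto
  note p = product_L2[OF \<psi>(1) G_L24[OF assms(2,4)] F_regular[OF assms(1) a] L2_D(1)[OF G_L2(1)[OF assms(2) c]] \<psi>(2)]
  show "(\<lambda>p. f p * g p) \<in> L2 h" by (rule p(1))
  show "L2_norm h (\<lambda>p. f p * g p) \<le> sqrt (1200 * h * ((1 / h)\<^sup>2 + 1) * (nrm (a + 1) * nrm (a + 2) * (nrm c * nrm (Suc c))))"
    using p(2) by (simp add: mult_ac)
qed

text \<open>Sums of \<open>n\<close> products carrying \<open>m + 1\<close> derivatives in total, with at least one of them on the
  second factor.\<close>

inductive R :: "nat \<Rightarrow> nat \<Rightarrow> (point \<Rightarrow> real) \<Rightarrow> bool" where
  R_0: "R 0 m (\<lambda>p. 0)"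
| R_Suc: "F a f \<Longrightarrow> G c g \<Longrightarrow> a + c = Suc m \<Longrightarrow> a \<le> m \<Longrightarrow> R n m q \<Longrightarrow> R (Suc n) m (\<lambda>p. f p * g p + q p)"
| R_cong: "R n m q \<Longrightarrow> AE p in Om h. q p = q2 p \<Longrightarrow> q2 \<in> L2 h \<Longrightarrow> R n m q2"

definition bnd :: "nat \<Rightarrow> real" where
  "bnd k = sqrt (1200 * h * ((1 / h)\<^sup>2 + 1)) * (sqrt (nrm k) * nrm (k + 1) * sqrt (nrm (k + 2)))"

text \<open>The four orders have to be matched with \<open>k\<close>, \<open>k + 1\<close>,
  \<open>k + 1\<close>, \<open>k + 2\<close>. The critical distributions are \<open>a = k\<close>
  and \<open>a = 0\<close>, where one order reaches \<open>k + 2\<close>; then the two small orders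
  are 1 and 2, which fit because \<open>k \<ge> 1\<close>. The condition \<open>a \<le> m\<close>,
  at least one derivative on the second factor, excludes the order \<open>k + 3\<close>.\<close>

lemma nrm_product_le:
  assumes "a + c = Suc m" "a \<le> m" "m \<le> k" "1 \<le> k"
  shows "nrm (a + 1) * nrm (a + 2) * (nrm c * nrm (Suc c)) \<le> nrm k * (nrm (k + 1))\<^sup>2 * nrm (k + 2)"
proof -
  have *: "x1 * x2 * x3 * x4 \<le> nrm k * nrm (k + 1) * nrm (k + 1) * nrm (k + 2)"
    if "x1 \<le> nrm k" "x2 \<le> nrm (k + 1)" "x3 \<le> nrm (k + 1)" "x4 \<le> nrm (k + 2)" "0 \<le> x1" "0 \<le> x2" "0 \<le> x3" "0 \<le> x4"
    for x1 x2 x3 x4 using that by (intro mult_mono mult_nonneg_nonneg nrm_nonneg)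
  consider "a = k" "c = 1" | "c = k + 1" "a = 0" | "a + 1 \<le> k" "c \<le> k" using assms by linarith
  then show ?thesis
  proof cases
    case 1
    have "nrm c * nrm (a + 1) * nrm (Suc c) * nrm (a + 2) \<le> nrm k * nrm (k + 1) * nrm (k + 1) * nrm (k + 2)"
      by (intro * nrm_mono nrm_nonneg) (use 1 assms in auto)
    then show ?thesis by (simp add: power2_eq_square mult_ac)
  next
    case 2
    have "nrm (a + 1) * nrm c * nrm (a + 2) * nrm (Suc c) \<le> nrm k * nrm (k + 1) * nrm (k + 1) * nrm (k + 2)"
      by (intro * nrm_mono nrm_nonneg) (use 2 assms in auto)
    then show ?thesis by (simp add: power2_eq_square mult_ac)
  next
    case 3
    have "nrm (a + 1) * nrm c * nrm (a + 2) * nrm (Suc c) \<le> nrm k * nrm (k + 1) * nrm (k + 1) * nrm (k + 2)"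
      by (intro * nrm_mono nrm_nonneg) (use 3 in auto)
    then show ?thesis by (simp add: power2_eq_square mult_ac)
  qed
qed

lemma R_L2:
  assumes "R n m q" "m \<le> k" "1 \<le> k" "k + 2 \<le> N"
  shows "q \<in> L2 h \<and> L2_norm h q \<le> real n * bnd k"
  using assms
proof induction
  case (R_0 m)
  have "(\<lambda>p. 0 :: real) \<in> L2 h" by (simp add: L2_iff hperiodic_def)
  then show ?case by (simp add: L2_norm_eq)
next
  case (R_Suc a f c g m n q)
  have o: "a + 2 \<le> N" "c < N" using R_Suc by auto
  note p = FG_product[OF R_Suc(1,2) o]
  have "sqrt (1200 * h * ((1 / h)\<^sup>2 + 1) * (nrm (a + 1) * nrm (a + 2) * (nrm c * nrm (Suc c))))
     \<le> sqrt (1200 * h * ((1 / h)\<^sup>2 + 1) * (nrm k * (nrm (k + 1))\<^sup>2 * nrm (k + 2)))"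
    using R_Suc h by (intro real_sqrt_le_mono mult_left_mono nrm_product_le[where m = m]) auto
  also have "\<dots> = bnd k" unfolding bnd_def by (simp add: real_sqrt_mult nrm_nonneg mult_ac)
  finally have "L2_norm h (\<lambda>p. f p * g p) \<le> bnd k" using p(2) by linarith
  moreover have q: "q \<in> L2 h" "L2_norm h q \<le> real n * bnd k" using R_Suc by auto
  ultimately show ?case using L2_triangle[OF p(1) q(1)] L2_add[OF p(1) q(1)] by (simp add: algebra_simps)
next
  case (R_cong n m q q2)
  have "q \<in> L2 h" "L2_norm h q \<le> real n * bnd k" using R_cong by auto
  moreover have "L2_norm h q2 = L2_norm h q"
    by (rule L2_norm_cong_AE) (use L2_D(2) R_cong calculation in auto)
  ultimately show ?case using R_cong by simp
qed

text \<open>The product rule doubles the number of products and adds one derivative to either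
  factor. The second factor never loses its derivative, so the invariant \<open>a \<le> m\<close> of
  \<open>R\<close> persists.\<close>

lemma R_derivative:
  assumes w: "w \<in> directional" and "R n m q" "m < k" "1 \<le> k" "k + 2 \<le> N"
  shows "\<exists>q'. R (2 * n) (Suc m) q' \<and> w q q'"
  using assms(2-)
proof induction
  case (R_0 m)
  \<comment> \<open>For an abstract direction the derivative of zero is obtained as zero times some
    function that is known to have a derivative.\<close>
  have "w (\<lambda>p. 0) (\<lambda>p. 0)"
  proof -
    have "G 0 (\<lambda>p. D (0, 0, 0) p $ 1)" by (rule G_D) simp
    moreover have "0 < N" using R_0 by simp
    ultimately obtain g where "w (\<lambda>p. D (0, 0, 0) p $ 1) g" by (rule G_derivative[OF w])
    from directional_rules(2)[OF w this, of 0] show ?thesis by simp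
  qed
  then show ?case using R.R_0 by auto
next
  case (R_Suc a f c g m n q)
  have o: "a + 2 \<le> N" "c < N" using R_Suc by auto
  obtain f' where f': "F (Suc a) f'" "w f f'" by (rule F_derivative[OF w R_Suc(1) o(1)])
  obtain g' where g': "G (Suc c) g'" "w g g'" by (rule G_derivative[OF w R_Suc(2) o(2)])
  obtain q' where q': "R (2 * n) (Suc m) q'" "w q q'" using R_Suc by auto
  have "w (\<lambda>p. f p * g p + q p) (\<lambda>p. (f' p * g p + f p * g' p) + q' p)"
    by (rule directional_rules(1)[OF w directional_rules(3)[OF w f'(2) g'(2)] q'(2)])
  moreover have "R (Suc (Suc (2 * n))) (Suc m) (\<lambda>p. f' p * g p + (f p * g' p + q' p))"
    by (rule R.R_Suc[OF f'(1) R_Suc(2) _ _ R.R_Suc[OF R_Suc(1) g'(1) _ _ q'(1)]]) (use R_Suc in auto)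
  ultimately show ?case by (auto simp: add.assoc)
next
  case (R_cong n m q q2)
  then obtain q' where q': "R (2 * n) (Suc m) q'" "w q q'" by auto
  have "q' \<in> L2 h" using R_L2[OF q'(1), of k] R_cong by auto
  then have "w q2 q'" using directional_rules(4)[OF w q'(2)] R_cong L2_D(2) by blast
  then show ?case using q' by auto
qed

section \<open>The derivatives of the projected advection\<close>

definition vel :: "2 \<Rightarrow> point \<Rightarrow> real" where
  "vel i p = D (0, 0, 0) p $ 1 * D (1, 0, 0) p $ i + (D (0, 0, 0) p $ 2 * D (0, 1, 0) p $ i + (vprim (divD (0, 0, 0)) p * D (0, 0, 1) p $ i + 0))"

text \<open>The identity is pointwise, not merely almost everywhere, because \<open>D\<close>
  selects the same representatives of the first derivatives as the advection. Periodicity on the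
  slab is thereby transferred as well.\<close>

lemma advection_slab:
  assumes "z \<in> {-h<..<0}"
  shows "advection h v v (x, y, z) $ i = vel i (x, y, z)"
proof -
  have "vert_velocity h v (x, y, z) = vprim (divD (0, 0, 0)) (x, y, z)"
  proof -
    have "(\<integral>\<xi>. indicator {..<z} \<xi> * divD (0, 0, 0) (x, y, \<xi>) \<partial>ZM h)
        = (\<integral>\<xi>. indicator {-h<..<0} \<xi> *\<^sub>R (indicator {..<z} \<xi> * divD (0, 0, 0) (x, y, \<xi>)) \<partial>lborel)"
      unfolding ZM_def by (rule integral_restrict_space) simp
    also have "\<dots> = (LINT \<xi>:{-h<..<z}|lborel. divH h v (x, y, \<xi>))"
      unfolding set_lebesgue_integral_def using assms
      by (intro Bochner_Integration.integral_cong refl) (auto simp: indicator_def divH_def D_def divD.simps)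
    finally show ?thesis by (simp add: vert_velocity_def vprim_def)
  qed
  then show ?thesis by (simp add: advection_def vel_def D_def)
qed

text \<open>The nesting of the sum and the trailing zero in \<open>vel\<close> are the shape
  produced by three applications of \<open>R_Suc\<close> to \<open>R_0\<close>. No factor in first
  position carries a net derivative: the divergence inside \<open>vprim\<close> counts as order
  zero.\<close>

lemma vel_R: "R 3 0 (vel i)"
proof -
  have F: "F 0 (\<lambda>p. D (0, 0, 0) p $ j)" for j by (intro F_G G_D) simp
  have W: "F 0 (vprim (divD (0, 0, 0)))" using F_w[of 0 0] by simp
  have G: "G 1 (\<lambda>p. D (1, 0, 0) p $ i)" "G 1 (\<lambda>p. D (0, 1, 0) p $ i)" "G 1 (\<lambda>p. D (0, 0, 1) p $ i)"
    by (rule G_D, simp)+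
  have "R (Suc (Suc (Suc 0))) 0 (vel i)" unfolding vel_def[abs_def]
    by (rule R_Suc[OF F G(1) _ _ R_Suc[OF F G(2) _ _ R_Suc[OF W G(3) _ _ R_0]]]) auto
  then show ?thesis by (simp add: numeral_3_eq_3)
qed

lemma advection_L2:
  assumes "\<And>i. vel i \<in> L2 h" shows "advection h v v \<in> L2 h"
    "L2_norm h (\<lambda>p. advection h v v p $ i) = L2_norm h (vel i)"
proof -
  have "(\<lambda>p. advection h v v p $ i) \<in> L2 h" for i
    by (rule L2_cong_slab(1)[OF assms advection_slab])
  then show "advection h v v \<in> L2 h" by (simp add: L2_component)
  show "L2_norm h (\<lambda>p. advection h v v p $ i) = L2_norm h (vel i)"
    by (rule L2_cong_slab(2)[OF assms advection_slab])
qed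

lemma R_field_derivative:
  fixes g :: field
  assumes w: "w \<in> directional" and R: "\<And>i. R n m (\<lambda>p. g p $ i)" and mk: "m < k" "1 \<le> k" "k + 2 \<le> N"
  obtains g' :: field where "g' \<in> L2 h" "\<And>i. R (2 * n) (Suc m) (\<lambda>p. g' p $ i)" "\<And>i. w (\<lambda>p. g p $ i) (\<lambda>p. g' p $ i)"
proof -
  obtain q where q: "\<And>i. R (2 * n) (Suc m) (q i)" "\<And>i. w (\<lambda>p. g p $ i) (q i)"
    using R_derivative[OF w R mk] by metis
  define g' :: field where "g' p = (\<chi> i. q i p)" for p
  have e: "(\<lambda>p. g' p $ i) = q i" for i by (simp add: g'_def)
  have "q i \<in> L2 h" for i using R_L2[OF q(1), of k] mk by auto
  then have "g' \<in> L2 h" by (simp add: L2_component e)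
  then show ?thesis using that q by (simp add: e)
qed

text \<open>A vertical derivative removes the projection, so the derivatives are taken in the order
  \<open>x\<close>, \<open>y\<close>, \<open>z\<close>.\<close>

lemma helmholtz_derivatives:
  fixes u :: field
  assumes u: "u \<in> L2 h" "\<And>i. R n 0 (\<lambda>p. u p $ i)" and k: "1 \<le> k" "k + 2 \<le> N"
  shows "a + b + c \<le> k \<Longrightarrow> \<exists>g. g \<in> L2 h \<and> (\<forall>i. R (2 ^ (a + b + c) * n) (a + b + c) (\<lambda>p. g p $ i)) \<and>
    has_weak_deriv h (a, b, c) (helmholtz_proj h u) (if c = 0 then helmholtz_proj h g else g)"
proof (induction c)
  case 0
  then show ?case
  proof (induction b)
    case 0
    then show ?case
    proof (induction a)
      case 0
      then show ?case using u has_weak_deriv_0[OF helmholtz(2)[OF u(1)]] by auto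
    next
      case (Suc a)
      have d: "dx.wd \<in> directional" by (simp add: directional_def)
      obtain g where g: "g \<in> L2 h" "\<And>i. R (2 ^ a * n) a (\<lambda>p. g p $ i)"
        "has_weak_deriv h (a, 0, 0) (helmholtz_proj h u) (helmholtz_proj h g)" using Suc by auto
      obtain g' where g': "g' \<in> L2 h" "\<And>i. R (2 * (2 ^ a * n)) (Suc a) (\<lambda>p. g' p $ i)" "\<And>i. dx.wd (\<lambda>p. g p $ i) (\<lambda>p. g' p $ i)"
        by (rule R_field_derivative[OF d g(2), where k = k]) (use Suc k in auto)
      have "has_weak_deriv h (Suc a, 0, 0) (helmholtz_proj h u) (helmholtz_proj h g')"
        by (rule has_weak_deriv_step_x[OF g(3) helmholtz(2)[OF g'(1)] helmholtz_wd_x[OF g(1) g'(1,3)]])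
      then show ?case using g' by (auto simp: mult.assoc)
    qed
  next
    case (Suc b)
    have d: "dy.wd \<in> directional" by (simp add: directional_def)
    obtain g where g: "g \<in> L2 h" "\<And>i. R (2 ^ (a + b) * n) (a + b) (\<lambda>p. g p $ i)"
      "has_weak_deriv h (a, b, 0) (helmholtz_proj h u) (helmholtz_proj h g)" using Suc by auto
    obtain g' where g': "g' \<in> L2 h" "\<And>i. R (2 * (2 ^ (a + b) * n)) (Suc (a + b)) (\<lambda>p. g' p $ i)" "\<And>i. dy.wd (\<lambda>p. g p $ i) (\<lambda>p. g' p $ i)"
      by (rule R_field_derivative[OF d g(2), where k = k]) (use Suc k in auto)
    have "has_weak_deriv h (a, Suc b, 0) (helmholtz_proj h u) (helmholtz_proj h g')"
      by (rule has_weak_deriv_step_y[OF g(3) helmholtz(2)[OF g'(1)] helmholtz_wd_y[OF g(1) g'(1,3)]])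
    then show ?case using g' by (auto simp: mult.assoc)
  qed
next
  case (Suc c)
  have d: "dz.wd \<in> directional" by (simp add: directional_def)
  obtain g where g: "g \<in> L2 h" "\<And>i. R (2 ^ (a + b + c) * n) (a + b + c) (\<lambda>p. g p $ i)"
    "has_weak_deriv h (a, b, c) (helmholtz_proj h u) (if c = 0 then helmholtz_proj h g else g)" using Suc by auto
  obtain g' where g': "g' \<in> L2 h" "\<And>i. R (2 * (2 ^ (a + b + c) * n)) (Suc (a + b + c)) (\<lambda>p. g' p $ i)" "\<And>i. dz.wd (\<lambda>p. g p $ i) (\<lambda>p. g' p $ i)"
    by (rule R_field_derivative[OF d g(2), where k = k]) (use Suc k in auto)
  \<comment> \<open>The first vertical derivative removes the projection by
    \<open>helmholtz_wd_z\<close>; for later ones it is already gone.\<close>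
  have "dz.wd (\<lambda>p. (if c = 0 then helmholtz_proj h g else g) p $ i) (\<lambda>p. g' p $ i)" for i
    using helmholtz_wd_z[OF g(1) g'(1,3)] g'(3) by (cases "c = 0") auto
  from has_weak_deriv_step_z[OF g(3) g'(1) this]
  show ?case using g' by (auto simp: mult.assoc)
qed

lemma hydro_F_Sobolev:
  assumes k: "1 \<le> k" "k + 2 \<le> N"
  shows "advection h v v \<in> L2 h" "hydro_F h v v \<in> Sobolev h k"
    "Sobolev_norm h k (hydro_F h v v) \<le> sqrt (card {\<alpha>. mi_order \<alpha> \<le> k}) * (6 * 2 ^ k * bnd k)"
proof -
  have velL: "vel i \<in> L2 h" for i using R_L2[OF vel_R _ k] by auto
  show L: "advection h v v \<in> L2 h" by (rule advection_L2(1)[OF velL])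
  have "R 3 0 (\<lambda>p. advection h v v p $ i)" for i
  proof (rule R_cong[OF vel_R])
    show "AE p in Om h. vel i p = advection h v v p $ i"
      using AE_space by eventually_elim (auto simp: cell_def advection_slab)
    show "(\<lambda>p. advection h v v p $ i) \<in> L2 h" using L by (simp add: L2_component)
  qed
  note der = helmholtz_derivatives[OF L this k]
  have bnd0: "0 \<le> bnd k" unfolding bnd_def using h by (intro mult_nonneg_nonneg) (auto simp: nrm_nonneg)
  \<comment> \<open>Three products at the start, doubled by each of at most \<open>k\<close>
    derivatives, and a factor 2 for the two components. The projection does not increase the
    norm.\<close>
  have *: "\<exists>g. has_weak_deriv h \<alpha> (hydro_F h v v) g \<and> L2_norm h g \<le> 6 * 2 ^ k * bnd k" if \<alpha>: "mi_order \<alpha> \<le> k" for \<alpha>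
  proof -
    obtain a b c where abc: "\<alpha> = (a, b, c)" by (cases \<alpha>)
    have o: "a + b + c \<le> k" using \<alpha> abc by simp
    obtain g where g: "g \<in> L2 h" "\<And>i. R (2 ^ (a + b + c) * 3) (a + b + c) (\<lambda>p. g p $ i)"
      "has_weak_deriv h (a, b, c) (hydro_F h v v) (if c = 0 then helmholtz_proj h g else g)"
      using der[OF o] unfolding hydro_F_def by blast
    have "L2_norm h (\<lambda>p. g p $ i) \<le> 3 * 2 ^ k * bnd k" for i
    proof -
      have "L2_norm h (\<lambda>p. g p $ i) \<le> real (2 ^ (a + b + c) * 3) * bnd k" using R_L2[OF g(2) o k] by blast
      also have "\<dots> \<le> 3 * 2 ^ k * bnd k"
        using bnd0 power_increasing[OF o, of "2 :: real"] by (intro mult_right_mono) auto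
      finally show ?thesis .
    qed
    from L2_norm_le_components[OF g(1) this] have "L2_norm h g \<le> 6 * 2 ^ k * bnd k" by simp
    then have "L2_norm h (if c = 0 then helmholtz_proj h g else g) \<le> 6 * 2 ^ k * bnd k"
      using helmholtz_norm_le[OF g(1)] by auto
    then show ?thesis using g(3) abc by blast
  qed
  then show "hydro_F h v v \<in> Sobolev h k"
    using helmholtz(2)[OF L] unfolding Sobolev_def hydro_F_def by blast
  have "(\<Sum>\<alpha> | mi_order \<alpha> \<le> k. (L2_norm h (weak_deriv h \<alpha> (hydro_F h v v)))\<^sup>2)
     \<le> (\<Sum>\<alpha> | mi_order \<alpha> \<le> k. (6 * 2 ^ k * bnd k)\<^sup>2)"
  proof (rule sum_mono)
    fix \<alpha> assume "\<alpha> \<in> {\<alpha>. mi_order \<alpha> \<le> k}"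
    then have "mi_order \<alpha> \<le> k" by blast
    from *[OF this] obtain g where g: "has_weak_deriv h \<alpha> (hydro_F h v v) g" "L2_norm h g \<le> 6 * 2 ^ k * bnd k" by blast
    then show "(L2_norm h (weak_deriv h \<alpha> (hydro_F h v v)))\<^sup>2 \<le> (6 * 2 ^ k * bnd k)\<^sup>2"
      using L2_norm_weak_deriv[OF g(1)] by (intro power_mono) (auto simp: L2_norm_nonneg)
  qed
  also have "\<dots> = card {\<alpha>. mi_order \<alpha> \<le> k} * (6 * 2 ^ k * bnd k)\<^sup>2" by simp
  finally have "Sobolev_norm h k (hydro_F h v v) \<le> sqrt (card {\<alpha>. mi_order \<alpha> \<le> k} * (6 * 2 ^ k * bnd k)\<^sup>2)"
    unfolding Sobolev_norm_def by (rule real_sqrt_le_mono)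
  also have "\<dots> = sqrt (card {\<alpha>. mi_order \<alpha> \<le> k}) * (6 * 2 ^ k * bnd k)"
    using bnd0 by (simp add: real_sqrt_mult)
  finally show "Sobolev_norm h k (hydro_F h v v) \<le> sqrt (card {\<alpha>. mi_order \<alpha> \<le> k}) * (6 * 2 ^ k * bnd k)" .
qed

end

section \<open>The estimate in the space of order 3/2\<close>

context slab
begin

definition frac_const :: real where "frac_const = 210 * (1 + 8 * (2 + h\<^sup>2)\<^sup>2 / h)"

text \<open>One constant for both kinds of first factor. For \<open>v\<close>, Ladyzhenskaya's
  inequality contributes \<open>3 * 20\<close> with the weight \<open>(1 / h)^2\<close>, and the
  vertical derivative contributes \<open>3 * frac_const\<close>; the divergence, a sum of two
  derivatives, takes \<open>3 * (frac_const + frac_const)\<close>.\<close>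

definition adv_const :: real where "adv_const = 60 * (1 / h)\<^sup>2 + 6 * frac_const"

lemma frac_Sobolev_L24:
  fixes v :: field
  assumes vf: "v \<in> frac_Sobolev h 1 (1/2)" and \<alpha>: "mi_order \<alpha> = 1"
  shows "L24 (\<lambda>p. weak_deriv h \<alpha> v p $ i) (frac_const * (frac_Sobolev_norm h 1 (1/2) v)\<^sup>2)"
proof -
  let ?M = "(frac_Sobolev_norm h 1 (1/2) v)\<^sup>2"
  let ?g = "weak_deriv h \<alpha> v"
  let ?k = "slobodeckij_kernel (1/2) ?g"
  interpret regular_field h v 1 using vf by unfold_locales (simp add: frac_Sobolev_def)
  have D: "D \<alpha> = ?g" using \<alpha> by (auto simp: D_def)
  have \<alpha>1: "mi_order \<alpha> \<le> 1" using \<alpha> by simp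
  have k0: "0 \<le> slobodeckij_kernel (1/2) f pq" for f :: field and pq
    by (cases pq) (simp add: slobodeckij_kernel_def)
  have fin: "finite {\<alpha>. mi_order \<alpha> = 1}" by (rule finite_subset[OF _ finite_multiindices[of 1]]) auto
  let ?S = "\<Sum>\<alpha> | mi_order \<alpha> = 1. (LINT pq:cell h \<times> cell h|lborel. slobodeckij_kernel (1/2) (weak_deriv h \<alpha> v) pq)"
  have int0: "0 \<le> (LINT pq:cell h \<times> cell h|lborel. slobodeckij_kernel (1/2) f pq)" for f :: field
    unfolding set_integral_cell_pair by (rule Bochner_Integration.integral_nonneg) (rule k0)
  have S0: "0 \<le> ?S" by (rule sum_nonneg) (rule int0)
  have M: "?M = (nrm 1)\<^sup>2 + ?S" unfolding frac_Sobolev_norm_def using S0 by simp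
  have ki: "integrable (Om h \<Otimes>\<^sub>M Om h) ?k"
    using vf \<alpha> unfolding frac_Sobolev_def set_integrable_cell_pair by blast
  have kM: "integral\<^sup>L (Om h \<Otimes>\<^sub>M Om h) ?k \<le> ?M"
  proof -
    have "integral\<^sup>L (Om h \<Otimes>\<^sub>M Om h) ?k \<le> ?S"
      unfolding set_integral_cell_pair[symmetric]
      by (rule member_le_sum[of \<alpha> _ "\<lambda>\<alpha>. (LINT pq:cell h \<times> cell h|lborel. slobodeckij_kernel (1/2) (weak_deriv h \<alpha> v) pq)"])
        (use \<alpha> int0 fin in auto)
    then show ?thesis unfolding M using zero_le_power2[of "nrm 1"] by linarith
  qed
  have "L24 (\<lambda>p. ?g p $ i) (210 * (?M + 8 * (2 + h\<^sup>2)\<^sup>2 / h * ?M))"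
  proof (rule frac_L24)
    have gL: "(\<lambda>p. ?g p $ i) \<in> L2 h" using D_component_L2[OF \<alpha>1] D by simp
    then show "(\<lambda>p. ?g p $ i) \<in> borel_measurable (Om h)" by (rule L2_D)
    have "(L2_norm h (\<lambda>p. ?g p $ i))\<^sup>2 \<le> (nrm 1)\<^sup>2"
      using D_norm_le[OF \<alpha>1, of i] by (intro power_mono) (simp_all add: D L2_norm_nonneg)
    also have "\<dots> \<le> ?M" using M S0 by simp
    finally show "(\<integral>\<^sup>+p. ennreal ((?g p $ i)\<^sup>2) \<partial>Om h) \<le> ennreal ?M"
      using nn_integral_L2[OF gL] by (simp add: ennreal_leI)
    show "?k \<in> borel_measurable (Om h \<Otimes>\<^sub>M Om h)" using ki by simp
    show "slobodeckij_kernel (1/2) (\<lambda>p. ?g p $ i) (p, p') \<le> ?k (p, p')" for p p'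
    proof -
      have "\<bar>?g p $ i - ?g p' $ i\<bar> \<le> norm (?g p - ?g p')" using component_le_norm_cart[of "?g p - ?g p'" i] by simp
      then have "(norm (?g p $ i - ?g p' $ i))\<^sup>2 \<le> (norm (?g p - ?g p'))\<^sup>2" by (intro power_mono) auto
      then show ?thesis by (simp add: slobodeckij_kernel_def divide_right_mono)
    qed
    have sf: "sigma_finite_measure (Om h)" using finite_measure_Om by (rule finite_measure.axioms)
    have "(\<integral>\<^sup>+p. \<integral>\<^sup>+p'. ennreal (?k (p, p')) \<partial>Om h \<partial>Om h) = (\<integral>\<^sup>+pq. ennreal (?k pq) \<partial>(Om h \<Otimes>\<^sub>M Om h))"
      by (rule sigma_finite_measure.nn_integral_fst[OF sf]) (use ki in simp)
    also have "\<dots> = ennreal (integral\<^sup>L (Om h \<Otimes>\<^sub>M Om h) ?k)" by (rule nn_integral_eq_integral[OF ki]) (simp add: k0)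
    also have "\<dots> \<le> ennreal ?M" by (rule ennreal_leI[OF kM])
    finally show "(\<integral>\<^sup>+p. \<integral>\<^sup>+p'. ennreal (?k (p, p')) \<partial>Om h \<partial>Om h) \<le> ennreal ?M" .
  qed auto
  then show ?thesis by (simp add: frac_const_def algebra_simps)
qed

text \<open>Every product has a second factor of order one, bounded by the fractional embedding. The
  majorants of the first factors consist of the divergence, of a vertical derivative of order one,
  and of \<open>v\<close> itself, for which Ladyzhenskaya's inequality is enough since
  \<open>nrm 0 * nrm 1\<close> is at most the squared fractional norm.\<close>

lemma hydro_F_frac:
  fixes v :: field
  assumes vf: "v \<in> frac_Sobolev h 1 (1/2)"
  shows "advection h v v \<in> L2 h" "hydro_F h v v \<in> L2 h"
    "L2_norm h (hydro_F h v v) \<le> 6 * sqrt (h * adv_const * frac_const) * (frac_Sobolev_norm h 1 (1/2) v)\<^sup>2"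
proof -
  define M where "M = (frac_Sobolev_norm h 1 (1/2) v)\<^sup>2"
  have M0: "0 \<le> M" by (simp add: M_def)
  have fc: "0 \<le> frac_const" using h by (simp add: frac_const_def)
  interpret regular_field h v 1 using vf by unfold_locales (simp add: frac_Sobolev_def)
  have nM: "nrm 0 * nrm 1 \<le> M"
  proof -
    have "0 \<le> (\<Sum>\<alpha> | mi_order \<alpha> = 1. (LINT pq:cell h \<times> cell h|lborel. slobodeckij_kernel (1/2) (weak_deriv h \<alpha> v) pq))"
      unfolding set_integral_cell_pair
      by (intro sum_nonneg Bochner_Integration.integral_nonneg) (auto simp: slobodeckij_kernel_def)
    then have "(nrm 1)\<^sup>2 \<le> M" unfolding M_def frac_Sobolev_norm_def by simp
    moreover have "nrm 0 * nrm 1 \<le> nrm 1 * nrm 1" by (intro mult_right_mono nrm_mono nrm_nonneg) simp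
    ultimately show ?thesis by (simp add: power2_eq_square)
  qed
  have D1: "L24 (\<lambda>p. D \<alpha> p $ i) (frac_const * M)" if "mi_order \<alpha> = 1" for \<alpha> i
  proof -
    have "D \<alpha> = weak_deriv h \<alpha> v" using that by (auto simp: D_def)
    then show ?thesis using frac_Sobolev_L24[OF vf that] by (simp add: M_def)
  qed
  have vL: "L24 (\<lambda>p. D (0, 0, 0) p $ i) (20 * M)" for i
  proof (rule L24_mono)
    have "G 0 (\<lambda>p. D (0, 0, 0) p $ i)" by (rule G_D) simp
    then show "L24 (\<lambda>p. D (0, 0, 0) p $ i) (20 * (nrm 0 * nrm (Suc 0)))" by (rule G_L24) simp
    show "20 * (nrm 0 * nrm (Suc 0)) \<le> 20 * M" using nM by simp
  qed
  have adv: "adv_const * M = 3 * ((1 / h)\<^sup>2 * (20 * M) + frac_const * M) + 3 * (frac_const * M)"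
    by (simp add: adv_const_def algebra_simps)
  have prod: "(\<lambda>p. D (0, 0, 0) p $ j * D \<alpha> p $ i) \<in> L2 h \<and> L2_norm h (\<lambda>p. D (0, 0, 0) p $ j * D \<alpha> p $ i) \<le> sqrt (h * adv_const * frac_const) * M"
    if \<alpha>: "mi_order \<alpha> = 1" for \<alpha> i j
  proof -
    let ?\<psi> = "\<lambda>p. (1 / h) * \<bar>D (0, 0, 0) p $ j\<bar> + \<bar>D (0, 0, 1) p $ j\<bar>"
    have "L24 ?\<psi> (3 * ((1 / h)\<^sup>2 * (20 * M) + frac_const * M))"
      by (intro L24_add L24_cmult L24_abs vL D1) simp
    then have \<psi>: "L24 ?\<psi> (adv_const * M)" by (rule L24_mono) (use adv M0 fc in simp)
    have z: "dz.wd (\<lambda>p. D (0, 0, 0) p $ j) (\<lambda>p. D (0, 0, 1) p $ j)" using D_wd(3)[of 0 0 0] by simp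
    note v0 = L2_D[OF D_component_L2[of "(0, 0, 0)" j, simplified]]
    have \<alpha>L: "hperiodic h (\<lambda>p. D \<alpha> p $ i)" using L2_D[OF D_component_L2[of \<alpha> i]] \<alpha> by simp
    note p = product_L2[OF \<psi> D1[OF \<alpha>, of i] v0(2,1) \<alpha>L wd_z_dominated[OF z v0(2) L24_measurable[OF D1]]]
    have "sqrt (h * (adv_const * M) * (frac_const * M)) = sqrt (h * adv_const * frac_const * M\<^sup>2)"
      by (simp add: power2_eq_square mult_ac)
    also have "\<dots> = sqrt (h * adv_const * frac_const) * M" using M0 by (simp add: real_sqrt_mult)
    finally show ?thesis using p by simp
  qed
  have w: "(\<lambda>p. vprim (divD (0, 0, 0)) p * D (0, 0, 1) p $ i) \<in> L2 h \<and>
      L2_norm h (\<lambda>p. vprim (divD (0, 0, 0)) p * D (0, 0, 1) p $ i) \<le> sqrt (h * adv_const * frac_const) * M" for i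
  proof -
    have dL: "divD (0, 0, 0) \<in> L2 h" by (rule divD_L2) simp
    have "L24 (divD (0, 0, 0)) (3 * (frac_const * M + frac_const * M))"
      unfolding divD.simps by (intro L24_add D1) simp_all
    then have \<psi>: "L24 (divD (0, 0, 0)) (adv_const * M)" by (rule L24_mono) (use adv M0 in simp)
    have o: "mi_order (0, 0, 1) = 1" by simp
    have z: "hperiodic h (\<lambda>p. D (0, 0, 1) p $ i)" by (rule L2_D[OF D_component_L2]) simp
    note p = product_L2[OF \<psi> D1[OF o, of i] vprim_measurable[OF L2_D(2)[OF dL]] vprim_hperiodic[OF L2_D(1)[OF dL]] z
        vprim_dominated[OF L2_integrable[OF dL]]]
    have "sqrt (h * (adv_const * M) * (frac_const * M)) = sqrt (h * adv_const * frac_const * M\<^sup>2)"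
      by (simp add: power2_eq_square mult_ac)
    also have "\<dots> = sqrt (h * adv_const * frac_const) * M" using M0 by (simp add: real_sqrt_mult)
    finally show ?thesis using p by simp
  qed
  have vel: "vel i \<in> L2 h \<and> L2_norm h (vel i) \<le> 3 * (sqrt (h * adv_const * frac_const) * M)" for i
  proof -
    have o: "mi_order (1, 0, 0) = 1" "mi_order (0, 1, 0) = 1" by simp_all
    note a = prod[OF o(1), of 1 i, THEN conjunct1] and b = prod[OF o(2), of 2 i, THEN conjunct1] and c = w[of i, THEN conjunct1]
    have e: "vel i = (\<lambda>p. D (0, 0, 0) p $ 1 * D (1, 0, 0) p $ i + (D (0, 0, 0) p $ 2 * D (0, 1, 0) p $ i + vprim (divD (0, 0, 0)) p * D (0, 0, 1) p $ i))"
      by (simp add: vel_def fun_eq_iff)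
    show ?thesis unfolding e
      using L2_add[OF a L2_add[OF b c]] L2_triangle[OF a L2_add[OF b c]] L2_triangle[OF b c]
        prod[OF o(1), of 1 i] prod[OF o(2), of 2 i] w[of i] by linarith
  qed
  then have velL: "vel i \<in> L2 h" for i by blast
  note L = advection_L2[OF velL]
  show "advection h v v \<in> L2 h" by (rule L)
  show "hydro_F h v v \<in> L2 h" unfolding hydro_F_def by (rule helmholtz(2)[OF L(1)])
  have "L2_norm h (hydro_F h v v) \<le> L2_norm h (advection h v v)"
    unfolding hydro_F_def by (rule helmholtz_norm_le[OF L(1)])
  also have "\<dots> \<le> 2 * (3 * (sqrt (h * adv_const * frac_const) * M))"
    by (rule L2_norm_le_components[OF L(1)]) (use L(2) vel in simp)
  finally show "L2_norm h (hydro_F h v v) \<le> 6 * sqrt (h * adv_const * frac_const) * (frac_Sobolev_norm h 1 (1/2) v)\<^sup>2"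
    by (simp add: M_def mult_ac)
qed

end

theorem lemma4p3:
  fixes h :: real
  assumes "h > 0"
  shows "(\<forall>k::nat. k \<ge> 1 \<longrightarrow> (\<exists>C>0. \<forall>v \<in> Sobolev h (k + 2) \<inter> L2_sigma h.
            advection h v v \<in> L2 h \<and> hydro_F h v v \<in> Sobolev h k \<and>
            Sobolev_norm h k (hydro_F h v v) \<le>
              C * Sobolev_norm h (k + 2) v powr (1 / 2) * Sobolev_norm h (k + 1) v
                * Sobolev_norm h k v powr (1 / 2))) \<and>
         (\<exists>C>0. \<forall>v \<in> frac_Sobolev h 1 (1 / 2) \<inter> L2_sigma h.
            advection h v v \<in> L2 h \<and> hydro_F h v v \<in> L2 h \<and>
            L2_norm h (hydro_F h v v) \<le> C * (frac_Sobolev_norm h 1 (1 / 2) v)\<^sup>2)"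
proof (intro conjI allI impI)
  interpret slab h using assms by unfold_locales
  fix k :: nat assume k: "k \<ge> 1"
  define C where "C = sqrt (card {\<alpha>. mi_order \<alpha> \<le> k}) * (6 * 2 ^ k * sqrt (1200 * h * ((1 / h)\<^sup>2 + 1)))"
  have "mi_order (0, 0, 0) \<le> k" by simp
  then have "{\<alpha>. mi_order \<alpha> \<le> k} \<noteq> {}" by blast
  then have "0 < card {\<alpha>. mi_order \<alpha> \<le> k}" using finite_multiindices by (simp add: card_gt_0_iff)
  moreover have "0 < (1 / h)\<^sup>2 + 1" by (simp add: add_nonneg_pos)
  ultimately have "0 < C" unfolding C_def using assms by simp
  moreover have "advection h v v \<in> L2 h \<and> hydro_F h v v \<in> Sobolev h k \<and>
      Sobolev_norm h k (hydro_F h v v) \<le> C * Sobolev_norm h (k + 2) v powr (1 / 2) * Sobolev_norm h (k + 1) v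
                * Sobolev_norm h k v powr (1 / 2)" if "v \<in> Sobolev h (k + 2) \<inter> L2_sigma h" for v
  proof -
    interpret regular_field h v "k + 2" using that by unfold_locales simp
    show ?thesis using hydro_F_Sobolev[OF k order_refl]
      by (simp add: powr_half_sqrt nrm_nonneg bnd_def C_def mult_ac)
  qed
  ultimately show "\<exists>C>0. \<forall>v \<in> Sobolev h (k + 2) \<inter> L2_sigma h.
            advection h v v \<in> L2 h \<and> hydro_F h v v \<in> Sobolev h k \<and>
            Sobolev_norm h k (hydro_F h v v) \<le>
              C * Sobolev_norm h (k + 2) v powr (1 / 2) * Sobolev_norm h (k + 1) v
                * Sobolev_norm h k v powr (1 / 2)" by blast
next
  interpret slab h using assms by unfold_locales
  have fc: "0 < frac_const" unfolding frac_const_def using assms by (simp add: add_pos_nonneg)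
  then have "0 < adv_const" unfolding adv_const_def by (simp add: add_nonneg_pos)
  with fc have "0 < 6 * sqrt (h * adv_const * frac_const)" using assms by simp
  then show "\<exists>C>0. \<forall>v \<in> frac_Sobolev h 1 (1 / 2) \<inter> L2_sigma h.
            advection h v v \<in> L2 h \<and> hydro_F h v v \<in> L2 h \<and>
            L2_norm h (hydro_F h v v) \<le> C * (frac_Sobolev_norm h 1 (1 / 2) v)\<^sup>2"
    using hydro_F_frac by blast
qed

end
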